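(* Let $a>0$, $x\in\mathbb{R}$, $q,r,u,v\geq0$ and put $p=q+r-\psi(u)$. Then $$\mathbb{E}_x\Big[e^{-q\widehat{\tau}_a-r\underline{G}_{\widehat{\tau}_a}+u\underline{X}_{\widehat{\tau}_a}}\mathbf{1}\{\overline{X}_{\widehat{\tau}_a}<v\}\Big]=\frac{W^{(q+r)}(a)}{W^{(q)}(a)}\Big[e^{-u(a-x)}\frac{Z^{(p)}_u(a+x-v)}{Z^{(p)}_u(a)}-e^{-u(a-v)}\frac{W^{(q+r)}(a+x-v)}{W^{(q+r)}(a)}\Big].$$
   Context: Let $X$ be a spectrally negative Lévy process (no positive jumps) with non-monotone paths; $\mathbb{P}_x$ is the law of $x+X$. Let $\psi(\theta)=\log\mathbb{E}[e^{\theta X_1}]$ for $\theta\geq0$, $\Phi(q)$ the largest root of $\psi(\theta)=q$. For $q\geq0$ the $q$-scale function $W^{(q)}$ vanishes on $(-\infty,0)$, is continuous increasing on $[0,\infty)$, and $\int_0^\infty e^{-\theta x}W^{(q)}(x)dx=(\psi(\theta)-q)^{-1}$ for $\theta>\Phi(q)$. For $u\geq0$ and $p=q+r-\psi(u)$, define $Z^{(p)}_u(y)=1+p\int_0^y e^{-uz}W^{(q+r)}(z)\,dz$ for $y\in\mathbb{R}$ (so $Z^{(p)}_u(y)=1$ for $y\leq0$). Let $\overline{X}_t=\sup_{s\leq t}X_s$, $\underline{X}_t=\inf_{s\leq t}X_s$, $\widehat{Y}_t=X_t-\underline{X}_t$, $\widehat{\tau}_a=\inf\{t\geq0:\widehat{Y}_t>a\}$,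 and $\underline{G}_t=\sup\{s\leq t: X_s=\underline{X}_s\text{ or }X_{s-}=\underline{X}_s\}$.
   Formalization: The formal statement adds the hypothesis x ≤ v; for x > v the left side is 0 while the right side is not (for Brownian motion with q=r=u=0 it equals (v−x)/a < 0). *)

theory Defs
  imports "HOL-Probability.Probability"
begin

text \<open>Paths of a process X :: real \<Rightarrow> 'a \<Rightarrow> real (time, outcome); only times t \<ge> 0 matter.
  Left limit of a path at time s.\<close>
definition left_lim :: "(real \<Rightarrow> real) \<Rightarrow> real \<Rightarrow> real" where
  "left_lim f s = Lim (at_left s) f"

definition spec_neg_levy :: "'a measure \<Rightarrow> (real \<Rightarrow> 'a \<Rightarrow> real) \<Rightarrow> bool" where
  "spec_neg_levy M X \<longleftrightarrow>
     prob_space M \<and>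
     (\<forall>t. X t \<in> borel_measurable M) \<and>
     (\<forall>\<omega>\<in>space M. X 0 \<omega> = 0) \<and>
     \<comment> \<open>cadlag paths\<close>
     (\<forall>\<omega>\<in>space M. \<forall>t\<ge>0. continuous (at_right t) (\<lambda>s. X s \<omega>)) \<and>
     (\<forall>\<omega>\<in>space M. \<forall>t>0. \<exists>l. ((\<lambda>s. X s \<omega>) \<longlongrightarrow> l) (at_left t)) \<and>
     \<comment> \<open>no positive jumps\<close>
     (\<forall>\<omega>\<in>space M. \<forall>t>0. X t \<omega> \<le> left_lim (\<lambda>s. X s \<omega>) t) \<and>
     \<comment> \<open>independent increments\<close>
     (\<forall>ts. sorted ts \<longrightarrow> (\<forall>t\<in>set ts. 0 \<le> t) \<longrightarrow>
        prob_space.indep_vars M (\<lambda>_. borel) (\<lambda>i \<omega>. X (ts ! Suc i) \<omega> - X (ts ! i) \<omega>)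
          {..<length ts - 1}) \<and>
     \<comment> \<open>stationary increments\<close>
     (\<forall>s t. 0 \<le> s \<longrightarrow> 0 \<le> t \<longrightarrow>
        distr M borel (\<lambda>\<omega>. X (s + t) \<omega> - X s \<omega>) = distr M borel (X t)) \<and>
     \<comment> \<open>non-monotone paths\<close>
     \<not> (AE \<omega> in M. mono_on {0..} (\<lambda>t. X t \<omega>)) \<and>
     \<not> (AE \<omega> in M. monotone_on {0..} (\<le>) (\<ge>) (\<lambda>t. X t \<omega>))"

definition psi :: "'a measure \<Rightarrow> (real \<Rightarrow> 'a \<Rightarrow> real) \<Rightarrow> real \<Rightarrow> real" where
  "psi M X \<theta> = ln (\<integral>\<omega>. exp (\<theta> * X 1 \<omega>) \<partial>M)"

definition Phi :: "'a measure \<Rightarrow> (real \<Rightarrow> 'a \<Rightarrow> real) \<Rightarrow> real \<Rightarrow> real" where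
  "Phi M X q = (GREATEST \<theta>. 0 \<le> \<theta> \<and> psi M X \<theta> = q)"

definition is_scale_fn :: "'a measure \<Rightarrow> (real \<Rightarrow> 'a \<Rightarrow> real) \<Rightarrow> real \<Rightarrow> (real \<Rightarrow> real) \<Rightarrow> bool" where
  "is_scale_fn M X q W \<longleftrightarrow>
     (\<forall>y<0. W y = 0) \<and> continuous_on {0..} W \<and> mono_on {0..} W \<and>
     (\<forall>\<theta>>Phi M X q. ((\<lambda>y. exp (- \<theta> * y) * W y) has_integral (1 / (psi M X \<theta> - q))) {0..})"

definition scale_fn :: "'a measure \<Rightarrow> (real \<Rightarrow> 'a \<Rightarrow> real) \<Rightarrow> real \<Rightarrow> real \<Rightarrow> real" where
  "scale_fn M X q = (THE W. is_scale_fn M X q W)"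

text \<open>Z^(p)_u(y) = 1 + p * int_0^y e^(-uz) W^(q+r)(z) dz with p = q + r - psi(u)
  (the integral over {0..y} is 0 for y \<le> 0).\<close>
definition Zfn :: "'a measure \<Rightarrow> (real \<Rightarrow> 'a \<Rightarrow> real) \<Rightarrow> real \<Rightarrow> real \<Rightarrow> real \<Rightarrow> real \<Rightarrow> real" where
  "Zfn M X q r u y = 1 + (q + r - psi M X u) *
      integral {0..y} (\<lambda>z. exp (- u * z) * scale_fn M X (q + r) z)"

text \<open>Path functionals of the process x + X (i.e. under P_x).\<close>
definition run_sup :: "(real \<Rightarrow> 'a \<Rightarrow> real) \<Rightarrow> real \<Rightarrow> real \<Rightarrow> 'a \<Rightarrow> real" where
  "run_sup X x t \<omega> = Sup ((\<lambda>s. x + X s \<omega>) ` {0..t})"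

definition run_inf :: "(real \<Rightarrow> 'a \<Rightarrow> real) \<Rightarrow> real \<Rightarrow> real \<Rightarrow> 'a \<Rightarrow> real" where
  "run_inf X x t \<omega> = Inf ((\<lambda>s. x + X s \<omega>) ` {0..t})"

definition exceed_set :: "(real \<Rightarrow> 'a \<Rightarrow> real) \<Rightarrow> real \<Rightarrow> real \<Rightarrow> 'a \<Rightarrow> real set" where
  "exceed_set X x a \<omega> = {t. 0 \<le> t \<and> (x + X t \<omega>) - run_inf X x t \<omega> > a}"

definition tau_hat :: "(real \<Rightarrow> 'a \<Rightarrow> real) \<Rightarrow> real \<Rightarrow> real \<Rightarrow> 'a \<Rightarrow> real" where
  "tau_hat X x a \<omega> = Inf (exceed_set X x a \<omega>)"

definition G_inf :: "(real \<Rightarrow> 'a \<Rightarrow> real) \<Rightarrow> real \<Rightarrow> real \<Rightarrow> 'a \<Rightarrow> real" where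
  "G_inf X x t \<omega> = Sup {s. 0 \<le> s \<and> s \<le> t \<and>
      (x + X s \<omega> = run_inf X x s \<omega> \<or>
       left_lim (\<lambda>r. x + X r \<omega>) s = run_inf X x s \<omega>)}"

end

theory Submission imports Defs begin

text \<open>
  The process is transported to a canonical space of right-continuous paths without upward jumps, where
  the strong Markov property is available in functional form. Since such paths cross levels upwards
  continuously, the transform \<open>hh q x b\<close> of the passage time over \<open>b\<close> before falling below \<open>-x\<close> is
  multiplicative in \<open>b\<close>, so it is a quotient of values of an increasing function. This function is harmonic for
  the process killed at 0; a short-time expansion of its Laplace transform shows that it is a multiple of
  the scale function. The same expansion, applied to the joint transform of the time and the position at the first passage
  below \<open>-x\<close>, expresses that transform by \<open>Z\<close> and \<open>W\<close> up to a constant, which disappears once the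
  process is stopped at an upper level.

  Let \<open>K\<close> be the value of the expectation without the restriction on the supremum. By the strong Markov property at the first passage below \<open>-y\<close>,
  \<open>K (1 - \<beta>(y)) = A(y)\<close>, where \<open>A(y)\<close> is the contribution of the
  paths that make their excursion of height \<open>a\<close> before falling below \<open>-y\<close>. Both \<open>1 - \<beta>(y)\<close> and \<open>A(y)\<close> are
  asymptotically proportional to \<open>W(y)\<close> as \<open>y\<close> tends to 0, which yields \<open>K\<close>. Finally, the supremum stays below a level \<open>b \<le> a\<close>
  essentially iff the path falls below \<open>b - a\<close> before exceeding \<open>b\<close>, so the
  restricted expectation is \<open>K\<close> times the transform of this two-sided exit.
\<close>

section \<open>Path space\<close>

text \<open>The weight at the first passage of the reflected process is not multiplicative in time:
  the discount rate is q + r up to the last time at the infimum and q afterwards. This shapes the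
  evaluation of \<open>K\<close>. A path that falls below -y first has spent all that time before
  its last infimum, so the fall is weighted with q + r and the rest is a fresh copy of the problem.
  A path that makes its excursion first keeps its infimum within y of the start; as y tends to 0 its
  excursion is weighted with q alone, up to an initial piece below a small level d. The price of
  that piece is the quotient of the scale functions for q and q + r at d, which tends to 1. This
  comparison of rates of decay takes the place of the excursion measure. Short times enter through
  an asymmetry. Without upward jumps, a reflected rise of fixed height within time t has probability
  O(t^4), since it splits into four smaller rises; a fall may be a jump and has probability O(t)
  only. Therefore the mass removed by killing at 0 does not depend on th in the limit, and each
  Laplace transform is determined up to a single constant.\<close>

definition Paths :: "(real => real) set" where
  "Paths = {w. (\<forall>t\<le>0. w t = 0) & (\<forall>t. continuous (at_right t) w) &
     (\<forall>t. \<exists>l. (w \<longlongrightarrow> l) (at_left t) & w t <= l)}"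

text \<open>Upper cylinders over finite sets of times are stable under intersection, so they
  determine finite measures, and they reduce measurability of a path-valued map to that of its
  coordinates.\<close>

definition path_space :: "(real => real) measure" where
  "path_space = sigma Paths {{w\<in>Paths. \<forall>s\<in>J. w s > c s} | J c. finite J}"

lemma Paths_0: "w \<in> Paths ==> t <= 0 ==> w t = 0"
  by (auto simp: Paths_def)

lemma right_cont_iff:
  fixes w :: "real => real"
  shows "continuous (at_right t) w \<longleftrightarrow> (\<forall>e>0. \<exists>d>0. \<forall>s. t <= s & s < t + d --> \<bar>w s - w t\<bar> < e)"
proof
  assume c: "continuous (at_right t) w"
  show "\<forall>e>0. \<exists>d>0. \<forall>s. t <= s & s < t + d --> \<bar>w s - w t\<bar> < e"
  proof (intro allI impI)
    fix e :: real assume e: "e > 0"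
    with c have "eventually (%s. dist (w s) (w t) < e) (at_right t)"
      by (auto simp: continuous_within tendsto_iff)
    then obtain b where "b > t" "\<forall>y>t. y < b --> dist (w y) (w t) < e"
      by (auto simp: eventually_at_right_field)
    then show "\<exists>d>0. \<forall>s. t <= s & s < t + d --> \<bar>w s - w t\<bar> < e"
      using e by (intro exI[of _ "b - t"]) (auto simp: dist_real_def le_less)
  qed
next
  assume a: "\<forall>e>0. \<exists>d>0. \<forall>s. t <= s & s < t + d --> \<bar>w s - w t\<bar> < e"
  show "continuous (at_right t) w"
    unfolding continuous_within tendsto_iff
  proof (intro allI impI)
    fix e :: real assume "e > 0"
    then obtain d where "d > 0" "\<forall>s. t <= s & s < t + d --> \<bar>w s - w t\<bar> < e" using a by blast
    then show "\<forall>\<^sub>F x in at_right t. dist (w x) (w t) < e"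
      unfolding eventually_at_right_field by (intro exI[of _ "t + d"]) (auto simp: dist_real_def)
  qed
qed

lemma left_lim_iff:
  fixes w :: "real => real"
  shows "(w \<longlongrightarrow> l) (at_left t) \<longleftrightarrow> (\<forall>e>0. \<exists>d>0. \<forall>s. t - d < s & s < t --> \<bar>w s - l\<bar> < e)"
proof
  assume c: "(w \<longlongrightarrow> l) (at_left t)"
  show "\<forall>e>0. \<exists>d>0. \<forall>s. t - d < s & s < t --> \<bar>w s - l\<bar> < e"
  proof (intro allI impI)
    fix e :: real assume e: "e > 0"
    with c have "eventually (%s. dist (w s) l < e) (at_left t)"
      by (auto simp: tendsto_iff)
    then obtain b where "b < t" "\<forall>y>b. y < t --> dist (w y) l < e"
      by (auto simp: eventually_at_left_field)
    then show "\<exists>d>0. \<forall>s. t - d < s & s < t --> \<bar>w s - l\<bar> < e"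
      using e by (intro exI[of _ "t - b"]) (auto simp: dist_real_def)
  qed
next
  assume a: "\<forall>e>0. \<exists>d>0. \<forall>s. t - d < s & s < t --> \<bar>w s - l\<bar> < e"
  show "(w \<longlongrightarrow> l) (at_left t)"
    unfolding tendsto_iff
  proof (intro allI impI)
    fix e :: real assume "e > 0"
    then obtain d where "d > 0" "\<forall>s. t - d < s & s < t --> \<bar>w s - l\<bar> < e" using a by blast
    then show "\<forall>\<^sub>F x in at_left t. dist (w x) l < e"
      unfolding eventually_at_left_field by (intro exI[of _ "t - d"]) (auto simp: dist_real_def)
  qed
qed

lemma Paths_right:
  assumes "w \<in> Paths" "e > 0"
  obtains d where "d > 0" "!!s. t <= s ==> s < t + d ==> \<bar>w s - w t\<bar> < e"
  using assms unfolding Paths_def right_cont_iff by blast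

lemma Paths_left:
  assumes "w \<in> Paths"
  obtains l where "w t <= l" "!!e. e > 0 ==> \<exists>d>0. \<forall>s. t - d < s & s < t --> \<bar>w s - l\<bar> < e"
  using assms unfolding Paths_def left_lim_iff by blast

lemma Paths_right_lim:
  assumes "w \<in> Paths" "!!n. f n \<ge> t" "f \<longlonglongrightarrow> t"
  shows "(%n. w (f n)) \<longlonglongrightarrow> w t"
proof (rule LIMSEQ_I)
  fix e :: real assume "e > 0"
  from Paths_right[OF assms(1) this, of t] obtain d
    where d: "d > 0" "!!s. t <= s ==> s < t + d ==> \<bar>w s - w t\<bar> < e" by blast
  from LIMSEQ_D[OF assms(3) d(1)] obtain N where "\<forall>n\<ge>N. norm (f n - t) < d" by blast
  then show "\<exists>no. \<forall>n\<ge>no. norm (w (f n) - w t) < e"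
    using assms(2) d by (intro exI[of _ N]) (auto simp: abs_less_iff)
qed

text \<open>The clamps at 0 make the result a path for all real arguments, so a random time can be
  inserted before it is known to be nonnegative.\<close>

definition pshift :: "real => (real => real) => real => real" where
  "pshift t w s = w (max 0 t + max 0 s) - w (max 0 t)"

definition pstop :: "real => (real => real) => real => real" where
  "pstop t w s = w (min s t)"

lemma PathsI:
  assumes "!!t. t <= 0 ==> w t = 0"
    and "!!t e. e > 0 ==> \<exists>d>0. \<forall>s. t <= s & s < t + d --> \<bar>w s - w t\<bar> < e"
    and "!!t. \<exists>l. w t <= l & (\<forall>e>0. \<exists>d>0. \<forall>s. t - d < s & s < t --> \<bar>w s - l\<bar> < e)"
  shows "w \<in> Paths"
  using assms unfolding Paths_def right_cont_iff left_lim_iff by blast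

lemma pshift_Paths [simp, intro]:
  assumes w: "w \<in> Paths" shows "pshift t w \<in> Paths"
proof (rule PathsI)
  fix s :: real assume "s <= 0" then show "pshift t w s = 0" by (simp add: pshift_def)
next
  fix s e :: real assume "e > 0"
  from Paths_right[OF w this, of "max 0 t + max 0 s"] obtain d where
    d: "d > 0" "!!r. max 0 t + max 0 s <= r ==> r < max 0 t + max 0 s + d ==> \<bar>w r - w (max 0 t + max 0 s)\<bar> < e" by blast
  have "\<bar>pshift t w r - pshift t w s\<bar> < e" if "s <= r" "r < s + d" for r
    using d(2)[of "max 0 t + max 0 r"] that d(1) by (auto simp: pshift_def max_def split: if_splits)
  then show "\<exists>d>0. \<forall>r. s <= r & r < s + d --> \<bar>pshift t w r - pshift t w s\<bar> < e" using d(1) by blast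
next
  fix s :: real
  show "\<exists>l. pshift t w s <= l & (\<forall>e>0. \<exists>d>0. \<forall>r. s - d < r & r < s --> \<bar>pshift t w r - l\<bar> < e)"
  proof (cases "s <= 0")
    case True
    then show ?thesis by (intro exI[of _ 0]) (auto simp: pshift_def intro!: exI[of _ 1])
  next
    case False
    from Paths_left[OF w, of "max 0 t + s"] obtain l where
      l: "w (max 0 t + s) <= l" "!!e. e > 0 ==> \<exists>d>0. \<forall>r. max 0 t + s - d < r & r < max 0 t + s --> \<bar>w r - l\<bar> < e" by blast
    show ?thesis
    proof (rule exI[of _ "l - w (max 0 t)"], intro conjI allI impI)
      show "pshift t w s <= l - w (max 0 t)" using l(1) False by (simp add: pshift_def)
      fix e :: real assume "e > 0"
      from l(2)[OF this] obtain d where d: "d > 0" "\<forall>r. max 0 t + s - d < r & r < max 0 t + s --> \<bar>w r - l\<bar> < e" by blast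
      have "\<bar>pshift t w r - (l - w (max 0 t))\<bar> < e" if "s - min d s < r" "r < s" for r
        using d(2)[rule_format, of "max 0 t + r"] that by (auto simp: pshift_def)
      then show "\<exists>d>0. \<forall>r. s - d < r & r < s --> \<bar>pshift t w r - (l - w (max 0 t))\<bar> < e"
        using d(1) False by (intro exI[of _ "min d s"]) auto
    qed
  qed
qed

lemma pstop_Paths [simp, intro]:
  assumes w: "w \<in> Paths" shows "pstop t w \<in> Paths"
proof (rule PathsI)
  fix s :: real assume "s <= 0" then show "pstop t w s = 0" using w by (simp add: pstop_def Paths_0 min_def)
next
  fix s e :: real assume e: "e > 0"
  show "\<exists>d>0. \<forall>r. s <= r & r < s + d --> \<bar>pstop t w r - pstop t w s\<bar> < e"
  proof (cases "s < t")
    case True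
    from Paths_right[OF w e, of s] obtain d where
      d: "d > 0" "!!r. s <= r ==> r < s + d ==> \<bar>w r - w s\<bar> < e" by blast
    then show ?thesis using True by (intro exI[of _ "min d (t - s)"]) (auto simp: pstop_def min_def)
  next
    case False
    then show ?thesis using e by (intro exI[of _ 1]) (auto simp: pstop_def min_def)
  qed
next
  fix s :: real
  show "\<exists>l. pstop t w s <= l & (\<forall>e>0. \<exists>d>0. \<forall>r. s - d < r & r < s --> \<bar>pstop t w r - l\<bar> < e)"
  proof (cases "s <= t")
    case True
    from Paths_left[OF w, of s] obtain l where
      l: "w s <= l" "!!e. e > 0 ==> \<exists>d>0. \<forall>r. s - d < r & r < s --> \<bar>w r - l\<bar> < e" by blast
    show ?thesis
      using True l by (intro exI[of _ l]) (auto simp: pstop_def min_def)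
  next
    case False
    then show ?thesis by (intro exI[of _ "w t"]) (auto simp: pstop_def min_def intro!: exI[of _ "s - t"])
  qed
qed

lemma pshift_at: "0 <= t ==> 0 <= s ==> pshift t w s = w (t + s) - w t"
  by (simp add: pshift_def)

lemma pstop_at: "s <= t ==> pstop t w s = w s"
  by (simp add: pstop_def min_def)

lemma space_path_space [simp]: "space path_space = Paths"
  by (auto simp: path_space_def intro!: space_measure_of)

lemma sets_path_space: "sets path_space = sigma_sets Paths {{w\<in>Paths. \<forall>s\<in>J. w s > c s} | J c. finite J}"
  unfolding path_space_def by (rule sets_measure_of) auto

lemma eval_measurable [measurable]: "(%w. w t) \<in> borel_measurable path_space"
proof (rule borel_measurableI_greater)
  fix c :: real
  show "{w \<in> space path_space. c < w t} \<in> sets path_space"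
    unfolding sets_path_space
    by (intro sigma_sets.Basic CollectI exI[of _ "{t}"] exI[of _ "%_. c"]) auto
qed

lemma measurable_path_spaceI:
  assumes "!!x. x \<in> space N ==> f x \<in> Paths" "!!t. (%x. f x t) \<in> borel_measurable N"
  shows "f \<in> N \<rightarrow>\<^sub>M path_space"
  unfolding path_space_def
proof (rule measurable_measure_of)
  show "f \<in> space N \<rightarrow> Paths" using assms by auto
  fix y assume "y \<in> {{w\<in>Paths. \<forall>s\<in>J. w s > c s} | J c. finite J}"
  then obtain J and c :: "real => real" where y: "y = {w\<in>Paths. \<forall>s\<in>J. w s > c s}" "finite J" by blast
  have "f -` y \<inter> space N = {x\<in>space N. \<forall>s\<in>J. f x s > c s}" using assms(1) y by auto
  also have "... \<in> sets N" using assms(2) y(2) by measurable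
  finally show "f -` y \<inter> space N \<in> sets N" .
qed auto

text \<open>The time is approximated strictly from above by multiples of 1 / (n + 1). Each
  approximation takes countably many values, and right continuity carries measurability to the
  limit.\<close>

lemma eval_at_measurable:
  assumes p: "p \<in> N \<rightarrow>\<^sub>M path_space" and f [measurable]: "f \<in> borel_measurable N"
  shows "(%x. p x (f x)) \<in> borel_measurable N"
proof -
  define g where "g n x = (of_int \<lfloor>real (Suc n) * f x\<rfloor> + 1) / real (Suc n)" for n x
  have g1: "g n x > f x" "g n x <= f x + 1 / real (Suc n)" for n x
  proof -
    have "real (Suc n) * f x < of_int \<lfloor>real (Suc n) * f x\<rfloor> + 1" by linarith
    then show "g n x > f x" unfolding g_def by (subst pos_less_divide_eq) (auto simp: mult.commute)
    have "of_int \<lfloor>real (Suc n) * f x\<rfloor> + 1 <= real (Suc n) * f x + 1" by linarith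
    then have "g n x <= (real (Suc n) * f x + 1) / real (Suc n)" unfolding g_def by (intro divide_right_mono) auto
    also have "... = f x + 1 / real (Suc n)" by (simp add: field_simps)
    finally show "g n x <= f x + 1 / real (Suc n)" .
  qed
  have pm: "(%x. p x t) \<in> borel_measurable N" for t
    using measurable_compose[OF p eval_measurable[of t]] .
  have pg: "(%x. p x (g n x)) \<in> borel_measurable N" for n
  proof -
    have "(%x. (%i::int. %x. p x ((of_int i + 1) / real (Suc n))) (\<lfloor>real (Suc n) * f x\<rfloor>) x) \<in> borel_measurable N"
      by (rule measurable_compose_countable) (use pm in measurable)
    then show ?thesis by (simp add: g_def)
  qed
  show ?thesis
  proof (rule borel_measurable_LIMSEQ_real[OF _ pg])
    fix x assume x: "x \<in> space N"
    have lim: "(%n. g n x) \<longlonglongrightarrow> f x"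
    proof (rule tendsto_sandwich[of "%n. f x" _ _ "%n. f x + 1 / real (Suc n)"])
      show "(%n. f x + 1 / real (Suc n)) \<longlonglongrightarrow> f x"
        using tendsto_add[OF tendsto_const LIMSEQ_Suc[OF lim_1_over_n]] by simp
    qed (use g1 in \<open>auto intro!: less_imp_le always_eventually\<close>)
    show "(%n. p x (g n x)) \<longlonglongrightarrow> p x (f x)"
      by (rule Paths_right_lim[OF _ _ lim]) (use measurable_space[OF p x] g1 in \<open>auto intro: less_imp_le\<close>)
  qed
qed

lemma pshift_measurable:
  assumes [measurable]: "p \<in> N \<rightarrow>\<^sub>M path_space" "f \<in> borel_measurable N"
  shows "(%x. pshift (f x) (p x)) \<in> N \<rightarrow>\<^sub>M path_space"
proof (rule measurable_path_spaceI)
  fix x assume "x \<in> space N" then show "pshift (f x) (p x) \<in> Paths"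
    using measurable_space[OF assms(1)] by auto
next
  fix t show "(%x. pshift (f x) (p x) t) \<in> borel_measurable N"
    unfolding pshift_def
    by (rule borel_measurable_diff; rule eval_at_measurable[OF assms(1)]; measurable)
qed

lemma pstop_measurable [measurable]: "pstop t \<in> path_space \<rightarrow>\<^sub>M path_space"
  by (rule measurable_path_spaceI) (auto simp: pstop_def)

lemma pshift_measurable1 [measurable]: "pshift t \<in> path_space \<rightarrow>\<^sub>M path_space"
  using pshift_measurable[of "%x. x" path_space "%_. t"] by simp

text \<open>Local bounds come from right continuity on one side of a point and from the left limit
  on the other; \<open>Bolzano\<close> supplies the compactness that joins them.\<close>

lemma Paths_bdd_below:
  assumes w: "w \<in> Paths" shows "\<exists>B. \<forall>s\<in>{a..b}. w s \<ge> B"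
proof (cases "a <= b")
  case True
  define P where "P x y \<longleftrightarrow> (\<exists>B. \<forall>s\<in>{x..y}. w s \<ge> B)" for x y :: real
  have "P a b"
  proof (rule Bolzano[OF True])
    fix x y z assume "P x y" "P y z" then obtain B1 B2 where "\<forall>s\<in>{x..y}. w s \<ge> B1" "\<forall>s\<in>{y..z}. w s \<ge> B2"
      by (auto simp: P_def)
    then show "P x z" unfolding P_def
      apply (intro exI[of _ "min B1 B2"] ballI)
      subgoal for s by (cases "s <= y") (auto simp: min_le_iff_disj)
      done
  next
    fix t assume "a <= t" "t <= b"
    obtain d1 where d1: "d1 > 0" "!!s. t <= s ==> s < t + d1 ==> \<bar>w s - w t\<bar> < 1"
      using Paths_right[OF w, of 1 t] by auto
    obtain l where l: "w t <= l" "!!e. e > 0 ==> \<exists>d>0. \<forall>s. t - d < s & s < t --> \<bar>w s - l\<bar> < e"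
      using Paths_left[OF w, of t] by blast
    from l(2)[of 1] obtain d2 where d2: "d2 > 0" "\<forall>s. t - d2 < s & s < t --> \<bar>w s - l\<bar> < 1" by auto
    have "w s \<ge> w t - 1" if "t - min d1 d2 < s" "s < t + min d1 d2" for s
      using d1(2)[of s] d2(2)[rule_format, of s] l(1) that by (cases "s < t") (auto simp: min_def split: if_splits)
    then show "\<exists>d>0. \<forall>a b. a <= t & t <= b & b - a < d --> P a b" unfolding P_def using d1(1) d2(1)
      by (intro exI[of _ "min d1 d2"]) (auto intro!: exI[of _ "w t - 1"])
  qed
  then show ?thesis by (simp add: P_def)
qed auto

lemma Paths_bdd_above:
  assumes w: "w \<in> Paths" shows "\<exists>B. \<forall>s\<in>{a..b}. w s <= B"
proof (cases "a <= b")
  case True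
  define P where "P x y \<longleftrightarrow> (\<exists>B. \<forall>s\<in>{x..y}. w s <= B)" for x y :: real
  have "P a b"
  proof (rule Bolzano[OF True])
    fix x y z assume "P x y" "P y z" then obtain B1 B2 where "\<forall>s\<in>{x..y}. w s <= B1" "\<forall>s\<in>{y..z}. w s <= B2"
      by (auto simp: P_def)
    then show "P x z" unfolding P_def
      apply (intro exI[of _ "max B1 B2"] ballI)
      subgoal for s by (cases "s <= y") (auto simp: le_max_iff_disj)
      done
  next
    fix t assume "a <= t" "t <= b"
    obtain d1 where d1: "d1 > 0" "!!s. t <= s ==> s < t + d1 ==> \<bar>w s - w t\<bar> < 1"
      using Paths_right[OF w, of 1 t] by auto
    obtain l where l: "w t <= l" "!!e. e > 0 ==> \<exists>d>0. \<forall>s. t - d < s & s < t --> \<bar>w s - l\<bar> < e"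
      using Paths_left[OF w, of t] by blast
    from l(2)[of 1] obtain d2 where d2: "d2 > 0" "\<forall>s. t - d2 < s & s < t --> \<bar>w s - l\<bar> < 1" by auto
    have "w s <= l + 1" if "t - min d1 d2 < s" "s < t + min d1 d2" for s
      using d1(2)[of s] d2(2)[rule_format, of s] l(1) that by (cases "s < t") (auto simp: min_def split: if_splits)
    then show "\<exists>d>0. \<forall>a b. a <= t & t <= b & b - a < d --> P a b" unfolding P_def using d1(1) d2(1)
      by (intro exI[of _ "min d1 d2"]) (auto intro!: exI[of _ "l + 1"])
  qed
  then show ?thesis by (simp add: P_def)
qed auto

section \<open>Running infima of paths\<close>

definition inf_on :: "(real => real) => real => real => real" where
  "inf_on w a b = Inf (w ` {a..b})"

lemma inf_on_le: "w \<in> Paths ==> a <= s ==> s <= b ==> inf_on w a b <= w s"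
  unfolding inf_on_def using Paths_bdd_below[of w a b] by (intro cInf_lower) (auto simp: bdd_below_def)

lemma inf_on_ge_iff: "w \<in> Paths ==> a <= b ==> c <= inf_on w a b \<longleftrightarrow> (\<forall>s\<in>{a..b}. c <= w s)"
proof
  assume "w \<in> Paths" "c <= inf_on w a b"
  then show "\<forall>s\<in>{a..b}. c <= w s" using inf_on_le[of w a _ b] by fastforce
next
  assume "a <= b" "\<forall>s\<in>{a..b}. c <= w s"
  then show "c <= inf_on w a b" unfolding inf_on_def by (intro cInf_greatest) auto
qed

lemma inf_on_less_iff: "w \<in> Paths ==> a <= b ==> inf_on w a b < c \<longleftrightarrow> (\<exists>s\<in>{a..b}. w s < c)"
  using inf_on_ge_iff[of w a b c] by (auto simp: not_le[symmetric])

text \<open>Right continuity moves a witness to a rational on its right. This fails only when the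
  witness is the endpoint \<open>b\<close>; hence the separate disjunct.\<close>

lemma exists_rat_less:
  assumes w: "w \<in> Paths" and "a <= b"
  shows "(\<exists>s\<in>{a..b}. w s < c) \<longleftrightarrow> w b < c \<or> (\<exists>r::rat. a <= of_rat r & of_rat r <= b & w (of_rat r) < c)"
proof
  assume "\<exists>s\<in>{a..b}. w s < c"
  then obtain s where s: "a <= s" "s <= b" "w s < c" by auto
  show "w b < c \<or> (\<exists>r::rat. a <= of_rat r & of_rat r <= b & w (of_rat r) < c)"
  proof (cases "s = b")
    case False
    from Paths_right[OF w, of "c - w s" s] s obtain d where
      d: "d > 0" "!!r. s <= r ==> r < s + d ==> \<bar>w r - w s\<bar> < c - w s" by auto
    obtain r where "s < of_rat r" "of_rat r < min b (s + d)"
      using of_rat_dense[of s "min b (s + d)"] s False d by auto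
    then show ?thesis using d(2)[of "of_rat r"] s by (intro disjI2 exI[of _ r]) auto
  qed (use s in auto)
qed (use assms in auto)

lemma inf_on_measurable:
  assumes p: "p \<in> N \<rightarrow>\<^sub>M path_space" and [measurable]: "f \<in> borel_measurable N"
  shows "(%x. inf_on (p x) c (f x)) \<in> borel_measurable N"
proof (rule borel_measurableI_less)
  fix z
  have [measurable]: "(%x. p x (f x)) \<in> borel_measurable N" "!!t. (%x. p x t) \<in> borel_measurable N"
    using eval_at_measurable[OF p] by auto
  have "{x\<in>space N. inf_on (p x) c (f x) < z} = {x\<in>space N. (c <= f x & (p x (f x) < z \<or>
      (\<exists>r::rat. c <= of_rat r & of_rat r <= f x & p x (of_rat r) < z))) \<or> (\<not> c <= f x & Inf {} < z)}"
  proof (intro Collect_cong conj_cong refl)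
    fix x assume x: "x \<in> space N"
    then have "p x \<in> Paths" using measurable_space[OF p] by auto
    then show "(inf_on (p x) c (f x) < z) = ((c <= f x & (p x (f x) < z \<or>
      (\<exists>r::rat. c <= of_rat r & of_rat r <= f x & p x (of_rat r) < z))) \<or> (\<not> c <= f x & Inf {} < z))"
      using inf_on_less_iff[of "p x" c "f x" z] exists_rat_less[of "p x" c "f x" z]
      by (cases "c <= f x") (simp_all add: inf_on_def)
  qed
  also have "... \<in> sets N" by measurable
  finally show "{x\<in>space N. inf_on (p x) c (f x) < z} \<in> sets N" .
qed

abbreviation "rinf w t \<equiv> inf_on w 0 t"

lemma rinf_le0: "w \<in> Paths ==> 0 <= t ==> rinf w t <= 0"
  using inf_on_le[of w 0 0 t] by (auto simp: Paths_0)

lemma rinf_mono: "w \<in> Paths ==> 0 <= s ==> s <= t ==> rinf w t <= rinf w s"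
  by (subst inf_on_ge_iff) (auto intro: inf_on_le)

lemma rinf_shift:
  assumes w: "w \<in> Paths" "0 <= t" "0 <= s"
  shows "rinf w (t + s) = min (rinf w t) (w t + rinf (pshift t w) s)"
proof -
  have "c <= rinf w (t + s) \<longleftrightarrow> c <= min (rinf w t) (w t + rinf (pshift t w) s)" for c
  proof -
    have "c <= min (rinf w t) (w t + rinf (pshift t w) s) \<longleftrightarrow> (\<forall>r\<in>{0..t}. c <= w r) & (\<forall>r\<in>{0..s}. c - w t <= pshift t w r)"
      using inf_on_ge_iff[of w 0 t c] inf_on_ge_iff[of "pshift t w" 0 s "c - w t"] w by auto
    also have "... \<longleftrightarrow> (\<forall>r\<in>{0..t+s}. c <= w r)"
    proof safe
      fix r assume *: "\<forall>r\<in>{0..t}. c <= w r" "\<forall>r\<in>{0..s}. c - w t <= pshift t w r" "r \<in> {0..t+s}"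
      show "c <= w r"
      proof (cases "r <= t")
        case False
        then show ?thesis using *(2)[rule_format, of "r - t"] *(3) w by (auto simp: pshift_at)
      qed (use * in auto)
    next
      fix r assume *: "\<forall>r\<in>{0..t+s}. c <= w r" "r \<in> {0..s}"
      then show "c - w t <= pshift t w r" using *(1)[rule_format, of "t + r"] w by (auto simp: pshift_at)
    qed (use w in auto)
    also have "... \<longleftrightarrow> c <= rinf w (t + s)" using inf_on_ge_iff[of w 0 "t + s" c] w by auto
    finally show ?thesis by simp
  qed
  then show ?thesis by (meson order_antisym order_refl)
qed

lemma stop_rinf: "0 <= s ==> s <= t ==> rinf (pstop t w) s = rinf w s"
  unfolding inf_on_def by (intro arg_cong[of _ _ Inf] image_cong) (auto simp: pstop_at)

text \<open>\<open>hit\<close> is a real infimum with an uninformative value on the empty set, so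
  finiteness of the hitting time is carried separately.\<close>

definition fin :: "((real => real) => real => bool) => (real => real) => bool" where
  "fin Q w \<longleftrightarrow> (\<exists>t\<ge>0. Q w t)"

definition hit :: "((real => real) => real => bool) => (real => real) => real" where
  "hit Q w = Inf {t. 0 <= t & Q w t}"

text \<open>Persistence to the right lets rational times decide whether the event has occurred; the
  last clause says that only the past of the path matters. All passage events below are strict
  inequalities because they must persist.\<close>

definition progressive :: "((real => real) => real => bool) => bool" where
  "progressive Q \<longleftrightarrow> (\<forall>t. Measurable.pred path_space (%w. Q w t)) &
     (\<forall>w\<in>Paths. \<forall>t\<ge>0. Q w t --> (\<exists>d>0. \<forall>s. t <= s & s < t + d --> Q w s)) &
     (\<forall>w\<in>Paths. \<forall>s\<ge>0. \<forall>t\<ge>s. Q (pstop t w) s = Q w s)"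

lemma hit_ge0: "fin Q w ==> 0 <= hit Q w"
  unfolding hit_def fin_def by (rule cInf_greatest) auto

lemma hit_le: "0 <= t ==> Q w t ==> hit Q w <= t"
  unfolding hit_def by (rule cInf_lower) (auto intro: bdd_belowI[of _ 0])

lemma hit_not: "0 <= s ==> s < hit Q w ==> \<not> Q w s"
  using hit_le[of s Q w] by auto

lemma hit_less_iff: "fin Q w ==> hit Q w < c \<longleftrightarrow> (\<exists>s\<ge>0. s < c & Q w s)"
  unfolding hit_def fin_def by (subst cInf_less_iff) (auto intro: bdd_belowI[of _ 0])

lemma hit_approach: "fin Q w ==> e > 0 ==> \<exists>s. hit Q w <= s & s < hit Q w + e & Q w s"
  using hit_less_iff[of Q w "hit Q w + e"] hit_le[of _ Q w] by auto

lemma hit_greatest: "fin Q w ==> (!!s. 0 <= s ==> Q w s ==> c <= s) ==> c <= hit Q w"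
  using hit_less_iff[of Q w c] by (force simp: not_le)

lemma hit_shift:
  assumes t: "0 <= t" "!!s. 0 <= s ==> s < t ==> \<not> Q w s" and s: "!!s. 0 <= s ==> Q w (t + s) \<longleftrightarrow> Q' w' s"
  shows "fin Q w \<longleftrightarrow> fin Q' w'" "fin Q' w' ==> hit Q w = t + hit Q' w'"
proof -
  have q: "Q w r \<longleftrightarrow> r \<ge> t & Q' w' (r - t)" if "0 <= r" for r
    using t(2)[of r] s[of "r - t"] that t(1) by (cases "r < t") auto
  show "fin Q w \<longleftrightarrow> fin Q' w'"
    unfolding fin_def using q t(1) s by (metis add_nonneg_nonneg diff_ge_0_iff_ge)
  then show "hit Q w = t + hit Q' w'" if f: "fin Q' w'"
  proof (intro antisym)
    have "\<exists>r\<ge>0. Q' w' r & r < hit Q' w' + e" if "e > 0" for e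
      using hit_approach[OF f that] hit_ge0[OF f] by (meson order_trans)
    then have "hit Q w <= t + hit Q' w' + e" if "e > 0" for e
      using hit_le[of _ Q w] s t(1) that by (smt (verit))
    then show "hit Q w <= t + hit Q' w'" by (rule field_le_epsilon)
    show "t + hit Q' w' <= hit Q w"
    proof (rule hit_greatest)
      fix r assume "0 <= r" "Q w r" then show "t + hit Q' w' <= r"
        using q[of r] hit_le[of "r - t" Q' w'] by auto
    qed (use f \<open>fin Q w \<longleftrightarrow> fin Q' w'\<close> in auto)
  qed
qed

text \<open>Stopping at \<open>t\<close> hides nothing about entrances strictly before
  \<open>t\<close>. This is the stopping time property, expressed through stopped paths instead of a
  filtration. The inequality has to be strict: an event with hitting time \<open>t\<close> may begin
  only after \<open>t\<close>, where the stopped path does not show it.\<close>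

lemma hit_stop:
  assumes "progressive Q" "w \<in> Paths"
  shows "fin Q w & hit Q w < t \<longleftrightarrow> fin Q (pstop t w) & hit Q (pstop t w) < t"
    and "fin Q w ==> hit Q w < t ==> hit Q (pstop t w) = hit Q w"
proof -
  have q: "Q (pstop t w) s = Q w s" if "0 <= s" "s <= t" for s
    using assms that by (auto simp: progressive_def)
  have e: "fin Q v & hit Q v < t \<longleftrightarrow> (\<exists>s\<ge>0. s < t & Q v s)" for v
    using hit_less_iff[of Q v t] by (auto simp: fin_def)
  show 1: "fin Q w & hit Q w < t \<longleftrightarrow> fin Q (pstop t w) & hit Q (pstop t w) < t"
    unfolding e using q by (meson less_imp_le)
  assume f: "fin Q w" "hit Q w < t"
  with 1 have g: "fin Q (pstop t w)" "hit Q (pstop t w) < t" by auto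
  show "hit Q (pstop t w) = hit Q w"
  proof (rule antisym)
    show "hit Q (pstop t w) <= hit Q w"
    proof (rule hit_greatest[OF f(1)])
      fix s assume "0 <= s" "Q w s" then show "hit Q (pstop t w) <= s"
        using q[of s] hit_le[of s Q "pstop t w"] g by (cases "s <= t") auto
    qed
    show "hit Q w <= hit Q (pstop t w)"
    proof (rule hit_greatest[OF g(1)])
      fix s assume "0 <= s" "Q (pstop t w) s" then show "hit Q w <= s"
        using q[of s] hit_le[of s Q "w"] f by (cases "s <= t") auto
    qed
  qed
qed

lemma progressive_rat:
  assumes "progressive Q" "w \<in> Paths"
  shows "(\<exists>s\<ge>0. s < c & Q w s) \<longleftrightarrow> (\<exists>r::rat. 0 <= real_of_rat r & of_rat r < c & Q w (of_rat r))"
proof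
  assume "\<exists>s\<ge>0. s < c & Q w s"
  then obtain s where s: "s \<ge> 0" "s < c" "Q w s" by auto
  with assms obtain d where d: "d > 0" "\<forall>r. s <= r & r < s + d --> Q w r" unfolding progressive_def by blast
  obtain r where "s < of_rat r" "of_rat r < min c (s + d)"
    using of_rat_dense[of s "min c (s + d)"] s d by auto
  then show "\<exists>r::rat. 0 <= real_of_rat r & of_rat r < c & Q w (of_rat r)" using s d by (intro exI[of _ r] conjI) (auto simp del: zero_le_of_rat_iff)
qed (auto simp del: zero_le_of_rat_iff)

lemma fin_measurable [measurable (raw)]:
  assumes Q: "progressive Q" shows "Measurable.pred path_space (fin Q)"
proof -
  have [measurable]: "!!t. Measurable.pred path_space (%w. Q w t)" using Q by (auto simp: progressive_def)
  have "{w\<in>space path_space. fin Q w} = {w\<in>space path_space. \<exists>r::rat. 0 <= real_of_rat r & Q w (of_rat r)}"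
  proof (intro Collect_cong conj_cong refl)
    fix w assume "w \<in> space path_space"
    then have w: "w \<in> Paths" by simp
    show "fin Q w \<longleftrightarrow> (\<exists>r::rat. 0 <= real_of_rat r & Q w (of_rat r))"
      using progressive_rat[OF Q w] unfolding fin_def by (metis less_add_one)
  qed
  also have "... \<in> sets path_space" by measurable
  finally show ?thesis by (simp add: pred_def)
qed

lemma hit_measurable [measurable (raw)]:
  assumes Q: "progressive Q" shows "hit Q \<in> borel_measurable path_space"
proof (rule borel_measurableI_less)
  fix c
  note [measurable] = fin_measurable[OF Q]
  have [measurable]: "!!t. Measurable.pred path_space (%w. Q w t)" using Q by (auto simp: progressive_def)
  \<comment> \<open>On paths that never enter, \<open>hit\<close> has the constant value
    \<open>Inf {}\<close>, which is compared with \<open>c\<close> separately.\<close>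
  have "{w\<in>space path_space. hit Q w < c} = {w\<in>space path_space.
    (\<exists>r::rat. 0 <= real_of_rat r & of_rat r < c & Q w (of_rat r)) \<or> (\<not> fin Q w & Inf {} < c)}"
  proof (intro Collect_cong conj_cong refl)
    fix w assume "w \<in> space path_space"
    then have w: "w \<in> Paths" by simp
    show "hit Q w < c \<longleftrightarrow> (\<exists>r::rat. 0 <= real_of_rat r & of_rat r < c & Q w (of_rat r)) \<or> (\<not> fin Q w & Inf {} < c)"
    proof (cases "fin Q w")
      case True then show ?thesis using hit_less_iff[OF True, of c] progressive_rat[OF Q w, of c] by simp
    next
      case False
      then have "{t. 0 <= t & Q w t} = {}" by (auto simp: fin_def)
      then show ?thesis using False unfolding hit_def fin_def by (metis (no_types, lifting))
    qed
  qed
  also have "... \<in> sets path_space" by measurable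
  finally show "{w\<in>space path_space. hit Q w < c} \<in> sets path_space" .
qed

definition up :: "real => (real => real) => real => bool" where "up b w t \<longleftrightarrow> w t > b"
text \<open>The parameter is the initial height of the path above a floor, so \<open>dn 0\<close>
  refers to the starting level and a larger parameter means a deeper floor.\<close>

definition dn :: "real => (real => real) => real => bool" where "dn x w t \<longleftrightarrow> w t < - x"
definition ex :: "real => (real => real) => real => bool" where "ex a w t \<longleftrightarrow> w t - rinf w t > a"

lemma progressive_up [simp, intro]: "progressive (up b)"
  unfolding progressive_def
proof (intro conjI allI ballI impI)
  fix w t assume w: "w \<in> Paths" and "up b w t"
  then obtain d where "d > 0" "!!s. t <= s ==> s < t + d ==> \<bar>w s - w t\<bar> < w t - b"
    using Paths_right[OF w, of "w t - b" t] by (auto simp: up_def)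
  then show "\<exists>d>0. \<forall>s. t <= s & s < t + d --> up b w s" by (intro exI[of _ d]) (force simp: up_def)
qed (auto simp: up_def pstop_at)

lemma progressive_dn [simp, intro]: "progressive (dn b)"
  unfolding progressive_def
proof (intro conjI allI ballI impI)
  fix w t assume w: "w \<in> Paths" and "dn b w t"
  then obtain d where "d > 0" "!!s. t <= s ==> s < t + d ==> \<bar>w s - w t\<bar> < - b - w t"
    using Paths_right[OF w, of "- b - w t" t] by (auto simp: dn_def)
  then show "\<exists>d>0. \<forall>s. t <= s & s < t + d --> dn b w s" by (intro exI[of _ d]) (force simp: dn_def)
qed (auto simp: dn_def pstop_at)

lemma progressive_ex [simp, intro]: "progressive (ex b)"
  unfolding progressive_def
proof (intro conjI allI ballI impI)
  fix t
  have [measurable]: "(%w. rinf w t) \<in> borel_measurable path_space"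
    using inf_on_measurable[of "%w. w" path_space "%_. t"] by simp
  show "Measurable.pred path_space (%w. ex b w t)" unfolding ex_def by measurable
next
  fix w t assume w: "w \<in> Paths" and t: "0 <= t" and e: "ex b w t"
  then obtain d where d: "d > 0" "!!s. t <= s ==> s < t + d ==> \<bar>w s - w t\<bar> < w t - rinf w t - b"
    using Paths_right[OF w, of "w t - rinf w t - b" t] by (auto simp: ex_def)
  have "ex b w s" if "t <= s" "s < t + d" for s
    using d(2)[OF that] rinf_mono[OF w t that(1)] unfolding ex_def by linarith
  then show "\<exists>d>0. \<forall>s. t <= s & s < t + d --> ex b w s" using d(1) by auto
qed (auto simp: ex_def pstop_at stop_rinf)

abbreviation cylinder :: "real set => (real => real) => (real => real) set" where
  "cylinder J c \<equiv> {w\<in>Paths. \<forall>s\<in>J. w s > c s}"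

lemma cylinder_sets: "finite J ==> cylinder J c \<in> sets path_space"
  unfolding sets_path_space by (intro sigma_sets.Basic) blast

lemma path_measure_eqI:
  assumes m: "sets \<mu> = sets path_space" and n: "sets \<nu> = sets path_space" and f: "emeasure \<mu> Paths \<noteq> \<infinity>"
    and eq: "!!J c. finite J ==> emeasure \<mu> (cylinder J c) = emeasure \<nu> (cylinder J c)"
  shows "\<mu> = \<nu>"
proof (rule measure_eqI_generator_eq[where E="{cylinder J c | J c. finite J}" and \<Omega>=Paths and A="%_. Paths"])
  show "Int_stable {cylinder J c | J c. finite J}"
  proof (rule Int_stableI, safe)
    fix J1 J2 :: "real set" and c1 c2 :: "real => real" assume "finite J1" "finite J2"
    show "\<exists>J c. cylinder J1 c1 \<inter> cylinder J2 c2 = cylinder J c & finite J"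
      by (rule exI[of _ "J1 \<union> J2"], rule exI[of _ "%s. if s \<in> J1 then if s \<in> J2 then max (c1 s) (c2 s) else c1 s else c2 s"])
         (use \<open>finite J1\<close> \<open>finite J2\<close> in \<open>auto split: if_splits\<close>)
  qed
  show "sets \<mu> = sigma_sets Paths {cylinder J c | J c. finite J}" "sets \<nu> = sigma_sets Paths {cylinder J c | J c. finite J}"
    by (simp_all add: m n sets_path_space)
  have "Paths = cylinder {} (%_. 0)" by simp
  then show "range (%_. Paths) \<subseteq> {cylinder J c | J c. finite J}" by blast
  show "emeasure \<mu> Paths \<noteq> \<infinity>" by fact
  show "emeasure \<mu> X = emeasure \<nu> X" if "X \<in> {cylinder J c | J c. finite J}" for X
    using eq that by auto
qed auto

section \<open>Strong Markov property\<close>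

text \<open>An optional time restricted to an event, in the form of Galmarino's test: the path
  stopped at \<open>t\<close> reveals whether the event occurs with a time less than
  \<open>t\<close>, and then also the time itself.\<close>

definition determined :: "(real => real) set => ((real => real) => real) => bool" where
  "determined A \<tau> \<longleftrightarrow> A \<in> sets path_space & \<tau> \<in> borel_measurable path_space & (\<forall>w\<in>A. 0 <= \<tau> w) &
     (\<forall>w\<in>Paths. \<forall>t. (w \<in> A & \<tau> w < t \<longleftrightarrow> pstop t w \<in> A & \<tau> (pstop t w) < t) &
        (w \<in> A & \<tau> w < t --> \<tau> (pstop t w) = \<tau> w))"

text \<open>Independence and stationarity of the increments are packed into one equation of
  measures: the shifted path is independent of the stopped one and has law \<open>P\<close> again.
  \<open>goes_up\<close> excludes decreasing paths.\<close>

locale levy_law = prob_space P for P :: "(real => real) measure" +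
  assumes sets_P [measurable_cong]: "sets P = sets path_space"
    and markov: "0 <= t ==> distr P (path_space \<Otimes>\<^sub>M path_space) (%w. (pstop t w, pshift t w)) = distr P path_space (pstop t) \<Otimes>\<^sub>M P"
    and goes_up: "\<exists>t>0. emeasure P {w\<in>Paths. w t > 0} > 0"
begin

lemma space_P [simp]: "space P = Paths"
  using sets_eq_imp_space_eq[OF sets_P] by simp

lemma emeasure_Paths [simp]: "emeasure P Paths = 1"
  using emeasure_space_1 by simp

abbreviation nn_expectation (binder "\<N>" 10) where "nn_expectation f \<equiv> integral\<^sup>N P f"
notation expectation (binder "\<E>" 10)

lemma markov_nn:
  assumes t: "0 <= t" and U [measurable]: "U \<in> path_space \<rightarrow>\<^sub>M N" and F [measurable]: "F \<in> borel_measurable (N \<Otimes>\<^sub>M path_space)"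
    and s: "!!w. w \<in> Paths ==> U (pstop t w) = U w"
  shows "(\<N> w. F (U w, pshift t w)) = (\<N> w. \<N> w'. F (U w, w'))"
proof -
  interpret D: prob_space "distr P path_space (pstop t)"
    by (rule prob_space_distr) measurable
  have "(\<N> w. F (U w, pshift t w)) = (\<N> w. F (U (pstop t w), pshift t w))"
    by (intro nn_integral_cong) (simp add: s)
  also have "... = (\<integral>\<^sup>+z. F (U (fst z), snd z) \<partial>distr P (path_space \<Otimes>\<^sub>M path_space) (%w. (pstop t w, pshift t w)))"
    by (subst nn_integral_distr) simp_all
  also have "... = (\<integral>\<^sup>+z. F (U (fst z), snd z) \<partial>(distr P path_space (pstop t) \<Otimes>\<^sub>M P))"
    by (simp add: markov t)
  also have "... = (\<integral>\<^sup>+v. (\<N> w'. F (U v, w')) \<partial>distr P path_space (pstop t))"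
    by (subst nn_integral_fst[symmetric]) simp_all
  also have "... = (\<N> w. \<N> w'. F (U (pstop t w), w'))"
    by (subst nn_integral_distr) (simp_all add: borel_measurable_nn_integral)
  also have "... = (\<N> w. \<N> w'. F (U w, w'))"
    by (intro nn_integral_cong) (simp add: s)
  finally show ?thesis .
qed

text \<open>The random time is replaced by grid values above it, where the Markov property at fixed
  times applies. Indicators of cylinders are not continuous in the path values, so they are first
  replaced by continuous functions \<open>\<phi> k\<close> that increase to them.\<close>

lemma strong_markov_cylinder:
  assumes A: "determined A \<tau>" and J: "finite J"
  shows "emeasure P {w\<in>A. \<forall>s\<in>J. pshift (\<tau> w) w s > c s} = emeasure P A * emeasure P (cylinder J c)"
proof -
  have Am [measurable]: "A \<in> sets path_space" and tm [measurable]: "\<tau> \<in> borel_measurable path_space"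
    and t0: "!!w. w \<in> A ==> 0 <= \<tau> w"
    and st: "!!w t. w \<in> Paths ==> (w \<in> A & \<tau> w < t \<longleftrightarrow> pstop t w \<in> A & \<tau> (pstop t w) < t)"
      "!!w t. w \<in> Paths ==> w \<in> A & \<tau> w < t ==> \<tau> (pstop t w) = \<tau> w"
    using A unfolding determined_def by blast+
  have AP: "A \<subseteq> Paths" using sets.sets_into_space[OF Am] by simp
  define \<phi> where "\<phi> k w = (\<Prod>s\<in>J. min 1 (max 0 (real k * (w s - c s))))" for k :: nat and w :: "real => real"
  have \<phi>m [measurable]: "\<phi> k \<in> borel_measurable path_space" for k unfolding \<phi>_def by measurable
  have \<phi>01: "0 <= \<phi> k w" "\<phi> k w <= 1" for k w unfolding \<phi>_def
    by (auto intro!: prod_nonneg prod_le_1)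
  \<comment> \<open>The summand 1 places the grid value strictly above the time, so that membership
    in \<open>B n i\<close> is decided by the path stopped at \<open>T n i\<close>.\<close>
  define T where "T n i = (real i + 1) / real (Suc n)" for n i :: nat
  define j where "j n w = nat \<lfloor>real (Suc n) * \<tau> w\<rfloor>" for n w
  have T: "\<tau> w < T n (j n w)" "T n (j n w) <= \<tau> w + 1 / real (Suc n)" if "w \<in> A" for n w
  proof -
    have *: "real (j n w) = of_int \<lfloor>real (Suc n) * \<tau> w\<rfloor>" using t0[OF that] by (simp add: j_def)
    have "real (Suc n) * \<tau> w < of_int \<lfloor>real (Suc n) * \<tau> w\<rfloor> + 1" by linarith
    then show "\<tau> w < T n (j n w)" unfolding T_def * by (subst pos_less_divide_eq) (auto simp: mult.commute)
    have "of_int \<lfloor>real (Suc n) * \<tau> w\<rfloor> + 1 <= real (Suc n) * \<tau> w + 1" by linarith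
    then have "T n (j n w) <= (real (Suc n) * \<tau> w + 1) / real (Suc n)" unfolding T_def * by (intro divide_right_mono) auto
    also have "... = \<tau> w + 1 / real (Suc n)" by (simp add: field_simps)
    finally show "T n (j n w) <= \<tau> w + 1 / real (Suc n)" .
  qed
  have T0: "0 <= T n i" for n i by (simp add: T_def)
  have jm [measurable]: "j n \<in> measurable path_space (count_space UNIV)" for n unfolding j_def by measurable
  have sm [measurable]: "(%w. pshift (T n (j n w)) w) \<in> path_space \<rightarrow>\<^sub>M path_space"
      "(%w. pshift (\<tau> w) w) \<in> path_space \<rightarrow>\<^sub>M path_space" for n
    unfolding T_def by (auto intro!: pshift_measurable)
  define B where "B n i = {w\<in>A. j n w = i}" for n i
  have Bm [measurable]: "B n i \<in> sets path_space" for n i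
  proof -
    have "B n i = A \<inter> {w\<in>space path_space. j n w = i}" unfolding B_def using AP by auto
    also have "... \<in> sets path_space" by measurable
    finally show ?thesis .
  qed
  have B_alt: "w \<in> B n i \<longleftrightarrow> w \<in> A & \<tau> w < T n i & real i / real (Suc n) <= \<tau> w" for w n i
  proof (cases "w \<in> A")
    case True
    then have "j n w = i \<longleftrightarrow> real i <= real (Suc n) * \<tau> w & real (Suc n) * \<tau> w < real i + 1"
      using t0[OF True] unfolding j_def by (auto simp: nat_eq_iff floor_eq_iff)
    also have "... \<longleftrightarrow> \<tau> w < T n i & real i / real (Suc n) <= \<tau> w"
      unfolding T_def by (subst pos_less_divide_eq, simp, subst pos_divide_le_eq) (auto simp: mult.commute)
    finally show ?thesis using True by (simp add: B_def)
  qed (simp add: B_def)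
  have Bst: "pstop (T n i) w \<in> B n i \<longleftrightarrow> w \<in> B n i" if "w \<in> Paths" for n i w
    unfolding B_alt using st[OF that, of "T n i"] by metis
  have ind: "(\<Sum>i. indicator (B n i) w * f i) = indicator A w * f (j n w)" for f :: "nat => ennreal" and w n
  proof -
    have "(\<Sum>i. indicator (B n i) w * f i) = (\<Sum>i\<in>{j n w}. indicator (B n i) w * f i)"
      by (rule suminf_finite) (auto simp: B_def)
    also have "... = indicator A w * f (j n w)" by (simp add: B_def indicator_def)
    finally show ?thesis .
  qed
  have step: "(\<N> w. indicator A w * ennreal (\<phi> k (pshift (T n (j n w)) w))) = emeasure P A * (\<N> w. ennreal (\<phi> k w))" for n k
  proof -
    have one: "(\<N> w. indicator (B n i) w * ennreal (\<phi> k (pshift (T n i) w))) = emeasure P (B n i) * (\<N> w. ennreal (\<phi> k w))" for i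
    proof -
      have "(\<N> w. indicator (B n i) w * ennreal (\<phi> k (pshift (T n i) w))) =
        (\<N> w. (%z. fst z * ennreal (\<phi> k (snd z))) (indicator (B n i) w, pshift (T n i) w))" by simp
      also have "... = (\<N> w. \<N> w'. (%z. fst z * ennreal (\<phi> k (snd z))) (indicator (B n i) w, w'))"
        by (rule markov_nn[OF T0, where N=borel]) (auto simp: indicator_def Bst)
      also have "... = (\<N> w. indicator (B n i) w * (\<N> w'. ennreal (\<phi> k w')))"
        by (simp add: nn_integral_cmult)
      also have "... = emeasure P (B n i) * (\<N> w. ennreal (\<phi> k w))"
        by (simp add: nn_integral_multc)
      finally show ?thesis .
    qed
    have "(\<N> w. indicator A w * ennreal (\<phi> k (pshift (T n (j n w)) w))) = (\<N> w. (\<Sum>i. indicator (B n i) w * ennreal (\<phi> k (pshift (T n i) w))))"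
      by (simp add: ind)
    also have "... = (\<Sum>i. \<N> w. indicator (B n i) w * ennreal (\<phi> k (pshift (T n i) w)))"
      by (rule nn_integral_suminf) measurable
    also have "... = (\<Sum>i. emeasure P (B n i)) * (\<N> w. ennreal (\<phi> k w))"
      by (simp add: one)
    also have "(\<Sum>i. emeasure P (B n i)) = (\<Sum>i. \<N> w. indicator (B n i) w * 1)" by simp
    also have "... = (\<N> w. (\<Sum>i. indicator (B n i) w * 1))"
      by (rule nn_integral_suminf[symmetric]) measurable
    also have "... = emeasure P A" by (subst ind) simp
    finally show ?thesis .
  qed
  have lim1: "(%n. \<phi> k (pshift (T n (j n w)) w)) \<longlonglongrightarrow> \<phi> k (pshift (\<tau> w) w)" if w: "w \<in> A" for k w
  proof -
    have wP: "w \<in> Paths" using w AP by auto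
    have lim: "(%n. T n (j n w)) \<longlonglongrightarrow> \<tau> w"
    proof (rule tendsto_sandwich[of "%n. \<tau> w" _ _ "%n. \<tau> w + 1 / real (Suc n)"])
      show "(%n. \<tau> w + 1 / real (Suc n)) \<longlonglongrightarrow> \<tau> w"
        using tendsto_add[OF tendsto_const LIMSEQ_Suc[OF lim_1_over_n]] by simp
    qed (use T[OF w] in \<open>auto intro!: less_imp_le always_eventually\<close>)
    have "(%n. pshift (T n (j n w)) w s) \<longlonglongrightarrow> pshift (\<tau> w) w s" for s
    proof -
      have a: "max 0 (T n (j n w)) = T n (j n w)" "max 0 (\<tau> w) = \<tau> w" for n using T0 t0[OF w] by auto
      show ?thesis unfolding pshift_def a
        by (intro tendsto_diff Paths_right_lim[OF wP] tendsto_add lim tendsto_const)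
           (use T(1)[OF w] in \<open>auto intro: less_imp_le\<close>)
    qed
    then show ?thesis unfolding \<phi>_def by (intro tendsto_intros)
  qed
  have lim2: "(%k. \<phi> k w) \<longlonglongrightarrow> indicator {w. \<forall>s\<in>J. w s > c s} w" for w
  proof (cases "\<forall>s\<in>J. w s > c s")
    case True
    have "(%k. min 1 (max 0 (real k * (w s - c s)))) \<longlonglongrightarrow> 1" if sJ: "s \<in> J" for s
    proof (rule tendsto_eventually)
      have "w s - c s > 0" using True sJ by auto
      obtain N where N: "real N * (w s - c s) > 1" using reals_Archimedean3[OF \<open>w s - c s > 0\<close>] by blast
      show "\<forall>\<^sub>F k in sequentially. min 1 (max 0 (real k * (w s - c s))) = 1"
        unfolding eventually_sequentially
      proof (intro exI[of _ N] allI impI)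
        fix k assume "N <= k"
        then have "real N * (w s - c s) <= real k * (w s - c s)" using \<open>w s - c s > 0\<close> by (intro mult_right_mono) (auto intro: less_imp_le)
        then show "min 1 (max 0 (real k * (w s - c s))) = 1" using N by auto
      qed
    qed
    then have "(%k. \<phi> k w) \<longlonglongrightarrow> (\<Prod>s\<in>J. 1)" unfolding \<phi>_def by (intro tendsto_prod)
    then show ?thesis using True by simp
  next
    case False
    then obtain s where s: "s \<in> J" "w s <= c s" by (auto simp: not_less)
    have "\<phi> k w = 0" for k unfolding \<phi>_def
    proof (rule prod_zero[OF J], intro bexI[OF _ s(1)])
      have "real k * (w s - c s) <= 0" using s(2) by (simp add: mult_nonneg_nonpos)
      then show "min 1 (max 0 (real k * (w s - c s))) = 0" by auto
    qed
    then show ?thesis using False by simp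
  qed
  have fin1: "(\<N> w. 1) < \<infinity>" by simp
  \<comment> \<open>The grid is refined at fixed k; this limit needs right continuity of the path
    and continuity of \<open>\<phi> k\<close>. Only afterwards k tends to infinity.\<close>
  have eq_k: "(\<N> w. indicator A w * ennreal (\<phi> k (pshift (\<tau> w) w))) = emeasure P A * (\<N> w. ennreal (\<phi> k w))" for k
  proof (rule LIMSEQ_unique)
    show "(%n. \<N> w. indicator A w * ennreal (\<phi> k (pshift (T n (j n w)) w))) \<longlonglongrightarrow> (\<N> w. indicator A w * ennreal (\<phi> k (pshift (\<tau> w) w)))"
    proof (rule nn_integral_dominated_convergence[where w="%_. 1"])
      show "AE w in P. (%n. indicator A w * ennreal (\<phi> k (pshift (T n (j n w)) w))) \<longlonglongrightarrow> indicator A w * ennreal (\<phi> k (pshift (\<tau> w) w))"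
      proof (rule AE_I2)
        fix w show "(%n. indicator A w * ennreal (\<phi> k (pshift (T n (j n w)) w))) \<longlonglongrightarrow> indicator A w * ennreal (\<phi> k (pshift (\<tau> w) w))"
          by (cases "w \<in> A") (auto intro!: tendsto_ennrealI lim1)
      qed
    qed (use fin1 \<phi>01 in \<open>auto simp: indicator_def\<close>)
    show "(%n. \<N> w. indicator A w * ennreal (\<phi> k (pshift (T n (j n w)) w))) \<longlonglongrightarrow> emeasure P A * (\<N> w. ennreal (\<phi> k w))"
      by (simp add: step)
  qed
  have r1: "(%k. \<N> w. indicator A w * ennreal (\<phi> k (pshift (\<tau> w) w))) \<longlonglongrightarrow> (\<N> w. indicator A w * ennreal (indicator {w. \<forall>s\<in>J. w s > c s} (pshift (\<tau> w) w)))"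
  proof (rule nn_integral_dominated_convergence[where w="%_. 1"])
    show "AE w in P. (%k. indicator A w * ennreal (\<phi> k (pshift (\<tau> w) w))) \<longlonglongrightarrow> indicator A w * ennreal (indicator {w. \<forall>s\<in>J. w s > c s} (pshift (\<tau> w) w))"
      by (rule AE_I2) (intro ennreal_tendsto_cmult tendsto_ennrealI lim2, simp add: indicator_def)
    have "(%w. indicator {w\<in>space path_space. \<forall>s\<in>J. w s > c s} (pshift (\<tau> w) w) :: real) \<in> borel_measurable path_space"
      using J by (intro measurable_compose[OF sm(2)] borel_measurable_indicator) measurable
    also have "?this \<longleftrightarrow> (%w. indicator {w. \<forall>s\<in>J. w s > c s} (pshift (\<tau> w) w) :: real) \<in> borel_measurable path_space"
      by (intro measurable_cong) (auto simp: indicator_def)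
    finally show "(%w. indicator A w * ennreal (indicator {w. \<forall>s\<in>J. w s > c s} (pshift (\<tau> w) w))) \<in> borel_measurable P"
      by simp
  qed (use fin1 \<phi>01 in \<open>auto simp: indicator_def\<close>)
  have C: "(cylinder J c) \<in> sets path_space" unfolding sets_path_space using J by (intro sigma_sets.Basic) blast
  have "(%k. \<N> w. ennreal (\<phi> k w)) \<longlonglongrightarrow> (\<N> w. ennreal (indicator (cylinder J c) w))"
  proof (rule nn_integral_dominated_convergence[where w="%_. 1"])
    show "AE w in P. (%k. ennreal (\<phi> k w)) \<longlonglongrightarrow> ennreal (indicator (cylinder J c) w)"
    proof (rule AE_I2)
      fix w assume "w \<in> space P"
      then have "indicator (cylinder J c) w = (indicator {w. \<forall>s\<in>J. w s > c s} w :: real)" by (auto simp: indicator_def)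
      then show "(%k. ennreal (\<phi> k w)) \<longlonglongrightarrow> ennreal (indicator (cylinder J c) w)"
        using lim2[of w] by auto
    qed
  qed (use fin1 \<phi>01 C[folded sets_P] in auto)
  then have "(%k. emeasure P A * (\<N> w. ennreal (\<phi> k w))) \<longlonglongrightarrow> emeasure P A * (\<N> w. ennreal (indicator (cylinder J c) w))"
    by (intro ennreal_tendsto_cmult) (simp_all add: less_top[symmetric] emeasure_eq_measure)
  with r1 have "(\<N> w. indicator A w * ennreal (indicator {w. \<forall>s\<in>J. w s > c s} (pshift (\<tau> w) w))) = emeasure P A * (\<N> w. ennreal (indicator (cylinder J c) w))"
    unfolding eq_k by (rule LIMSEQ_unique)
  also have "(\<N> w. ennreal (indicator (cylinder J c) w)) = emeasure P (cylinder J c)"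
    using C by (simp add: ennreal_indicator sets_P)
  also have "(\<N> w. indicator A w * ennreal (indicator {w. \<forall>s\<in>J. w s > c s} (pshift (\<tau> w) w))) = (\<N> w. indicator {w\<in>A. \<forall>s\<in>J. pshift (\<tau> w) w s > c s} w)"
    by (intro nn_integral_cong) (auto simp: indicator_def)
  also have "... = emeasure P {w\<in>A. \<forall>s\<in>J. pshift (\<tau> w) w s > c s}"
  proof (rule nn_integral_indicator)
    have "{w\<in>A. \<forall>s\<in>J. pshift (\<tau> w) w s > c s} = A \<inter> ((%w. pshift (\<tau> w) w) -` (cylinder J c) \<inter> space path_space)"
      using AP by auto
    also have "... \<in> sets path_space" using C by measurable
    finally show "{w\<in>A. \<forall>s\<in>J. pshift (\<tau> w) w s > c s} \<in> sets P" by (simp add: sets_P)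
  qed
  finally show ?thesis .
qed

text \<open>Restricting \<open>A\<close> to an event of \<open>V\<close> gives another determined
  event, so the cylinder case yields the product formula on rectangles, and rectangles determine a
  product measure. Since \<open>F\<close> is jointly measurable, the functional of the future may
  depend on what has been observed before the random time.\<close>

lemma strong_markov:
  assumes A: "determined A \<tau>" and V [measurable]: "V \<in> path_space \<rightarrow>\<^sub>M N"
    and Vst: "!!w t. w \<in> A ==> \<tau> w < t ==> V (pstop t w) = V w"
    and F [measurable]: "F \<in> borel_measurable (N \<Otimes>\<^sub>M path_space)"
  shows "(\<N> w. indicator A w * F (V w, pshift (\<tau> w) w)) = (\<N> w. indicator A w * (\<N> w'. F (V w, w')))"
proof -
  have Am [measurable]: "A \<in> sets path_space" and tm [measurable]: "\<tau> \<in> borel_measurable path_space"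
    and t0: "!!w. w \<in> A ==> 0 <= \<tau> w"
    and st: "!!w t. w \<in> Paths ==> (w \<in> A & \<tau> w < t \<longleftrightarrow> pstop t w \<in> A & \<tau> (pstop t w) < t)"
      "!!w t. w \<in> Paths ==> w \<in> A & \<tau> w < t ==> \<tau> (pstop t w) = \<tau> w"
    using A unfolding determined_def by blast+
  have AP: "A \<subseteq> Paths" using sets.sets_into_space[OF Am] by simp
  have sm [measurable]: "(%w. pshift (\<tau> w) w) \<in> path_space \<rightarrow>\<^sub>M path_space"
    by (auto intro!: pshift_measurable)
  define A' where "A' B = {w\<in>A. V w \<in> B}" for B
  have A'm: "A' B \<in> sets path_space" if "B \<in> sets N" for B
  proof -
    have "A' B = A \<inter> (V -` B \<inter> space path_space)" unfolding A'_def using AP by auto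
    also have "... \<in> sets path_space" using that by measurable
    finally show ?thesis .
  qed
  have det: "determined (A' B) \<tau>" if B: "B \<in> sets N" for B
    unfolding determined_def
  proof (intro conjI ballI allI A'm B tm)
    fix w assume "w \<in> A' B" then show "0 <= \<tau> w" using t0 by (simp add: A'_def)
  next
    fix w t assume w: "w \<in> Paths"
    have "V (pstop t w) = V w" if "w \<in> A & \<tau> w < t" using Vst that by auto
    then show "(w \<in> A' B & \<tau> w < t) = (pstop t w \<in> A' B & \<tau> (pstop t w) < t)"
      using st(1)[OF w, of t] unfolding A'_def by auto
    show "w \<in> A' B & \<tau> w < t --> \<tau> (pstop t w) = \<tau> w" using st(2)[OF w, of t] unfolding A'_def by auto
  qed
  \<comment> \<open>For fixed \<open>B\<close> both sides are finite measures in \<open>C\<close>,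
    so cylinders are enough, and for them the cylinder case applies to the event
    \<open>A' B\<close>.\<close>
  have rect: "emeasure P {w\<in>A' B. pshift (\<tau> w) w \<in> C} = emeasure P (A' B) * emeasure P C" if B: "B \<in> sets N" and C: "C \<in> sets path_space" for B C
  proof -
    note A'm[OF B, measurable]
    define \<mu> where "\<mu> = distr (density P (indicator (A' B))) path_space (%w. pshift (\<tau> w) w)"
    define \<nu> where "\<nu> = scale_measure (emeasure P (A' B)) P"
    have em: "emeasure \<mu> C = emeasure P {w\<in>A' B. pshift (\<tau> w) w \<in> C}" if C: "C \<in> sets path_space" for C
    proof -
      have "emeasure \<mu> C = emeasure (density P (indicator (A' B))) ((%w. pshift (\<tau> w) w) -` C \<inter> Paths)"
        unfolding \<mu>_def using C by (subst emeasure_distr) simp_all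
      also have "... = (\<N> w. indicator (A' B) w * indicator ((%w. pshift (\<tau> w) w) -` C \<inter> Paths) w)"
        using C measurable_sets[OF sm C] by (subst emeasure_density) (simp_all add: sets_P)
      also have "... = (\<N> w. indicator {w\<in>A' B. pshift (\<tau> w) w \<in> C} w)"
        by (intro nn_integral_cong) (auto simp: indicator_def)
      also have "... = emeasure P {w\<in>A' B. pshift (\<tau> w) w \<in> C}"
      proof (rule nn_integral_indicator)
        have "{w\<in>A' B. pshift (\<tau> w) w \<in> C} = A' B \<inter> ((%w. pshift (\<tau> w) w) -` C \<inter> space path_space)"
          using AP by (auto simp: A'_def)
        also have "... \<in> sets path_space" using C by measurable
        finally show "{w\<in>A' B. pshift (\<tau> w) w \<in> C} \<in> sets P" by (simp add: sets_P)
      qed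
      finally show ?thesis .
    qed
    have en: "emeasure \<nu> C = emeasure P (A' B) * emeasure P C" for C
      unfolding \<nu>_def by simp
    have "\<mu> = \<nu>"
    proof (rule path_measure_eqI)
      show "sets \<mu> = sets path_space" "sets \<nu> = sets path_space" by (simp_all add: \<mu>_def \<nu>_def sets_P)
      show "emeasure \<mu> Paths \<noteq> \<infinity>" using em[of Paths] sets.top[of path_space] by (simp add: emeasure_eq_measure)
      fix J c assume J: "finite (J :: real set)"
      have "{w\<in>A' B. pshift (\<tau> w) w \<in> cylinder J c} = {w\<in>A' B. \<forall>s\<in>J. pshift (\<tau> w) w s > c s}" using AP by (auto simp: A'_def)
      then show "emeasure \<mu> (cylinder J c) = emeasure \<nu> (cylinder J c)"
        unfolding em[OF cylinder_sets[OF J]] en using strong_markov_cylinder[OF det[OF B] J] by simp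
    qed
    then show ?thesis using em[OF C] en[of C] by simp
  qed
  define \<rho> where "\<rho> = distr (density P (indicator A)) (N \<Otimes>\<^sub>M path_space) (%w. (V w, pshift (\<tau> w) w))"
  define \<rho>1 where "\<rho>1 = distr (density P (indicator A)) N V"
  have fA: "finite_measure (density P (indicator A))"
  proof (rule finite_measureI)
    have "emeasure (density P (indicator A)) Paths = (\<N> w. indicator A w)"
    proof -
      have "Paths \<in> sets P" using sets.top[of P] by simp
      then have "emeasure (density P (indicator A)) Paths = (\<N> w. indicator A w * indicator Paths w)"
        by (intro emeasure_density) simp_all
      also have "... = (\<N> w. indicator A w)" by (intro nn_integral_cong) simp
      finally show ?thesis .
    qed
    then show "emeasure (density P (indicator A)) (space (density P (indicator A))) \<noteq> \<infinity>"
      by (simp add: emeasure_eq_measure)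
  qed
  then interpret R1: finite_measure \<rho>1 unfolding \<rho>1_def
    by (rule finite_measure.finite_measure_distr) measurable
  have "\<rho>1 \<Otimes>\<^sub>M P = \<rho>"
  proof (rule pair_measure_eqI)
    show "sigma_finite_measure \<rho>1" "sigma_finite_measure P" by unfold_locales
    show "sets (\<rho>1 \<Otimes>\<^sub>M P) = sets \<rho>" by (simp add: \<rho>_def \<rho>1_def sets_P cong: sets_pair_measure_cong)
    fix B C assume "B \<in> sets \<rho>1" "C \<in> sets P"
    then have B: "B \<in> sets N" and C: "C \<in> sets path_space" by (simp_all add: \<rho>1_def sets_P)
    have "emeasure \<rho>1 B = emeasure (density P (indicator A)) (V -` B \<inter> Paths)"
      unfolding \<rho>1_def using B by (subst emeasure_distr) simp_all
    also have "... = (\<N> w. indicator A w * indicator (V -` B \<inter> Paths) w)"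
      using measurable_sets[OF V B] by (subst emeasure_density) (simp_all add: sets_P)
    also have "... = (\<N> w. indicator (A' B) w)"
      by (intro nn_integral_cong) (auto simp: indicator_def A'_def)
    also have "... = emeasure P (A' B)" using A'm[OF B] by (simp add: sets_P)
    finally have 1: "emeasure \<rho>1 B = emeasure P (A' B)" .
    have BC: "(%w. (V w, pshift (\<tau> w) w)) -` (B \<times> C) \<inter> space path_space \<in> sets path_space"
      using B C by (intro measurable_sets[of _ _ "N \<Otimes>\<^sub>M path_space"]) auto
    have "emeasure \<rho> (B \<times> C) = emeasure (density P (indicator A)) ((%w. (V w, pshift (\<tau> w) w)) -` (B \<times> C) \<inter> Paths)"
      unfolding \<rho>_def using B C by (subst emeasure_distr) simp_all
    also have "... = (\<N> w. indicator A w * indicator ((%w. (V w, pshift (\<tau> w) w)) -` (B \<times> C) \<inter> Paths) w)"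
      using BC by (subst emeasure_density) (simp_all add: sets_P)
    also have "... = (\<N> w. indicator {w\<in>A' B. pshift (\<tau> w) w \<in> C} w)"
      by (intro nn_integral_cong) (auto simp: indicator_def A'_def)
    also have "... = emeasure P {w\<in>A' B. pshift (\<tau> w) w \<in> C}"
    proof (rule nn_integral_indicator)
      have "{w\<in>A' B. pshift (\<tau> w) w \<in> C} = A' B \<inter> ((%w. pshift (\<tau> w) w) -` C \<inter> space path_space)"
        using AP by (auto simp: A'_def)
      also have "... \<in> sets path_space" using C A'm[OF B] by measurable
      finally show "{w\<in>A' B. pshift (\<tau> w) w \<in> C} \<in> sets P" by (simp add: sets_P)
    qed
    finally show "emeasure \<rho>1 B * emeasure P C = emeasure \<rho> (B \<times> C)" using rect[OF B C] 1 by simp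
  qed
  have "(\<N> w. indicator A w * F (V w, pshift (\<tau> w) w)) = (\<integral>\<^sup>+w. F (V w, pshift (\<tau> w) w) \<partial>density P (indicator A))"
    by (subst nn_integral_density) simp_all
  also have "... = (\<integral>\<^sup>+z. F z \<partial>\<rho>)" unfolding \<rho>_def by (subst nn_integral_distr) simp_all
  also have "... = (\<integral>\<^sup>+v. (\<N> w'. F (v, w')) \<partial>\<rho>1)"
    unfolding \<open>\<rho>1 \<Otimes>\<^sub>M P = \<rho>\<close>[symmetric]
    by (subst nn_integral_fst[symmetric]) (simp_all add: \<rho>1_def)
  also have "... = (\<integral>\<^sup>+w. (\<N> w'. F (V w, w')) \<partial>density P (indicator A))"
    unfolding \<rho>1_def by (subst nn_integral_distr) (simp_all add: borel_measurable_nn_integral)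
  also have "... = (\<N> w. indicator A w * (\<N> w'. F (V w, w')))"
    by (subst nn_integral_density) (simp_all add: borel_measurable_nn_integral)
  finally show ?thesis .
qed

end

section \<open>The law of the process on path space\<close>

text \<open>Cylinders determine a measure in one path variable. The product formula is therefore
  extended from cylinders to measurable sets first in the second factor and then in the
  first.\<close>

lemma path_pair_measure_eqI:
  assumes s: "sets \<mu> = sets (path_space \<Otimes>\<^sub>M path_space)" and s1: "sets \<mu>1 = sets path_space" and s2: "sets \<mu>2 = sets path_space"
    and f: "finite_measure \<mu>" and f1: "finite_measure \<mu>1" and f2: "finite_measure \<mu>2"
    and eq: "!!J c K d. finite J ==> finite K ==> emeasure \<mu> (cylinder J c \<times> cylinder K d) = emeasure \<mu>1 (cylinder J c) * emeasure \<mu>2 (cylinder K d)"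
  shows "\<mu>1 \<Otimes>\<^sub>M \<mu>2 = \<mu>"
proof -
  have P: "Paths \<in> sets path_space" using sets.top[of path_space] by simp
  have sp: "space \<mu> = Paths \<times> Paths" using sets_eq_imp_space_eq[OF s] by (simp add: space_pair_measure)
  have fin: "emeasure \<mu> A \<noteq> \<infinity>" "emeasure \<mu>1 B \<noteq> \<infinity>" "emeasure \<mu>2 B \<noteq> \<infinity>" for A B
    using f f1 f2 by (simp_all add: finite_measure.emeasure_eq_measure)
  have fst [measurable]: "fst \<in> \<mu> \<rightarrow>\<^sub>M path_space" and snd [measurable]: "snd \<in> \<mu> \<rightarrow>\<^sub>M path_space"
    using measurable_fst[of path_space path_space] measurable_snd[of path_space path_space]
    by (simp_all add: measurable_cong_sets[OF s refl])
  have e2: "emeasure (distr (density \<mu> (indicator (C \<times> Paths))) path_space snd) B = emeasure \<mu> (C \<times> B)"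
    if "C \<in> sets path_space" "B \<in> sets path_space" for B C
  proof -
    have [measurable]: "C \<times> Paths \<in> sets \<mu>" unfolding s using that P by auto
    have CB: "C \<times> B \<in> sets \<mu>" unfolding s using that by auto
    have "emeasure (distr (density \<mu> (indicator (C \<times> Paths))) path_space snd) B = emeasure (density \<mu> (indicator (C \<times> Paths))) (snd -` B \<inter> space \<mu>)"
      using that by (subst emeasure_distr) simp_all
    also have "... = (\<integral>\<^sup>+z. indicator (C \<times> Paths) z * indicator (snd -` B \<inter> space \<mu>) z \<partial>\<mu>)"
      using measurable_sets[OF snd that(2)] by (subst emeasure_density) simp_all
    also have "... = (\<integral>\<^sup>+z. indicator (C \<times> B) z \<partial>\<mu>)"
      using sets.sets_into_space[OF that(1)] sets.sets_into_space[OF that(2)]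
      by (intro nn_integral_cong) (auto simp: indicator_def sp)
    also have "... = emeasure \<mu> (C \<times> B)" using CB by simp
    finally show ?thesis .
  qed
  have e1: "emeasure (distr (density \<mu> (indicator (Paths \<times> B))) path_space fst) C = emeasure \<mu> (C \<times> B)"
    if "C \<in> sets path_space" "B \<in> sets path_space" for B C
  proof -
    have [measurable]: "Paths \<times> B \<in> sets \<mu>" unfolding s using that P by auto
    have CB: "C \<times> B \<in> sets \<mu>" unfolding s using that by auto
    have "emeasure (distr (density \<mu> (indicator (Paths \<times> B))) path_space fst) C = emeasure (density \<mu> (indicator (Paths \<times> B))) (fst -` C \<inter> space \<mu>)"
      using that by (subst emeasure_distr) simp_all
    also have "... = (\<integral>\<^sup>+z. indicator (Paths \<times> B) z * indicator (fst -` C \<inter> space \<mu>) z \<partial>\<mu>)"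
      using measurable_sets[OF fst that(1)] by (subst emeasure_density) simp_all
    also have "... = (\<integral>\<^sup>+z. indicator (C \<times> B) z \<partial>\<mu>)"
      using sets.sets_into_space[OF that(1)] sets.sets_into_space[OF that(2)]
      by (intro nn_integral_cong) (auto simp: indicator_def sp)
    also have "... = emeasure \<mu> (C \<times> B)" using CB by simp
    finally show ?thesis .
  qed
  have st1: "emeasure \<mu> (cylinder J c \<times> B) = emeasure \<mu>1 (cylinder J c) * emeasure \<mu>2 B"
    if J: "finite J" and B: "B \<in> sets path_space" for J c B
  proof -
    have "distr (density \<mu> (indicator (cylinder J c \<times> Paths))) path_space snd = scale_measure (emeasure \<mu>1 (cylinder J c)) \<mu>2"
      by (rule path_measure_eqI)
         (use e2[OF cylinder_sets[OF J, of c]] eq[OF J, of _ c] fin P cylinder_sets in \<open>simp_all add: s2\<close>)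
    then have "emeasure (distr (density \<mu> (indicator (cylinder J c \<times> Paths))) path_space snd) B = emeasure \<mu>1 (cylinder J c) * emeasure \<mu>2 B"
      by simp
    then show ?thesis using e2[OF cylinder_sets[OF J] B, of c] by simp
  qed
  have st2: "emeasure \<mu> (C \<times> B) = emeasure \<mu>1 C * emeasure \<mu>2 B"
    if C: "C \<in> sets path_space" and B: "B \<in> sets path_space" for C B
  proof -
    have "distr (density \<mu> (indicator (Paths \<times> B))) path_space fst = scale_measure (emeasure \<mu>2 B) \<mu>1"
      by (rule path_measure_eqI)
         (use e1[OF _ B] st1[OF _ B] fin P cylinder_sets in \<open>simp_all add: s1 mult.commute\<close>)
    then have "emeasure (distr (density \<mu> (indicator (Paths \<times> B))) path_space fst) C = emeasure \<mu>2 B * emeasure \<mu>1 C"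
      by simp
    then show ?thesis using e1[OF C B] by (simp add: mult.commute)
  qed
  show ?thesis
  proof (rule pair_measure_eqI)
    show "sigma_finite_measure \<mu>1" "sigma_finite_measure \<mu>2" using f1 f2 by (simp_all add: finite_measure_def)
    show "sets (\<mu>1 \<Otimes>\<^sub>M \<mu>2) = sets \<mu>" by (simp add: s s1 s2 cong: sets_pair_measure_cong)
    show "emeasure \<mu>1 A * emeasure \<mu>2 B = emeasure \<mu> (A \<times> B)" if "A \<in> sets \<mu>1" "B \<in> sets \<mu>2" for A B
      using st2[of A B] that by (simp add: s1 s2)
  qed
qed

text \<open>Nothing is known about the process at negative times; the value 0 there provides a left
  limit at time 0.\<close>

definition path_of :: "(real => 'a => real) => 'a => real => real" where
  "path_of X \<omega> t = (if t <= 0 then 0 else X t \<omega>)"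

lemma path_of_Paths:
  assumes "spec_neg_levy M X" "\<omega> \<in> space M" shows "path_of X \<omega> \<in> Paths"
proof (rule PathsI)
  have X0: "X 0 \<omega> = 0" and rc: "!!t. t \<ge> 0 ==> continuous (at_right t) (%s. X s \<omega>)"
    and ll: "!!t. t > 0 ==> \<exists>l. ((%s. X s \<omega>) \<longlongrightarrow> l) (at_left t)"
    and nj: "!!t. t > 0 ==> X t \<omega> <= left_lim (%s. X s \<omega>) t"
    using assms unfolding spec_neg_levy_def by auto
  show "path_of X \<omega> t = 0" if "t <= 0" for t using that by (simp add: path_of_def)
  fix t
  show "\<exists>d>0. \<forall>s. t <= s & s < t + d --> \<bar>path_of X \<omega> s - path_of X \<omega> t\<bar> < e" if e: "e > 0" for e
  proof (cases "t < 0")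
    case True
    then show ?thesis using e by (intro exI[of _ "- t"]) (auto simp: path_of_def)
  next
    case False
    with rc[of t] e obtain d where "d > 0" "\<forall>s. t <= s & s < t + d --> \<bar>X s \<omega> - X t \<omega>\<bar> < e"
      unfolding right_cont_iff by auto
    moreover have "path_of X \<omega> s = X s \<omega>" if "t <= s" for s using False that X0 by (cases "s = 0") (auto simp: path_of_def)
    ultimately show ?thesis by auto
  qed
  show "\<exists>l. path_of X \<omega> t <= l & (\<forall>e>0. \<exists>d>0. \<forall>s. t - d < s & s < t --> \<bar>path_of X \<omega> s - l\<bar> < e)"
  proof (cases "t <= 0")
    case True
    then show ?thesis by (intro exI[of _ 0]) (auto simp: path_of_def intro!: exI[of _ 1])
  next
    case False
    with ll[of t] obtain l where l: "((%s. X s \<omega>) \<longlongrightarrow> l) (at_left t)" by auto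
    have "left_lim (%s. X s \<omega>) t = l" unfolding left_lim_def using l by (intro tendsto_Lim) auto
    with nj[of t] False have 1: "path_of X \<omega> t <= l" by (simp add: path_of_def)
    show ?thesis
    proof (rule exI[of _ l], intro conjI 1 allI impI)
      fix e :: real assume "e > 0"
      with l obtain d where d: "d > 0" "\<forall>s. t - d < s & s < t --> \<bar>X s \<omega> - l\<bar> < e" unfolding left_lim_iff by blast
      then show "\<exists>d>0. \<forall>s. t - d < s & s < t --> \<bar>path_of X \<omega> s - l\<bar> < e"
        using False by (intro exI[of _ "min d t"]) (auto simp: path_of_def)
    qed
  qed
qed

lemma path_of_measurable:
  assumes "spec_neg_levy M X" shows "path_of X \<in> M \<rightarrow>\<^sub>M path_space"
proof (rule measurable_path_spaceI)
  have [measurable]: "X t \<in> borel_measurable M" for t using assms by (auto simp: spec_neg_levy_def)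
  show "(%\<omega>. path_of X \<omega> t) \<in> borel_measurable M" for t by (cases "t <= 0") (simp_all add: path_of_def)
qed (use path_of_Paths[OF assms] in auto)

text \<open>All times are put on one sorted grid that contains \<open>t\<close>. Positions up to
  \<open>t\<close> and increments after \<open>t\<close> are then sums over disjoint blocks of grid
  increments.\<close>

lemma levy_increments_indep:
  assumes L: "spec_neg_levy M X" and t: "0 <= t" and J: "finite J" and K: "finite K"
  shows "measure M {\<omega>\<in>space M. (\<forall>s\<in>J. path_of X \<omega> (min s t) > c s) & (\<forall>s\<in>K. path_of X \<omega> (t + max 0 s) - path_of X \<omega> t > d s)} =
    measure M {\<omega>\<in>space M. \<forall>s\<in>J. path_of X \<omega> (min s t) > c s} * measure M {\<omega>\<in>space M. \<forall>s\<in>K. path_of X \<omega> (t + max 0 s) - path_of X \<omega> t > d s}"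
proof -
  interpret prob_space M using L by (simp add: spec_neg_levy_def)
  have [measurable]: "X t \<in> borel_measurable M" for t using L by (auto simp: spec_neg_levy_def)
  have X0: "X 0 \<omega> = 0" if "\<omega> \<in> space M" for \<omega> using L that by (auto simp: spec_neg_levy_def)
  have pX: "path_of X \<omega> s = X s \<omega>" if "\<omega> \<in> space M" "0 <= s" for \<omega> s using that X0 by (auto simp: path_of_def)
  have pm: "path_of X \<omega> s = path_of X \<omega> (max 0 s)" for \<omega> s by (auto simp: path_of_def)
  define S where "S = {0, t} \<union> (%s. max 0 (min s t)) ` J \<union> (%s. t + max 0 s) ` K"
  define ts where "ts = sorted_list_of_set S"
  have fS: "finite S" using J K by (simp add: S_def)
  have ts: "set ts = S" "sorted ts" "distinct ts" using fS by (auto simp: ts_def)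
  have S0: "\<forall>s\<in>S. 0 <= s" using t by (auto simp: S_def)
  define \<Delta> where "\<Delta> i \<omega> = X (ts ! Suc i) \<omega> - X (ts ! i) \<omega>" for i \<omega>
  define n where "n = length ts - 1"
  have ind: "indep_vars (%_. borel) \<Delta> {..<n}"
    using L ts S0 unfolding spec_neg_levy_def \<Delta>_def n_def by blast
  have "\<exists>k. k < length ts & ts ! k = s" if "s \<in> S" for s using ts(1) that by (metis in_set_conv_nth)
  then obtain k where k: "!!s. s \<in> S ==> k s < length ts & ts ! k s = s" by metis
  have kmono: "k r <= k s" if "r \<in> S" "s \<in> S" "r <= s" for r s
  proof (rule ccontr)
    assume "\<not> k r <= k s"
    then have "ts ! k s <= ts ! k r" "k s < k r" using sorted_nth_mono[OF ts(2), of "k s" "k r"] k that by auto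
    then have "r = s" using k that by auto
    then show False using \<open>k s < k r\<close> by simp
  qed
  have tele: "X s \<omega> - X r \<omega> = (\<Sum>i\<in>{k r..<k s}. \<Delta> i \<omega>)" if "r \<in> S" "s \<in> S" "r <= s" for r s \<omega>
  proof -
    have "(\<Sum>i\<in>{k r..<k s}. \<Delta> i \<omega>) = X (ts ! k s) \<omega> - X (ts ! k r) \<omega>"
      unfolding \<Delta>_def by (rule sum_Suc_diff'[OF kmono[OF that], of "%i. X (ts ! i) \<omega>"])
    then show ?thesis using k that by simp
  qed
  have mS: "t \<in> S" "0 \<in> S" by (auto simp: S_def)
  define A where "A = {..<k t}" define B where "B = {k t..<n}"
  have AB: "A \<inter> B = {}" "A \<subseteq> {..<n}" "B \<subseteq> {..<n}" using k[OF mS(1)] by (auto simp: A_def B_def n_def)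
  define SA where "SA = {f\<in>space (PiM A (%_. borel :: real measure)). \<forall>s\<in>J. (\<Sum>i\<in>{k 0..<k (max 0 (min s t))}. f i) > c s}"
  define SB where "SB = {f\<in>space (PiM B (%_. borel :: real measure)). \<forall>s\<in>K. (\<Sum>i\<in>{k t..<k (t + max 0 s)}. f i) > d s}"
  have subA: "{k 0..<k (max 0 (min s t))} \<subseteq> A" if "s \<in> J" for s
    using kmono[of "max 0 (min s t)" t] that mS t by (auto simp: A_def S_def)
  have subB: "{k t..<k (t + max 0 s)} \<subseteq> B" if "s \<in> K" for s
    using k[of "t + max 0 s"] that by (auto simp: B_def n_def S_def)
  have mA: "SA \<in> sets (PiM A (%_. borel))"
  proof -
    have [measurable]: "(%f. (\<Sum>i\<in>{k 0..<k (max 0 (min s t))}. f i)) \<in> borel_measurable (PiM A (%_. borel :: real measure))" if "s \<in> J" for s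
      using subA[OF that] by (intro borel_measurable_sum measurable_component_singleton) auto
    show ?thesis unfolding SA_def using J by measurable
  qed
  have mB: "SB \<in> sets (PiM B (%_. borel))"
  proof -
    have [measurable]: "(%f. (\<Sum>i\<in>{k t..<k (t + max 0 s)}. f i)) \<in> borel_measurable (PiM B (%_. borel :: real measure))" if "s \<in> K" for s
      using subB[OF that] by (intro borel_measurable_sum measurable_component_singleton) auto
    show ?thesis unfolding SB_def using K by measurable
  qed
  have eA: "(%\<omega>. restrict (%i. \<Delta> i \<omega>) A) -` SA \<inter> space M = {\<omega>\<in>space M. \<forall>s\<in>J. path_of X \<omega> (min s t) > c s}"
  proof -
    have "(\<Sum>i\<in>{k 0..<k (max 0 (min s t))}. restrict (%i. \<Delta> i \<omega>) A i) = path_of X \<omega> (min s t)" if s: "s \<in> J" and "\<omega> \<in> space M" for s \<omega>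
    proof -
      have "(\<Sum>i\<in>{k 0..<k (max 0 (min s t))}. restrict (%i. \<Delta> i \<omega>) A i) = (\<Sum>i\<in>{k 0..<k (max 0 (min s t))}. \<Delta> i \<omega>)"
        using subA[OF s] by (intro sum.cong) auto
      also have "... = X (max 0 (min s t)) \<omega> - X 0 \<omega>" using s by (intro tele[symmetric]) (auto simp: S_def)
      finally show ?thesis using X0 pX pm[of \<omega> "min s t"] that by simp
    qed
    then show ?thesis by (auto simp: SA_def space_PiM)
  qed
  have eB: "(%\<omega>. restrict (%i. \<Delta> i \<omega>) B) -` SB \<inter> space M = {\<omega>\<in>space M. \<forall>s\<in>K. path_of X \<omega> (t + max 0 s) - path_of X \<omega> t > d s}"
  proof -
    have "(\<Sum>i\<in>{k t..<k (t + max 0 s)}. restrict (%i. \<Delta> i \<omega>) B i) = path_of X \<omega> (t + max 0 s) - path_of X \<omega> t" if s: "s \<in> K" and "\<omega> \<in> space M" for s \<omega>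
    proof -
      have "(\<Sum>i\<in>{k t..<k (t + max 0 s)}. restrict (%i. \<Delta> i \<omega>) B i) = (\<Sum>i\<in>{k t..<k (t + max 0 s)}. \<Delta> i \<omega>)"
        using subB[OF s] by (intro sum.cong) auto
      also have "... = X (t + max 0 s) \<omega> - X t \<omega>" using s by (intro tele[symmetric]) (auto simp: S_def)
      finally show ?thesis using pX that t by simp
    qed
    then show ?thesis by (auto simp: SB_def space_PiM)
  qed
  have "prob ((%x. ((%\<omega>. restrict (%i. \<Delta> i \<omega>) A) x, (%\<omega>. restrict (%i. \<Delta> i \<omega>) B) x)) -` (SA \<times> SB) \<inter> space M) =
    prob ((%\<omega>. restrict (%i. \<Delta> i \<omega>) A) -` SA \<inter> space M) * prob ((%\<omega>. restrict (%i. \<Delta> i \<omega>) B) -` SB \<inter> space M)"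
    by (rule indep_varD[OF indep_var_restrict[OF ind AB] mA mB])
  also have "(%x. ((%\<omega>. restrict (%i. \<Delta> i \<omega>) A) x, (%\<omega>. restrict (%i. \<Delta> i \<omega>) B) x)) -` (SA \<times> SB) \<inter> space M =
    {\<omega>\<in>space M. (\<forall>s\<in>J. path_of X \<omega> (min s t) > c s) & (\<forall>s\<in>K. path_of X \<omega> (t + max 0 s) - path_of X \<omega> t > d s)}"
    using eA eB by blast
  finally show ?thesis unfolding eA eB .
qed

text \<open>The vector of grid increments started at time r has a product law in which r does not
  occur; the choices r = t and r = 0 are compared.\<close>

lemma levy_increments_stationary:
  assumes L: "spec_neg_levy M X" and t: "0 <= t" and K: "finite K"
  shows "measure M {\<omega>\<in>space M. \<forall>s\<in>K. path_of X \<omega> (t + max 0 s) - path_of X \<omega> t > d s} = measure M {\<omega>\<in>space M. \<forall>s\<in>K. path_of X \<omega> s > d s}"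
proof -
  interpret prob_space M using L by (simp add: spec_neg_levy_def)
  have [measurable]: "X t \<in> borel_measurable M" for t using L by (auto simp: spec_neg_levy_def)
  have X0: "X 0 \<omega> = 0" if "\<omega> \<in> space M" for \<omega> using L that by (auto simp: spec_neg_levy_def)
  have pX: "path_of X \<omega> s = X s \<omega>" if "\<omega> \<in> space M" "0 <= s" for \<omega> s using that X0 by (auto simp: path_of_def)
  have pm: "path_of X \<omega> s = path_of X \<omega> (max 0 s)" for \<omega> s by (auto simp: path_of_def)
  \<comment> \<open>The time 1 guarantees two grid points, hence a nonempty index set for the
    product of the increment laws.\<close>
  define S where "S = {0, 1} \<union> (%s. max 0 s) ` K"
  define ts where "ts = sorted_list_of_set S"
  have fS: "finite S" using K by (simp add: S_def)
  have ts: "set ts = S" "sorted ts" "distinct ts" using fS by (auto simp: ts_def)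
  have S0: "\<forall>s\<in>S. 0 <= s" using t by (auto simp: S_def)
  define \<Delta> where "\<Delta> r i \<omega> = X (r + ts ! Suc i) \<omega> - X (r + ts ! i) \<omega>" for r i \<omega>
  define n where "n = length ts - 1"
  have "length ts = card S" using ts distinct_card by fastforce
  moreover have "card S \<ge> card {0, 1 :: real}" using fS by (intro card_mono) (auto simp: S_def)
  ultimately have n: "n > 0" by (simp add: n_def)
  have ind: "indep_vars (%_. borel) (\<Delta> r) {..<n}" if "0 <= r" for r
  proof -
    have "sorted (map ((+) r) ts)" using ts(2) by (simp add: sorted_map sorted_wrt_mono_rel[of _ "(<=)"])
    moreover have "\<forall>s\<in>set (map ((+) r) ts). 0 <= s" using S0 ts(1) that by auto
    ultimately have "indep_vars (%_. borel) (%i \<omega>. X (map ((+) r) ts ! Suc i) \<omega> - X (map ((+) r) ts ! i) \<omega>) {..<length (map ((+) r) ts) - 1}"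
      using L unfolding spec_neg_levy_def by blast
    also have "?this \<longleftrightarrow> indep_vars (%_. borel) (\<Delta> r) {..<n}"
      by (intro indep_vars_cong) (auto simp: \<Delta>_def n_def)
    finally show ?thesis .
  qed
  have law: "distr M borel (\<Delta> r i) = distr M borel (X (ts ! Suc i - ts ! i))" if "0 <= r" "i < n" for r i
  proof -
    have "ts ! i <= ts ! Suc i" "0 <= ts ! i" using that S0 ts sorted_nth_mono[OF ts(2), of i "Suc i"] nth_mem[of i ts] by (auto simp: n_def)
    then have "distr M borel (%\<omega>. X ((r + ts ! i) + (ts ! Suc i - ts ! i)) \<omega> - X (r + ts ! i) \<omega>) = distr M borel (X (ts ! Suc i - ts ! i))"
    proof -
      have "\<forall>s t. 0 <= s --> 0 <= t --> distr M borel (%\<omega>. X (s + t) \<omega> - X s \<omega>) = distr M borel (X t)"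
        using L unfolding spec_neg_levy_def by blast
      then show ?thesis using that \<open>ts ! i <= ts ! Suc i\<close> \<open>0 <= ts ! i\<close> by (metis add_nonneg_nonneg diff_ge_0_iff_ge)
    qed
    then show ?thesis by (simp add: \<Delta>_def[abs_def] add.assoc)
  qed
  have PI: "distr M (PiM {..<n} (%_. borel)) (%\<omega>. \<lambda>i\<in>{..<n}. \<Delta> r i \<omega>) = (PiM {..<n} (%i. distr M borel (X (ts ! Suc i - ts ! i))))" if "0 <= r" for r
  proof -
    have "distr M (PiM {..<n} (%_. borel)) (%\<omega>. \<lambda>i\<in>{..<n}. \<Delta> r i \<omega>) = PiM {..<n} (%i. distr M borel (\<Delta> r i))"
      using n by (subst indep_vars_iff_distr_eq_PiM[symmetric]) (auto simp: ind that, simp add: \<Delta>_def[abs_def])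
    also have "... = (PiM {..<n} (%i. distr M borel (X (ts ! Suc i - ts ! i))))"
      by (intro PiM_cong) (auto simp: law that)
    finally show ?thesis .
  qed
  have "\<exists>k. k < length ts & ts ! k = s" if "s \<in> S" for s using ts(1) that by (metis in_set_conv_nth)
  then obtain k where k: "!!s. s \<in> S ==> k s < length ts & ts ! k s = s" by metis
  have kmono: "k r <= k s" if "r \<in> S" "s \<in> S" "r <= s" for r s
  proof (rule ccontr)
    assume "\<not> k r <= k s"
    then have "ts ! k s <= ts ! k r" "k s < k r" using sorted_nth_mono[OF ts(2), of "k s" "k r"] k that by auto
    then have "r = s" using k that by auto
    then show False using \<open>k s < k r\<close> by simp
  qed
  have mS: "0 \<in> S" by (auto simp: S_def)
  have tele: "X (r + s) \<omega> - X r \<omega> = (\<Sum>i\<in>{k 0..<k s}. \<Delta> r i \<omega>)" if "s \<in> S" for r s \<omega>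
  proof -
    have "(\<Sum>i\<in>{k 0..<k s}. \<Delta> r i \<omega>) = X (r + ts ! k s) \<omega> - X (r + ts ! k 0) \<omega>"
      unfolding \<Delta>_def using S0 that by (intro sum_Suc_diff'[OF kmono[OF mS that], of "%i. X (r + ts ! i) \<omega>"]) auto
    then show ?thesis using k[OF that] k[OF mS] by simp
  qed
  define SB where "SB = {f\<in>space (PiM {..<n} (%_. borel :: real measure)). \<forall>s\<in>K. (\<Sum>i\<in>{k 0..<k (max 0 s)}. f i) > d s}"
  have sub: "{k 0..<k (max 0 s)} \<subseteq> {..<n}" if "s \<in> K" for s
    using k[of "max 0 s"] that by (auto simp: n_def S_def)
  have mB: "SB \<in> sets (PiM {..<n} (%_. borel))"
  proof -
    have [measurable]: "(%f. (\<Sum>i\<in>{k 0..<k (max 0 s)}. f i)) \<in> borel_measurable (PiM {..<n} (%_. borel :: real measure))" if "s \<in> K" for s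
      by (intro borel_measurable_sum measurable_component_singleton) (rule subsetD[OF sub[OF that]])
    show ?thesis unfolding SB_def using K by measurable
  qed
  have eB: "(%\<omega>. \<lambda>i\<in>{..<n}. \<Delta> r i \<omega>) -` SB \<inter> space M = {\<omega>\<in>space M. \<forall>s\<in>K. path_of X \<omega> (r + max 0 s) - path_of X \<omega> r > d s}" if r: "0 <= r" for r
  proof -
    have "(\<Sum>i\<in>{k 0..<k (max 0 s)}. restrict (%i. \<Delta> r i \<omega>) {..<n} i) = path_of X \<omega> (r + max 0 s) - path_of X \<omega> r" if s: "s \<in> K" and "\<omega> \<in> space M" for s \<omega>
    proof -
      have "(\<Sum>i\<in>{k 0..<k (max 0 s)}. restrict (%i. \<Delta> r i \<omega>) {..<n} i) = (\<Sum>i\<in>{k 0..<k (max 0 s)}. \<Delta> r i \<omega>)"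
        using sub[OF s] by (intro sum.cong refl) (meson restrict_apply' subsetD)
      also have "... = X (r + max 0 s) \<omega> - X r \<omega>" using s by (intro tele[symmetric]) (auto simp: S_def)
      finally show ?thesis using pX that r by simp
    qed
    then show ?thesis by (auto simp: SB_def space_PiM)
  qed
  have "measure M {\<omega>\<in>space M. \<forall>s\<in>K. path_of X \<omega> (r + max 0 s) - path_of X \<omega> r > d s} = measure (PiM {..<n} (%i. distr M borel (X (ts ! Suc i - ts ! i)))) SB" if "0 <= r" for r
    unfolding PI[OF that, symmetric] eB[OF that, symmetric] using mB
    by (subst measure_distr) (auto intro!: measurable_restrict simp: \<Delta>_def[abs_def])
  from this[OF t] this[of 0] show ?thesis
    using pm by (simp add: path_of_def)
qed

lemma spec_neg_levy_law:
  assumes L: "spec_neg_levy M X"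
  shows "levy_law (distr M path_space (path_of X))"
proof -
  interpret M: prob_space M using L by (simp add: spec_neg_levy_def)
  define P where "P = distr M path_space (path_of X)"
  have pm [measurable]: "path_of X \<in> M \<rightarrow>\<^sub>M path_space" by (rule path_of_measurable[OF L])
  have sP: "sets P = sets path_space" by (simp add: P_def)
  have spP: "space P = Paths" by (simp add: P_def)
  interpret P: prob_space P unfolding P_def by (rule M.prob_space_distr) measurable
  have pth: "\<omega> \<in> space M ==> path_of X \<omega> \<in> Paths" for \<omega> by (rule path_of_Paths[OF L])
  have "distr P path_space (pstop t) \<Otimes>\<^sub>M P = distr P (path_space \<Otimes>\<^sub>M path_space) (%w. (pstop t w, pshift t w))" if t: "0 <= t" for t
  proof (rule path_pair_measure_eqI)
    have [measurable_cong]: "sets P = sets path_space" by (rule sP)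
    show "finite_measure P" by unfold_locales
    show "finite_measure (distr P path_space (pstop t))" "finite_measure (distr P (path_space \<Otimes>\<^sub>M path_space) (%w. (pstop t w, pshift t w)))"
      by (rule P.finite_measure_distr; measurable)+
    fix J K c d assume J: "finite (J :: real set)" and K: "finite (K :: real set)"
    note [measurable] = cylinder_sets[OF J, of c] cylinder_sets[OF K, of d]
    have "emeasure (distr P (path_space \<Otimes>\<^sub>M path_space) (%w. (pstop t w, pshift t w))) (cylinder J c \<times> cylinder K d)
      = emeasure M {\<omega>\<in>space M. (\<forall>s\<in>J. path_of X \<omega> (min s t) > c s) & (\<forall>s\<in>K. path_of X \<omega> (t + max 0 s) - path_of X \<omega> t > d s)}"
    proof -
      have "distr P (path_space \<Otimes>\<^sub>M path_space) (%w. (pstop t w, pshift t w)) = distr M (path_space \<Otimes>\<^sub>M path_space) (%\<omega>. (pstop t (path_of X \<omega>), pshift t (path_of X \<omega>)))"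
        unfolding P_def by (subst distr_distr) (simp_all add: comp_def)
      then show ?thesis
        using t pth by (simp only:, subst emeasure_distr)
          (auto simp: pstop_def pshift_def intro!: arg_cong[of _ _ "emeasure M"])
    qed
    moreover have "emeasure (distr P path_space (pstop t)) (cylinder J c) = emeasure M {\<omega>\<in>space M. \<forall>s\<in>J. path_of X \<omega> (min s t) > c s}"
    proof -
      have "distr P path_space (pstop t) = distr M path_space (%\<omega>. pstop t (path_of X \<omega>))"
        unfolding P_def by (subst distr_distr) (simp_all add: comp_def)
      then show ?thesis
        using t pth by (simp only:, subst emeasure_distr)
          (auto simp: pstop_def intro!: arg_cong[of _ _ "emeasure M"])
    qed
    moreover have "emeasure P (cylinder K d) = emeasure M {\<omega>\<in>space M. \<forall>s\<in>K. path_of X \<omega> s > d s}"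
      unfolding P_def using pth by (subst emeasure_distr) (auto intro!: arg_cong[of _ _ "emeasure M"])
    ultimately show "emeasure (distr P (path_space \<Otimes>\<^sub>M path_space) (%w. (pstop t w, pshift t w))) (cylinder J c \<times> cylinder K d) =
       emeasure (distr P path_space (pstop t)) (cylinder J c) * emeasure P (cylinder K d)"
      using levy_increments_indep[OF L t J K, of c d] levy_increments_stationary[OF L t K, of d]
      by (simp add: M.emeasure_eq_measure ennreal_mult)
  qed (simp_all add: sP)
  moreover have "\<exists>t>0. emeasure P {w\<in>Paths. w t > 0} > 0"
  proof (rule ccontr)
    \<comment> \<open>If the process were almost surely nonpositive at each time, stationarity would
      make all increments between rational times nonpositive, and right continuity would make the
      paths decreasing.\<close>
    assume "\<not> ?thesis"
    then have z: "emeasure P {w\<in>Paths. w t > 0} = 0" if "t > 0" for t using that by (metis not_gr_zero)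
    have [measurable]: "X t \<in> borel_measurable M" for t using L by (auto simp: spec_neg_levy_def)
    have X0: "X 0 \<omega> = 0" if "\<omega> \<in> space M" for \<omega> using L that by (auto simp: spec_neg_levy_def)
    have zM: "emeasure M {\<omega>\<in>space M. X t \<omega> > 0} = 0" if "t > 0" for t
    proof -
      have "{w\<in>space path_space. w t > 0} \<in> sets path_space" by measurable
      then have "emeasure P {w\<in>Paths. w t > 0} = emeasure M {\<omega>\<in>space M. X t \<omega> > 0}"
        unfolding P_def using pth that by (subst emeasure_distr) (auto simp: path_of_def intro!: arg_cong[of _ _ "emeasure M"])
      then show ?thesis using z[OF that] by simp
    qed
    have inc: "AE \<omega> in M. X r \<omega> - X s \<omega> <= 0" if "0 <= s" "s < r" for r s
    proof (rule AE_I)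
      show "{\<omega>\<in>space M. \<not> (X r \<omega> - X s \<omega> <= 0)} \<subseteq> {\<omega>\<in>space M. X r \<omega> - X s \<omega> > 0}" by auto
      have "emeasure M {\<omega>\<in>space M. X r \<omega> - X s \<omega> > 0} = emeasure (distr M borel (%\<omega>. X (s + (r - s)) \<omega> - X s \<omega>)) {0<..}"
        by (subst emeasure_distr) (auto intro!: arg_cong[of _ _ "emeasure M"])
      also have "distr M borel (%\<omega>. X (s + (r - s)) \<omega> - X s \<omega>) = distr M borel (X (r - s))"
      proof -
        have "\<forall>s t. 0 <= s --> 0 <= t --> distr M borel (%\<omega>. X (s + t) \<omega> - X s \<omega>) = distr M borel (X t)"
          using L unfolding spec_neg_levy_def by blast
        then show ?thesis using that by (metis diff_ge_0_iff_ge less_imp_le)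
      qed
      also have "emeasure (distr M borel (X (r - s))) {0<..} = emeasure M {\<omega>\<in>space M. X (r - s) \<omega> > 0}"
        by (subst emeasure_distr) (auto intro!: arg_cong[of _ _ "emeasure M"])
      finally show "emeasure M {\<omega>\<in>space M. X r \<omega> - X s \<omega> > 0} = 0" using zM that by simp
    qed measurable
    have "AE \<omega> in M. \<forall>r s::rat. 0 <= real_of_rat s --> real_of_rat s < of_rat r --> X (of_rat r) \<omega> - X (of_rat s) \<omega> <= 0"
      unfolding AE_all_countable using inc by (auto simp del: zero_le_of_rat_iff of_rat_less)
    then have "AE \<omega> in M. monotone_on {0..} (<=) (\<ge>) (%t. X t \<omega>)"
    proof (rule AE_mp, intro AE_I2 impI)
      fix \<omega> assume \<omega>: "\<omega> \<in> space M" and mon: "\<forall>r s::rat. 0 <= real_of_rat s --> real_of_rat s < of_rat r --> X (of_rat r) \<omega> - X (of_rat s) \<omega> <= 0"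
      have rc: "\<exists>d>0. \<forall>s. t <= s & s < t + d --> \<bar>X s \<omega> - X t \<omega>\<bar> < e" if "0 <= t" "e > 0" for t e
        using L \<omega> that unfolding spec_neg_levy_def right_cont_iff[symmetric] by (auto simp: right_cont_iff)
      show "monotone_on {0..} (<=) (\<ge>) (%t. X t \<omega>)"
      proof (rule monotone_onI, rule ccontr)
        fix s t :: real assume st: "s \<in> {0..}" "t \<in> {0..}" "s <= t" and n: "\<not> X s \<omega> \<ge> X t \<omega>"
        define e where "e = (X t \<omega> - X s \<omega>) / 2"
        have e: "e > 0" "s < t" using n st by (auto simp: e_def less_le)
        obtain d1 where d1: "d1 > 0" "\<forall>r. s <= r & r < s + d1 --> \<bar>X r \<omega> - X s \<omega>\<bar> < e" using rc[of s e] st e by auto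
        obtain d2 where d2: "d2 > 0" "\<forall>r. t <= r & r < t + d2 --> \<bar>X r \<omega> - X t \<omega>\<bar> < e" using rc[of t e] st e by auto
        obtain r1 where r1: "s < of_rat r1" "of_rat r1 < min (s + d1) t" using of_rat_dense[of s "min (s + d1) t"] d1 e by auto
        obtain r2 where r2: "t < of_rat r2" "of_rat r2 < t + d2" using of_rat_dense[of t "t + d2"] d2 by auto
        have "X (of_rat r2) \<omega> - X (of_rat r1) \<omega> <= 0"
        proof (rule mon[rule_format])
          show "0 <= real_of_rat r1" using r1(1) st(1) by (metis atLeast_iff less_imp_le order_trans)
          show "real_of_rat r1 < real_of_rat r2" using r1(2) r2(1) by linarith
        qed
        moreover have "\<bar>X (of_rat r1) \<omega> - X s \<omega>\<bar> < e" "\<bar>X (of_rat r2) \<omega> - X t \<omega>\<bar> < e" using d1 d2 r1 r2 by auto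
        moreover have "X t \<omega> - X s \<omega> = 2 * e" by (simp add: e_def)
        ultimately show False by linarith
      qed
    qed
    then show False using L by (simp add: spec_neg_levy_def)
  qed
  ultimately have "levy_law P" by unfold_locales (simp_all add: sP)
  then show ?thesis by (simp add: P_def)
qed

section \<open>Passage times and exponential moments\<close>

lemma no_up_jump:
  assumes w: "w \<in> Paths" and "r < t" and b: "!!s. r <= s ==> s < t ==> w s <= c"
  shows "w t <= c"
proof (rule ccontr)
  assume n: "\<not> w t <= c"
  obtain l where l: "w t <= l" "!!e. e > 0 ==> \<exists>d>0. \<forall>s. t - d < s & s < t --> \<bar>w s - l\<bar> < e"
    using Paths_left[OF w, of t] by blast
  have "l - c > 0" using n l(1) by auto
  from l(2)[OF this] obtain d where d: "d > 0" "\<forall>s. t - d < s & s < t --> \<bar>w s - l\<bar> < l - c" by blast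
  define s where "s = max r (t - d / 2)"
  have "t - d < s" "s < t" "r <= s" using d(1) \<open>r < t\<close> by (auto simp: s_def)
  then show False using d(2)[rule_format, of s] b[of s] by auto
qed

text \<open>A path without upward jumps cannot skip the level, so at the passage time it is exactly
  there. This exactness makes the exit transforms multiplicative in the level. For downward passage
  \<open>dn_hit\<close> has only an inequality, since a jump may overshoot.\<close>

lemma up_hit:
  assumes w: "w \<in> Paths" and b: "0 <= b" and f: "fin (up b) w"
  shows "w (hit (up b) w) = b" "!!s. 0 <= s ==> s <= hit (up b) w ==> w s <= b"
proof -
  let ?T = "hit (up b) w"
  have lt: "w s <= b" if "0 <= s" "s < ?T" for s using hit_not[OF that] by (simp add: up_def)
  have T0: "0 <= ?T" by (rule hit_ge0[OF f])
  have le: "w ?T <= b"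
  proof (cases "?T = 0")
    case False
    then show ?thesis using T0 lt by (rule_tac no_up_jump[OF w, of 0]) auto
  qed (use w b in \<open>simp add: Paths_0\<close>)
  have "w ?T \<ge> b"
  proof (rule ccontr)
    assume "\<not> w ?T \<ge> b"
    then obtain d where d: "d > 0" "!!s. ?T <= s ==> s < ?T + d ==> \<bar>w s - w ?T\<bar> < b - w ?T"
      using Paths_right[OF w, of "b - w ?T" ?T] by auto
    then obtain s where "?T <= s" "s < ?T + d" "w s > b" using hit_approach[OF f, of d] by (auto simp: up_def)
    then show False using d(2)[of s] by auto
  qed
  with le show eq: "w ?T = b" by simp
  show "w s <= b" if "0 <= s" "s <= ?T" for s using lt[of s] that eq by (cases "s = ?T") auto
qed

lemma dn_hit:
  assumes w: "w \<in> Paths" and f: "fin (dn x) w"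
  shows "w (hit (dn x) w) <= - x" "!!s. 0 <= s ==> s < hit (dn x) w ==> - x <= w s"
proof -
  let ?T = "hit (dn x) w"
  show "w s \<ge> - x" if "0 <= s" "s < ?T" for s using hit_not[OF that] by (simp add: dn_def)
  show "w ?T <= - x"
  proof (rule ccontr)
    assume "\<not> w ?T <= - x"
    then obtain d where d: "d > 0" "!!s. ?T <= s ==> s < ?T + d ==> \<bar>w s - w ?T\<bar> < w ?T + x"
      using Paths_right[OF w, of "w ?T + x" ?T] by auto
    then obtain s where "?T <= s" "s < ?T + d" "w s < - x" using hit_approach[OF f, of d] by (auto simp: dn_def)
    then show False using d(2)[of s] by auto
  qed
qed

text \<open>The maximum distinguishes whether the infimum was reached before or after time
  t.\<close>

lemma reflected_shift:
  assumes w: "w \<in> Paths" "0 <= t" "0 <= s"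
  shows "w (t + s) - rinf w (t + s) = max (w t - rinf w t + pshift t w s) (pshift t w s - rinf (pshift t w) s)"
  using rinf_shift[OF assms] assms by (auto simp: pshift_at)

text \<open>For each earlier time r the path stays below \<open>w r + a\<close> until the passage
  and cannot jump over this bound, so the reflected path does not overshoot a.\<close>

lemma ex_hit:
  assumes w: "w \<in> Paths" and a: "0 < a" and f: "fin (ex a) w"
  shows "w (hit (ex a) w) = rinf w (hit (ex a) w) + a" "!!s. 0 <= s ==> s <= hit (ex a) w ==> w s - rinf w s <= a"
proof -
  let ?T = "hit (ex a) w"
  have lt: "w s - rinf w s <= a" if "0 <= s" "s < ?T" for s using hit_not[OF that] by (simp add: ex_def)
  have T0: "0 <= ?T" by (rule hit_ge0[OF f])
  have "w ?T - a <= rinf w ?T"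
  proof (subst inf_on_ge_iff[OF w T0], safe)
    fix r assume r: "r \<in> {0..?T}"
    show "w ?T - a <= w r"
    proof (cases "r = ?T")
      case False
      have "w ?T <= w r + a"
      proof (rule no_up_jump[OF w, of r])
        fix s assume "r <= s" "s < ?T"
        then show "w s <= w r + a" using lt[of s] inf_on_le[OF w, of 0 r s] r by auto
      qed (use r False in auto)
      then show ?thesis by simp
    qed (use a in auto)
  qed
  then have le: "w ?T - rinf w ?T <= a" by simp
  have "w ?T - rinf w ?T \<ge> a"
  proof (rule ccontr)
    assume n: "\<not> w ?T - rinf w ?T \<ge> a"
    \<comment> \<open>The two parts serve the two terms of the maximum in
      \<open>reflected_shift\<close>: relative to the old infimum half of the gap to a remains, and
      relative to a new infimum the path rises by at most a / 2.\<close>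
    define e where "e = min ((a - (w ?T - rinf w ?T)) / 2) (a / 4)"
    have e: "e > 0" using n a by (auto simp: e_def)
    obtain d where d: "d > 0" "!!s. ?T <= s ==> s < ?T + d ==> \<bar>w s - w ?T\<bar> < e"
      using Paths_right[OF w e, of ?T] by auto
    then obtain s where s: "?T <= s" "s < ?T + d" "w s - rinf w s > a" using hit_approach[OF f, of d] by (auto simp: ex_def)
    have "- e <= rinf (pshift ?T w) (s - ?T)"
    proof (subst inf_on_ge_iff)
      show "\<forall>r\<in>{0..s - ?T}. - e <= pshift ?T w r"
      proof
        fix r assume "r \<in> {0..s - ?T}"
        then show "- e <= pshift ?T w r" using d(2)[of "?T + r"] s T0 by (auto simp: pshift_at)
      qed
    qed (use w s in auto)
    moreover have "\<bar>pshift ?T w (s - ?T)\<bar> < e" using d(2)[of s] s T0 by (simp add: pshift_at)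
    moreover have "w s - rinf w s = max (w ?T - rinf w ?T + pshift ?T w (s - ?T)) (pshift ?T w (s - ?T) - rinf (pshift ?T w) (s - ?T))"
      using reflected_shift[OF w T0, of "s - ?T"] s by simp
    moreover have "e <= (a - (w ?T - rinf w ?T)) / 2" "e <= a / 4" unfolding e_def by (rule min.cobounded1, rule min.cobounded2)
    ultimately show False using s(3) a by (auto simp: max_def split: if_splits)
  qed
  with le show eq: "w ?T = rinf w ?T + a" by simp
  show "w s - rinf w s <= a" if "0 <= s" "s <= ?T" for s using lt[of s] that eq by (cases "s = ?T") auto
qed

text \<open>When the reflected path first completes height a it equals a. Reaching a + b later
  therefore requires the shifted path, whose infimum starts afresh, to make a reflected rise above
  b. Submultiplicativity of the tail probabilities in the height follows from this.\<close>

lemma ex_add: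
  assumes w: "w \<in> Paths" and ab: "0 < a" "0 < b" and f: "fin (ex (a + b)) w"
  shows "fin (ex a) w" "hit (ex a) w <= hit (ex (a + b)) w"
    "fin (ex b) (pshift (hit (ex a) w) w)" "hit (ex b) (pshift (hit (ex a) w) w) <= hit (ex (a + b)) w - hit (ex a) w"
proof -
  have imp: "ex a w s" if "ex (a + b) w s" for s using that ab by (simp add: ex_def)
  show fa: "fin (ex a) w" using f imp by (auto simp: fin_def)
  show "hit (ex a) w <= hit (ex (a + b)) w" by (rule hit_greatest[OF f]) (rule hit_le[where Q="ex a"], assumption, rule imp)
  let ?T = "hit (ex a) w" and ?v = "pshift (hit (ex a) w) w"
  have T0: "0 <= ?T" by (rule hit_ge0[OF fa])
  have key: "?T <= s & ex b ?v (s - ?T)" if s: "0 <= s" "ex (a + b) w s" for s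
  proof -
    have le: "?T <= s" by (rule hit_le[where Q="ex a", OF s(1) imp[OF s(2)]])
    have "w s - rinf w s = max (a + ?v (s - ?T)) (?v (s - ?T) - rinf ?v (s - ?T))"
      using reflected_shift[OF w T0, of "s - ?T"] le ex_hit[OF w ab(1) fa] by simp
    moreover have "rinf ?v (s - ?T) <= 0" using le w by (intro rinf_le0) auto
    ultimately show ?thesis using s(2) le ab unfolding ex_def by (auto simp: max_def split: if_splits)
  qed
  obtain s where "0 <= s" "ex (a + b) w s" using f by (auto simp: fin_def)
  with key[of s] show fb: "fin (ex b) ?v" by (auto simp: fin_def intro!: exI[of _ "s - ?T"])
  have "hit (ex b) ?v + ?T <= hit (ex (a + b)) w"
  proof (rule hit_greatest[OF f])
    fix s assume s: "0 <= s" "ex (a + b) w s"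
    then show "hit (ex b) ?v + ?T <= s" using key[OF s] hit_le[of "s - ?T" "ex b" ?v] by auto
  qed
  then show "hit (ex b) ?v <= hit (ex (a + b)) w - ?T" by simp
qed

definition hits :: "((real => real) => real => bool) => real => (real => real) set" where
  "hits Q t = {w\<in>Paths. fin Q w & hit Q w <= t}"

lemma hits_sets [measurable]:
  assumes Q: "progressive Q" shows "hits Q t \<in> sets path_space"
proof -
  note [measurable] = fin_measurable[OF Q] hit_measurable[OF Q]
  have "hits Q t = {w\<in>space path_space. fin Q w & hit Q w <= t}" by (simp add: hits_def)
  also have "... \<in> sets path_space" by measurable
  finally show ?thesis .
qed

lemma hits_I: "w \<in> Paths ==> 0 <= s ==> s <= t ==> Q w s ==> w \<in> hits Q t"
  using hit_le[of s Q w] by (auto simp: hits_def fin_def)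

lemma determined_hit:
  assumes Q: "progressive Q" and R: "Measurable.pred path_space R"
    and st: "!!w t. w \<in> Paths ==> fin Q w ==> hit Q w < t ==> R (pstop t w) = R w"
  shows "determined {w\<in>Paths. fin Q w & R w} (hit Q)"
  unfolding determined_def
proof (intro conjI ballI allI)
  note [measurable] = fin_measurable[OF Q] hit_measurable[OF Q] R
  have "{w\<in>space path_space. fin Q w & R w} \<in> sets path_space" by measurable
  then show "{w\<in>Paths. fin Q w & R w} \<in> sets path_space" by simp
  show "hit Q \<in> borel_measurable path_space" by measurable
  show "0 <= hit Q w" if "w \<in> {w\<in>Paths. fin Q w & R w}" for w using that hit_ge0 by auto
  fix w t assume w: "w \<in> Paths"
  show "(w \<in> {w\<in>Paths. fin Q w & R w} & hit Q w < t) = (pstop t w \<in> {w\<in>Paths. fin Q w & R w} & hit Q (pstop t w) < t)"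
    using hit_stop[OF Q w, of t] st[OF w, of t] w by auto
  show "w \<in> {w\<in>Paths. fin Q w & R w} & hit Q w < t --> hit Q (pstop t w) = hit Q w"
    using hit_stop[OF Q w, of t] by auto
qed

lemma determined_ev:
  assumes Q: "progressive Q" shows "determined (hits Q t) (hit Q)"
  unfolding hits_def
proof (rule determined_hit[OF Q])
  note [measurable] = hit_measurable[OF Q]
  show "Measurable.pred path_space (%w. hit Q w <= t)" by measurable
qed (use hit_stop[OF Q] in auto)

lemma exp_minus_one_le: "\<bar>exp y - 1\<bar> <= \<bar>y\<bar> * exp \<bar>y\<bar>" for y :: real
proof (cases "y \<ge> 0")
  case True
  have "1 - y <= exp (- y)" using exp_ge_add_one_self[of "- y"] by simp
  then have "(1 - y) * exp y <= exp (- y) * exp y" by (intro mult_right_mono) auto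
  then have "exp y - 1 <= y * exp y" by (simp add: exp_minus algebra_simps)
  then show ?thesis using True by simp
next
  case False
  have "1 - exp y <= - y" using exp_ge_add_one_self[of y] by linarith
  also have "... <= \<bar>y\<bar> * exp \<bar>y\<bar>" using False by (simp add: mult_le_cancel_left1)
  finally show ?thesis using False by simp
qed

lemma ex_pos: "w \<in> Paths ==> 0 < a ==> fin (ex a) w ==> hit (ex a) w > 0"
proof -
  assume a: "w \<in> Paths" "0 < a" "fin (ex a) w"
  have "hit (ex a) w \<noteq> 0"
  proof
    assume "hit (ex a) w = 0"
    with ex_hit(1)[OF a] have "w 0 = rinf w 0 + a" by simp
    moreover have "rinf w 0 = w 0" by (simp add: inf_on_def)
    ultimately show False using a by simp
  qed
  then show ?thesis using hit_ge0[OF a(3)] by simp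
qed

lemma up_pos: "w \<in> Paths ==> 0 < b ==> fin (up b) w ==> hit (up b) w > 0"
  using up_hit(1)[of w b] hit_ge0[of "up b" w] Paths_0[of w 0] by (cases "hit (up b) w = 0") auto

lemma dn_pos: "w \<in> Paths ==> 0 < x ==> fin (dn x) w ==> hit (dn x) w > 0"
  using dn_hit(1)[of w x] hit_ge0[of "dn x" w] Paths_0[of w 0] by (cases "hit (dn x) w = 0") auto

context levy_law begin

lemma hits_P [measurable]: "progressive Q ==> hits Q t \<in> sets P"
  by (simp add: sets_P hits_sets)

lemma strong_markov_prod:
  assumes A: "determined A \<tau>" and H [measurable]: "H \<in> borel_measurable path_space" and K [measurable]: "K \<in> borel_measurable path_space"
    and st: "!!w t. w \<in> A ==> \<tau> w < t ==> H (pstop t w) = H w"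
  shows "(\<N> w. indicator A w * (H w * K (pshift (\<tau> w) w))) = (\<N> w. indicator A w * H w) * (\<N> w. K w :: ennreal)"
proof -
  have [measurable]: "A \<in> sets path_space" using A by (simp add: determined_def)
  have "(\<N> w. indicator A w * (H w * K (pshift (\<tau> w) w))) = (\<N> w. indicator A w * (%z. fst z * K (snd z)) (H w, pshift (\<tau> w) w))" by simp
  also have "... = (\<N> w. indicator A w * (\<N> w'. (%z. fst z * K (snd z)) (H w, w')))"
    by (rule strong_markov[OF A, where N=borel]) (auto simp: st)
  also have "... = (\<N> w. (indicator A w * H w) * (\<N> w'. K w'))"
    by (simp add: nn_integral_cmult mult.assoc)
  also have "... = (\<N> w. indicator A w * H w) * (\<N> w. K w)"
    by (rule nn_integral_multc) simp
  finally show ?thesis .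
qed

lemma strong_markov_event:
  assumes A: "determined A \<tau>" and B: "B \<in> sets path_space" and C: "C \<in> sets path_space"
    and sub: "!!w. w \<in> A ==> pshift (\<tau> w) w \<in> B ==> w \<in> C"
  shows "prob A * prob B <= prob C"
proof -
  have [measurable]: "A \<in> sets path_space" using A by (simp add: determined_def)
  note [measurable] = B C
  have "emeasure P A * emeasure P B = (\<N> w. indicator A w * (1 * indicator B (pshift (\<tau> w) w)))"
    by (subst strong_markov_prod[OF A, of "%_. 1" "indicator B"]) simp_all
  also have "... <= (\<N> w. indicator C w)"
    by (intro nn_integral_mono) (auto simp: indicator_def sub)
  also have "... = emeasure P C" by simp
  finally show ?thesis by (simp add: emeasure_eq_measure ennreal_mult[symmetric])
qed

lemma strong_markov_event':
  assumes A: "determined A \<tau>" and B: "B \<in> sets path_space" and C: "C \<in> sets path_space"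
    and sub: "!!w. w \<in> C ==> w \<in> A & pshift (\<tau> w) w \<in> B"
  shows "prob C <= prob A * prob B"
proof -
  have [measurable]: "A \<in> sets path_space" using A by (simp add: determined_def)
  note [measurable] = B C
  have "emeasure P C = (\<N> w. indicator C w)" by simp
  also have "... <= (\<N> w. indicator A w * (1 * indicator B (pshift (\<tau> w) w)))"
    using sub by (intro nn_integral_mono) (auto simp: indicator_def)
  also have "... = emeasure P A * emeasure P B"
    by (subst strong_markov_prod[OF A, of "%_. 1" "indicator B"]) simp_all
  finally show ?thesis by (simp add: emeasure_eq_measure ennreal_mult[symmetric])
qed

lemma hits_ex_submult:
  assumes "0 < a" "0 < b" shows "prob (hits (ex (a + b)) t) <= prob (hits (ex a) t) * prob (hits (ex b) t)"
proof (rule strong_markov_event'[where \<tau>="hit (ex a)"])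
  fix w assume "w \<in> hits (ex (a + b)) t"
  then have w: "w \<in> Paths" and f: "fin (ex (a + b)) w" and h: "hit (ex (a + b)) w <= t" by (auto simp: hits_def)
  note e = ex_add[OF w assms f]
  then show "w \<in> hits (ex a) t & pshift (hit (ex a) w) w \<in> hits (ex b) t"
    using w h hit_ge0[OF e(1)] by (auto simp: hits_def)
qed (auto intro: determined_ev)

lemma hits_to_0:
  assumes Q: "progressive Q" and p: "!!w. w \<in> Paths ==> fin Q w ==> hit Q w > 0"
  shows "(%n. prob (hits Q (1 / real (Suc n)))) \<longlonglongrightarrow> 0"
proof -
  have e: "(\<Inter>n. hits Q (1 / real (Suc n))) = {}"
  proof safe
    fix w assume w: "w \<in> (\<Inter>n. hits Q (1 / real (Suc n)))"
    then have "w \<in> Paths" "fin Q w" by (auto simp: hits_def)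
    from reals_Archimedean[OF p[OF this]] obtain n where "inverse (real (Suc n)) < hit Q w" by blast
    moreover have "hit Q w <= 1 / real (Suc n)" using w by (auto simp: hits_def)
    ultimately show "w \<in> {}" by (simp add: inverse_eq_divide)
  qed
  have "(%n. prob (hits Q (1 / real (Suc n)))) \<longlonglongrightarrow> prob (\<Inter>n. hits Q (1 / real (Suc n)))"
  proof (rule finite_Lim_measure_decseq)
    show "range (%n. hits Q (1 / real (Suc n))) \<subseteq> events" using Q by auto
    show "decseq (%n. hits Q (1 / real (Suc n)))"
      by (auto simp: decseq_def hits_def intro: order_trans[OF _ divide_left_mono])
  qed
  then show ?thesis unfolding e by simp
qed

text \<open>Reflected rises of height n within a short time have geometrically small probabilities.
  When the ratio beats \<open>exp th\<close>, a sum over layers of height 1 is integrable and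
  dominates the exponential at all times up to \<open>t0\<close> at once.\<close>

lemma dominating_exp:
  assumes th: "0 <= th"
  obtains t0 Z where "0 < t0" "Z \<in> borel_measurable path_space" "(\<N> w. Z w) < \<infinity>"
    "!!t w. w \<in> Paths ==> 0 <= t ==> t <= t0 ==> ennreal (exp (th * w t)) <= Z w"
proof -
  have "(%n. prob (hits (ex 1) (1 / real (Suc n)))) \<longlonglongrightarrow> 0" by (rule hits_to_0) (auto intro: ex_pos)
  \<comment> \<open>Each unit of height costs a factor \<open>exp th\<close> in \<open>Z\<close>;
    the bound chosen here leaves a geometric series of ratio 1 / 2.\<close>
  then obtain n0 where n0: "prob (hits (ex 1) (1 / real (Suc n0))) < exp (- th) / 2"
    using order_tendstoD(2)[of _ 0 sequentially "exp (- th) / 2"] by (auto simp: eventually_sequentially)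
  define t0 where "t0 = 1 / real (Suc n0)"
  define p where "p = prob (hits (ex 1) t0)"
  have p: "0 <= p" "exp th * p <= 1 / 2" using n0 by (auto simp: p_def t0_def exp_minus field_simps)
  have pn: "prob (hits (ex (real (Suc n))) t0) <= p ^ Suc n" for n
  proof (induction n)
    case (Suc n)
    have "prob (hits (ex (real (Suc n) + 1)) t0) <= prob (hits (ex (real (Suc n))) t0) * p"
      unfolding p_def by (rule hits_ex_submult) auto
    also have "... <= p ^ Suc n * p" using Suc p by (intro mult_right_mono) auto
    finally show ?case by (simp add: algebra_simps)
  qed (simp add: p_def)
  define B where "B n = (if n = 0 then Paths else hits (ex (real n)) t0)" for n :: nat
  have Bm [measurable]: "B n \<in> sets path_space" for n
    using sets.top[of path_space] by (auto simp: B_def hits_sets)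
  define Z where "Z w = (\<Sum>n. ennreal (exp (th * (real n + 1))) * indicator (B n) w)" for w
  have "prob (B n) <= p ^ n" for n
    using pn[of "n - 1"] emeasure_Paths by (cases n) (auto simp: B_def emeasure_eq_measure)
  then have "exp (th * (real n + 1)) * prob (B n) <= exp (th * (real n + 1)) * p ^ n" for n
    by (intro mult_left_mono) auto
  also have "exp (th * (real n + 1)) * p ^ n = exp th * (exp th * p) ^ n" for n
    by (simp add: power_mult_distrib exp_of_nat_mult[symmetric] exp_add[symmetric] algebra_simps)
  also have "exp th * (exp th * p) ^ n <= exp th * (1 / 2) ^ n" for n
    using p by (intro mult_left_mono power_mono) auto
  finally have le: "exp (th * (real n + 1)) * prob (B n) <= exp th * (1 / 2) ^ n" for n .
  have "(\<N> w. Z w) = (\<Sum>n. ennreal (exp (th * (real n + 1))) * emeasure P (B n))"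
    unfolding Z_def by (subst nn_integral_suminf) (auto simp: nn_integral_cmult_indicator sets_P)
  also have "... = (\<Sum>n. ennreal (exp (th * (real n + 1)) * prob (B n)))"
    by (simp add: emeasure_eq_measure ennreal_mult)
  also have "... <= (\<Sum>n. ennreal (exp th * (1 / 2) ^ n))"
    using le by (intro suminf_le) (auto intro!: ennreal_leI)
  also have "... = ennreal (\<Sum>n. exp th * (1 / 2) ^ n)"
    by (intro suminf_ennreal2) (auto intro!: summable_mult summable_geometric)
  also have "... < \<infinity>" by simp
  finally have Zf: "(\<N> w. Z w) < \<infinity>" .
  show thesis
  proof (rule that[of t0 Z])
    show "0 < t0" by (simp add: t0_def)
    show "Z \<in> borel_measurable path_space" unfolding Z_def by measurable
    show "(\<N> w. Z w) < \<infinity>" by (rule Zf)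
    fix t w assume w: "w \<in> Paths" and t: "0 <= t" "t <= t0"
    obtain n :: nat where n: "w t <= real n + 1" "w \<in> B n"
    proof (cases "w t <= 1")
      case True then show ?thesis using that[of 0] w by (auto simp: B_def)
    next
      case False
      define n where "n = nat (\<lceil>w t\<rceil> - 1)"
      have *: "real n < w t" "w t <= real n + 1" "n > 0" using False unfolding n_def by linarith+
      have "ex (real n) w t" using * rinf_le0[OF w t(1)] by (auto simp: ex_def)
      then have "w \<in> B n" using hits_I[OF w t, of "ex (real n)"] * by (simp add: B_def)
      then show ?thesis using that * by auto
    qed
    have "ennreal (exp (th * w t)) <= ennreal (exp (th * (real n + 1))) * indicator (B n) w"
      using n th by (auto intro!: ennreal_leI mult_left_mono)
    also have "... = (\<Sum>m\<in>{n}. ennreal (exp (th * (real m + 1))) * indicator (B m) w)"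
      by (simp only: sum.insert finite.emptyI empty_iff not_False_eq_True sum.empty add_0_right)
    also have "... <= Z w" unfolding Z_def by (rule sum_le_suminf) auto
    finally show "ennreal (exp (th * w t)) <= Z w" .
  qed
qed

section \<open>Exponential moments and the Laplace exponent\<close>

definition mgf :: "real => real => real" where "mgf th t = (\<E> w. exp (th * w t))"
definition \<psi> :: "real => real" where "\<psi> th = ln (mgf th 1)"

lemma exp_nn_add:
  assumes "0 <= s" "0 <= t"
  shows "(\<N> w. ennreal (exp (th * w (s + t)))) = (\<N> w. ennreal (exp (th * w s))) * (\<N> w. ennreal (exp (th * w t)))"
proof -
  have "(\<N> w. ennreal (exp (th * w (s + t)))) = (\<N> w. (%z. ennreal (exp (th * fst z)) * ennreal (exp (th * snd z t))) (w s, pshift s w))"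
    using assms by (intro nn_integral_cong) (auto simp: pshift_at ennreal_mult[symmetric] exp_add[symmetric] algebra_simps)
  also have "... = (\<N> w. \<N> w'. (%z. ennreal (exp (th * fst z)) * ennreal (exp (th * snd z t))) (w s, w'))"
    by (rule markov_nn[OF assms(1), where N=borel]) (auto simp: pstop_at)
  also have "... = (\<N> w. ennreal (exp (th * w s))) * (\<N> w. ennreal (exp (th * w t)))"
    by (simp add: nn_integral_cmult nn_integral_multc)
  finally show ?thesis .
qed

text \<open>Domination is available only up to \<open>t0\<close>; a general time is cut into equal
  steps no longer than that.\<close>

lemma exp_nn_finite:
  assumes th: "0 <= th" and t: "0 <= t" shows "(\<N> w. ennreal (exp (th * w t))) < \<infinity>"
proof -
  obtain t0 Z where Z: "0 < t0" "Z \<in> borel_measurable path_space" "(\<N> w. Z w) < \<infinity>"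
    "!!t w. w \<in> Paths ==> 0 <= t ==> t <= t0 ==> ennreal (exp (th * w t)) <= Z w"
    using dominating_exp[OF th] by blast
  have small: "(\<N> w. ennreal (exp (th * w s))) < \<infinity>" if "0 <= s" "s <= t0" for s
    using Z that by (intro le_less_trans[OF nn_integral_mono Z(3)]) auto
  obtain n :: nat where n: "t / t0 < real n" using reals_Archimedean2 by blast
  with t Z(1) have n0: "n > 0" by (metis divide_nonneg_pos gr0I less_imp_le linorder_not_less of_nat_0)
  have "(\<N> w. ennreal (exp (th * w (real k * (t / real n))))) < \<infinity>" for k :: nat
  proof (induction k)
    case 0
    then show ?case using small[of 0] Z(1) by simp
  next
    case (Suc k)
    have "t / real n <= t0" using n n0 Z(1) by (simp add: field_simps)
    then have "(\<N> w. ennreal (exp (th * w (t / real n)))) < \<infinity>" using t by (intro small) auto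
    moreover have "real (Suc k) * (t / real n) = real k * (t / real n) + t / real n" by (simp add: algebra_simps add_divide_distrib)
    moreover have "(\<N> w. ennreal (exp (th * w (real k * (t / real n) + t / real n)))) =
      (\<N> w. ennreal (exp (th * w (real k * (t / real n))))) * (\<N> w. ennreal (exp (th * w (t / real n))))"
      using t by (intro exp_nn_add) auto
    ultimately show ?case using Suc by (metis ennreal_mult_less_top infinity_ennreal_def)
  qed
  from this[of n] show ?thesis using n0 by simp
qed

lemma exp_integrable: "0 <= th ==> 0 <= t ==> integrable P (%w. exp (th * w t))"
  by (rule integrableI_bounded) (use exp_nn_finite in auto)

lemma mgf_nn: "0 <= th ==> 0 <= t ==> (\<N> w. ennreal (exp (th * w t))) = ennreal (mgf th t)"
  unfolding mgf_def by (intro nn_integral_eq_integral exp_integrable) auto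

lemma mgf_pos: assumes "0 <= th" "0 <= t" shows "mgf th t > 0"
proof -
  have "0 <= mgf th t" "mgf th t \<noteq> 0" unfolding mgf_def
    using integral_nonneg_eq_0_iff_AE[OF exp_integrable[OF assms]] AE_False by (auto intro!: integral_nonneg_AE)
  then show ?thesis by simp
qed

lemma mgf_add: assumes "0 <= th" "0 <= s" "0 <= t" shows "mgf th (s + t) = mgf th s * mgf th t"
proof -
  have p: "mgf th s > 0" "mgf th t > 0" "mgf th (s + t) > 0" using assms by (auto intro!: mgf_pos)
  have "ennreal (mgf th (s + t)) = ennreal (mgf th s * mgf th t)"
    using exp_nn_add[OF assms(2,3), of th] assms p by (simp add: mgf_nn ennreal_mult less_imp_le)
  then show ?thesis using p by (simp add: less_imp_le)
qed

lemma mgf_to_1: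
  assumes th: "0 <= th" and f: "!!n. 0 <= f n" "f \<longlonglongrightarrow> 0" shows "(%n. mgf th (f n)) \<longlonglongrightarrow> 1"
proof -
  obtain t0 Z where Z: "0 < t0" "Z \<in> borel_measurable path_space" "(\<N> w. Z w) < \<infinity>"
    "!!t w. w \<in> Paths ==> 0 <= t ==> t <= t0 ==> ennreal (exp (th * w t)) <= Z w"
    using dominating_exp[OF th] by blast
  define g where "g n = min t0 (f n)" for n
  have g: "0 <= g n" "g n <= t0" for n using f Z(1) by (auto simp: g_def)
  have "g \<longlonglongrightarrow> min t0 0" unfolding g_def by (intro tendsto_min tendsto_const f)
  then have g0: "g \<longlonglongrightarrow> 0" using Z(1) by simp
  have "(%n. \<N> w. ennreal (exp (th * w (g n)))) \<longlonglongrightarrow> (\<N> w. 1)"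
  proof (rule nn_integral_dominated_convergence[where w=Z])
    show "AE w in P. (%n. ennreal (exp (th * w (g n)))) \<longlonglongrightarrow> 1"
    proof (rule AE_I2)
      fix w assume "w \<in> space P"
      then have "(%n. w (g n)) \<longlonglongrightarrow> w 0" by (intro Paths_right_lim[OF _ g(1) g0]) simp
      then have "(%n. exp (th * w (g n))) \<longlonglongrightarrow> exp (th * w 0)" by (intro tendsto_intros)
      then have "(%n. ennreal (exp (th * w (g n)))) \<longlonglongrightarrow> ennreal (exp (th * w 0))" by (rule tendsto_ennrealI)
      then show "(%n. ennreal (exp (th * w (g n)))) \<longlonglongrightarrow> 1" using Paths_0[of w 0] \<open>w \<in> space P\<close> by (simp del: tendsto_ennreal_iff)
    qed
  qed (use Z g in auto)
  then have "(%n. ennreal (mgf th (g n))) \<longlonglongrightarrow> ennreal 1" using th g by (simp add: mgf_nn)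
  then have "(%n. mgf th (g n)) \<longlonglongrightarrow> 1" using mgf_pos[OF th g(1)] by (subst (asm) tendsto_ennreal_iff) (auto intro!: always_eventually less_imp_le)
  moreover have "eventually (%n. mgf th (g n) = mgf th (f n)) sequentially"
    using order_tendstoD(2)[OF f(2) Z(1)] by eventually_elim (simp add: g_def)
  ultimately show ?thesis by (rule Lim_transform_eventually)
qed

text \<open>Multiplicativity gives the formula at all multiples of 1 / (n + 1), through roots of the
  value at time 1. Rational times decreasing to t and the limit 1 of the moment at time 0 extend it
  to real t.\<close>

lemma mgf_exp: assumes th: "0 <= th" and t: "0 <= t" shows "mgf th t = exp (t * \<psi> th)"
proof -
  have e1: "mgf th 1 = exp (\<psi> th)" using mgf_pos[OF th, of 1] by (simp add: \<psi>_def)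
  have m0: "mgf th 0 = 1"
  proof -
    have "mgf th 0 = mgf th 0 * mgf th 0" using mgf_add[OF th, of 0 0] by simp
    then show ?thesis using mgf_pos[OF th, of 0] by simp
  qed
  have mult: "mgf th (real k * s) = mgf th s ^ k" if "0 <= s" for k s
  proof (induction k)
    case (Suc k)
    have "mgf th (real (Suc k) * s) = mgf th (real k * s + s)" by (simp add: algebra_simps)
    then show ?case using Suc mgf_add[OF th, of "real k * s" s] that by simp
  qed (simp add: m0)
  have inv: "mgf th (1 / real (Suc n)) = exp (\<psi> th / real (Suc n))" for n
  proof -
    have "mgf th (1 / real (Suc n)) ^ Suc n = mgf th 1" using mult[of "1 / real (Suc n)" "Suc n"] by simp
    also have "... = exp (\<psi> th / real (Suc n)) ^ Suc n"
      using e1 exp_of_nat_mult[of "Suc n" "\<psi> th / real (Suc n)"] by simp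
    finally show ?thesis
      by (rule power_eq_imp_eq_base) (use mgf_pos[OF th, of "1 / real (Suc n)"] in \<open>auto intro: less_imp_le\<close>)
  qed
  define T where "T n = real (nat \<lfloor>real (Suc n) * t\<rfloor> + 1) / real (Suc n)" for n
  have T: "t < T n" "T n <= t + 1 / real (Suc n)" for n
  proof -
    have *: "real (nat \<lfloor>real (Suc n) * t\<rfloor> + 1) = of_int \<lfloor>real (Suc n) * t\<rfloor> + 1" using t by simp
    have "real (Suc n) * t < real (nat \<lfloor>real (Suc n) * t\<rfloor> + 1)" unfolding * by linarith
    then show "t < T n" unfolding T_def by (subst pos_less_divide_eq) (auto simp: mult.commute)
    have "real (nat \<lfloor>real (Suc n) * t\<rfloor> + 1) <= real (Suc n) * t + 1" unfolding * by linarith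
    then have "T n <= (real (Suc n) * t + 1) / real (Suc n)" unfolding T_def by (intro divide_right_mono) auto
    also have "... = t + 1 / real (Suc n)" by (simp add: field_simps)
    finally show "T n <= t + 1 / real (Suc n)" .
  qed
  have lim: "T \<longlonglongrightarrow> t"
  proof (rule tendsto_sandwich[of "%n. t" _ _ "%n. t + 1 / real (Suc n)"])
    show "(%n. t + 1 / real (Suc n)) \<longlonglongrightarrow> t"
      using tendsto_add[OF tendsto_const LIMSEQ_Suc[OF lim_1_over_n]] by simp
  qed (use T in \<open>auto intro!: less_imp_le always_eventually\<close>)
  have 1: "(%n. mgf th (T n)) \<longlonglongrightarrow> exp (t * \<psi> th)"
  proof -
    have "mgf th (T n) = exp (T n * \<psi> th)" for n
    proof -
      define k where "k = nat \<lfloor>real (Suc n) * t\<rfloor> + 1"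
      have Tk: "T n = real k * (1 / real (Suc n))" by (simp add: T_def k_def)
      have "mgf th (T n) = mgf th (1 / real (Suc n)) ^ k" unfolding Tk by (rule mult) simp
      also have "... = exp (real k * (\<psi> th / real (Suc n)))" by (simp only: inv exp_of_nat_mult)
      finally show ?thesis by (simp add: Tk)
    qed
    then show ?thesis using lim by (simp add: tendsto_exp tendsto_mult_right)
  qed
  have "mgf th (T n) = mgf th t * mgf th (T n - t)" for n using mgf_add[OF th t, of "T n - t"] T(1)[of n] by simp
  moreover have "(%n. T n - t) \<longlonglongrightarrow> t - t" by (intro tendsto_intros lim)
  then have "(%n. mgf th (T n - t)) \<longlonglongrightarrow> 1" using T by (intro mgf_to_1[OF th]) (auto intro: less_imp_le)
  then have "(%n. mgf th t * mgf th (T n - t)) \<longlonglongrightarrow> mgf th t * 1" by (intro tendsto_mult tendsto_const)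
  ultimately have "(%n. mgf th (T n)) \<longlonglongrightarrow> mgf th t" by simp
  then show ?thesis using 1 LIMSEQ_unique by blast
qed

lemma \<psi>_continuous: "continuous_on {0..} \<psi>"
proof -
  have "continuous_on {0..} (%th. mgf th 1)"
    unfolding continuous_on_sequentially
  proof (intro allI ballI impI, elim conjE)
    fix x :: "nat => real" and a assume a: "a \<in> {0..}" and x: "\<forall>n. x n \<in> {0..}" and lim: "x \<longlonglongrightarrow> a"
    obtain B where B: "!!n. norm (x n) <= B" using convergent_imp_Bseq[OF convergentI[OF lim]] by (auto simp: Bseq_def)
    have B0: "0 <= B" using B[of 0] norm_ge_zero order_trans by blast
    have "(%n. \<E> w. exp (x n * w 1)) \<longlonglongrightarrow> (\<E> w. exp (a * w 1))"
    proof (rule integral_dominated_convergence[where w="%w. 1 + exp (B * w 1)"])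
      show "integrable P (%w. 1 + exp (B * w 1))" using B0 by (intro Bochner_Integration.integrable_add exp_integrable) auto
      show "AE w in P. norm (exp (x n * w 1)) <= 1 + exp (B * w 1)" for n
      proof (rule AE_I2)
        fix w :: "real => real"
        have "x n * w 1 <= max 0 (B * w 1)"
        proof (cases "w 1 \<ge> 0")
          case True
          have "x n <= B" using B[of n] by simp
          then have "x n * w 1 <= B * w 1" using True by (rule mult_right_mono)
          then show ?thesis by simp
        next
          case False then show ?thesis using x by (simp add: mult_nonneg_nonpos le_max_iff_disj)
        qed
        then have "exp (x n * w 1) <= exp (max 0 (B * w 1))" by simp
        also have "... <= 1 + exp (B * w 1)" by (simp add: max_def)
        finally show "norm (exp (x n * w 1)) <= 1 + exp (B * w 1)" by simp
      qed
      show "AE w in P. (%n. exp (x n * w 1)) \<longlonglongrightarrow> exp (a * w 1)"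
        by (intro AE_I2 tendsto_exp tendsto_mult lim tendsto_const)
    qed measurable
    then show "((%th. mgf th 1) \<circ> x) \<longlonglongrightarrow> mgf a 1" by (simp add: comp_def mgf_def)
  qed
  then show ?thesis unfolding \<psi>_def using mgf_pos by (intro continuous_on_ln) (auto simp: less_le)
qed

lemma ex_up_level: "\<exists>t>0. \<exists>eps>0. prob {w\<in>Paths. w t > eps} > 0"
proof -
  obtain t where t: "t > 0" "emeasure P {w\<in>Paths. w t > 0} > 0" using goes_up by blast
  have m: "{w\<in>Paths. w t > c} \<in> sets P" for c
  proof -
    have "{w\<in>space P. w t > c} \<in> sets P" by measurable
    then show ?thesis by simp
  qed
  have "\<exists>n. prob {w\<in>Paths. w t > 1 / real (Suc n)} > 0"
  proof (rule ccontr)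
    assume "\<not> ?thesis"
    then have z: "emeasure P {w\<in>Paths. w t > 1 / real (Suc n)} = 0" for n by (simp add: not_less emeasure_eq_measure measure_le_0_iff)
    have "emeasure P (\<Union>n. {w\<in>Paths. w t > 1 / real (Suc n)}) = 0"
      by (rule emeasure_UN_eq_0) (use z m in auto)
    also have "(\<Union>n. {w\<in>Paths. w t > 1 / real (Suc n)}) = {w\<in>Paths. w t > 0}"
    proof safe
      fix w n assume "1 / real (Suc n) < w t"
      then show "0 < w t" by (meson less_trans of_nat_0_less_iff zero_less_Suc zero_less_divide_1_iff)
    next
      fix w assume "w \<in> Paths" "0 < w t"
      then show "w \<in> (\<Union>n. {w\<in>Paths. w t > 1 / real (Suc n)})"
        using reals_Archimedean[of "w t"] by (auto simp: inverse_eq_divide)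
    qed
    finally show False using t by simp
  qed
  then show ?thesis using t(1) by (metis of_nat_0_less_iff zero_less_Suc zero_less_divide_1_iff)
qed

text \<open>If only the event that the path exceeds \<open>eps\<close> at one time is retained, the
  moment is at least \<open>exp (th * eps) * p\<close>; so the exponent grows at least
  linearly.\<close>

lemma \<psi>_at_top: "filterlim \<psi> at_top at_top"
proof -
  obtain t eps where t: "t > 0" "eps > 0" "prob {w\<in>Paths. w t > eps} > 0" using ex_up_level by blast
  define p where "p = prob {w\<in>Paths. w t > eps}"
  have "ln p / t + (eps / t) * th <= \<psi> th" if "th \<ge> 0" for th
  proof -
    have m: "{w\<in>Paths. w t > eps} \<in> sets P"
    proof -
      have "{w\<in>space P. w t > eps} \<in> sets P" by measurable
      then show ?thesis by simp
    qed
    have "exp (th * eps) * p = (\<E> w. exp (th * eps) * indicator {w\<in>Paths. w t > eps} w)"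
      using m sets.sets_into_space[OF m] by (simp add: p_def Int_absorb2)
    also have "... <= mgf th t" unfolding mgf_def
    proof (rule integral_mono)
      show "integrable P (%w. exp (th * eps) * indicator {w\<in>Paths. w t > eps} w)" using m by (intro integrable_mult_right) (simp add: emeasure_eq_measure)
      show "exp (th * eps) * indicator {w\<in>Paths. w t > eps} w <= exp (th * w t)" for w
        using that by (auto simp: indicator_def intro: mult_left_mono)
    qed (use that t in \<open>auto intro: exp_integrable\<close>)
    finally have "exp (th * eps) * p <= exp (t * \<psi> th)" using mgf_exp that t by simp
    then have "ln (exp (th * eps) * p) <= ln (exp (t * \<psi> th))" using t(3) by (subst ln_le_cancel_iff) (auto simp: p_def)
    moreover have "ln (exp (th * eps) * p) = th * eps + ln p" using t(3) by (subst ln_mult) (auto simp: p_def)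
    ultimately show ?thesis using t(1) by (simp add: field_simps)
  qed
  then have "eventually (%th. ln p / t + (eps / t) * th <= \<psi> th) at_top"
    unfolding eventually_at_top_linorder by blast
  moreover have "filterlim (%th. ln p / t + (eps / t) * th) at_top at_top"
    using t by (intro filterlim_tendsto_add_at_top[OF tendsto_const] filterlim_tendsto_pos_mult_at_top[OF tendsto_const] filterlim_ident) auto
  ultimately show ?thesis
    by (metis filterlim_at_top_mono)
qed

end

section \<open>Short-time tails of the path and of its reflected rises\<close>

context levy_law begin

text \<open>Chebyshev's inequality for \<open>exp (w t) - 1\<close> in place of the position:
  negative exponential moments need not exist, but the second moment of this variable combines the
  moments at 1 and 2 only and is of order t. The constant \<open>c\<close> is the least value of its
  square for positions at distance at least \<open>eps\<close> from 0.\<close>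

lemma deviation_bound:
  assumes e: "eps > 0"
  shows "\<exists>C. \<forall>n. prob {w\<in>Paths. \<bar>w (1 / real (Suc n))\<bar> \<ge> eps} <= C / real (Suc n)"
proof -
  define c where "c = (1 - exp (- eps))\<^sup>2"
  have c: "c > 0" using e by (auto simp: c_def)
  define D where "D x = \<bar>x\<bar> * exp \<bar>x\<bar>" for x :: real
  have D: "\<bar>exp (x / real (Suc n)) - 1\<bar> <= D x / real (Suc n)" for x n
  proof -
    have "\<bar>exp (x / real (Suc n)) - 1\<bar> <= \<bar>x / real (Suc n)\<bar> * exp \<bar>x / real (Suc n)\<bar>" by (rule exp_minus_one_le)
    also have "... <= \<bar>x / real (Suc n)\<bar> * exp \<bar>x\<bar>"
    proof (intro mult_left_mono)
      have "\<bar>x / real (Suc n)\<bar> <= \<bar>x\<bar>" by (simp add: divide_le_eq mult_le_cancel_left1)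
      then show "exp \<bar>x / real (Suc n)\<bar> <= exp \<bar>x\<bar>" by simp
    qed auto
    finally show ?thesis by (simp add: D_def)
  qed
  show ?thesis
  proof (intro exI[of _ "(D (\<psi> 2) + 2 * D (\<psi> 1)) / c"] allI)
    fix n
    let ?t = "1 / real (Suc n)"
    have m: "{w\<in>Paths. \<bar>w ?t\<bar> \<ge> eps} \<in> sets P"
    proof -
      have "{w\<in>space P. \<bar>w ?t\<bar> \<ge> eps} \<in> sets P" by measurable
      then show ?thesis by simp
    qed
    have *: "(exp (w ?t) - 1)\<^sup>2 = exp (2 * w ?t) - 2 * exp (1 * w ?t) + 1" for w :: "real => real"
      by (simp add: power2_diff exp_double)
    have ii: "integrable P (%w. exp (2 * w ?t))" "integrable P (%w. exp (1 * w ?t))" by (rule exp_integrable; simp)+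
    have i: "integrable P (%w. (exp (w ?t) - 1)\<^sup>2)" unfolding * using ii by (intro Bochner_Integration.integrable_add Bochner_Integration.integrable_diff integrable_mult_right) auto
    have v: "(\<E> w. (exp (w ?t) - 1)\<^sup>2) = mgf 2 ?t - 2 * mgf 1 ?t + 1"
    proof -
      have "(\<E> w. (exp (w ?t) - 1)\<^sup>2) = (\<E> w. (exp (2 * w ?t) - 2 * exp (1 * w ?t)) + 1)" unfolding * ..
      also have "... = (\<E> w. exp (2 * w ?t) - 2 * exp (1 * w ?t)) + (\<E> w. 1)"
        using ii by (intro Bochner_Integration.integral_add Bochner_Integration.integrable_diff integrable_mult_right) auto
      also have "(\<E> w. exp (2 * w ?t) - 2 * exp (1 * w ?t)) = mgf 2 ?t - 2 * mgf 1 ?t"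
        unfolding mgf_def using ii by (subst Bochner_Integration.integral_diff) auto
      finally show ?thesis using prob_space by simp
    qed
    have "c * prob {w\<in>Paths. \<bar>w ?t\<bar> \<ge> eps} = (\<E> w. c * indicator {w\<in>Paths. \<bar>w ?t\<bar> \<ge> eps} w)" using m sets.sets_into_space[OF m] by (simp add: Int_absorb2)
    also have "... <= (\<E> w. (exp (w ?t) - 1)\<^sup>2)"
    proof (rule integral_mono)
      fix w assume "w \<in> space P"
      have "c <= (exp (w ?t) - 1)\<^sup>2" if "\<bar>w ?t\<bar> \<ge> eps"
      proof -
        have "1 - exp (- eps) <= \<bar>exp (w ?t) - 1\<bar>"
        proof (cases "w ?t \<ge> 0")
          case True
          then have "exp eps <= exp (w ?t)" using that by simp
          moreover have "1 - exp (- eps) <= exp eps - 1"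
            using exp_ge_add_one_self[of eps] exp_ge_add_one_self[of "- eps"] by linarith
          ultimately show ?thesis by linarith
        next
          case False
          then have "exp (w ?t) <= exp (- eps)" using that by simp
          then show ?thesis by linarith
        qed
        then have "c <= \<bar>exp (w ?t) - 1\<bar>\<^sup>2" unfolding c_def using e by (intro power_mono) auto
        then show ?thesis by simp
      qed
      then show "c * indicator {w\<in>Paths. \<bar>w ?t\<bar> \<ge> eps} w <= (exp (w ?t) - 1)\<^sup>2" by (auto simp: indicator_def)
    next
      show "integrable P (%w. c * indicator {w\<in>Paths. \<bar>w ?t\<bar> \<ge> eps} w)"
        using m by (intro integrable_mult_right) (simp add: emeasure_eq_measure)
    qed (rule i)
    also have "... = (exp (\<psi> 2 / real (Suc n)) - 1) - 2 * (exp (\<psi> 1 / real (Suc n)) - 1)"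
      unfolding v by (simp add: mgf_exp)
    also have "... <= D (\<psi> 2) / real (Suc n) + 2 * (D (\<psi> 1) / real (Suc n))"
    proof -
      have "(e2 - 1) - 2 * (e1 - 1) <= A + 2 * B" if "\<bar>e2 - 1\<bar> <= A" "\<bar>e1 - 1\<bar> <= B" for e1 e2 A B :: real
        using that unfolding abs_le_iff by simp
      from this[OF D D] show ?thesis .
    qed
    also have "... = (D (\<psi> 2) + 2 * D (\<psi> 1)) / real (Suc n)" by (simp add: add_divide_distrib)
    finally have "prob {w\<in>Paths. \<bar>w ?t\<bar> \<ge> eps} <= (D (\<psi> 2) + 2 * D (\<psi> 1)) / real (Suc n) / c"
      using c by (subst pos_le_divide_eq) (auto simp: mult.commute)
    then show "prob {w\<in>Paths. \<bar>w ?t\<bar> \<ge> eps} <= (D (\<psi> 2) + 2 * D (\<psi> 1)) / c / real (Suc n)"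
      by (simp add: mult.commute)
  qed
qed

text \<open>An Ottaviani argument. After rising above 2 eps the path fails, with probability at
  least one half, to fall back by eps before the end of the interval, which leaves a deviation of at
  least eps there; likewise downwards. A reflected rise of 5 eps ends above 2 eps or has an infimum
  below -2 eps, with room for the strict inequalities.\<close>

lemma hits_ex_bound1:
  assumes e: "eps > 0"
  shows "\<exists>C. \<forall>\<^sub>F n in sequentially. prob (hits (ex (5 * eps)) (1 / real (Suc n))) <= C / real (Suc n)"
proof -
  obtain C where C: "!!n. prob {w\<in>Paths. \<bar>w (1 / real (Suc n))\<bar> \<ge> eps} <= C / real (Suc n)" using deviation_bound[OF e] by blast
  have "(%n. prob (hits (up eps) (1 / real (Suc n)))) \<longlonglongrightarrow> 0" "(%n. prob (hits (dn eps) (1 / real (Suc n)))) \<longlonglongrightarrow> 0"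
    using e by (intro hits_to_0; auto intro: up_pos dn_pos)+
  then have "\<forall>\<^sub>F n in sequentially. prob (hits (up eps) (1 / real (Suc n))) < 1 / 2" "\<forall>\<^sub>F n in sequentially. prob (hits (dn eps) (1 / real (Suc n))) < 1 / 2"
    by (auto dest!: order_tendstoD(2)[where a="1/2"])
  then have "\<forall>\<^sub>F n in sequentially. prob (hits (ex (5 * eps)) (1 / real (Suc n))) <= (4 * C) / real (Suc n)"
  proof eventually_elim
    case (elim n)
    let ?t = "1 / real (Suc n)"
    have P: "Paths \<in> sets path_space" using sets.top[of path_space] by simp
    have md: "{w\<in>Paths. \<bar>w ?t\<bar> \<ge> eps} \<in> sets path_space"
    proof -
      have "{w\<in>space path_space. \<bar>w ?t\<bar> \<ge> eps} \<in> sets path_space" by measurable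
      then show ?thesis by simp
    qed
    have c1: "prob (Paths - hits Q ?t) = 1 - prob (hits Q ?t)" if "progressive Q" for Q
      using prob_compl[of "hits Q ?t"] hits_P[OF that] by simp
    have "prob (hits (up (2 * eps)) ?t) * prob (Paths - hits (dn eps) ?t) <= prob {w\<in>Paths. \<bar>w ?t\<bar> \<ge> eps}"
    proof (rule strong_markov_event[OF determined_ev])
      fix w assume a: "w \<in> hits (up (2 * eps)) ?t" "pshift (hit (up (2 * eps)) w) w \<in> Paths - hits (dn eps) ?t"
      then have w: "w \<in> Paths" "fin (up (2 * eps)) w" and h: "hit (up (2 * eps)) w <= ?t" by (auto simp: hits_def)
      let ?T = "hit (up (2 * eps)) w"
      have T: "0 <= ?T" by (rule hit_ge0[OF w(2)])
      have "\<not> dn eps (pshift ?T w) (?t - ?T)" using a(2) hits_I[of "pshift ?T w" "?t - ?T" ?t "dn eps"] T h by auto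
      then have "w ?t - w ?T \<ge> - eps" using T h by (simp add: dn_def pshift_at)
      then show "w \<in> {w\<in>Paths. \<bar>w ?t\<bar> \<ge> eps}" using up_hit(1)[OF w(1) _ w(2)] e w by auto
    qed (use md P in \<open>auto intro: hits_sets\<close>)
    then have "prob (hits (up (2 * eps)) ?t) * (1 - prob (hits (dn eps) ?t)) <= C / real (Suc n)" using C[of n] unfolding c1[OF progressive_dn] by linarith
    moreover have "prob (hits (up (2 * eps)) ?t) * (1 / 2) <= prob (hits (up (2 * eps)) ?t) * (1 - prob (hits (dn eps) ?t))"
      using elim(2) by (intro mult_left_mono) auto
    ultimately have 1: "prob (hits (up (2 * eps)) ?t) <= 2 * (C / real (Suc n))" by linarith
    have "prob (hits (dn (2 * eps)) ?t) * prob (Paths - hits (up eps) ?t) <= prob {w\<in>Paths. \<bar>w ?t\<bar> \<ge> eps}"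
    proof (rule strong_markov_event[OF determined_ev])
      fix w assume a: "w \<in> hits (dn (2 * eps)) ?t" "pshift (hit (dn (2 * eps)) w) w \<in> Paths - hits (up eps) ?t"
      then have w: "w \<in> Paths" "fin (dn (2 * eps)) w" and h: "hit (dn (2 * eps)) w <= ?t" by (auto simp: hits_def)
      let ?T = "hit (dn (2 * eps)) w"
      have T: "0 <= ?T" by (rule hit_ge0[OF w(2)])
      have "\<not> up eps (pshift ?T w) (?t - ?T)" using a(2) hits_I[of "pshift ?T w" "?t - ?T" ?t "up eps"] T h by auto
      then have "w ?t - w ?T <= eps" using T h by (simp add: up_def pshift_at)
      then show "w \<in> {w\<in>Paths. \<bar>w ?t\<bar> \<ge> eps}" using dn_hit(1)[OF w(1) w(2)] e w by auto
    qed (use md P in \<open>auto intro: hits_sets\<close>)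
    then have "prob (hits (dn (2 * eps)) ?t) * (1 - prob (hits (up eps) ?t)) <= C / real (Suc n)" using C[of n] unfolding c1[OF progressive_up] by linarith
    moreover have "prob (hits (dn (2 * eps)) ?t) * (1 / 2) <= prob (hits (dn (2 * eps)) ?t) * (1 - prob (hits (up eps) ?t))"
      using elim(1) by (intro mult_left_mono) auto
    ultimately have 2: "prob (hits (dn (2 * eps)) ?t) <= 2 * (C / real (Suc n))" by linarith
    have "hits (ex (5 * eps)) ?t \<subseteq> hits (up (2 * eps)) ?t \<union> hits (dn (2 * eps)) ?t"
    proof
      fix w assume "w \<in> hits (ex (5 * eps)) ?t"
      then have w: "w \<in> Paths" "fin (ex (5 * eps)) w" and h: "hit (ex (5 * eps)) w <= ?t" by (auto simp: hits_def)
      let ?T = "hit (ex (5 * eps)) w"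
      have T: "0 <= ?T" by (rule hit_ge0[OF w(2)])
      have eq: "w ?T = rinf w ?T + 5 * eps" using ex_hit(1)[OF w(1) _ w(2)] e by simp
      show "w \<in> hits (up (2 * eps)) ?t \<union> hits (dn (2 * eps)) ?t"
      proof (cases "w ?T > 2 * eps")
        case True
        then show ?thesis using hits_I[OF w(1) T h, of "up (2 * eps)"] by (simp add: up_def)
      next
        case False
        then have "rinf w ?T < - (2 * eps)" using eq e by simp
        then obtain s where "s \<in> {0..?T}" "w s < - (2 * eps)" using inf_on_less_iff[OF w(1) T] by blast
        then show ?thesis using hits_I[OF w(1), of s ?t "dn (2 * eps)"] h by (simp add: dn_def)
      qed
    qed
    then have "prob (hits (ex (5 * eps)) ?t) <= prob (hits (up (2 * eps)) ?t \<union> hits (dn (2 * eps)) ?t)"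
      by (intro finite_measure_mono) auto
    also have "... <= prob (hits (up (2 * eps)) ?t) + prob (hits (dn (2 * eps)) ?t)" by (rule measure_Un_le) auto
    also have "... <= 2 * (C / real (Suc n)) + 2 * (C / real (Suc n))" by (rule add_mono[OF 1 2])
    finally show ?case by simp
  qed
  then show ?thesis by blast
qed

text \<open>Submultiplicativity, applied twice, splits the rise into four. The fourth power is what
  \<open>hits_exp_bound\<close> consumes: there it has to outweigh a factor of order n
  cubed.\<close>

lemma hits_ex_bound:
  assumes d: "\<delta> > 0"
  shows "\<exists>C. \<forall>\<^sub>F n in sequentially. prob (hits (ex \<delta>) (1 / real (Suc n))) <= (C / real (Suc n)) ^ 4"
proof -
  obtain C where C: "\<forall>\<^sub>F n in sequentially. prob (hits (ex (\<delta> / 4)) (1 / real (Suc n))) <= C / real (Suc n)"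
    using hits_ex_bound1[of "\<delta> / 20"] d by auto
  then have "\<forall>\<^sub>F n in sequentially. prob (hits (ex \<delta>) (1 / real (Suc n))) <= (C / real (Suc n)) ^ 4"
  proof eventually_elim
    case (elim n)
    let ?t = "1 / real (Suc n)"
    have c0: "0 <= C / real (Suc n)" using elim measure_nonneg order_trans by blast
    have "prob (hits (ex (\<delta> / 2)) ?t) <= prob (hits (ex (\<delta> / 4)) ?t) * prob (hits (ex (\<delta> / 4)) ?t)"
      using hits_ex_submult[of "\<delta> / 4" "\<delta> / 4" ?t] d by simp
    also have "... <= (C / real (Suc n)) * (C / real (Suc n))"
      by (intro mult_mono elim c0) auto
    finally have 1: "prob (hits (ex (\<delta> / 2)) ?t) <= (C / real (Suc n)) * (C / real (Suc n))" .
    have "prob (hits (ex \<delta>) ?t) <= prob (hits (ex (\<delta> / 2)) ?t) * prob (hits (ex (\<delta> / 2)) ?t)"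
      using hits_ex_submult[of "\<delta> / 2" "\<delta> / 2" ?t] d by simp
    also have "... <= ((C / real (Suc n)) * (C / real (Suc n))) * ((C / real (Suc n)) * (C / real (Suc n)))"
      by (intro mult_mono 1 mult_nonneg_nonneg c0) auto
    finally show ?case by (simp add: power4_eq_xxxx mult.assoc)
  qed
  then show ?thesis by blast
qed

end

section \<open>Two-sided exit upwards\<close>

text \<open>After a Markov shift the remaining level depends on the position already reached, so
  hitting times must be measurable jointly in the level and the path.\<close>

lemma hit_param_measurable:
  assumes Q: "!!z. progressive (Q z)" and p: "p \<in> N \<rightarrow>\<^sub>M path_space" and m [measurable]: "!!t. Measurable.pred N (%z. Q z (p z) t)"
  shows "Measurable.pred N (%z. fin (Q z) (p z))" "(%z. hit (Q z) (p z)) \<in> borel_measurable N"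
proof -
  have pP: "p z \<in> Paths" if "z \<in> space N" for z using measurable_space[OF p that] by simp
  have "{z\<in>space N. fin (Q z) (p z)} = {z\<in>space N. \<exists>r::rat. 0 <= real_of_rat r & Q z (p z) (of_rat r)}"
  proof (intro Collect_cong conj_cong refl)
    fix z assume "z \<in> space N"
    then show "fin (Q z) (p z) \<longleftrightarrow> (\<exists>r::rat. 0 <= real_of_rat r & Q z (p z) (of_rat r))"
      using progressive_rat[OF Q pP] unfolding fin_def by (metis less_add_one)
  qed
  also have "... \<in> sets N" by measurable
  finally show f [measurable]: "Measurable.pred N (%z. fin (Q z) (p z))" by (simp add: pred_def)
  show "(%z. hit (Q z) (p z)) \<in> borel_measurable N"
  proof (rule borel_measurableI_less)
    fix c
    have "{z\<in>space N. hit (Q z) (p z) < c} = {z\<in>space N.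
      (\<exists>r::rat. 0 <= real_of_rat r & of_rat r < c & Q z (p z) (of_rat r)) \<or> (\<not> fin (Q z) (p z) & Inf {} < c)}"
    proof (intro Collect_cong conj_cong refl)
      fix z assume z: "z \<in> space N"
      show "hit (Q z) (p z) < c \<longleftrightarrow> (\<exists>r::rat. 0 <= real_of_rat r & of_rat r < c & Q z (p z) (of_rat r)) \<or> (\<not> fin (Q z) (p z) & Inf {} < c)"
      proof (cases "fin (Q z) (p z)")
        case True then show ?thesis using hit_less_iff[OF True, of c] progressive_rat[OF Q pP[OF z], of c] by simp
      next
        case False
        then have "{t. 0 <= t & Q z (p z) t} = {}" by (auto simp: fin_def)
        then show ?thesis using False unfolding hit_def fin_def by (metis (no_types, lifting))
      qed
    qed
    also have "... \<in> sets N" by measurable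
    finally show "{z\<in>space N. hit (Q z) (p z) < c} \<in> sets N" .
  qed
qed

lemma up_param_measurable:
  assumes p: "p \<in> N \<rightarrow>\<^sub>M path_space" and f [measurable]: "f \<in> borel_measurable N"
  shows "Measurable.pred N (%z. fin (up (f z)) (p z))" "(%z. hit (up (f z)) (p z)) \<in> borel_measurable N"
proof -
  have [measurable]: "(%z. p z t) \<in> borel_measurable N" for t using measurable_compose[OF p eval_measurable[of t]] .
  show "Measurable.pred N (%z. fin (up (f z)) (p z))" "(%z. hit (up (f z)) (p z)) \<in> borel_measurable N"
    by (rule hit_param_measurable[OF _ p]; simp add: up_def)+
qed

lemma fin_up_mono: "fin (up b) w ==> c <= b ==> fin (up c) w"
  by (force simp: fin_def up_def)

lemma hit_up_mono: "fin (up b) w ==> c <= b ==> hit (up c) w <= hit (up b) w"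
  by (rule hit_greatest) (auto intro!: hit_le[where Q="up c"] simp: up_def)

lemma up_shift:
  assumes w: "w \<in> Paths" and b: "0 <= b" "0 <= c" and f: "fin (up b) w"
  shows "fin (up (b + c)) w \<longleftrightarrow> fin (up c) (pshift (hit (up b) w) w)"
    "fin (up c) (pshift (hit (up b) w) w) ==> hit (up (b + c)) w = hit (up b) w + hit (up c) (pshift (hit (up b) w) w)"
proof -
  let ?T = "hit (up b) w"
  have T: "0 <= ?T" by (rule hit_ge0[OF f])
  have 1: "\<not> up (b + c) w s" if "0 <= s" "s < ?T" for s using up_hit(2)[OF w b(1) f, of s] that b by (simp add: up_def)
  have 2: "up (b + c) w (?T + s) \<longleftrightarrow> up c (pshift ?T w) s" if "0 <= s" for s
    using up_hit(1)[OF w b(1) f] that T by (auto simp: up_def pshift_at)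
  show "fin (up (b + c)) w \<longleftrightarrow> fin (up c) (pshift ?T w)" "fin (up c) (pshift ?T w) ==> hit (up (b + c)) w = ?T + hit (up c) (pshift ?T w)"
    using hit_shift[of ?T "up (b + c)" w "up c" "pshift ?T w", OF T 1 2] by auto
qed

definition exit_up :: "real => real => (real => real) set" where
  "exit_up x b = {w\<in>Paths. fin (up b) w & - x <= rinf w (hit (up b) w)}"

lemma exit_up_param_measurable:
  assumes p [measurable]: "p \<in> N \<rightarrow>\<^sub>M path_space" and [measurable]: "f \<in> borel_measurable N" "g \<in> borel_measurable N"
  shows "Measurable.pred N (%z. p z \<in> exit_up (g z) (f z))"
proof -
  note up_param_measurable[OF p, measurable]
  have [measurable]: "(%z. rinf (p z) (hit (up (f z)) (p z))) \<in> borel_measurable N"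
    by (rule inf_on_measurable[OF p]) measurable
  have "{z\<in>space N. p z \<in> exit_up (g z) (f z)} = {z\<in>space N. fin (up (f z)) (p z) & - g z <= rinf (p z) (hit (up (f z)) (p z))}"
    using measurable_space[OF p] by (auto simp: exit_up_def)
  also have "... \<in> sets N" by measurable
  finally show ?thesis by (simp add: pred_def)
qed

lemma exit_up_sets [measurable]: "exit_up x b \<in> sets path_space"
proof -
  have "{w\<in>space path_space. w \<in> exit_up x b} \<in> sets path_space"
    using exit_up_param_measurable[of "%w. w" path_space "%_. b" "%_. x"] by (simp add: pred_def)
  then show ?thesis by (simp add: exit_up_def)
qed

lemma determined_exit_up: "determined (exit_up x b) (hit (up b))"
  unfolding exit_up_def
proof (rule determined_hit)
  note hit_measurable[OF progressive_up, measurable]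
  have [measurable]: "(%w. rinf w (hit (up b) w)) \<in> borel_measurable path_space"
    by (rule inf_on_measurable) measurable
  show "Measurable.pred path_space (%w. - x <= rinf w (hit (up b) w))" by measurable
  fix w t assume "w \<in> Paths" "fin (up b) w" "hit (up b) w < t"
  then show "(- x <= rinf (pstop t w) (hit (up b) (pstop t w))) = (- x <= rinf w (hit (up b) w))"
    using hit_stop(2)[of "up b" w t] hit_ge0[of "up b" w] by (simp add: stop_rinf)
qed simp

text \<open>At the passage of b the path is exactly at b, so its distance from the floor is then the
  deterministic number x + b. Overshoot would make this distance random and destroy the product
  formula \<open>hh_mult\<close>.\<close>

lemma exit_up_shift:
  assumes w: "w \<in> Paths" and b: "0 <= b" "0 <= c"
  shows "w \<in> exit_up x (b + c) \<longleftrightarrow> w \<in> exit_up x b & pshift (hit (up b) w) w \<in> exit_up (x + b) c"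
    and "w \<in> exit_up x (b + c) ==> hit (up (b + c)) w = hit (up b) w + hit (up c) (pshift (hit (up b) w) w)"
proof -
  let ?T = "hit (up b) w" and ?v = "pshift (hit (up b) w) w"
  show "w \<in> exit_up x (b + c) \<longleftrightarrow> w \<in> exit_up x b & ?v \<in> exit_up (x + b) c"
  proof (cases "fin (up b) w")
    case True
    note s = up_shift[OF w b True]
    show ?thesis
    proof (cases "fin (up c) ?v")
      case f: True
      have "rinf w (?T + hit (up c) ?v) = min (rinf w ?T) (b + rinf ?v (hit (up c) ?v))"
        using rinf_shift[OF w hit_ge0[OF True] hit_ge0[OF f]] up_hit(1)[OF w b(1) True] by simp
      then show ?thesis using s f True w by (auto simp: exit_up_def)
    qed (use s in \<open>auto simp: exit_up_def\<close>)
  qed (use fin_up_mono[of "b + c" w b] b in \<open>auto simp: exit_up_def\<close>)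
  assume "w \<in> exit_up x (b + c)"
  then show "hit (up (b + c)) w = ?T + hit (up c) ?v"
    using up_shift[OF w b] fin_up_mono[of "b + c" w b] b by (auto simp: exit_up_def)
qed

context levy_law begin

definition hh :: "real => real => real => real" where
  "hh q x b = (\<E> w. indicator (exit_up x b) w * exp (- q * hit (up b) w))"

lemma hit_up_P [measurable]: "hit (up b) \<in> borel_measurable P"
  using hit_measurable[OF progressive_up, of b] by (simp add: measurable_cong_sets[OF sets_P refl])

lemma exit_up_P [measurable]: "exit_up x b \<in> sets P"
  by (simp add: sets_P)

lemma hh_integrand: "0 <= q ==> 0 <= indicator (exit_up x b) w * exp (- q * hit (up b) w) & indicator (exit_up x b) w * exp (- q * hit (up b) w) <= 1"
  using hit_ge0[of "up b" w] by (auto simp: indicator_def exit_up_def)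

lemma hh_integrable: "0 <= q ==> integrable P (%w. indicator (exit_up x b) w * exp (- q * hit (up b) w))"
  using hh_integrand[of q x b] by (intro integrable_const_bound[where B=1]) auto

lemma hh_nn: "0 <= q ==> (\<N> w. indicator (exit_up x b) w * ennreal (exp (- q * hit (up b) w))) = ennreal (hh q x b)"
proof -
  assume q: "0 <= q"
  have "(\<N> w. indicator (exit_up x b) w * ennreal (exp (- q * hit (up b) w))) = (\<N> w. ennreal (indicator (exit_up x b) w * exp (- q * hit (up b) w)))"
    by (intro nn_integral_cong) (auto simp: indicator_def)
  also have "... = ennreal (hh q x b)" unfolding hh_def
    using hh_integrand[OF q] by (intro nn_integral_eq_integral hh_integrable q) auto
  finally show ?thesis .
qed

lemma hh_nonneg: "0 <= q ==> 0 <= hh q x b" and hh_le1: "0 <= q ==> hh q x b <= 1"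
proof -
  assume q: "0 <= q"
  show "0 <= hh q x b" unfolding hh_def using hh_integrand[OF q] by (intro integral_nonneg_AE) auto
  have "hh q x b <= (\<E> w. 1)" unfolding hh_def using hh_integrand[OF q] by (intro integral_mono hh_integrable q) auto
  then show "hh q x b <= 1" using prob_space by simp
qed

lemma hh_mono: assumes "0 <= q" "x <= y" shows "hh q x b <= hh q y b"
  unfolding hh_def by (intro integral_mono hh_integrable assms(1)) (use assms(2) in \<open>auto simp: indicator_def exit_up_def\<close>)

lemma hh_mult: assumes q: "0 <= q" and b: "0 <= b" "0 <= c" shows "hh q x (b + c) = hh q x b * hh q (x + b) c"
proof -
  note hit_measurable[OF progressive_up, measurable]
  have "ennreal (hh q x (b + c)) = (\<N> w. indicator (exit_up x (b + c)) w * ennreal (exp (- q * hit (up (b + c)) w)))"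
    using hh_nn[OF q] by simp
  also have "... = (\<N> w. indicator (exit_up x b) w * (ennreal (exp (- q * hit (up b) w)) *
      (%v. indicator (exit_up (x + b) c) v * ennreal (exp (- q * hit (up c) v))) (pshift (hit (up b) w) w)))"
  proof (intro nn_integral_cong)
    fix w assume "w \<in> space P"
    then have w: "w \<in> Paths" by simp
    show "indicator (exit_up x (b + c)) w * ennreal (exp (- q * hit (up (b + c)) w)) = indicator (exit_up x b) w * (ennreal (exp (- q * hit (up b) w)) *
      (%v. indicator (exit_up (x + b) c) v * ennreal (exp (- q * hit (up c) v))) (pshift (hit (up b) w) w))"
      using exit_up_shift[OF w b, of x] by (auto simp: indicator_def ennreal_mult[symmetric] exp_add[symmetric] algebra_simps)
  qed
  also have "... = (\<N> w. indicator (exit_up x b) w * ennreal (exp (- q * hit (up b) w))) * (\<N> w. indicator (exit_up (x + b) c) w * ennreal (exp (- q * hit (up c) w)))"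
  proof (rule strong_markov_prod[OF determined_exit_up])
    fix w t assume "w \<in> exit_up x b" "hit (up b) w < t"
    then show "ennreal (exp (- q * hit (up b) (pstop t w))) = ennreal (exp (- q * hit (up b) w))"
      using hit_stop(2)[OF progressive_up, of w b t] by (simp add: exit_up_def)
  qed measurable
  also have "... = ennreal (hh q x b * hh q (x + b) c)" using hh_nn[OF q] hh_nonneg[OF q] by (simp add: ennreal_mult)
  finally show ?thesis using hh_nonneg[OF q] by simp
qed

lemma hh_antimono: assumes q: "0 <= q" and b: "0 <= b" "b <= c" shows "hh q x c <= hh q x b"
  using hh_mult[OF q, of b "c - b" x] mult_left_mono[OF hh_le1[OF q, of "x + b" "c - b"] hh_nonneg[OF q, of x b]] b by simp

text \<open>Upward regularity: the Laplace transform of the passage time over level \<open>b\<close> is multiplicative in \<open>b\<close> and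
  not identically zero, hence tends to 1 as \<open>b\<close> tends to 0.\<close>

lemma regular_up: "AE w in P. \<forall>e>0. \<exists>b>0. fin (up b) w & hit (up b) w < e"
proof -
  define A where "A b = {w\<in>Paths. fin (up b) w}" for b
  note fin_measurable[OF progressive_up, measurable] hit_measurable[OF progressive_up, measurable]
  have Am [measurable]: "A b \<in> sets path_space" for b
  proof -
    have "{w\<in>space path_space. fin (up b) w} \<in> sets path_space" by measurable
    then show ?thesis by (simp add: A_def)
  qed
  have det: "determined (A b) (hit (up b))" for b
    using determined_hit[of "up b" "%_. True"] by (simp add: A_def)
  define m where "m b = (\<E> w. indicator (A b) w * exp (- hit (up b) w))" for b
  have int01: "0 <= indicator (A b) w * exp (- hit (up b) w) & indicator (A b) w * exp (- hit (up b) w) <= (1::real)" for b w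
    using hit_ge0[of "up b" w] by (auto simp: indicator_def A_def)
  have int: "integrable P (%w. indicator (A b) w * exp (- hit (up b) w))" for b
    using int01[of b] by (intro integrable_const_bound[where B=1]) auto
  have mnn: "(\<N> w. indicator (A b) w * ennreal (exp (- hit (up b) w))) = ennreal (m b)" for b
  proof -
    have "(\<N> w. indicator (A b) w * ennreal (exp (- hit (up b) w))) = (\<N> w. ennreal (indicator (A b) w * exp (- hit (up b) w)))"
      by (intro nn_integral_cong) (auto simp: indicator_def)
    also have "... = ennreal (m b)" unfolding m_def
      using int01 by (intro nn_integral_eq_integral int) auto
    finally show ?thesis .
  qed
  have m0: "0 <= m b" for b unfolding m_def using int01 by (intro integral_nonneg_AE) auto
  have mmult: "m (b + c) = m b * m c" if b: "0 <= b" "0 <= c" for b c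
  proof -
    have "ennreal (m (b + c)) = (\<N> w. indicator (A (b + c)) w * ennreal (exp (- hit (up (b + c)) w)))"
      using mnn by simp
    also have "... = (\<N> w. indicator (A b) w * (ennreal (exp (- hit (up b) w)) *
        (%v. indicator (A c) v * ennreal (exp (- hit (up c) v))) (pshift (hit (up b) w) w)))"
    proof (intro nn_integral_cong)
      fix w assume "w \<in> space P"
      then have w: "w \<in> Paths" by simp
      show "indicator (A (b + c)) w * ennreal (exp (- hit (up (b + c)) w)) = indicator (A b) w * (ennreal (exp (- hit (up b) w)) *
        (%v. indicator (A c) v * ennreal (exp (- hit (up c) v))) (pshift (hit (up b) w) w))"
        using up_shift[OF w b] fin_up_mono[of "b + c" w b] b w by (auto simp: A_def indicator_def ennreal_mult[symmetric] exp_add[symmetric] algebra_simps)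
    qed
    also have "... = (\<N> w. indicator (A b) w * ennreal (exp (- hit (up b) w))) * (\<N> w. indicator (A c) w * ennreal (exp (- hit (up c) w)))"
    proof (rule strong_markov_prod[OF det])
      fix w t assume "w \<in> A b" "hit (up b) w < t"
      then show "ennreal (exp (- hit (up b) (pstop t w))) = ennreal (exp (- hit (up b) w))"
        using hit_stop(2)[OF progressive_up, of w b t] by (simp add: A_def)
    qed measurable
    also have "... = ennreal (m b * m c)" using mnn m0 by (simp add: ennreal_mult)
    finally show ?thesis using m0 by simp
  qed
  obtain t eps where t: "t > 0" "eps > 0" "prob {w\<in>Paths. w t > eps} > 0" using ex_up_level by blast
  have mpos: "m eps > 0"
  proof -
    have mm: "{w\<in>Paths. w t > eps} \<in> sets P"
    proof -
      have "{w\<in>space P. w t > eps} \<in> sets P" by measurable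
      then show ?thesis by simp
    qed
    have "exp (- t) * prob {w\<in>Paths. w t > eps} = (\<E> w. exp (- t) * indicator {w\<in>Paths. w t > eps} w)"
      using mm sets.sets_into_space[OF mm] by (simp add: Int_absorb2)
    also have "... <= m eps" unfolding m_def
    proof (rule integral_mono)
      show "integrable P (%w. exp (- t) * indicator {w\<in>Paths. w t > eps} w)" using mm by (intro integrable_mult_right) (simp add: emeasure_eq_measure)
      fix w assume "w \<in> space P"
      have "w \<in> A eps & hit (up eps) w <= t" if "w t > eps" using that t \<open>w \<in> space P\<close> hit_le[of t "up eps" w] by (auto simp: A_def fin_def up_def intro!: exI[of _ t])
      then show "exp (- t) * indicator {w\<in>Paths. w t > eps} w <= indicator (A eps) w * exp (- hit (up eps) w)"
        by (auto simp: indicator_def)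
    qed (rule int)
    finally show ?thesis using t(3) by (meson exp_gt_zero less_le_trans mult_pos_pos)
  qed
  define eps' where "eps' n = eps / real (Suc n)" for n
  have m00: "m (real k * b) = m b ^ k" if "0 <= b" "k > 0" for k b
    using that(2)
  proof (induction k)
    case (Suc k)
    show ?case
    proof (cases "k = 0")
      case False
      have "m (real (Suc k) * b) = m (real k * b + b)" by (simp add: algebra_simps)
      then show ?thesis using Suc False mmult[of "real k * b" b] that(1) by simp
    qed simp
  qed simp
  have mlim: "(%n. m (eps' n)) \<longlonglongrightarrow> 1"
  proof -
    have "m (eps' n) = exp (ln (m eps) / real (Suc n))" for n
    proof -
      have "real (Suc n) * eps' n = eps" by (simp add: eps'_def)
      then have "m (eps' n) ^ Suc n = m eps" using m00[of "eps' n" "Suc n"] t(2) by (simp add: eps'_def del: of_nat_Suc power_Suc)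
      also have "... = exp (ln (m eps) / real (Suc n)) ^ Suc n"
        using mpos exp_of_nat_mult[of "Suc n" "ln (m eps) / real (Suc n)"] by simp
      finally show ?thesis by (rule power_eq_imp_eq_base) (use m0 in auto)
    qed
    moreover have "(%n. exp (ln (m eps) / real (Suc n))) \<longlonglongrightarrow> exp 0"
      by (intro tendsto_exp LIMSEQ_Suc[of "%n. ln (m eps) / real n"] lim_const_over_n)
    ultimately show ?thesis by simp
  qed
  have "AE w in P. \<exists>n. fin (up (eps' n)) w & hit (up (eps' n)) w < e" if e: "e > 0" for e
  proof -
    define B where "B = {w\<in>Paths. \<forall>n. \<not> (fin (up (eps' n)) w & hit (up (eps' n)) w < e)}"
    have Bm: "B \<in> sets P"
    proof -
      have "{w\<in>space path_space. \<forall>n. \<not> (fin (up (eps' n)) w & hit (up (eps' n)) w < e)} \<in> sets path_space" by measurable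
      then show ?thesis by (simp add: B_def sets_P)
    qed
    \<comment> \<open>On \<open>B\<close> none of the levels is passed before time e, so the
      integrand is at most \<open>exp (- e)\<close> there. The left-hand sides tend to 1, which
      forces \<open>B\<close> to be a null set.\<close>
    have "m (eps' n) <= 1 - prob B * (1 - exp (- e))" for n
    proof -
      have "m (eps' n) <= (\<E> w. 1 - indicator B w * (1 - exp (- e)))" unfolding m_def
      proof (rule integral_mono)
        show "integrable P (%w. 1 - indicator B w * (1 - exp (- e)))"
          using Bm by (intro Bochner_Integration.integrable_diff integrable_mult_left) (auto simp: emeasure_eq_measure)
        fix w
        show "indicator (A (eps' n)) w * exp (- hit (up (eps' n)) w) <= 1 - indicator B w * (1 - exp (- e))"
          using int01[of "eps' n" w] by (auto simp: indicator_def B_def A_def)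
      qed (rule int)
      also have "... = 1 - prob B * (1 - exp (- e))"
      proof -
        have "integrable P (%w. indicator B w * (1 - exp (- e)))"
          using Bm by (intro integrable_mult_left) (auto simp: emeasure_eq_measure)
        then show ?thesis using Bm sets.sets_into_space[OF Bm] prob_space by (simp add: Int_absorb2)
      qed
      finally show ?thesis .
    qed
    then have "1 <= 1 - prob B * (1 - exp (- e))"
      by (intro LIMSEQ_le_const2[OF mlim]) blast
    then have "prob B <= 0" using e by (simp add: mult_le_0_iff not_le)
    then have "prob B = 0" by (simp add: measure_le_0_iff)
    then show ?thesis using Bm by (intro AE_I'[of B]) (auto simp: B_def emeasure_eq_measure null_sets_def)
  qed
  then have "AE w in P. \<forall>k. \<exists>n. fin (up (eps' n)) w & hit (up (eps' n)) w < 1 / real (Suc k)"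
    unfolding AE_all_countable by (simp del: of_nat_Suc)
  then show ?thesis
  proof (rule AE_mp, intro AE_I2 impI allI)
    fix w and e :: real assume k: "\<forall>k. \<exists>n. fin (up (eps' n)) w & hit (up (eps' n)) w < 1 / real (Suc k)" and "e > 0"
    from reals_Archimedean[OF \<open>e > 0\<close>] obtain j where "1 / real (Suc j) < e" by (auto simp: inverse_eq_divide)
    moreover obtain n where "fin (up (eps' n)) w" "hit (up (eps' n)) w < 1 / real (Suc j)" using k by blast
    moreover have "eps' n > 0" using t by (simp add: eps'_def)
    ultimately show "\<exists>b>0. fin (up b) w & hit (up b) w < e" by (intro exI[of _ "eps' n"]) auto
  qed
qed

text \<open>Right continuity keeps the path within x of 0 for a short time, and by upward regularity
  all sufficiently small levels are passed within it.\<close>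

lemma hh_tendsto_1:
  assumes q: "0 <= q" and x: "0 < x" shows "(%n. hh q x (1 / real (Suc n))) \<longlonglongrightarrow> 1"
proof -
  have "(%n. \<E> w. indicator (exit_up x (1 / real (Suc n))) w * exp (- q * hit (up (1 / real (Suc n))) w)) \<longlonglongrightarrow> (\<E> w. 1)"
  proof (rule integral_dominated_convergence[where w="%_. 1"])
    show "AE w in P. norm (indicator (exit_up x (1 / real (Suc n))) w * exp (- q * hit (up (1 / real (Suc n))) w)) <= 1" for n
      using hh_integrand[OF q, of x "1 / real (Suc n)"] by auto
    show "AE w in P. (%n. indicator (exit_up x (1 / real (Suc n))) w * exp (- q * hit (up (1 / real (Suc n))) w)) \<longlonglongrightarrow> 1"
      using regular_up
    proof (rule AE_mp, intro AE_I2 impI)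
      fix w assume "w \<in> space P" and reg: "\<forall>e>0. \<exists>b>0. fin (up b) w & hit (up b) w < e"
      then have w: "w \<in> Paths" by simp
      obtain d where d: "d > 0" "!!s. 0 <= s ==> s < 0 + d ==> \<bar>w s - w 0\<bar> < x" using Paths_right[OF w x, of 0] by blast
      have hits: "\<forall>\<^sub>F n in sequentially. fin (up (1 / real (Suc n))) w & hit (up (1 / real (Suc n))) w < e" if e0: "e > 0" for e
      proof -
        obtain b where b: "b > 0" "fin (up b) w" "hit (up b) w < e" using reg e0 by blast
        have "(%n. 1 / real (Suc n)) \<longlonglongrightarrow> 0" using LIMSEQ_Suc[OF lim_1_over_n] by simp
        from order_tendstoD(2)[OF this b(1)] show ?thesis
        proof eventually_elim
          case (elim n)
          then have "1 / real (Suc n) <= b" by (rule less_imp_le)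
          then show ?case using fin_up_mono[OF b(2)] hit_up_mono[OF b(2)] b(3) by (meson le_less_trans)
        qed
      qed
      have "\<forall>\<^sub>F n in sequentially. w \<in> exit_up x (1 / real (Suc n))"
        using hits[OF d(1)]
      proof eventually_elim
        case (elim n)
        then have "- x <= rinf w (hit (up (1 / real (Suc n))) w)"
        proof (subst inf_on_ge_iff[OF w], intro hit_ge0, simp, intro ballI)
          fix s assume "s \<in> {0..hit (up (1 / real (Suc n))) w}"
          then have "\<bar>w s - w 0\<bar> < x" using elim by (intro d(2)) auto
          then show "- x <= w s" using Paths_0[OF w, of 0] by simp
        qed
        then show ?case using w elim by (simp add: exit_up_def)
      qed
      then have e1: "\<forall>\<^sub>F n in sequentially. exp (- q * hit (up (1 / real (Suc n))) w) = indicator (exit_up x (1 / real (Suc n))) w * exp (- q * hit (up (1 / real (Suc n))) w)"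
        by eventually_elim simp
      have "(%n. hit (up (1 / real (Suc n))) w) \<longlonglongrightarrow> 0"
      proof (rule LIMSEQ_I)
        fix e :: real assume "e > 0"
        have "\<forall>\<^sub>F n in sequentially. norm (hit (up (1 / real (Suc n))) w - 0) < e"
          using hits[OF \<open>e > 0\<close>] by eventually_elim (use hit_ge0 in force)
        then show "\<exists>no. \<forall>n\<ge>no. norm (hit (up (1 / real (Suc n))) w - 0) < e" by (simp add: eventually_sequentially)
      qed
      then have "(%n. exp (- q * hit (up (1 / real (Suc n))) w)) \<longlonglongrightarrow> exp (- q * 0)" by (intro tendsto_intros)
      then show "(%n. indicator (exit_up x (1 / real (Suc n))) w * exp (- q * hit (up (1 / real (Suc n))) w)) \<longlonglongrightarrow> 1"
        using e1 by (intro Lim_transform_eventually[OF _ e1]) simp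
    qed
  qed measurable
  then show ?thesis using prob_space by (simp add: hh_def)
qed

lemma hh_near_1:
  assumes q: "0 <= q" and x: "0 < x" and e: "e > 0"
  shows "\<exists>d>0. \<forall>b. 0 <= b & b <= d --> 1 - e < hh q x b"
proof -
  obtain n where "1 - e < hh q x (1 / real (Suc n))"
    using order_tendstoD(1)[OF hh_tendsto_1[OF q x], of "1 - e"] e by (auto simp: eventually_sequentially)
  then show ?thesis using hh_antimono[OF q, of _ "1 / real (Suc n)" x] by (intro exI[of _ "1 / real (Suc n)"]) force
qed

lemma hh_zero: assumes q: "0 <= q" and x: "0 <= x" shows "hh q x 0 = 1"
proof -
  have "hh q x 0 = (\<E> w. 1)" unfolding hh_def
  proof (rule integral_cong_AE)
    show "AE w in P. indicator (exit_up x 0) w * exp (- q * hit (up 0) w) = 1"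
      using regular_up
    proof (rule AE_mp, intro AE_I2 impI)
      fix w assume "w \<in> space P" and reg: "\<forall>e>0. \<exists>b>0. fin (up b) w & hit (up b) w < e"
      then have w: "w \<in> Paths" by simp
      have f: "fin (up 0) w" using reg fin_up_mono[of _ w 0] by (meson less_imp_le zero_less_one)
      have "hit (up 0) w < e" if e0: "e > 0" for e
      proof -
        obtain b where "b > 0" "fin (up b) w" "hit (up b) w < e" using reg e0 by blast
        then show ?thesis using hit_up_mono[of b w 0] by auto
      qed
      then have "\<not> hit (up 0) w > 0" by blast
      with hit_ge0[OF f] have "hit (up 0) w = 0" by simp
      then show "indicator (exit_up x 0) w * exp (- q * hit (up 0) w) = 1"
        using f w x Paths_0[OF w, of 0] by (simp add: exit_up_def inf_on_def)
    qed
  qed measurable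
  then show ?thesis using prob_space by simp
qed

text \<open>A small rise has weight above 1 / 2. When such rises are repeated the distance from the
  floor only grows, so every further factor is at least the first one.\<close>

lemma hh_pos: assumes q: "0 <= q" and x: "0 < x" and b: "0 <= b" shows "hh q x b > 0"
proof -
  obtain d where d: "d > 0" "\<forall>b. 0 <= b & b <= d --> 1 - 1/2 < hh q x b" using hh_near_1[OF q x, of "1/2"] by auto
  have pw: "(hh q x d) ^ k <= hh q x (real k * d)" for k
  proof (induction k)
    case 0 then show ?case using hh_zero[OF q] x by simp
  next
    case (Suc k)
    have "hh q x d ^ Suc k = hh q x d ^ k * hh q x d" by simp
    also have "... <= hh q x (real k * d) * hh q (x + real k * d) d"
      using Suc d(1) by (intro mult_mono hh_mono q hh_nonneg) auto
    also have "... = hh q x (real k * d + d)" using hh_mult[OF q, of "real k * d" d x] d(1) by simp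
    finally show ?case by (simp add: algebra_simps)
  qed
  obtain k :: nat where k: "b < real k * d" using reals_Archimedean3[OF d(1)] by blast
  have "hh q x d > 0" using d by (auto dest: spec[of _ d])
  then have "0 < hh q x d ^ k" by simp
  also have "... <= hh q x (real k * d)" by (rule pw)
  also have "... <= hh q x b" using k b by (intro hh_antimono q) auto
  finally show ?thesis .
qed

end

section \<open>The increasing function behind the exit transforms, and its growth\<close>

context levy_law begin

text \<open>Normalised to take the value 1 at 1. The two branches solve
  \<open>W q x = hh q x b * W q (x + b)\<close> with one of the two arguments equal to the reference
  point 1.\<close>

definition W :: "real => real => real" where
  "W q x = (if x < 0 then 0 else if x <= 1 then hh q x (1 - x) else 1 / hh q 1 (x - 1))"

lemma W_neg: "x < 0 ==> W q x = 0" by (simp add: W_def)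

lemma W_hh: assumes q: "0 <= q" and x: "0 <= x" and b: "0 <= b" shows "W q x = hh q x b * W q (x + b)"
proof -
  consider "x + b <= 1" | "x <= 1" "x + b > 1" | "x > 1" by linarith
  then show ?thesis
  proof cases
    case 1
    then show ?thesis using hh_mult[OF q, of b "1 - (x + b)" x] x b by (simp add: W_def)
  next
    case 2
    then show ?thesis using hh_mult[OF q, of "1 - x" "x + b - 1" x] hh_pos[OF q, of 1 "x + b - 1"] x b by (simp add: W_def)
  next
    case 3
    then show ?thesis using hh_mult[OF q, of "x - 1" b 1] hh_pos[OF q, of 1 "x + b - 1"] hh_pos[OF q, of 1 "x - 1"] hh_pos[OF q, of x b] x b
      by (simp add: W_def field_simps)
  qed
qed

lemma W_nonneg: "0 <= q ==> 0 <= W q x" using hh_nonneg[of q] by (auto simp: W_def)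

lemma W_pos: "0 <= q ==> 0 < x ==> 0 < W q x" using hh_pos[of q] by (auto simp: W_def)

lemma W_mono: assumes q: "0 <= q" and "x <= y" shows "W q x <= W q y"
proof (cases "x < 0")
  case False
  then show ?thesis using W_hh[OF q, of x "y - x"] mult_right_mono[OF hh_le1[OF q, of x "y - x"] W_nonneg[OF q, of y]] assms by simp
qed (simp add: W_neg W_nonneg[OF q])

lemma W_measurable [measurable]: "0 <= q ==> W q \<in> borel_measurable borel"
  by (intro borel_measurable_mono monoI W_mono)

lemma hh_ratio: assumes q: "0 <= q" and x: "0 <= x" and b: "0 <= b" "0 < x + b" shows "hh q x b = W q x / W q (x + b)"
  using W_hh[OF q x b(1)] W_pos[OF q b(2)] by (simp add: field_simps)

lemma W_isCont: assumes q: "0 <= q" and x: "0 < x" shows "isCont (W q) x"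
unfolding isCont_def
proof (rule LIM_I)
  fix e :: real assume e: "e > 0"
  define M where "M = W q (x + 1)"
  have M: "M > 0" using W_pos[OF q] x by (simp add: M_def)
  \<comment> \<open>One d, chosen for the distance x / 2 from the floor, serves all starting points
    near x, since \<open>hh\<close> increases with that distance.\<close>
  obtain d where d: "d > 0" "\<forall>b. 0 <= b & b <= d --> 1 - e / (2 * M) < hh q (x / 2) b"
    using hh_near_1[OF q, of "x / 2" "e / (2 * M)"] x e M by auto
  have key: "W q z - W q y < e" if "x / 2 <= y" "y <= z" "z <= x + 1" "z - y <= d" for y z
  proof -
    have "1 - e / (2 * M) < hh q (x / 2) (z - y)" using d(2) that by auto
    also have "... <= hh q y (z - y)" using that by (intro hh_mono q)
    finally have "1 - hh q y (z - y) < e / (2 * M)" by simp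
    then have "(1 - hh q y (z - y)) * W q z <= e / (2 * M) * W q z" using W_nonneg[OF q] by (intro mult_right_mono) auto
    also have "... <= e / (2 * M) * M" using W_mono[OF q, of z "x + 1"] that e M by (intro mult_left_mono) (auto simp: M_def)
    also have "... < e" using M e by simp
    finally show ?thesis using W_hh[OF q, of y "z - y"] that x by (simp add: algebra_simps)
  qed
  show "\<exists>s>0. \<forall>y. y \<noteq> x & norm (y - x) < s --> norm (W q y - W q x) < e"
  proof (intro exI[of _ "min d (min 1 (x / 2))"] conjI allI impI)
    fix y assume y: "y \<noteq> x & norm (y - x) < min d (min 1 (x / 2))"
    have "\<bar>y - x\<bar> < d" "\<bar>y - x\<bar> < 1" "\<bar>y - x\<bar> < x / 2" using y by auto
    then show "norm (W q y - W q x) < e"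
      using key[of x y] key[of y x] W_mono[OF q, of x y] W_mono[OF q, of y x] x by (cases "y <= x") (auto simp: abs_less_iff)
  qed (use d x in auto)
qed

text \<open>\<open>hh q x 1\<close> is the quotient of \<open>W q\<close> at x and x + 1 and
  increases with x, so the supremum is its limit and \<open>growth q\<close> is the exponential rate
  of \<open>W q\<close>. It turns out to be the largest root of \<psi> = q.\<close>

definition growth :: "real => real" where "growth q = - ln (SUP x\<in>{0<..}. hh q x 1)"

lemma hh_bdd: "0 <= q ==> bdd_above ((%x. hh q x 1) ` {0<..})"
  using hh_le1[of q] by (auto intro!: bdd_aboveI2[of _ _ 1])

lemma hh_sup: assumes q: "0 <= q"
  shows "(SUP x\<in>{0<..}. hh q x 1) > 0" "(SUP x\<in>{0<..}. hh q x 1) <= 1" "exp (- growth q) = (SUP x\<in>{0<..}. hh q x 1)"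
proof -
  show 1: "(SUP x\<in>{0<..}. hh q x 1) > 0"
    using less_le_trans[OF hh_pos[OF q, of 1 1] cSUP_upper[OF _ hh_bdd[OF q], of 1]] by auto
  show "(SUP x\<in>{0<..}. hh q x 1) <= 1" using hh_le1[OF q] by (intro cSUP_least) (auto intro!: exI[of _ 1])
  show "exp (- growth q) = (SUP x\<in>{0<..}. hh q x 1)" using 1 by (simp add: growth_def)
qed

lemma growth_nonneg: "0 <= q ==> 0 <= growth q"
  unfolding growth_def using hh_sup(1,2)[of q] by simp

lemma W_growth_upper:
  assumes q: "0 <= q" and c: "c > growth q" shows "\<exists>C>0. \<forall>x. W q x <= C * exp (c * x)"
proof -
  have c0: "0 <= c" using growth_nonneg[OF q] c by simp
  have "exp (- c) < (SUP x\<in>{0<..}. hh q x 1)" using hh_sup(3)[OF q] c by (metis exp_less_cancel_iff neg_less_iff_less)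
  then obtain x0 where x0: "x0 > 0" "exp (- c) < hh q x0 1"
    using less_cSUP_iff[OF _ hh_bdd[OF q]] by (auto intro: exI[of _ 1])
  have step: "W q (x0 + real n) <= W q x0 * exp (c * real n)" for n
  proof (induction n)
    case (Suc n)
    let ?x = "x0 + real n"
    have "exp (- c) <= hh q ?x 1" using x0 hh_mono[OF q, of x0 ?x 1] by simp
    then have "exp (- c) * W q (?x + 1) <= hh q ?x 1 * W q (?x + 1)" using W_nonneg[OF q] by (intro mult_right_mono) auto
    also have "... = W q ?x" using W_hh[OF q, of ?x 1] x0 by simp
    also have "... <= W q x0 * exp (c * real n)" by (rule Suc)
    finally have "exp c * (exp (- c) * W q (?x + 1)) <= exp c * (W q x0 * exp (c * real n))" by (rule mult_left_mono) simp
    then have "W q (?x + 1) <= W q x0 * (exp c * exp (c * real n))" by (simp add: mult.assoc[symmetric] exp_minus) (simp add: algebra_simps)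
    then show ?case by (simp add: exp_add[symmetric] algebra_simps)
  qed simp
  show ?thesis
  proof (intro exI[of _ "W q x0 * exp c"] conjI allI)
    show "0 < W q x0 * exp c" using W_pos[OF q x0(1)] by simp
    fix x show "W q x <= W q x0 * exp c * exp (c * x)"
    proof (cases "x < 0")
      case True then show ?thesis using W_nonneg[OF q, of x0] by (simp add: W_neg)
    next
      case False
      define n where "n = nat \<lceil>x\<rceil>"
      have n: "x <= real n" "real n <= x + 1" using False unfolding n_def by linarith+
      have "W q x <= W q (x0 + real n)" using n x0 by (intro W_mono q) auto
      also have "... <= W q x0 * exp (c * real n)" by (rule step)
      also have "... <= W q x0 * exp (c * (x + 1))" using n c0 W_nonneg[OF q, of x0] by (intro mult_left_mono) (auto intro: mult_left_mono)
      finally show ?thesis by (simp add: exp_add algebra_simps)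
    qed
  qed
qed

text \<open>No quotient exceeds the supremum, so the bound holds at the exact rate, without the
  margin of \<open>W_growth_upper\<close>. It forces the Laplace transform to diverge at
  \<open>growth q\<close>.\<close>

lemma W_growth_lower:
  assumes q: "0 <= q" shows "W q 1 * exp (growth q * real n) <= W q (1 + real n)"
proof (induction n)
  case (Suc n)
  let ?x = "1 + real n"
  have "hh q ?x 1 <= exp (- growth q)" unfolding hh_sup(3)[OF q] by (rule cSUP_upper[OF _ hh_bdd[OF q]]) auto
  then have "hh q ?x 1 * W q (?x + 1) <= exp (- growth q) * W q (?x + 1)" using W_nonneg[OF q] by (intro mult_right_mono) auto
  then have "W q ?x <= exp (- growth q) * W q (?x + 1)" using W_hh[OF q, of ?x 1] by simp
  then have "exp (growth q) * W q ?x <= exp (growth q) * (exp (- growth q) * W q (?x + 1))" by (rule mult_left_mono) simp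
  then have a: "exp (growth q) * W q ?x <= W q (?x + 1)" unfolding mult.assoc[symmetric] exp_add[symmetric] by simp
  have "W q 1 * exp (growth q * real (Suc n)) = exp (growth q) * (W q 1 * exp (growth q * real n))"
    by (simp add: exp_add algebra_simps)
  also have "... <= exp (growth q) * W q ?x" using Suc by (intro mult_left_mono) auto
  finally show ?case using a by (simp add: algebra_simps)
qed simp

section \<open>Harmonicity\<close>

lemma hits_ex_power: "prob (hits (ex (real (Suc n))) t) <= prob (hits (ex 1) t) ^ Suc n"
proof (induction n)
  case (Suc n)
  have "prob (hits (ex (real (Suc n) + 1)) t) <= prob (hits (ex (real (Suc n))) t) * prob (hits (ex 1) t)"
    by (rule hits_ex_submult) auto
  also have "... <= prob (hits (ex 1) t) ^ Suc n * prob (hits (ex 1) t)" using Suc by (intro mult_right_mono) auto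
  finally show ?case by (simp add: algebra_simps)
qed simp

lemma hits_up_ex: "0 <= t ==> hits (up b) t \<subseteq> hits (ex b) t"
proof
  fix w assume t: "0 <= t" and "w \<in> hits (up b) t"
  then have w: "w \<in> Paths" "fin (up b) w" "hit (up b) w <= t" by (auto simp: hits_def)
  have imp: "ex b w s" if "0 <= s" "up b w s" for s using that rinf_le0[OF w(1), of s] by (auto simp: ex_def up_def)
  then have f: "fin (ex b) w" using w(2) by (auto simp: fin_def)
  have "hit (ex b) w <= hit (up b) w" by (rule hit_greatest[OF w(2)]) (rule hit_le[where Q="ex b"], assumption, rule imp)
  then show "w \<in> hits (ex b) t" using w f by (auto simp: hits_def)
qed

lemma exit_up_markov:
  assumes w: "w \<in> Paths" and t: "0 <= t" and le: "\<forall>s\<in>{0..t}. w s <= b"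
  shows "w \<in> exit_up x b \<longleftrightarrow> - x <= rinf w t & pshift t w \<in> exit_up (x + w t) (b - w t)"
    "w \<in> exit_up x b ==> hit (up b) w = t + hit (up (b - w t)) (pshift t w)"
proof -
  have 1: "\<not> up b w s" if "0 <= s" "s < t" for s using bspec[OF le, of s] that by (auto simp: up_def)
  have 2: "up b w (t + s) \<longleftrightarrow> up (b - w t) (pshift t w) s" if "0 <= s" for s
    using that t by (auto simp: up_def pshift_at)
  have h: "fin (up b) w \<longleftrightarrow> fin (up (b - w t)) (pshift t w)"
    "fin (up (b - w t)) (pshift t w) ==> hit (up b) w = t + hit (up (b - w t)) (pshift t w)"
    using hit_shift[of t "up b" w "up (b - w t)" "pshift t w", OF t 1 2] by auto
  show "w \<in> exit_up x b \<longleftrightarrow> - x <= rinf w t & pshift t w \<in> exit_up (x + w t) (b - w t)"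
  proof (cases "fin (up b) w")
    case True
    then have f: "fin (up (b - w t)) (pshift t w)" using h by blast
    have "rinf w (t + hit (up (b - w t)) (pshift t w)) = min (rinf w t) (w t + rinf (pshift t w) (hit (up (b - w t)) (pshift t w)))"
      by (rule rinf_shift[OF w t hit_ge0[OF f]])
    then show ?thesis using True h(2)[OF f] f w by (auto simp: exit_up_def)
  qed (use h in \<open>auto simp: exit_up_def\<close>)
  assume "w \<in> exit_up x b"
  then show "hit (up b) w = t + hit (up (b - w t)) (pshift t w)" using h by (auto simp: exit_up_def)
qed

definition sup_le :: "real => real => (real => real) set" where
  "sup_le t b = {w\<in>Paths. \<forall>s\<in>{0..t}. w s <= b}"

lemma sup_le_mono: "b <= c ==> sup_le t b \<subseteq> sup_le t c"
  by (auto simp: sup_le_def intro: order_trans)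

lemma sup_le_sets [measurable]: assumes t: "0 <= t" shows "sup_le t b \<in> sets path_space"
proof -
  have "sup_le t b = {w\<in>space path_space. w t <= b & (\<forall>r::rat. 0 <= real_of_rat r & of_rat r <= t --> w (of_rat r) <= b)}"
  proof safe
    fix w assume w: "w \<in> space path_space" and 1: "w t <= b" and 2: "\<forall>r::rat. 0 <= real_of_rat r & of_rat r <= t --> w (of_rat r) <= b"
    have "w s <= b" if s: "s \<in> {0..t}" for s
    proof (rule ccontr)
      assume n: "\<not> w s <= b"
      then obtain d where d: "d > 0" "!!r. s <= r ==> r < s + d ==> \<bar>w r - w s\<bar> < w s - b"
        using Paths_right[of w "w s - b" s] w by auto
      have "s < t" using n 1 s by (cases "s = t") auto
      then obtain r where r: "s < of_rat r" "of_rat r < min t (s + d)" using of_rat_dense[of s "min t (s + d)"] d by auto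
      have "0 <= real_of_rat r & of_rat r <= t" using r s by (metis atLeastAtMost_iff less_imp_le min_less_iff_conj order_trans)
      then have "w (of_rat r) <= b" using 2 by blast
      then show False using d(2)[of "of_rat r"] r by auto
    qed
    then show "w \<in> sup_le t b" using w by (auto simp: sup_le_def)
  qed (use t in \<open>auto simp: sup_le_def\<close>)
  also have "... \<in> sets path_space" by measurable
  finally show ?thesis .
qed

lemma rinf_P [measurable]: "(%w. rinf w t) \<in> borel_measurable P"
proof -
  have "(%w. rinf w t) \<in> borel_measurable path_space"
    using inf_on_measurable[of "%w. w" path_space "%_. t"] by simp
  then show ?thesis by (simp add: measurable_cong_sets[OF sets_P refl])
qed

text \<open>The exit transform is split according to whether level b has been exceeded by time t. If
  not, the Markov property at t leaves the exit transform from the new position, and the factor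
  \<open>W q (x + b)\<close> turns it into \<open>W q\<close> at that position.\<close>

lemma W_markov:
  assumes q: "0 <= q" and t: "0 <= t" and x: "0 <= x" "0 <= b"
  shows "ennreal (W q x) = ennreal (W q (x + b)) * (\<N> w. indicator (exit_up x b - sup_le t b) w * ennreal (exp (- q * hit (up b) w))) +
    ennreal (exp (- q * t)) * (\<N> w. indicator (sup_le t b) w * (indicator {w. - x <= rinf w t} w * ennreal (W q (x + w t))))"
proof -
  note [measurable] = sup_le_sets[OF t] W_measurable[OF q]
  have [measurable]: "(%w. rinf w t) \<in> borel_measurable path_space"
    using inf_on_measurable[of "%w. w" path_space "%_. t"] by simp
  note hit_measurable[OF progressive_up, measurable]
  \<comment> \<open>The position at t, and whether level and floor have been respected so far, are
    all of the past that enters the remaining exit problem.\<close>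
  define V where "V w = (w t, if w \<in> sup_le t b & - x <= rinf w t then 1 else 0 :: ennreal)" for w :: "real => real"
  have Vm [measurable]: "V \<in> path_space \<rightarrow>\<^sub>M (borel \<Otimes>\<^sub>M borel)" unfolding V_def by measurable
  define F where "F z = snd (fst z) * (indicator {z. snd z \<in> exit_up (x + fst (fst z)) (b - fst (fst z))} z * ennreal (exp (- q * (t + hit (up (b - fst (fst z))) (snd z)))))"
    for z :: "(real \<times> ennreal) \<times> (real => real)"
  have Fm [measurable]: "F \<in> borel_measurable ((borel \<Otimes>\<^sub>M borel) \<Otimes>\<^sub>M path_space)"
  proof -
    let ?N = "(borel \<Otimes>\<^sub>M borel) \<Otimes>\<^sub>M path_space :: ((real \<times> ennreal) \<times> (real => real)) measure"
    have s: "snd \<in> ?N \<rightarrow>\<^sub>M path_space" by measurable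
    have [measurable]: "(%z. hit (up (b - fst (fst z))) (snd z)) \<in> borel_measurable ?N"
      by (rule up_param_measurable[OF s]) measurable
    have [measurable]: "Measurable.pred ?N (%z. snd z \<in> exit_up (x + fst (fst z)) (b - fst (fst z)))"
      by (rule exit_up_param_measurable[OF s]) measurable
    have "(%z. indicator {z. snd z \<in> exit_up (x + fst (fst z)) (b - fst (fst z))} z :: ennreal) = (%z. if snd z \<in> exit_up (x + fst (fst z)) (b - fst (fst z)) then 1 else 0)"
      by (auto simp: indicator_def)
    then show ?thesis unfolding F_def by simp
  qed
  have FV [measurable]: "(%w. F (V w, pshift t w)) \<in> borel_measurable P"
    by measurable
  have "ennreal (hh q x b) = (\<N> w. indicator (exit_up x b) w * ennreal (exp (- q * hit (up b) w)))" using hh_nn[OF q] by simp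
  also have "... = (\<N> w. indicator (exit_up x b - sup_le t b) w * ennreal (exp (- q * hit (up b) w)) + F (V w, pshift t w))"
  proof (intro nn_integral_cong)
    fix w assume "w \<in> space P"
    then have w: "w \<in> Paths" by simp
    show "indicator (exit_up x b) w * ennreal (exp (- q * hit (up b) w)) = indicator (exit_up x b - sup_le t b) w * ennreal (exp (- q * hit (up b) w)) + F (V w, pshift t w)"
    proof (cases "w \<in> sup_le t b")
      case True
      then have "\<forall>s\<in>{0..t}. w s <= b" by (simp add: sup_le_def)
      note e = exit_up_markov[OF w t this, of x]
      show ?thesis using True e by (cases "w \<in> exit_up x b") (auto simp: F_def V_def)
    qed (simp add: F_def V_def indicator_def)
  qed
  also have "... = (\<N> w. indicator (exit_up x b - sup_le t b) w * ennreal (exp (- q * hit (up b) w))) + (\<N> w. F (V w, pshift t w))"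
    by (rule nn_integral_add) measurable
  also have "(\<N> w. F (V w, pshift t w)) = (\<N> w. \<N> w'. F (V w, w'))"
  proof (rule markov_nn[OF t Vm Fm])
    fix w assume "w \<in> Paths"
    moreover have "pstop t w \<in> sup_le t b \<longleftrightarrow> w \<in> sup_le t b" if "w \<in> Paths" for w
      using that by (auto simp: sup_le_def pstop_at)
    ultimately show "V (pstop t w) = V w" unfolding V_def using t by (simp add: pstop_at stop_rinf)
  qed
  finally have h: "ennreal (hh q x b) = (\<N> w. indicator (exit_up x b - sup_le t b) w * ennreal (exp (- q * hit (up b) w))) + (\<N> w. \<N> w'. F (V w, w'))" .
  have "ennreal (W q (x + b)) * (\<N> w. \<N> w'. F (V w, w')) = (\<N> w. ennreal (W q (x + b)) * (\<N> w'. F (V w, w')))"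
    by (rule nn_integral_cmult[symmetric]) measurable
  also have "... = (\<N> w. ennreal (exp (- q * t)) * (indicator (sup_le t b) w * (indicator {w. - x <= rinf w t} w * ennreal (W q (x + w t)))))"
  proof (intro nn_integral_cong)
    fix w assume "w \<in> space P"
    then have w: "w \<in> Paths" by simp
    show "ennreal (W q (x + b)) * (\<N> w'. F (V w, w')) = ennreal (exp (- q * t)) * (indicator (sup_le t b) w * (indicator {w. - x <= rinf w t} w * ennreal (W q (x + w t))))"
    proof (cases "w \<in> sup_le t b & - x <= rinf w t")
      case True
      then have "(\<N> w'. F (V w, w')) = (\<N> w'. ennreal (exp (- q * t)) * (indicator (exit_up (x + w t) (b - w t)) w' * ennreal (exp (- q * hit (up (b - w t)) w'))))"
        unfolding F_def V_def by (intro nn_integral_cong) (auto simp: indicator_def ennreal_mult[symmetric] exp_add[symmetric] algebra_simps)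
      also have "... = ennreal (exp (- q * t)) * ennreal (hh q (x + w t) (b - w t))"
        using hh_nn[OF q, of "x + w t" "b - w t"] by (subst nn_integral_cmult) simp_all
      finally have "ennreal (W q (x + b)) * (\<N> w'. F (V w, w')) = ennreal (exp (- q * t) * (hh q (x + w t) (b - w t) * W q (x + b)))"
        using W_nonneg[OF q] hh_nonneg[OF q] by (simp add: ennreal_mult[symmetric] mult_ac)
      also have "hh q (x + w t) (b - w t) * W q (x + b) = W q (x + w t)"
      proof -
        have "w t <= b" using True t by (auto simp: sup_le_def)
        moreover have "- x <= w t" using True inf_on_le[OF w, of 0 t t] t by auto
        ultimately show ?thesis using W_hh[OF q, of "x + w t" "b - w t"] by simp
      qed
      finally show ?thesis using True W_nonneg[OF q] by (simp add: ennreal_mult)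
    next
      case False
      then show ?thesis by (auto simp: F_def V_def)
    qed
  qed
  also have "... = ennreal (exp (- q * t)) * (\<N> w. indicator (sup_le t b) w * (indicator {w. - x <= rinf w t} w * ennreal (W q (x + w t))))"
    by (rule nn_integral_cmult) measurable
  finally have 2: "ennreal (W q (x + b)) * (\<N> w. \<N> w'. F (V w, w')) = ennreal (exp (- q * t)) * (\<N> w. indicator (sup_le t b) w * (indicator {w. - x <= rinf w t} w * ennreal (W q (x + w t))))" .
  have "ennreal (W q x) = ennreal (W q (x + b)) * ennreal (hh q x b)"
    using W_hh[OF q x] hh_nonneg[OF q] W_nonneg[OF q] by (simp add: ennreal_mult mult.commute)
  then show ?thesis unfolding h distrib_left 2 .
qed

text \<open>The upper level b in \<open>W_markov\<close> runs to infinity through the positive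
  integers. \<open>W q\<close> grows at most like \<open>exp (c * b)\<close>, while for small t
  level b is exceeded with probability at most \<open>(exp (- c) / 2) ^ b\<close>, so the boundary
  term vanishes. Short times are enough for the expansion at time 0.\<close>

lemma W_harmonic:
  assumes q: "0 <= q"
  shows "\<exists>t0>0. \<forall>t. 0 < t & t <= t0 --> (\<forall>x\<ge>0. (\<N> w. indicator {w. - x <= rinf w t} w * ennreal (W q (x + w t))) = ennreal (exp (q * t) * W q x))"
proof -
  define c where "c = growth q + 1"
  have c: "c > growth q" "c \<ge> 0" using growth_nonneg[OF q] by (auto simp: c_def)
  obtain C where C: "C > 0" "!!x. W q x <= C * exp (c * x)" using W_growth_upper[OF q c(1)] by blast
  have "(%n. prob (hits (ex 1) (1 / real (Suc n)))) \<longlonglongrightarrow> 0" by (rule hits_to_0) (auto intro: ex_pos)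
  then obtain n0 where n0: "prob (hits (ex 1) (1 / real (Suc n0))) < exp (- c) / 2"
    using order_tendstoD(2)[of _ 0 sequentially "exp (- c) / 2"] by (auto simp: eventually_sequentially)
  define t0 where "t0 = 1 / real (Suc n0)"
  show ?thesis
  proof (intro exI[of _ t0] conjI allI impI)
    show "t0 > 0" by (simp add: t0_def)
    fix t x :: real assume t: "0 < t & t <= t0" and x: "0 <= x"
    then have t': "0 <= t" by simp
    note [measurable] = sup_le_sets[OF t'] W_measurable[OF q]
    have p: "prob (hits (ex 1) t) <= exp (- c) / 2"
    proof -
      have "hits (ex 1) t \<subseteq> hits (ex 1) t0" using t by (auto simp: hits_def)
      then have "prob (hits (ex 1) t) <= prob (hits (ex 1) t0)" by (rule finite_measure_mono) simp
      then show ?thesis using n0 by (simp add: t0_def)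
    qed
    define g where "g w = indicator Paths w * (indicator {w. - x <= rinf w t} w * ennreal (W q (x + w t)))" for w
    have [measurable]: "Paths \<in> sets P" using sets.top[of P] by simp
    have gm [measurable]: "g \<in> borel_measurable P" unfolding g_def by measurable
    have g_eq: "g w = indicator {w. - x <= rinf w t} w * ennreal (W q (x + w t))" if "w \<in> space P" for w
      using that by (simp add: g_def)
    define err where "err n = ennreal (W q (x + real (Suc n))) * (\<N> w. indicator (exit_up x (real (Suc n)) - sup_le t (real (Suc n))) w * ennreal (exp (- q * hit (up (real (Suc n))) w)))" for n
    have err_le: "err n <= ennreal (C * exp (c * x) * (1 / 2) ^ Suc n)" for n
    proof -
      let ?b = "real (Suc n)"
      have "(\<N> w. indicator (exit_up x ?b - sup_le t ?b) w * ennreal (exp (- q * hit (up ?b) w))) <= (\<N> w. indicator (hits (ex ?b) t) w)"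
      proof (intro nn_integral_mono)
        fix w assume "w \<in> space P"
        then have w: "w \<in> Paths" by simp
        have "w \<in> hits (ex ?b) t & exp (- q * hit (up ?b) w) <= 1" if a: "w \<in> exit_up x ?b - sup_le t ?b"
        proof -
          obtain s where "s \<in> {0..t}" "w s > ?b" using a w by (auto simp: sup_le_def not_le)
          then have "w \<in> hits (up ?b) t" using hits_I[OF w, of s t "up ?b"] by (auto simp: up_def)
          then show ?thesis using hits_up_ex[OF t', of ?b] a q hit_ge0[of "up ?b" w] by (auto simp: exit_up_def)
        qed
        then show "indicator (exit_up x ?b - sup_le t ?b) w * ennreal (exp (- q * hit (up ?b) w)) <= indicator (hits (ex ?b) t) w"
          by (auto simp: indicator_def ennreal_le_1)
      qed
      also have "... = ennreal (prob (hits (ex ?b) t))" by (simp add: emeasure_eq_measure)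
      also have "... <= ennreal ((exp (- c) / 2) ^ Suc n)"
      proof (intro ennreal_leI)
        have "prob (hits (ex ?b) t) <= prob (hits (ex 1) t) ^ Suc n" by (rule hits_ex_power)
        also have "... <= (exp (- c) / 2) ^ Suc n" using p by (intro power_mono) auto
        finally show "prob (hits (ex ?b) t) <= (exp (- c) / 2) ^ Suc n" .
      qed
      finally have "err n <= ennreal (W q (x + ?b)) * ennreal ((exp (- c) / 2) ^ Suc n)" unfolding err_def by (rule mult_left_mono) simp
      also have "... <= ennreal (C * exp (c * (x + ?b))) * ennreal ((exp (- c) / 2) ^ Suc n)" using C(2) by (intro mult_right_mono ennreal_leI) auto
      also have "... = ennreal (C * exp (c * (x + ?b)) * (exp (- c) / 2) ^ Suc n)" using C(1) by (intro ennreal_mult[symmetric]) auto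
      also have "C * exp (c * (x + ?b)) * (exp (- c) / 2) ^ Suc n = C * exp (c * x) * (1 / 2) ^ Suc n"
      proof -
        have e: "exp (- c) ^ Suc n = exp (?b * - c)" by (rule exp_of_nat_mult[symmetric])
        have h: "(exp (- c) / 2) ^ Suc n = exp (- c) ^ Suc n * (1 / 2) ^ Suc n" by (subst power_mult_distrib[symmetric]) simp
        have "exp (c * (x + b)) * exp (b * - c) = exp (c * x)" for b :: real by (simp add: exp_add[symmetric] algebra_simps)
        then have "C * (exp (c * (x + ?b)) * exp (?b * - c)) * (1 / 2) ^ Suc n = C * exp (c * x) * (1 / 2) ^ Suc n" by (simp only:)
        then show ?thesis by (simp only: h e mult.assoc)
      qed
      finally show ?thesis .
    qed
    have err0: "err \<longlonglongrightarrow> 0"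
    proof (rule tendsto_sandwich[OF _ _ tendsto_const])
      show "\<forall>\<^sub>F n in sequentially. 0 <= err n" by simp
      show "\<forall>\<^sub>F n in sequentially. err n <= ennreal (C * exp (c * x) * (1 / 2) ^ Suc n)" using err_le by simp
      have "(%n. C * exp (c * x) * (1 / 2) ^ Suc n :: real) \<longlonglongrightarrow> C * exp (c * x) * 0"
        by (intro tendsto_mult tendsto_const LIMSEQ_Suc LIMSEQ_power_zero) simp
      then show "(%n. ennreal (C * exp (c * x) * (1 / 2) ^ Suc n)) \<longlonglongrightarrow> 0"
        using tendsto_ennrealI[of "%n. C * exp (c * x) * (1 / 2) ^ Suc n" "C * exp (c * x) * 0"] by (simp only: mult_zero_right ennreal_0)
    qed
    have "(%n. \<N> w. indicator (sup_le t (real (Suc n))) w * g w) \<longlonglongrightarrow> (\<N> w. g w)"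
    proof (rule nn_integral_LIMSEQ)
      show "incseq (%n w. indicator (sup_le t (real (Suc n))) w * g w)"
      proof (rule incseq_SucI, rule le_funI, rule mult_right_mono)
        fix n w
        show "indicator (sup_le t (real (Suc n))) w <= (indicator (sup_le t (real (Suc (Suc n)))) w :: ennreal)"
          using subsetD[OF sup_le_mono[of "real (Suc n)" "real (Suc (Suc n))" t], of w] by (auto simp: indicator_def)
      qed simp
      fix w
      show "(%n. indicator (sup_le t (real (Suc n))) w * g w) \<longlonglongrightarrow> g w"
      proof (cases "w \<in> Paths")
      case w: True
      obtain B where B: "\<forall>s\<in>{0..t}. w s <= B" using Paths_bdd_above[OF w] by blast
      obtain N :: nat where N: "B < real N" using reals_Archimedean2 by blast
      show ?thesis
      proof (rule tendsto_eventually, unfold eventually_sequentially, intro exI[of _ N] allI impI)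
        fix n assume "N <= n"
        then have "w \<in> sup_le t (real (Suc n))" using subsetD[OF sup_le_mono[of B "real (Suc n)" t], of w] B N w by (simp add: sup_le_def)
        then show "indicator (sup_le t (real (Suc n))) w * g w = g w" by simp
      qed
      qed (simp add: g_def)
    qed measurable
    then have "(%n. err n + ennreal (exp (- q * t)) * (\<N> w. indicator (sup_le t (real (Suc n))) w * g w)) \<longlonglongrightarrow> 0 + ennreal (exp (- q * t)) * (\<N> w. g w)"
      by (intro tendsto_add err0 ennreal_tendsto_cmult) auto
    moreover have "err n + ennreal (exp (- q * t)) * (\<N> w. indicator (sup_le t (real (Suc n))) w * g w) = ennreal (W q x)" for n
    proof -
      have *: "(\<N> w. indicator (sup_le t (real (Suc n))) w * g w) = (\<N> w. indicator (sup_le t (real (Suc n))) w * (indicator {w. - x <= rinf w t} w * ennreal (W q (x + w t))))"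
        by (intro nn_integral_cong) (simp only: g_eq)
      show ?thesis unfolding err_def * by (rule W_markov[OF q t' x, symmetric]) simp
    qed
    ultimately have "ennreal (W q x) = ennreal (exp (- q * t)) * (\<N> w. g w)" by (simp add: LIMSEQ_const_iff)
    then have "ennreal (exp (q * t)) * ennreal (W q x) = (ennreal (exp (q * t)) * ennreal (exp (- q * t))) * (\<N> w. g w)" by (simp add: mult.assoc)
    also have "ennreal (exp (q * t)) * ennreal (exp (- q * t)) = 1" by (simp add: ennreal_mult[symmetric] exp_minus)
    finally have *: "ennreal (exp (q * t)) * ennreal (W q x) = (\<N> w. g w)" by simp
    show "(\<N> w. indicator {w. - x <= rinf w t} w * ennreal (W q (x + w t))) = ennreal (exp (q * t) * W q x)"
    proof -
      have "(\<N> w. indicator {w. - x <= rinf w t} w * ennreal (W q (x + w t))) = (\<N> w. g w)"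
        by (intro nn_integral_cong) (simp only: g_eq)
      then show ?thesis using * W_nonneg[OF q] by (simp add: ennreal_mult)
    qed
  qed
qed

end

section \<open>Uniqueness of Laplace transforms\<close>

text \<open>Under y = exp (- x) the transforms at c + n become the moments of a signed measure on
  [0, 1]. By Weierstrass approximation every continuous function of y integrates to 0, then every
  half-line has measure 0, and the positive and negative parts have equal densities.\<close>

lemma laplace_zero_imp_AE_zero:
  fixes f :: "real => real"
  assumes f [measurable]: "f \<in> borel_measurable borel" and f0: "!!x. x < 0 ==> f x = 0"
    and int: "integrable lborel (%x. exp (- c * x) * f x)"
    and zero: "!!n::nat. (\<integral>x. exp (- (c + real n) * x) * f x \<partial>lborel) = 0"
  shows "AE x in lborel. f x = 0"
proof -
  define F where "F x = exp (- c * x) * f x" for x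
  have Fm [measurable]: "F \<in> borel_measurable borel" unfolding F_def by measurable
  have F0: "F x = 0" if "x < 0" for x using f0 that by (simp add: F_def)
  have Fi: "integrable lborel F" using int unfolding F_def[abs_def] .
  have bd: "integrable lborel (%x. F x * h x)" if "h \<in> borel_measurable borel" "!!x. 0 <= x ==> \<bar>h x\<bar> <= K" for h K
  proof (rule Bochner_Integration.integrable_bound[of _ "%x. K * F x"])
    show "AE x in lborel. norm (F x * h x) <= norm (K * F x)"
    proof (intro AE_I2)
      fix x show "norm (F x * h x) <= norm (K * F x)"
      proof (cases "x < 0")
        case False
        then have "\<bar>h x\<bar> <= \<bar>K\<bar>" using that(2)[of x] by simp
        then show ?thesis using mult_right_mono[of "\<bar>h x\<bar>" "\<bar>K\<bar>" "\<bar>F x\<bar>"] by (simp add: abs_mult mult.commute)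
      qed (simp add: F0)
    qed
  qed (use Fi that in auto)
  have pow: "(\<integral>x. F x * exp (- x) ^ n \<partial>lborel) = 0" for n
  proof -
    have "F x * exp (- x) ^ n = exp (- (c + real n) * x) * f x" for x
      unfolding F_def exp_of_nat_mult[symmetric] by (simp add: exp_add[symmetric] algebra_simps)
    then show ?thesis using zero[of n] by simp
  qed
  have e01: "exp (- x) \<in> {0..1}" if "0 <= x" for x :: real using that by simp
  have poly: "(\<integral>x. F x * p (exp (- x)) \<partial>lborel) = 0" if p: "real_polynomial_function p" for p
  proof -
    obtain a n where p: "p = (%x. \<Sum>i\<le>n. a i * x ^ i)" using p by (auto simp: real_polynomial_function_iff_sum)
    have i1: "integrable lborel (%x. F x * exp (- x) ^ i)" for i
    proof (rule bd[where K=1])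
      fix x :: real assume "0 <= x"
      then show "\<bar>exp (- x) ^ i\<bar> <= 1" using e01[of x] by (simp add: power_le_one power_abs)
    qed measurable
    have "(\<integral>x. F x * p (exp (- x)) \<partial>lborel) = (\<integral>x. (\<Sum>i\<le>n. a i * (F x * exp (- x) ^ i)) \<partial>lborel)"
      unfolding p by (simp add: sum_distrib_left mult_ac)
    also have "... = (\<Sum>i\<le>n. a i * (\<integral>x. F x * exp (- x) ^ i \<partial>lborel))"
      using i1 by (subst Bochner_Integration.integral_sum) auto
    finally show ?thesis by (simp add: pow)
  qed
  have cont: "(\<integral>x. F x * h (exp (- x)) \<partial>lborel) = 0" if h: "continuous_on UNIV h" "!!y. \<bar>h y\<bar> <= 1" for h :: "real => real"
  proof -
    have hm [measurable]: "h \<in> borel_measurable borel" using h(1) by (rule borel_measurable_continuous_onI)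
    define K where "K = (\<integral>x. \<bar>F x\<bar> \<partial>lborel)"
    have K0: "0 <= K" unfolding K_def by simp
    have "\<bar>\<integral>x. F x * h (exp (- x)) \<partial>lborel\<bar> <= e" if e: "e > 0" for e
    proof -
      have "e / (K + 1) > 0" using e K0 by simp
      moreover have "continuous_on {0..1} h" by (rule continuous_on_subset[OF h(1)]) simp
      ultimately have "\<exists>p. real_polynomial_function p & (\<forall>y\<in>{0..1}. \<bar>h y - p y\<bar> < e / (K + 1))"
        by (rule_tac Stone_Weierstrass_real_polynomial_function[OF compact_Icc, of 0 1 h "e / (K + 1)"]) (assumption, assumption, blast)
      then obtain p where p: "real_polynomial_function p" "\<forall>y\<in>{0..1}. \<bar>h y - p y\<bar> < e / (K + 1)" by blast
      obtain a n where p': "p = (%x. \<Sum>i\<le>n. a i * x ^ i)" using p(1) by (auto simp: real_polynomial_function_iff_sum)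
      have pm [measurable]: "p \<in> borel_measurable borel" unfolding p' by measurable
      have ih: "integrable lborel (%x. F x * h (exp (- x)))" by (rule bd[where K=1]) (use h(2) in auto)
      have ip: "integrable lborel (%x. F x * p (exp (- x)))"
      proof (rule bd[where K="1 + e / (K + 1)"])
        fix x :: real assume "0 <= x"
        then have "\<bar>h (exp (- x)) - p (exp (- x))\<bar> < e / (K + 1)" using p(2) e01 by blast
        then show "\<bar>p (exp (- x))\<bar> <= 1 + e / (K + 1)" using h(2)[of "exp (- x)"] by linarith
      qed measurable
      have "(\<integral>x. F x * h (exp (- x)) \<partial>lborel) = (\<integral>x. F x * h (exp (- x)) \<partial>lborel) - (\<integral>x. F x * p (exp (- x)) \<partial>lborel)"
        using poly[OF p(1)] by simp
      also have "... = (\<integral>x. F x * h (exp (- x)) - F x * p (exp (- x)) \<partial>lborel)" by (rule Bochner_Integration.integral_diff[symmetric, OF ih ip])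
      finally have "\<bar>\<integral>x. F x * h (exp (- x)) \<partial>lborel\<bar> = \<bar>\<integral>x. F x * h (exp (- x)) - F x * p (exp (- x)) \<partial>lborel\<bar>" by simp
      also have "... <= (\<integral>x. \<bar>F x * h (exp (- x)) - F x * p (exp (- x))\<bar> \<partial>lborel)" by (rule integral_abs_bound)
      also have "... <= (\<integral>x. e / (K + 1) * \<bar>F x\<bar> \<partial>lborel)"
      proof (rule integral_mono)
        fix x
        show "\<bar>F x * h (exp (- x)) - F x * p (exp (- x))\<bar> <= e / (K + 1) * \<bar>F x\<bar>"
        proof (cases "x < 0")
          case False
          then have "\<bar>h (exp (- x)) - p (exp (- x))\<bar> <= e / (K + 1)" using p(2) e01[of x] by (auto simp: less_imp_le)
          then have "\<bar>F x\<bar> * \<bar>h (exp (- x)) - p (exp (- x))\<bar> <= \<bar>F x\<bar> * (e / (K + 1))" by (rule mult_left_mono) simp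
          then show ?thesis by (simp add: abs_mult[symmetric] right_diff_distrib mult.commute)
        qed (simp add: F0)
      qed (use ih ip Fi in auto)
      also have "... = e / (K + 1) * K" by (simp add: K_def)
      also have "... <= e" using e K0 by (simp add: field_simps)
      finally show ?thesis .
    qed
    then have "\<bar>\<integral>x. F x * h (exp (- x)) \<partial>lborel\<bar> <= 0" by (rule_tac field_le_epsilon) simp
    then show ?thesis by simp
  qed
  have tail: "(\<integral>x. F x * indicator {z<..} x \<partial>lborel) = 0" for z
  proof (rule LIMSEQ_unique)
    \<comment> \<open>Continuous functions of y = exp (- x) that increase to the indicator of the
      half-line to the right of z.\<close>
    define h where "h k y = min 1 (max 0 (real k * (exp (- z) - y)))" for k :: nat and y
    show "(%k. \<integral>x. F x * h k (exp (- x)) \<partial>lborel) \<longlonglongrightarrow> (\<integral>x. F x * indicator {z<..} x \<partial>lborel)"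
    proof (rule integral_dominated_convergence[where w="%x. \<bar>F x\<bar>"])
      show "AE x in lborel. (%k. F x * h k (exp (- x))) \<longlonglongrightarrow> F x * indicator {z<..} x"
      proof (intro AE_I2 tendsto_mult tendsto_const)
        fix x
        show "(%k. h k (exp (- x))) \<longlonglongrightarrow> indicator {z<..} x"
        proof (cases "z < x")
          case True
          then have d: "exp (- z) - exp (- x) > 0" by simp
          obtain N where N: "1 < real N * (exp (- z) - exp (- x))" using reals_Archimedean3[OF d] by blast
          show ?thesis
          proof (rule tendsto_eventually, unfold eventually_sequentially, intro exI[of _ N] allI impI)
            fix k assume "N <= k"
            then have "real N * (exp (- z) - exp (- x)) <= real k * (exp (- z) - exp (- x))" using d by (intro mult_right_mono) auto
            then have "1 <= real k * (exp (- z) - exp (- x))" using N by linarith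
            then have "max 0 (real k * (exp (- z) - exp (- x))) = real k * (exp (- z) - exp (- x))" "1 <= real k * (exp (- z) - exp (- x))" by linarith+
            then show "h k (exp (- x)) = indicator {z<..} x" using True unfolding h_def by (simp only: min_absorb1) simp
          qed
        next
          case False
          then have "real k * (exp (- z) - exp (- x)) <= 0" for k :: nat by (intro mult_nonneg_nonpos) auto
          then show ?thesis using False unfolding h_def by (simp add: max_absorb1)
        qed
      qed
      show "AE x in lborel. norm (F x * h k (exp (- x))) <= \<bar>F x\<bar>" for k
        by (intro AE_I2) (auto simp: h_def abs_mult mult_left_le)
    qed (use Fi in \<open>auto simp: h_def\<close>)
    have "(\<integral>x. F x * h k (exp (- x)) \<partial>lborel) = 0" for k
      unfolding h_def by (rule cont) (auto intro!: continuous_intros)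
    then show "(%k. \<integral>x. F x * h k (exp (- x)) \<partial>lborel) \<longlonglongrightarrow> 0" by simp
  qed
  have nn: "(\<integral>\<^sup>+x. ennreal (F x) * indicator {z<..} x \<partial>lborel) = (\<integral>\<^sup>+x. ennreal (- F x) * indicator {z<..} x \<partial>lborel)" for z
  proof -
    have i: "integrable lborel (%x. F x * indicator {z<..} x)" by (rule bd[where K=1]) (auto simp: indicator_def)
    have p: "(\<integral>\<^sup>+x. ennreal (F x) * indicator {z<..} x \<partial>lborel) = (\<integral>\<^sup>+x. ennreal (F x * indicator {z<..} x) \<partial>lborel)"
      "(\<integral>\<^sup>+x. ennreal (- F x) * indicator {z<..} x \<partial>lborel) = (\<integral>\<^sup>+x. ennreal (- (F x * indicator {z<..} x)) \<partial>lborel)"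
      by (intro nn_integral_cong; auto simp: indicator_def)+
    have "enn2real (\<integral>\<^sup>+x. ennreal (F x * indicator {z<..} x) \<partial>lborel) = enn2real (\<integral>\<^sup>+x. ennreal (- (F x * indicator {z<..} x)) \<partial>lborel)"
      using real_lebesgue_integral_def[OF i] tail[of z] by simp
    moreover have "(\<integral>\<^sup>+x. ennreal (F x * indicator {z<..} x) \<partial>lborel) \<noteq> \<infinity>" "(\<integral>\<^sup>+x. ennreal (- (F x * indicator {z<..} x)) \<partial>lborel) \<noteq> \<infinity>"
      using i by (auto simp: real_integrable_def)
    moreover have "a = b" if "enn2real a = enn2real b" "a \<noteq> \<infinity>" "b \<noteq> \<infinity>" for a b :: ennreal
      using that by (cases a; cases b) auto
    ultimately show ?thesis unfolding p by (simp only: not_False_eq_True)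
  qed
  have "density lborel (%x. ennreal (F x)) = density lborel (%x. ennreal (- F x))"
  proof (rule measure_eqI_lessThan)
    fix z
    show "emeasure (density lborel (%x. ennreal (F x))) {z<..} = emeasure (density lborel (%x. ennreal (- F x))) {z<..}"
      using nn[of z] by (simp add: emeasure_density)
    have "(\<integral>\<^sup>+x. ennreal (F x) * indicator {z<..} x \<partial>lborel) <= (\<integral>\<^sup>+x. ennreal (F x) \<partial>lborel)"
      by (intro nn_integral_mono) (auto simp: indicator_def)
    also have "... < \<infinity>" using Fi by (auto simp: real_integrable_def less_top)
    finally show "emeasure (density lborel (%x. ennreal (F x))) {z<..} < \<infinity>" by (simp add: emeasure_density)
  qed auto
  then have "AE x in lborel. ennreal (F x) = ennreal (- F x)"
    by (subst (asm) sigma_finite_measure.density_unique_iff[OF sigma_finite_lborel]) auto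
  then show ?thesis
  proof (rule AE_mp, intro AE_I2 impI)
    fix x assume e: "ennreal (F x) = ennreal (- F x)"
    have "F x = 0"
    proof (rule ccontr)
      assume "F x \<noteq> 0"
      then consider "F x > 0" | "F x < 0" by linarith
      then show False
      proof cases
        case 1 then show ?thesis using e by (simp add: ennreal_neg)
      next
        case 2 then show ?thesis using e by (simp add: ennreal_neg)
      qed
    qed
    then show "f x = 0" by (simp add: F_def)
  qed
qed

lemma tendsto_exp_scaled: "(%n. real (Suc n) * (exp (a / real (Suc n)) - 1)) \<longlonglongrightarrow> a" for a :: real
proof (cases "a = 0")
  case False
  have l: "((%z::real. (exp z - 1) / z) \<longlongrightarrow> 1) (at 0)" using lim_exp_minus_1 .
  have "(%n. a / real (Suc n)) \<longlonglongrightarrow> 0" by (rule LIMSEQ_Suc[OF lim_const_over_n])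
  then have "filterlim (%n. a / real (Suc n)) (at 0) sequentially"
    using False by (simp add: filterlim_at)
  from filterlim_compose[OF l this] have "(%n. (exp (a / real (Suc n)) - 1) / (a / real (Suc n))) \<longlonglongrightarrow> 1" .
  then have "(%n. a * ((exp (a / real (Suc n)) - 1) / (a / real (Suc n)))) \<longlonglongrightarrow> a * 1" by (intro tendsto_mult tendsto_const)
  moreover have "a * ((exp (a / k) - 1) / (a / k)) = k * (exp (a / k) - 1)" if "k > 0" for k using False that by simp
  ultimately show ?thesis by (simp del: of_nat_Suc)
qed simp

section \<open>Laplace transforms of functions of the killed process\<close>

lemma nn_integral_translate:
  fixes f :: "real => ennreal"
  assumes "f \<in> borel_measurable borel"
  shows "(\<integral>\<^sup>+x. f (x + y) \<partial>lborel) = (\<integral>\<^sup>+x. f x \<partial>lborel)"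
  using nn_integral_real_affine[OF assms, of 1 y] by (simp add: add.commute)

lemma nn_integral_exp_tail:
  fixes a :: real
  assumes a: "a > 0" shows "(\<integral>\<^sup>+x. ennreal (exp (- a * x)) * indicator {0..} x \<partial>lborel) = ennreal (1 / a)"
proof -
  have "(\<integral>\<^sup>+x. ennreal (exp (- a * x)) * indicator {0..} x \<partial>lborel) = ennreal (0 - (- exp (- a * 0) / a))"
  proof (rule nn_integral_FTC_atLeast)
    show "((%x. - exp (- a * x) / a) has_real_derivative exp (- a * x)) (at x)" for x
      using a by (auto intro!: derivative_eq_intros simp: field_simps)
    have "((%x. exp (- a * x)) \<longlongrightarrow> 0) at_top"
      by (rule filterlim_compose[OF exp_at_bot], rule filterlim_tendsto_neg_mult_at_bot[OF tendsto_const _ filterlim_ident]) (use a in simp)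
    then have "((%x. - exp (- a * x) / a) \<longlongrightarrow> - 0 / a) at_top"
      by (rule tendsto_divide[OF tendsto_minus tendsto_const]) (use a in simp)
    then show "((%x. - exp (- a * x) / a) \<longlongrightarrow> 0) at_top" by simp
  qed auto
  then show ?thesis by simp
qed

lemma integral_exp_tail:
  fixes a :: real
  assumes a: "a > 0"
  shows "integrable lborel (%x. exp (- a * x) * indicator {0..} x)" "(\<integral>x. exp (- a * x) * indicator {0..} x \<partial>lborel) = 1 / a"
proof -
  have "(\<integral>\<^sup>+x. ennreal (exp (- a * x) * indicator {0..} x) \<partial>lborel) = (\<integral>\<^sup>+x. ennreal (exp (- a * x)) * indicator {0..} x \<partial>lborel)"
    by (intro nn_integral_cong) (auto simp: indicator_def)
  then have nn: "(\<integral>\<^sup>+x. ennreal (exp (- a * x) * indicator {0..} x) \<partial>lborel) = ennreal (1 / a)" using nn_integral_exp_tail[OF a] by simp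
  show i: "integrable lborel (%x. exp (- a * x) * indicator {0..} x)" by (rule integrableI_nonneg) (use nn in auto)
  show "(\<integral>x. exp (- a * x) * indicator {0..} x \<partial>lborel) = 1 / a" using nn_integral_eq_integral[OF i] nn a by (simp add: integral_nonneg_AE)
qed

text \<open>Applied both to \<open>W q\<close> and to the defect of the transform at downward
  passage. That g vanishes on negative arguments represents killing below the floor at 0.\<close>

locale levy_laplace = levy_law P for P +
  fixes g :: "real => real" and c C :: real
  assumes g_meas [measurable]: "g \<in> borel_measurable borel" and g_nonneg: "!!x. 0 <= g x"
    and g_neg: "!!x. x < 0 ==> g x = 0" and g_growth: "!!x. 0 <= x ==> g x <= C * exp (c * x)" and c0: "0 <= c"
begin

definition lap :: "real => real" where "lap th = (\<integral>x. exp (- th * x) * g x \<partial>lborel)"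
definition part :: "real => real => real" where "part th y = (\<integral>x. exp (- th * x) * g x * indicator {..<y} x \<partial>lborel)"

lemma C0: "0 <= C" using g_growth[of 0] g_nonneg[of 0] by simp

lemma lap_integrable: assumes th: "th > c" shows "integrable lborel (%x. exp (- th * x) * g x)"
proof (rule integrableI_nonneg)
  have "(\<integral>\<^sup>+x. ennreal (exp (- th * x) * g x) \<partial>lborel) <= (\<integral>\<^sup>+x. ennreal C * (ennreal (exp (- (th - c) * x)) * indicator {0..} x) \<partial>lborel)"
  proof (rule nn_integral_mono)
    fix x
    show "ennreal (exp (- th * x) * g x) <= ennreal C * (ennreal (exp (- (th - c) * x)) * indicator {0..} x)"
    proof (cases "x < 0")
      case False
      have "exp (- th * x) * g x <= exp (- th * x) * (C * exp (c * x))" using False by (intro mult_left_mono g_growth) auto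
      also have "... = C * exp (- (th - c) * x)" by (simp add: exp_add[symmetric] algebra_simps)
      finally show ?thesis using False C0 by (simp add: ennreal_mult[symmetric] ennreal_leI)
    qed (simp add: g_neg)
  qed
  also have "... = ennreal C * (\<integral>\<^sup>+x. ennreal (exp (- (th - c) * x)) * indicator {0..} x \<partial>lborel)"
    by (rule nn_integral_cmult) simp
  also have "(\<integral>\<^sup>+x. ennreal (exp (- (th - c) * x)) * indicator {0..} x \<partial>lborel) = ennreal (1 / (th - c))"
    by (rule nn_integral_exp_tail) (use th in simp)
  also have "ennreal C * ennreal (1 / (th - c)) < \<infinity>" by (simp add: ennreal_mult_less_top)
  finally show "(\<integral>\<^sup>+x. ennreal (exp (- th * x) * g x) \<partial>lborel) < \<infinity>" .
qed (use g_nonneg in auto)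

lemma lap_nn: "th > c ==> (\<integral>\<^sup>+x. ennreal (exp (- th * x) * g x) \<partial>lborel) = ennreal (lap th)"
  unfolding lap_def using g_nonneg by (intro nn_integral_eq_integral lap_integrable) auto

lemma part_integrable: "th > c ==> integrable lborel (%x. exp (- th * x) * g x * indicator {..<y} x)"
  by (intro integrable_real_mult_indicator lap_integrable) auto

lemma part_nn: "th > c ==> (\<integral>\<^sup>+x. ennreal (exp (- th * x) * g x) * indicator {..<y} x \<partial>lborel) = ennreal (part th y)"
proof -
  assume th: "th > c"
  have "(\<integral>\<^sup>+x. ennreal (exp (- th * x) * g x) * indicator {..<y} x \<partial>lborel) = (\<integral>\<^sup>+x. ennreal (exp (- th * x) * g x * indicator {..<y} x) \<partial>lborel)"
    by (intro nn_integral_cong) (auto simp: indicator_def)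
  also have "... = ennreal (part th y)" unfolding part_def using g_nonneg by (intro nn_integral_eq_integral part_integrable th) auto
  finally show ?thesis .
qed

lemma part_nonneg: "0 <= part th y" unfolding part_def using g_nonneg by (intro integral_nonneg_AE) auto

lemma part_mono: "th > c ==> y <= z ==> part th y <= part th z"
  unfolding part_def using g_nonneg by (intro integral_mono part_integrable) (auto simp: indicator_def)

lemma part_le_lap: "th > c ==> part th y <= lap th"
  unfolding part_def lap_def using g_nonneg by (intro integral_mono part_integrable lap_integrable) (auto simp: indicator_def)

lemma lap_nonneg: "0 <= lap th" unfolding lap_def using g_nonneg by (intro integral_nonneg_AE) auto

lemma part_theta_mono: assumes "th > c" "th <= th'" shows "part th' y <= part th y"
  unfolding part_def
proof (rule integral_mono)
  fix x
  show "exp (- th' * x) * g x * indicator {..<y} x <= exp (- th * x) * g x * indicator {..<y} x"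
    using assms(2) g_nonneg[of x] by (cases "x < 0") (auto simp: g_neg intro!: mult_right_mono)
  show "integrable lborel (%x. exp (- th * x) * g x * indicator {..<y} x)" by (rule part_integrable) (use assms in simp)
  show "integrable lborel (%x. exp (- th' * x) * g x * indicator {..<y} x)" by (rule part_integrable) (use assms in simp)
qed

lemma part_theta_le: assumes "th > c" "th <= th'" "y <= \<delta>" shows "part th y <= exp ((th' - th) * \<delta>) * part th' y"
proof -
  have "part th y <= (\<integral>x. exp ((th' - th) * \<delta>) * (exp (- th' * x) * g x * indicator {..<y} x) \<partial>lborel)"
    unfolding part_def
  proof (rule integral_mono)
    fix x
    show "exp (- th * x) * g x * indicator {..<y} x <= exp ((th' - th) * \<delta>) * (exp (- th' * x) * g x * indicator {..<y} x)"
    proof (cases "0 <= x & x < y")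
      case True
      then have "(th' - th) * x <= (th' - th) * \<delta>" using assms by (intro mult_left_mono) auto
      then have "exp (- th * x) <= exp ((th' - th) * \<delta>) * exp (- th' * x)" unfolding exp_add[symmetric] by (simp add: algebra_simps)
      then have "exp (- th * x) * g x <= exp ((th' - th) * \<delta>) * exp (- th' * x) * g x" using g_nonneg by (intro mult_right_mono) auto
      then show ?thesis using True by (simp add: mult.assoc)
    qed (auto simp: g_neg)
    show "integrable lborel (%x. exp (- th * x) * g x * indicator {..<y} x)" by (rule part_integrable) (use assms in simp)
    show "integrable lborel (%x. exp ((th' - th) * \<delta>) * (exp (- th' * x) * g x * indicator {..<y} x))"
      by (rule integrable_mult_right, rule part_integrable) (use assms in simp)
  qed
  then show ?thesis by (simp add: part_def)
qed

lemma part_tendsto_0: assumes th: "th > c" shows "(%n. part th (1 / real (Suc n))) \<longlonglongrightarrow> 0"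
proof -
  have "(%n. \<integral>x. exp (- th * x) * g x * indicator {..<1 / real (Suc n)} x \<partial>lborel) \<longlonglongrightarrow> (\<integral>x. exp (- th * x) * g x * indicator {0} x \<partial>lborel)"
  proof (rule integral_dominated_convergence[where w="%x. exp (- th * x) * g x"])
    show "AE x in lborel. norm (exp (- th * x) * g x * indicator {..<1 / real (Suc n)} x) <= exp (- th * x) * g x" for n
      using g_nonneg by (auto simp: indicator_def)
    show "AE x in lborel. (%n. exp (- th * x) * g x * indicator {..<1 / real (Suc n)} x) \<longlonglongrightarrow> exp (- th * x) * g x * indicator {0} x"
    proof (intro AE_I2)
      fix x :: real
      consider "x < 0" | "x = 0" | "x > 0" by linarith
      then show "(%n. exp (- th * x) * g x * indicator {..<1 / real (Suc n)} x) \<longlonglongrightarrow> exp (- th * x) * g x * indicator {0} x"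
      proof cases
        case 3
        from order_tendstoD(2)[OF LIMSEQ_Suc[OF lim_1_over_n] 3]
        have "\<forall>\<^sub>F n in sequentially. exp (- th * x) * g x * indicator {..<1 / real (Suc n)} x = exp (- th * x) * g x * indicator {0} x"
          by eventually_elim (use 3 in auto)
        then show ?thesis by (rule tendsto_eventually)
      qed (auto simp: g_neg)
    qed
  qed (use lap_integrable[OF th] in auto)
  moreover have "(\<integral>x. exp (- th * x) * g x * indicator {0} x \<partial>lborel) = 0"
  proof -
    have "AE x in lborel. exp (- th * x) * g x * indicator {0} x = 0"
      using AE_lborel_singleton[of 0] by eventually_elim simp
    then show ?thesis by (rule integral_eq_zero_AE)
  qed
  ultimately show ?thesis by (simp add: part_def)
qed

lemma part_measurable [measurable]: "th > c ==> part th \<in> borel_measurable borel"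
  by (intro borel_measurable_mono monoI part_mono)

text \<open>Substitute z = x + w t. Without killing the integral would be the product of
  \<open>mgf\<close> and \<open>lap\<close>. The starting points x that are killed, those with -x
  above the infimum, correspond to z < w t - rinf w t and make up the term with
  \<open>part\<close>.\<close>

lemma laplace_identity:
  assumes th: "th > c" and t: "0 <= t"
  shows "(\<integral>\<^sup>+x. ennreal (exp (- th * x)) * (\<N> w. indicator {w. - x <= rinf w t} w * ennreal (g (x + w t))) \<partial>lborel)
    + (\<N> w. ennreal (exp (th * w t) * part th (w t - rinf w t))) = ennreal (mgf th t) * ennreal (lap th)"
proof -
  have th0: "0 <= th" using th c0 by simp
  interpret L: pair_sigma_finite lborel P by unfold_locales
  have rm [measurable]: "(%z. rinf (snd z) t) \<in> borel_measurable (lborel \<Otimes>\<^sub>M P)" "(%z. snd z t) \<in> borel_measurable (lborel \<Otimes>\<^sub>M P)"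
    using measurable_compose[OF measurable_snd rinf_P[of t], of lborel] measurable_compose[OF measurable_snd, of "%w. w t" P borel lborel] by auto
  have ind: "indicator {w. - x <= rinf w t} w = (if - x <= rinf w t then 1 else 0 :: ennreal)" for x w by (simp add: indicator_def)
  have "(\<integral>\<^sup>+x. ennreal (exp (- th * x)) * (\<N> w. indicator {w. - x <= rinf w t} w * ennreal (g (x + w t))) \<partial>lborel) =
    (\<integral>\<^sup>+x. (\<N> w. ennreal (exp (- th * x)) * (indicator {w. - x <= rinf w t} w * ennreal (g (x + w t)))) \<partial>lborel)"
    by (intro nn_integral_cong, rule nn_integral_cmult[symmetric]) measurable
  also have "... = (\<N> w. \<integral>\<^sup>+x. ennreal (exp (- th * x)) * (indicator {w. - x <= rinf w t} w * ennreal (g (x + w t))) \<partial>lborel)"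
    unfolding ind by (rule L.Fubini'[symmetric]) (simp add: case_prod_beta')
  finally have E1: "(\<integral>\<^sup>+x. ennreal (exp (- th * x)) * (\<N> w. indicator {w. - x <= rinf w t} w * ennreal (g (x + w t))) \<partial>lborel) =
    (\<N> w. \<integral>\<^sup>+x. ennreal (exp (- th * x)) * (indicator {w. - x <= rinf w t} w * ennreal (g (x + w t))) \<partial>lborel)" .
  have "(\<N> w. \<integral>\<^sup>+x. ennreal (exp (- th * x)) * (indicator {w. - x <= rinf w t} w * ennreal (g (x + w t))) \<partial>lborel) + (\<N> w. ennreal (exp (th * w t) * part th (w t - rinf w t))) =
     (\<N> w. (\<integral>\<^sup>+x. ennreal (exp (- th * x)) * (indicator {w. - x <= rinf w t} w * ennreal (g (x + w t))) \<partial>lborel) + ennreal (exp (th * w t) * part th (w t - rinf w t)))"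
  proof (rule nn_integral_add[symmetric])
    show "(%w. \<integral>\<^sup>+x. ennreal (exp (- th * x)) * (indicator {w. - x <= rinf w t} w * ennreal (g (x + w t))) \<partial>lborel) \<in> borel_measurable P"
      unfolding ind
      by (rule lborel.borel_measurable_nn_integral) measurable
  qed (use part_measurable[OF th] in measurable)
  also have "... = (\<N> w. ennreal (exp (th * w t)) * ennreal (lap th))"
  proof (intro nn_integral_cong)
    fix w :: "real => real"
    define y where "y = w t"
    define i where "i = rinf w t"
    have e: "exp (- th * x) * g (x + y) = exp (th * y) * (exp (- th * (x + y)) * g (x + y))" for x
    proof -
      have "exp (th * y) * exp (- th * (x + y)) = exp (- th * x)" by (subst exp_add[symmetric]) (simp add: algebra_simps)
      then show ?thesis by (simp only: mult.assoc[symmetric])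
    qed
    have tr: "(\<integral>\<^sup>+x. ennreal (exp (- th * (x + y)) * g (x + y)) * indicator {..<y - i} (x + y) \<partial>lborel) = (\<integral>\<^sup>+x. ennreal (exp (- th * x) * g x) * indicator {..<y - i} x \<partial>lborel)"
      by (rule nn_integral_translate[of "%x. ennreal (exp (- th * x) * g x) * indicator {..<y - i} x"]) simp
    have "ennreal (exp (th * y)) * ennreal (part th (y - i)) = ennreal (exp (th * y)) * (\<integral>\<^sup>+x. ennreal (exp (- th * x) * g x) * indicator {..<y - i} x \<partial>lborel)"
      by (simp only: part_nn[OF th])
    also have "... = ennreal (exp (th * y)) * (\<integral>\<^sup>+x. ennreal (exp (- th * (x + y)) * g (x + y)) * indicator {..<y - i} (x + y) \<partial>lborel)"
      by (simp only: tr)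
    also have "... = (\<integral>\<^sup>+x. ennreal (exp (th * y)) * (ennreal (exp (- th * (x + y)) * g (x + y)) * indicator {..<y - i} (x + y)) \<partial>lborel)"
      by (rule nn_integral_cmult[symmetric]) simp
    finally have a: "ennreal (exp (th * y)) * ennreal (part th (y - i)) = (\<integral>\<^sup>+x. ennreal (exp (th * y)) * (ennreal (exp (- th * (x + y)) * g (x + y)) * indicator {..<y - i} (x + y)) \<partial>lborel)" .
    have "(\<integral>\<^sup>+x. ennreal (exp (- th * x)) * (indicator {w. - x <= rinf w t} w * ennreal (g (x + y))) \<partial>lborel) + ennreal (exp (th * y)) * ennreal (part th (y - i))
      = (\<integral>\<^sup>+x. ennreal (exp (- th * x)) * (indicator {- i..} x * ennreal (g (x + y))) + ennreal (exp (th * y)) * (ennreal (exp (- th * (x + y)) * g (x + y)) * indicator {..<y - i} (x + y)) \<partial>lborel)"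
    proof -
      have "(\<integral>\<^sup>+x. ennreal (exp (- th * x)) * (indicator {w. - x <= rinf w t} w * ennreal (g (x + y))) \<partial>lborel) = (\<integral>\<^sup>+x. ennreal (exp (- th * x)) * (indicator {- i..} x * ennreal (g (x + y))) \<partial>lborel)"
        by (intro nn_integral_cong) (auto simp: i_def indicator_def)
      then show ?thesis unfolding a by (simp only:) (rule nn_integral_add[symmetric], simp_all)
    qed
    also have "... = (\<integral>\<^sup>+x. ennreal (exp (th * y)) * ennreal (exp (- th * (x + y)) * g (x + y)) \<partial>lborel)"
    proof (intro nn_integral_cong)
      fix x
      have "ennreal (exp (- th * x)) * ennreal (g (x + y)) = ennreal (exp (th * y)) * ennreal (exp (- th * (x + y)) * g (x + y))"
        using e[of x] g_nonneg by (simp add: ennreal_mult[symmetric])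
      then show "ennreal (exp (- th * x)) * (indicator {- i..} x * ennreal (g (x + y))) + ennreal (exp (th * y)) * (ennreal (exp (- th * (x + y)) * g (x + y)) * indicator {..<y - i} (x + y)) =
        ennreal (exp (th * y)) * ennreal (exp (- th * (x + y)) * g (x + y))"
        by (cases "- i <= x") (auto simp: indicator_def)
    qed
    also have "... = ennreal (exp (th * y)) * (\<integral>\<^sup>+x. ennreal (exp (- th * (x + y)) * g (x + y)) \<partial>lborel)"
      by (rule nn_integral_cmult) simp
    also have "(\<integral>\<^sup>+x. ennreal (exp (- th * (x + y)) * g (x + y)) \<partial>lborel) = ennreal (lap th)"
      by (subst nn_integral_translate[of "%x. ennreal (exp (- th * x) * g x)" y]) (simp, rule lap_nn[OF th])
    finally show "(\<integral>\<^sup>+x. ennreal (exp (- th * x)) * (indicator {w. - x <= rinf w t} w * ennreal (g (x + w t))) \<partial>lborel) + ennreal (exp (th * w t) * part th (w t - rinf w t)) = ennreal (exp (th * w t)) * ennreal (lap th)"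
      using part_nonneg by (simp add: ennreal_mult y_def i_def)
  qed
  also have "... = ennreal (mgf th t) * ennreal (lap th)"
    using mgf_nn[OF th0 t] by (subst nn_integral_multc) auto
  finally show ?thesis unfolding E1 .
qed

text \<open>The weighted mass removed by killing during a time 1 / (n + 1), per unit of
  time.\<close>

definition rem :: "real => nat => real" where "rem th n = real (Suc n) * (\<E> w. exp (th * w (1 / real (Suc n))) * part th (w (1 / real (Suc n)) - rinf w (1 / real (Suc n))))"

lemma rem_integrable:
  assumes th: "th > c" and t: "0 <= t"
  shows "integrable P (%w. exp (th * w t) * part th (w t - rinf w t))"
proof (rule Bochner_Integration.integrable_bound[of _ "%w. lap th * exp (th * w t)"])
  show "integrable P (%w. lap th * exp (th * w t))" using th c0 t by (intro integrable_mult_right exp_integrable) auto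
  show "(%w. exp (th * w t) * part th (w t - rinf w t)) \<in> borel_measurable P" using part_measurable[OF th] by measurable
  show "AE w in P. norm (exp (th * w t) * part th (w t - rinf w t)) <= norm (lap th * exp (th * w t))"
    using part_nonneg part_le_lap[OF th] lap_nonneg by (auto simp: abs_mult mult.commute intro!: mult_right_mono)
qed

text \<open>With N = n + 1 and E the exponential, the inequality 2 E <= E^2 / N^2 + N^2 trades E for
  a second moment with weight 1 / N^2 and a probability with weight N^2. The fourth-power bound on
  that probability leaves order 1 / N after the prefactor N.\<close>

lemma hits_exp_bound:
  assumes th: "0 <= th" and d: "\<delta> > 0"
  shows "(%n. real (Suc n) * (\<E> w. exp (th * w (1 / real (Suc n))) * indicator (hits (ex \<delta>) (1 / real (Suc n))) w)) \<longlonglongrightarrow> 0"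
proof -
  obtain K where K: "\<forall>\<^sub>F n in sequentially. prob (hits (ex \<delta>) (1 / real (Suc n))) <= (K / real (Suc n)) ^ 4" using hits_ex_bound[OF d] by blast
  define b where "b n = exp \<bar>\<psi> (2 * th)\<bar> / real (Suc n) + K ^ 4 / real (Suc n)" for n
  have le: "\<forall>\<^sub>F n in sequentially. real (Suc n) * (\<E> w. exp (th * w (1 / real (Suc n))) * indicator (hits (ex \<delta>) (1 / real (Suc n))) w) <= b n"
    using K
  proof eventually_elim
    case (elim n)
    define N where "N = real (Suc n)"
    have N: "N \<ge> 1" by (simp add: N_def)
    let ?A = "hits (ex \<delta>) (1 / N)"
    have A: "?A \<in> sets P" by simp
    have ii: "integrable P (%w. exp ((2 * th) * w (1 / N)))" using th N by (intro exp_integrable) auto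
    have jj: "integrable P (indicator ?A :: _ => real)" using A by (simp add: emeasure_eq_measure)
    have "(\<E> w. exp (th * w (1 / N)) * indicator ?A w) <= (\<E> w. (1 / N ^ 2) * exp ((2 * th) * w (1 / N)) + N ^ 2 * indicator ?A w)"
    proof (rule integral_mono)
      show "integrable P (%w. exp (th * w (1 / N)) * indicator ?A w)"
        using th N A by (intro integrable_real_mult_indicator exp_integrable) auto
      show "integrable P (%w. (1 / N ^ 2) * exp ((2 * th) * w (1 / N)) + N ^ 2 * indicator ?A w)"
        using ii jj by (intro Bochner_Integration.integrable_add integrable_mult_right) auto
      fix w
      define E where "E = exp (th * w (1 / N))"
      have E2: "exp ((2 * th) * w (1 / N)) = E ^ 2" unfolding E_def by (simp add: exp_double[symmetric] mult.assoc)
      have "0 <= (E / N - N) ^ 2" by simp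
      also have "... = E ^ 2 / N ^ 2 - 2 * E + N ^ 2" using N by (simp add: power2_eq_square field_simps)
      finally have "E <= E ^ 2 / N ^ 2 + N ^ 2" using exp_gt_zero[of "th * w (1 / N)"] unfolding E_def by (simp, smt (verit))
      then show "E * indicator ?A w <= (1 / N ^ 2) * exp ((2 * th) * w (1 / N)) + N ^ 2 * indicator ?A w"
        unfolding E2 by (auto simp: indicator_def)
    qed
    also have "... = (1 / N ^ 2) * mgf (2 * th) (1 / N) + N ^ 2 * prob ?A"
      using ii jj A sets.sets_into_space[OF A] by (subst Bochner_Integration.integral_add) (auto simp: mgf_def Int_absorb2)
    also have "mgf (2 * th) (1 / N) <= exp \<bar>\<psi> (2 * th)\<bar>"
    proof -
      have "\<psi> (2 * th) / N <= \<bar>\<psi> (2 * th)\<bar>" using N by (simp add: divide_le_eq) (smt (verit) mult_le_cancel_left1)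
      then show ?thesis using th N by (subst mgf_exp) auto
    qed
    also have "N ^ 2 * prob ?A <= N ^ 2 * (K / N) ^ 4" using elim by (intro mult_left_mono) (auto simp: N_def)
    finally have "(\<E> w. exp (th * w (1 / N)) * indicator ?A w) <= (1 / N ^ 2) * exp \<bar>\<psi> (2 * th)\<bar> + N ^ 2 * (K / N) ^ 4"
      using N by (simp add: mult_left_mono divide_right_mono)
    then have "N * (\<E> w. exp (th * w (1 / N)) * indicator ?A w) <= N * ((1 / N ^ 2) * exp \<bar>\<psi> (2 * th)\<bar> + N ^ 2 * (K / N) ^ 4)"
      using N by (intro mult_left_mono) auto
    also have "... = exp \<bar>\<psi> (2 * th)\<bar> / N + K ^ 4 / N" using N by (simp add: field_simps power2_eq_square power4_eq_xxxx)
    finally show ?case by (simp only: b_def N_def)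
  qed
  have "b \<longlonglongrightarrow> 0 + 0" unfolding b_def by (intro tendsto_add LIMSEQ_Suc[OF lim_const_over_n])
  then have b0: "b \<longlonglongrightarrow> 0" by simp
  show ?thesis
    by (rule tendsto_sandwich[OF _ le tendsto_const b0]) (auto intro!: always_eventually mult_nonneg_nonneg integral_nonneg_AE)
qed

text \<open>While the position is at most eps the weights for th and th' differ by a factor close to
  1 in this direction, and \<open>part\<close> decreases in th. Larger positions require a reflected
  rise of eps.\<close>

lemma rem_le1:
  assumes th: "th > c" "th <= th'" and e: "eps > 0"
  shows "rem th' n <= exp ((th' - th) * eps) * rem th n + lap th' * (real (Suc n) * (\<E> w. exp (th' * w (1 / real (Suc n))) * indicator (hits (ex eps) (1 / real (Suc n))) w))"
proof -
  let ?t = "1 / real (Suc n)"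
  have t: "0 <= ?t" by simp
  have th': "th' > c" "0 <= th'" using th c0 by auto
  have i1: "integrable P (%w. exp (th' * w ?t) * indicator (hits (ex eps) ?t) w)" using th' by (intro integrable_real_mult_indicator exp_integrable) auto
  have "(\<E> w. exp (th' * w ?t) * part th' (w ?t - rinf w ?t)) <=
    (\<E> w. exp ((th' - th) * eps) * (exp (th * w ?t) * part th (w ?t - rinf w ?t)) + lap th' * (exp (th' * w ?t) * indicator (hits (ex eps) ?t) w))"
  proof (rule integral_mono)
    show "integrable P (%w. exp (th' * w ?t) * part th' (w ?t - rinf w ?t))" by (rule rem_integrable[OF th'(1) t])
    show "integrable P (%w. exp ((th' - th) * eps) * (exp (th * w ?t) * part th (w ?t - rinf w ?t)) + lap th' * (exp (th' * w ?t) * indicator (hits (ex eps) ?t) w))"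
      by (intro Bochner_Integration.integrable_add integrable_mult_right rem_integrable[OF th(1) t] i1)
    fix w assume "w \<in> space P"
    then have w: "w \<in> Paths" by simp
    define y where "y = w ?t"
    define Y where "Y = w ?t - rinf w ?t"
    have yY: "y <= Y" using rinf_le0[OF w t] by (simp add: y_def Y_def)
    have "exp (th' * y) * part th' Y <= exp ((th' - th) * eps) * (exp (th * y) * part th Y) + lap th' * (exp (th' * y) * indicator (hits (ex eps) ?t) w)"
    proof (cases "y <= eps")
      case True
      then have "(th' - th) * y <= (th' - th) * eps" using th by (intro mult_left_mono) auto
      then have "exp (th' * y) <= exp ((th' - th) * eps) * exp (th * y)" unfolding exp_add[symmetric] by (simp add: algebra_simps)
      then have "exp (th' * y) * part th' Y <= (exp ((th' - th) * eps) * exp (th * y)) * part th Y"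
        using part_theta_mono[OF th] part_nonneg by (intro mult_mono) auto
      moreover have "0 <= lap th' * (exp (th' * y) * indicator (hits (ex eps) ?t) w)" using lap_nonneg by (simp add: indicator_def)
      ultimately show ?thesis by (simp only: mult.assoc)
    next
      case False
      then have "ex eps w ?t" using yY by (simp add: ex_def Y_def)
      then have "w \<in> hits (ex eps) ?t" by (rule hits_I[of w ?t ?t "ex eps", OF w t order_refl])
      then have one: "indicator (hits (ex eps) ?t) w = (1::real)" by simp
      moreover have "exp (th' * y) * part th' Y <= lap th' * exp (th' * y)" using part_le_lap[OF th'(1), of Y] by (subst mult.commute) (intro mult_right_mono, auto)
      moreover have "0 <= exp ((th' - th) * eps) * (exp (th * y) * part th Y)" using part_nonneg by simp
      ultimately show ?thesis unfolding one mult_1_right by linarith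
    qed
    then show "exp (th' * w ?t) * part th' (w ?t - rinf w ?t) <= exp ((th' - th) * eps) * (exp (th * w ?t) * part th (w ?t - rinf w ?t)) + lap th' * (exp (th' * w ?t) * indicator (hits (ex eps) ?t) w)"
      by (simp only: y_def Y_def)
  qed
  also have "... = exp ((th' - th) * eps) * (\<E> w. exp (th * w ?t) * part th (w ?t - rinf w ?t)) + lap th' * (\<E> w. exp (th' * w ?t) * indicator (hits (ex eps) ?t) w)"
    by (subst Bochner_Integration.integral_add, rule integrable_mult_right, rule rem_integrable[OF th(1) t], rule integrable_mult_right, rule i1)
       (simp only: integral_mult_right_zero)
  finally have "real (Suc n) * (\<E> w. exp (th' * w ?t) * part th' (w ?t - rinf w ?t)) <= real (Suc n) * (exp ((th' - th) * eps) * (\<E> w. exp (th * w ?t) * part th (w ?t - rinf w ?t)) + lap th' * (\<E> w. exp (th' * w ?t) * indicator (hits (ex eps) ?t) w))"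
    by (rule mult_left_mono) simp
  then show ?thesis unfolding rem_def by (simp only: distrib_left mult.left_commute)
qed

text \<open>In this direction a very negative position, after a downward jump, makes the weight for
  th' too small for comparison. Such an event has probability of order 1 / n and not smaller order
  in general, but on it the small factor \<open>part th \<delta>\<close> remains.\<close>

lemma rem_le2:
  assumes th: "th > c" "th <= th'" and e: "eps > 0" and d: "\<delta> > 0"
  shows "rem th n <= exp ((th' - th) * (\<delta> + eps)) * rem th' n + part th \<delta> * (real (Suc n) * prob {w\<in>Paths. \<bar>w (1 / real (Suc n))\<bar> \<ge> eps})
    + lap th * (real (Suc n) * (\<E> w. exp (th * w (1 / real (Suc n))) * indicator (hits (ex \<delta>) (1 / real (Suc n))) w))"
proof -
  let ?t = "1 / real (Suc n)" and ?D = "{w\<in>Paths. \<bar>w (1 / real (Suc n))\<bar> \<ge> eps}"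
  have t: "0 <= ?t" by simp
  have th': "th' > c" "0 <= th'" "0 <= th" using th c0 by auto
  have D: "?D \<in> sets P"
  proof -
    have "{w\<in>space P. \<bar>w ?t\<bar> \<ge> eps} \<in> sets P" by measurable
    then show ?thesis by simp
  qed
  have i1: "integrable P (%w. exp (th * w ?t) * indicator (hits (ex \<delta>) ?t) w)" using th' by (intro integrable_real_mult_indicator exp_integrable) auto
  have i2: "integrable P (indicator ?D :: _ => real)" using D by (simp add: emeasure_eq_measure)
  have "(\<E> w. exp (th * w ?t) * part th (w ?t - rinf w ?t)) <=
    (\<E> w. exp ((th' - th) * (\<delta> + eps)) * (exp (th' * w ?t) * part th' (w ?t - rinf w ?t)) + part th \<delta> * indicator ?D w + lap th * (exp (th * w ?t) * indicator (hits (ex \<delta>) ?t) w))"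
  proof (rule integral_mono)
    show "integrable P (%w. exp (th * w ?t) * part th (w ?t - rinf w ?t))" by (rule rem_integrable[OF th(1) t])
    show "integrable P (%w. exp ((th' - th) * (\<delta> + eps)) * (exp (th' * w ?t) * part th' (w ?t - rinf w ?t)) + part th \<delta> * indicator ?D w + lap th * (exp (th * w ?t) * indicator (hits (ex \<delta>) ?t) w))"
      by (intro Bochner_Integration.integrable_add integrable_mult_right rem_integrable[OF th'(1) t] i1 i2)
    fix w assume "w \<in> space P"
    then have w: "w \<in> Paths" by simp
    define y where "y = w ?t"
    define Y where "Y = w ?t - rinf w ?t"
    have p1: "0 <= exp ((th' - th) * (\<delta> + eps)) * (exp (th' * y) * part th' Y)" using part_nonneg by simp
    have p2: "0 <= part th \<delta> * indicator ?D w" using part_nonneg by (simp add: indicator_def)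
    have p3: "0 <= lap th * (exp (th * y) * indicator (hits (ex \<delta>) ?t) w)" using lap_nonneg by (simp add: indicator_def)
    have "exp (th * y) * part th Y <= exp ((th' - th) * (\<delta> + eps)) * (exp (th' * y) * part th' Y) + part th \<delta> * indicator ?D w + lap th * (exp (th * y) * indicator (hits (ex \<delta>) ?t) w)"
    proof (cases "Y <= \<delta>")
      case Y: True
      show ?thesis
      proof (cases "y < - eps")
        case True
        then have "w \<in> ?D" using w by (simp add: y_def)
        moreover have "exp (th * y) * part th Y <= 1 * part th \<delta>"
          using True e th' part_mono[OF th(1) Y] part_nonneg by (intro mult_mono) (auto simp: mult_nonneg_nonpos)
        ultimately show ?thesis using p1 p3 by (simp only: indicator_simps mult_1_left mult_1_right)
      next
        case False
        then have "(th' - th) * (- y) <= (th' - th) * eps" using th by (intro mult_left_mono) auto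
        then have "exp (th * y) <= exp ((th' - th) * eps) * exp (th' * y)" unfolding exp_add[symmetric] by (simp add: algebra_simps)
        then have "exp (th * y) * part th Y <= (exp ((th' - th) * eps) * exp (th' * y)) * (exp ((th' - th) * \<delta>) * part th' Y)"
          using part_theta_le[OF th Y] part_nonneg by (intro mult_mono) auto
        also have "... = exp ((th' - th) * (\<delta> + eps)) * (exp (th' * y) * part th' Y)" by (simp add: distrib_left exp_add mult_ac)
        finally show ?thesis using p2 p3 by linarith
      qed
    next
      case False
      then have "ex \<delta> w ?t" by (simp add: ex_def Y_def)
      then have "w \<in> hits (ex \<delta>) ?t" by (rule hits_I[of w ?t ?t "ex \<delta>", OF w t order_refl])
      then have one: "indicator (hits (ex \<delta>) ?t) w = (1::real)" by simp
      moreover have "exp (th * y) * part th Y <= lap th * exp (th * y)" using part_le_lap[OF th(1), of Y] by (subst mult.commute) (intro mult_right_mono, auto)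
      ultimately show ?thesis using p1 p2 unfolding one mult_1_right by linarith
    qed
    then show "exp (th * w ?t) * part th (w ?t - rinf w ?t) <= exp ((th' - th) * (\<delta> + eps)) * (exp (th' * w ?t) * part th' (w ?t - rinf w ?t)) + part th \<delta> * indicator ?D w + lap th * (exp (th * w ?t) * indicator (hits (ex \<delta>) ?t) w)"
      by (simp only: y_def Y_def)
  qed
  also have "... = exp ((th' - th) * (\<delta> + eps)) * (\<E> w. exp (th' * w ?t) * part th' (w ?t - rinf w ?t)) + part th \<delta> * prob ?D + lap th * (\<E> w. exp (th * w ?t) * indicator (hits (ex \<delta>) ?t) w)"
  proof -
    have "(\<E> w. (exp ((th' - th) * (\<delta> + eps)) * (exp (th' * w ?t) * part th' (w ?t - rinf w ?t)) + part th \<delta> * indicator ?D w) + lap th * (exp (th * w ?t) * indicator (hits (ex \<delta>) ?t) w))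
      = (\<E> w. exp ((th' - th) * (\<delta> + eps)) * (exp (th' * w ?t) * part th' (w ?t - rinf w ?t)) + part th \<delta> * indicator ?D w) + (\<E> w. lap th * (exp (th * w ?t) * indicator (hits (ex \<delta>) ?t) w))"
      by (rule Bochner_Integration.integral_add) (intro Bochner_Integration.integrable_add integrable_mult_right rem_integrable[OF th'(1) t] i1 i2)+
    also have "(\<E> w. exp ((th' - th) * (\<delta> + eps)) * (exp (th' * w ?t) * part th' (w ?t - rinf w ?t)) + part th \<delta> * indicator ?D w)
      = (\<E> w. exp ((th' - th) * (\<delta> + eps)) * (exp (th' * w ?t) * part th' (w ?t - rinf w ?t))) + (\<E> w. part th \<delta> * indicator ?D w)"
      by (rule Bochner_Integration.integral_add) (intro integrable_mult_right rem_integrable[OF th'(1) t] i2)+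
    also have "(\<E> w. part th \<delta> * indicator ?D w) = part th \<delta> * prob ?D" using D sets.sets_into_space[OF D] by (simp add: Int_absorb2)
    finally show ?thesis by (simp only: integral_mult_right_zero)
  qed
  finally have "real (Suc n) * (\<E> w. exp (th * w ?t) * part th (w ?t - rinf w ?t)) <= real (Suc n) * (exp ((th' - th) * (\<delta> + eps)) * (\<E> w. exp (th' * w ?t) * part th' (w ?t - rinf w ?t)) + part th \<delta> * prob ?D + lap th * (\<E> w. exp (th * w ?t) * indicator (hits (ex \<delta>) ?t) w))"
    by (rule mult_left_mono) simp
  then show ?thesis unfolding rem_def by (simp only: distrib_left mult.left_commute)
qed

text \<open>The remainder only charges starting points near 0, where the exponential weight is trivial, so its limit does not depend on \<open>th\<close>.\<close>

lemma rem_limit_unique: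
  assumes th: "th > c" "th <= th'" and L: "rem th \<longlonglongrightarrow> L" and L': "rem th' \<longlonglongrightarrow> L'"
  shows "L = L'"
proof (rule antisym)
  have th': "th' > c" "0 <= th'" "0 <= th" using th c0 by auto
  have exp_lim: "x <= y" if "!!n. x <= exp (a * (1 / real (Suc n))) * y" for x y a :: real
  proof -
    have "(%n. exp (a * (1 / real (Suc n))) * y) \<longlonglongrightarrow> exp (a * 0) * y"
      using LIMSEQ_Suc[OF lim_1_over_n] by (intro tendsto_intros) auto
    then show ?thesis using that by (intro LIMSEQ_le_const[of _ y]) auto
  qed
  have le1: "L' <= exp ((th' - th) * eps) * L" if e: "eps > 0" for eps
  proof -
    have "(%n. exp ((th' - th) * eps) * rem th n + lap th' * (real (Suc n) * (\<E> w. exp (th' * w (1 / real (Suc n))) * indicator (hits (ex eps) (1 / real (Suc n))) w))) \<longlonglongrightarrow> exp ((th' - th) * eps) * L + lap th' * 0"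
      by (intro tendsto_intros L hits_exp_bound th' e)
    then show ?thesis using rem_le1[OF th e] by (intro LIMSEQ_le[OF L']) auto
  qed
  show "L' <= L" by (rule exp_lim[of L' "th' - th" L], rule le1) simp
  have le2: "L <= exp ((th' - th) * eps) * L'" if e: "eps > 0" for eps
  proof -
    obtain K where K: "!!n. prob {w\<in>Paths. \<bar>w (1 / real (Suc n))\<bar> \<ge> eps} <= K / real (Suc n)" using deviation_bound[OF e] by blast
    \<comment> \<open>The term with K does not vanish with n, only with \<delta>. Since K depends on
      eps, \<delta> has to tend to 0 before eps does.\<close>
    have "L <= exp ((th' - th) * (\<delta> + eps)) * L' + part th \<delta> * K" if d: "\<delta> > 0" for \<delta>
    proof -
      have lim: "(%n. exp ((th' - th) * (\<delta> + eps)) * rem th' n + part th \<delta> * K + lap th * (real (Suc n) * (\<E> w. exp (th * w (1 / real (Suc n))) * indicator (hits (ex \<delta>) (1 / real (Suc n))) w))) \<longlonglongrightarrow> exp ((th' - th) * (\<delta> + eps)) * L' + part th \<delta> * K + lap th * 0"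
        by (intro tendsto_intros L' hits_exp_bound th' d)
      have "rem th n <= exp ((th' - th) * (\<delta> + eps)) * rem th' n + part th \<delta> * K + lap th * (real (Suc n) * (\<E> w. exp (th * w (1 / real (Suc n))) * indicator (hits (ex \<delta>) (1 / real (Suc n))) w))" for n
      proof -
        have "real (Suc n) * prob {w\<in>Paths. \<bar>w (1 / real (Suc n))\<bar> \<ge> eps} <= K" using K[of n] by (simp add: pos_le_divide_eq mult.commute del: of_nat_Suc)
        then have "part th \<delta> * (real (Suc n) * prob {w\<in>Paths. \<bar>w (1 / real (Suc n))\<bar> \<ge> eps}) <= part th \<delta> * K" using part_nonneg by (intro mult_left_mono) auto
        then show ?thesis using rem_le2[OF th e d, of n] by linarith
      qed
      then have "L <= exp ((th' - th) * (\<delta> + eps)) * L' + part th \<delta> * K + lap th * 0" by (intro LIMSEQ_le[OF L lim]) blast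
      then show ?thesis by simp
    qed
    then have le: "L <= exp ((th' - th) * (1 / real (Suc n) + eps)) * L' + part th (1 / real (Suc n)) * K" for n by simp
    have "(%n. exp ((th' - th) * (1 / real (Suc n) + eps)) * L' + part th (1 / real (Suc n)) * K) \<longlonglongrightarrow> exp ((th' - th) * (0 + eps)) * L' + 0 * K"
      by (intro tendsto_intros part_tendsto_0 th LIMSEQ_Suc[OF lim_1_over_n])
    then show ?thesis using le by (intro LIMSEQ_le_const) auto
  qed
  show "L <= L'" by (rule exp_lim[of L "th' - th" L'], rule le2) simp
qed

end

context levy_laplace begin

lemma rem_eq:
  assumes th: "th > c" and t: "0 <= t" and h: "0 <= h"
    and H: "(\<integral>\<^sup>+x. ennreal (exp (- th * x)) * (\<N> w. indicator {w. - x <= rinf w t} w * ennreal (g (x + w t))) \<partial>lborel) = ennreal h"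
  shows "(\<E> w. exp (th * w t) * part th (w t - rinf w t)) = exp (t * \<psi> th) * lap th - h"
proof -
  let ?I = "\<E> w. exp (th * w t) * part th (w t - rinf w t)"
  have I: "(\<N> w. ennreal (exp (th * w t) * part th (w t - rinf w t))) = ennreal ?I"
    using part_nonneg by (intro nn_integral_eq_integral rem_integrable[OF th t]) auto
  have I0: "0 <= ?I" using part_nonneg by (intro integral_nonneg_AE) auto
  have m: "mgf th t = exp (t * \<psi> th)" using th c0 t by (intro mgf_exp) auto
  have "ennreal (h + ?I) = ennreal (exp (t * \<psi> th) * lap th)"
    using laplace_identity[OF th t] I0 h lap_nonneg unfolding H I m by (simp add: ennreal_mult)
  then have "h + ?I = exp (t * \<psi> th) * lap th" using I0 h lap_nonneg by (subst (asm) ennreal_inj) auto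
  then show ?thesis by simp
qed

end

section \<open>The Laplace transform of the harmonic function and its abscissa of
  convergence\<close>

context levy_law begin

text \<open>By harmonicity the killed transform is \<open>exp (q * t)\<close> times the full one, so
  \<open>laplace_identity\<close> leaves a difference of two exponentials in t, whose derivative at
  0 is the limit.\<close>

lemma W_laplace_limit:
  assumes q: "0 <= q" and G: "levy_laplace P (W q) c C" and th: "th > c"
  shows "levy_laplace.rem P (W q) th \<longlonglongrightarrow> (\<psi> th - q) * levy_laplace.lap (W q) th"
proof -
  interpret G: levy_laplace P "W q" c C by (rule G)
  obtain t0 where t0: "t0 > 0" "!!t x. 0 < t ==> t <= t0 ==> x \<ge> 0 ==> (\<N> w. indicator {w. - x <= rinf w t} w * ennreal (W q (x + w t))) = ennreal (exp (q * t) * W q x)"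
    using W_harmonic[OF q] by blast
  have eq: "G.rem th n = (real (Suc n) * (exp (\<psi> th / real (Suc n)) - 1)) * G.lap th - (real (Suc n) * (exp (q / real (Suc n)) - 1)) * G.lap th"
    if n: "1 / real (Suc n) < t0" for n
  proof -
    define t where "t = 1 / real (Suc n)"
    have t: "0 < t" "t <= t0" using n by (auto simp: t_def)
    have "(\<integral>\<^sup>+x. ennreal (exp (- th * x)) * (\<N> w. indicator {w. - x <= rinf w t} w * ennreal (W q (x + w t))) \<partial>lborel)
      = (\<integral>\<^sup>+x. ennreal (exp (q * t)) * ennreal (exp (- th * x) * W q x) \<partial>lborel)"
    proof (rule nn_integral_cong)
      fix x :: real
      show "ennreal (exp (- th * x)) * (\<N> w. indicator {w. - x <= rinf w t} w * ennreal (W q (x + w t))) = ennreal (exp (q * t)) * ennreal (exp (- th * x) * W q x)"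
      proof (cases "x < 0")
        case True
        have "(\<N> w. indicator {w. - x <= rinf w t} w * ennreal (W q (x + w t))) = (\<N> w. 0)"
        proof (rule nn_integral_cong)
          fix w assume "w \<in> space P"
          then show "indicator {w. - x <= rinf w t} w * ennreal (W q (x + w t)) = 0" using rinf_le0[of w t] True t by (auto simp: indicator_def)
        qed
        then show ?thesis using True by (simp add: W_neg)
      next
        case False
        then show ?thesis using t0(2)[OF t, of x] W_nonneg[OF q] by (simp add: ennreal_mult[symmetric] mult_ac)
      qed
    qed
    also have "... = ennreal (exp (q * t)) * ennreal (G.lap th)"
      using G.lap_nn[OF th] W_measurable[OF q] by (subst nn_integral_cmult) auto
    also have "... = ennreal (exp (q * t) * G.lap th)" using G.lap_nonneg by (simp add: ennreal_mult)
    finally have "(\<E> w. exp (th * w t) * G.part th (w t - rinf w t)) = exp (t * \<psi> th) * G.lap th - exp (q * t) * G.lap th"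
      using t G.lap_nonneg by (intro G.rem_eq[OF th]) auto
    then have "G.rem th n = real (Suc n) * (exp (t * \<psi> th) * G.lap th - exp (q * t) * G.lap th)"
      by (simp only: G.rem_def t_def)
    also have "... = (real (Suc n) * (exp (\<psi> th / real (Suc n)) - 1)) * G.lap th - (real (Suc n) * (exp (q / real (Suc n)) - 1)) * G.lap th"
    proof -
      have "N * (a * L - b * L) = (N * (a - 1)) * L - (N * (b - 1)) * L" for N a b L :: real by (simp add: algebra_simps)
      moreover have "t * \<psi> th = \<psi> th / real (Suc n)" "q * t = q / real (Suc n)" by (simp_all add: t_def)
      ultimately show ?thesis by (simp only:)
    qed
    finally show ?thesis .
  qed
  have hits: "\<forall>\<^sub>F n in sequentially. (real (Suc n) * (exp (\<psi> th / real (Suc n)) - 1)) * G.lap th - (real (Suc n) * (exp (q / real (Suc n)) - 1)) * G.lap th = G.rem th n"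
    using order_tendstoD(2)[OF LIMSEQ_Suc[OF lim_1_over_n] t0(1)] by eventually_elim (simp only: eq)
  have "(%n. (real (Suc n) * (exp (\<psi> th / real (Suc n)) - 1)) * G.lap th - (real (Suc n) * (exp (q / real (Suc n)) - 1)) * G.lap th) \<longlonglongrightarrow> \<psi> th * G.lap th - q * G.lap th"
    by (intro tendsto_diff tendsto_mult tendsto_exp_scaled tendsto_const)
  then show ?thesis by (intro Lim_transform_eventually[OF _ hits]) (simp add: left_diff_distrib)
qed

definition WL :: "real => real => real" where "WL q th = (\<integral>x. exp (- th * x) * W q x \<partial>lborel)"
text \<open>The value that \<open>(\<psi> th - q) * WL q th\<close> has for every th above
  \<open>growth q\<close>; the point \<open>growth q + 1\<close> is an arbitrary representative.
  Division of \<open>W q\<close> by it gives the scale function.\<close>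

definition kk :: "real => real" where "kk q = (\<psi> (growth q + 1) - q) * WL q (growth q + 1)"

lemma W_levy_laplace: assumes q: "0 <= q" and c: "c > growth q" shows "\<exists>C. levy_laplace P (W q) c C"
proof -
  obtain C where C: "C > 0" "!!x. W q x <= C * exp (c * x)" using W_growth_upper[OF q c] by blast
  have "levy_laplace P (W q) c C"
    by unfold_locales (use C W_nonneg[OF q] W_neg W_measurable[OF q] growth_nonneg[OF q] c in auto)
  then show ?thesis ..
qed

lemma WL_props:
  assumes q: "0 <= q" and th: "th > growth q"
  shows "integrable lborel (%x. exp (- th * x) * W q x)" "(\<integral>\<^sup>+x. ennreal (exp (- th * x) * W q x) \<partial>lborel) = ennreal (WL q th)"
    "(\<psi> th - q) * WL q th = kk q"
proof -
  define m where "m = min th (growth q + 1)"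
  \<comment> \<open>A growth exponent below both \<open>th\<close> and \<open>growth q + 1\<close>,
    so that both limits belong to the same instance of the locale and can be compared.\<close>
  define c where "c = (growth q + m) / 2"
  have c: "c > growth q" "c < th" "c < growth q + 1" using th by (auto simp: c_def m_def)
  obtain C where G: "levy_laplace P (W q) c C" using W_levy_laplace[OF q c(1)] by blast
  interpret G: levy_laplace P "W q" c C by (rule G)
  show "integrable lborel (%x. exp (- th * x) * W q x)" by (rule G.lap_integrable[OF c(2)])
  have WL: "WL q th = G.lap th" for th by (simp add: WL_def G.lap_def)
  show "(\<integral>\<^sup>+x. ennreal (exp (- th * x) * W q x) \<partial>lborel) = ennreal (WL q th)" unfolding WL by (rule G.lap_nn[OF c(2)])
  note l1 = W_laplace_limit[OF q G c(2)] and l2 = W_laplace_limit[OF q G c(3)]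
  show "(\<psi> th - q) * WL q th = kk q"
  proof (cases "th <= growth q + 1")
    case True
    then show ?thesis using G.rem_limit_unique[OF c(2) True l1 l2] by (simp add: kk_def WL)
  next
    case False
    then show ?thesis using G.rem_limit_unique[OF c(3) _ l2 l1] by (simp add: kk_def WL)
  qed
qed

text \<open>The growth bound at the exact rate is integrated, after a translation by 1 that leads
  from integers to real arguments. The resulting pole at \<open>growth q\<close> is used in
  \<open>\<psi>_growth\<close>.\<close>

lemma WL_lower:
  assumes q: "0 <= q" and th: "th > growth q"
  shows "W q 1 * exp (- th - growth q) / (th - growth q) <= WL q th"
proof -
  let ?g = "growth q"
  have g0: "0 <= ?g" by (rule growth_nonneg[OF q])
  have low: "W q 1 * exp (?g * (x - 1)) <= W q (x + 1)" if "0 <= x" for x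
  proof -
    define n where "n = nat \<lfloor>x\<rfloor>"
    have n: "real n <= x" "x - 1 <= real n" using that unfolding n_def by linarith+
    have "W q 1 * exp (?g * (x - 1)) <= W q 1 * exp (?g * real n)" using n g0 W_nonneg[OF q] by (intro mult_left_mono) (auto intro: mult_left_mono)
    also have "... <= W q (1 + real n)" by (rule W_growth_lower[OF q])
    also have "... <= W q (x + 1)" using n by (intro W_mono q) auto
    finally show ?thesis .
  qed
  have "ennreal (W q 1 * exp (- th - ?g)) * ennreal (1 / (th - ?g)) = ennreal (W q 1 * exp (- th - ?g)) * (\<integral>\<^sup>+x. ennreal (exp (- (th - ?g) * x)) * indicator {0..} x \<partial>lborel)"
    using nn_integral_exp_tail[of "th - ?g"] th by simp
  also have "... = (\<integral>\<^sup>+x. ennreal (W q 1 * exp (- th - ?g)) * (ennreal (exp (- (th - ?g) * x)) * indicator {0..} x) \<partial>lborel)"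
    by (rule nn_integral_cmult[symmetric]) simp
  also have "... <= (\<integral>\<^sup>+x. ennreal (exp (- th * (x + 1)) * W q (x + 1)) \<partial>lborel)"
  proof (rule nn_integral_mono)
    fix x :: real
    show "ennreal (W q 1 * exp (- th - ?g)) * (ennreal (exp (- (th - ?g) * x)) * indicator {0..} x) <= ennreal (exp (- th * (x + 1)) * W q (x + 1))"
    proof (cases "0 <= x")
      case True
      have "exp (- th - ?g) * exp (- (th - ?g) * x) = exp (- th * (x + 1)) * exp (?g * (x - 1))"
        unfolding exp_add[symmetric] by (simp add: algebra_simps)
      then have "W q 1 * exp (- th - ?g) * exp (- (th - ?g) * x) = exp (- th * (x + 1)) * (W q 1 * exp (?g * (x - 1)))"
        by (simp only: mult.assoc mult.left_commute)
      also have "... <= exp (- th * (x + 1)) * W q (x + 1)" using low[OF True] by (rule mult_left_mono) simp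
      finally show ?thesis using True W_nonneg[OF q] by (simp add: ennreal_mult[symmetric] ennreal_leI)
    qed simp
  qed
  also have "... = ennreal (WL q th)"
    using nn_integral_translate[of "%x. ennreal (exp (- th * x) * W q x)" 1] W_measurable[OF q] WL_props(2)[OF q th] by simp
  finally have "ennreal (W q 1 * exp (- th - ?g) * (1 / (th - ?g))) <= ennreal (WL q th)"
    using W_nonneg[OF q, of 1] th by (subst ennreal_mult) auto
  moreover have "0 <= WL q th" unfolding WL_def using W_nonneg[OF q] by (intro integral_nonneg_AE) auto
  ultimately show ?thesis by simp
qed

lemma WL_pos: assumes q: "0 <= q" and th: "th > growth q" shows "WL q th > 0"
proof -
  have "0 < W q 1 * exp (- th - growth q) / (th - growth q)" using W_pos[OF q, of 1] th by simp
  then show ?thesis using WL_lower[OF q th] by linarith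
qed

text \<open>The sign of the constant can be read off at a single large th, where \<psi> th > q; it
  then yields \<psi> > q on the whole half-line in \<open>\<psi>_gt\<close>.\<close>

lemma kk_pos: assumes q: "0 <= q" shows "kk q > 0"
proof -
  have "eventually (%th. th > growth q & \<psi> th > q) at_top"
    using filterlim_at_top_dense[THEN iffD1, OF \<psi>_at_top] eventually_gt_at_top by (auto intro: eventually_conj)
  then obtain th where th: "th > growth q" "\<psi> th > q" by (auto simp: eventually_at_top_linorder)
  then show ?thesis using WL_props(3)[OF q th(1)] WL_pos[OF q th(1)] by (metis diff_gt_0_iff_gt mult_pos_pos)
qed

lemma \<psi>_gt: assumes q: "0 <= q" and th: "th > growth q" shows "\<psi> th > q"
  using WL_props(3)[OF q th] WL_pos[OF q th] kk_pos[OF q] by (metis diff_gt_0_iff_gt zero_less_mult_pos2)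

lemma WL_eq: assumes q: "0 <= q" and th: "th > growth q" shows "WL q th / kk q = 1 / (\<psi> th - q)"
  using WL_props(3)[OF q th] kk_pos[OF q] \<psi>_gt[OF q th] by (simp add: field_simps)

text \<open>Since \<open>(\<psi> th - q) * WL q th\<close> is constant and \<open>WL q\<close> has a
  pole at \<open>growth q\<close>, the first factor must tend to 0 there.\<close>

lemma \<psi>_growth: assumes q: "0 <= q" shows "\<psi> (growth q) = q"
proof -
  let ?g = "growth q"
  have g0: "0 <= ?g" by (rule growth_nonneg[OF q])
  define f where "f n = ?g + 1 / real (Suc n)" for n
  have fg: "f n > ?g" for n by (simp add: f_def)
  have "f \<longlonglongrightarrow> ?g + 0" unfolding f_def by (intro tendsto_add tendsto_const LIMSEQ_Suc[OF lim_1_over_n])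
  then have fl: "f \<longlonglongrightarrow> ?g" by simp
  have "(%n. \<psi> (f n)) \<longlonglongrightarrow> \<psi> ?g"
    by (rule continuous_on_tendsto_compose[OF \<psi>_continuous fl]) (use g0 fg in \<open>auto intro!: always_eventually intro: order_trans less_imp_le\<close>)
  moreover have "(%n. \<psi> (f n)) \<longlonglongrightarrow> q"
  proof (rule tendsto_sandwich)
    show "\<forall>\<^sub>F n in sequentially. q <= \<psi> (f n)" by (rule always_eventually, rule allI, rule less_imp_le, rule \<psi>_gt[OF q fg])
    define B where "B n = q + kk q * ((f n - ?g) * exp (f n + ?g)) / W q 1" for n
    show "\<forall>\<^sub>F n in sequentially. \<psi> (f n) <= B n"
    proof (intro always_eventually allI)
      fix n
      define L where "L = W q 1 * exp (- f n - ?g) / (f n - ?g)"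
      have L: "L > 0" "L <= WL q (f n)" using W_pos[OF q, of 1] fg WL_lower[OF q fg] by (auto simp: L_def)
      have "\<psi> (f n) - q = kk q / WL q (f n)" using WL_props(3)[OF q fg[of n]] WL_pos[OF q fg[of n]] by (simp add: eq_divide_eq)
      also have "... <= kk q / L" using L kk_pos[OF q] by (intro divide_left_mono) auto
      also have "... = kk q * ((f n - ?g) * exp (f n + ?g)) / W q 1"
      proof -
        have "exp (- f n - ?g) = inverse (exp (f n + ?g))" by (simp add: exp_minus[symmetric])
        then show ?thesis unfolding L_def by (simp only: divide_inverse inverse_mult_distrib inverse_inverse_eq mult_ac)
      qed
      finally show "\<psi> (f n) <= B n" by (simp add: B_def)
    qed
    have "B \<longlonglongrightarrow> q + kk q * ((?g - ?g) * exp (?g + ?g)) / W q 1" unfolding B_def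
      using W_pos[OF q, of 1] by (intro tendsto_intros fl) auto
    then show "B \<longlonglongrightarrow> q" by simp
  qed simp
  ultimately show ?thesis using LIMSEQ_unique by blast
qed

lemma growth_greatest: assumes q: "0 <= q" shows "(GREATEST th. 0 <= th & \<psi> th = q) = growth q"
proof (rule Greatest_equality)
  show "0 <= growth q & \<psi> (growth q) = q" using growth_nonneg[OF q] \<psi>_growth[OF q] by simp
  show "th <= growth q" if "0 <= th & \<psi> th = q" for th using \<psi>_gt[OF q, of th] that by force
qed

section \<open>The scale function\<close>

text \<open>\<open>W q 0\<close> need not be the right limit at 0, hence the correction at 0.\<close>

definition Ws :: "real => real => real" where
  "Ws q x = (if x = 0 then (INF y\<in>{0<..}. W q y) else W q x) / kk q"

lemma Ws_pos_eq: "x \<noteq> 0 ==> Ws q x = W q x / kk q" by (simp add: Ws_def)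

lemma Ws_neg: "x < 0 ==> Ws q x = 0" by (simp add: Ws_def W_neg)

lemma W_INF_le: assumes q: "0 <= q" and "0 < y" shows "(INF y\<in>{0<..}. W q y) <= W q y"
  using assms W_nonneg[OF q] by (intro cINF_lower) (auto intro: bdd_belowI2[of _ 0])

lemma W_INF_nonneg: assumes q: "0 <= q" shows "0 <= (INF y\<in>{0<..}. W q y)"
  using W_nonneg[OF q] by (intro cINF_greatest) auto

lemma Ws_nonneg: "0 <= q ==> 0 <= Ws q x"
  using W_nonneg[of q] W_INF_nonneg[of q] kk_pos[of q] by (auto simp: Ws_def)

lemma Ws_pos: "0 <= q ==> 0 < x ==> 0 < Ws q x"
  using W_pos[of q x] kk_pos[of q] by (simp add: Ws_def)

lemma Ws_mono: assumes q: "0 <= q" and xy: "x <= y" shows "Ws q x <= Ws q y"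
proof -
  consider "x < 0" | "x = y" | "x = 0" "0 < y" | "0 < x" "x <= y" using xy by linarith
  then show ?thesis
  proof cases
    case 3 then show ?thesis using W_INF_le[OF q, of y] kk_pos[OF q] by (simp add: Ws_def divide_right_mono)
  next
    case 4 then show ?thesis using W_mono[OF q, of x y] kk_pos[OF q] by (simp add: Ws_def divide_right_mono)
  qed (use Ws_neg Ws_nonneg[OF q] in auto)
qed

lemma Ws_measurable [measurable]: "0 <= q ==> Ws q \<in> borel_measurable borel"
  by (intro borel_measurable_mono monoI Ws_mono)

lemma Ws_isCont: assumes q: "0 <= q" and x: "0 < x" shows "isCont (Ws q) x"
proof -
  have "isCont (%y. W q y / kk q) x" using W_isCont[OF q x] kk_pos[OF q] by (intro continuous_intros) auto
  moreover have "\<forall>\<^sub>F y in nhds x. Ws q y = W q y / kk q"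
  proof -
    have "\<forall>\<^sub>F y in nhds x. y \<in> {0<..}" by (rule eventually_nhds_in_open) (use x in auto)
    then show ?thesis by eventually_elim (simp add: Ws_def)
  qed
  ultimately show ?thesis using isCont_cong[of "Ws q" "%y. W q y / kk q" x] by simp
qed

lemma Ws_right_0: assumes q: "0 <= q" shows "(Ws q \<longlongrightarrow> Ws q 0) (at_right 0)"
proof (rule tendstoI)
  fix e :: real assume e: "e > 0"
  have k: "kk q > 0" by (rule kk_pos[OF q])
  let ?i = "INF y\<in>{0<..}. W q y"
  have "?i < ?i + e * kk q" using e k by simp
  then obtain y where y: "y > 0" "W q y < ?i + e * kk q"
  proof -
    have "bdd_below (W q ` {0<..})" using W_nonneg[OF q] by (intro bdd_belowI2[of _ 0]) auto
    then have "\<exists>y\<in>{0<..}. W q y < ?i + e * kk q" using \<open>?i < ?i + e * kk q\<close> by (subst cINF_less_iff[symmetric]) auto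
    then show ?thesis using that by auto
  qed
  then have "Ws q y < Ws q 0 + e" using k by (simp add: Ws_def field_simps)
  then have "dist (Ws q z) (Ws q 0) < e" if "0 < z" "z < y" for z
    using Ws_mono[OF q, of z y] Ws_mono[OF q, of 0 z] that by (simp add: dist_real_def)
  then show "\<forall>\<^sub>F x in at_right 0. dist (Ws q x) (Ws q 0) < e"
    using y(1) by (auto simp: eventually_at_right_field)
qed

lemma Ws_continuous: assumes q: "0 <= q" shows "continuous_on {0..} (Ws q)"
  unfolding continuous_on_eq_continuous_within
proof
  fix x :: real assume "x \<in> {0..}"
  show "continuous (at x within {0..}) (Ws q)"
  proof (cases "x = 0")
    case True
    have "at (0::real) within {0..} = at_right 0" by (rule at_within_Ici_at_right)
    then show ?thesis using Ws_right_0[OF q] True by (simp add: continuous_within)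
  next
    case False
    then show ?thesis using \<open>x \<in> {0..}\<close> by (intro continuous_at_imp_continuous_at_within[OF Ws_isCont[OF q]]) simp
  qed
qed

lemma Ws_lap:
  assumes q: "0 <= q" and th: "th > growth q"
  shows "integrable lborel (%x. exp (- th * x) * Ws q x)" "(\<integral>x. exp (- th * x) * Ws q x \<partial>lborel) = 1 / (\<psi> th - q)"
    "(\<integral>\<^sup>+x. ennreal (exp (- th * x) * Ws q x) \<partial>lborel) = ennreal (1 / (\<psi> th - q))"
proof -
  have ae: "AE x in lborel. exp (- th * x) * W q x / kk q = exp (- th * x) * Ws q x"
    using AE_lborel_singleton[of 0] by eventually_elim (simp add: Ws_def)
  have i: "integrable lborel (%x. exp (- th * x) * W q x / kk q)" using WL_props(1)[OF q th] by (intro integrable_divide) auto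
  have m: "(%x. exp (- th * x) * Ws q x) \<in> borel_measurable lborel" using Ws_measurable[OF q] by auto
  show I: "integrable lborel (%x. exp (- th * x) * Ws q x)"
    using integrable_cong_AE[OF borel_measurable_integrable[OF i] m ae] i by simp
  have "(\<integral>x. exp (- th * x) * Ws q x \<partial>lborel) = (\<integral>x. exp (- th * x) * W q x / kk q \<partial>lborel)"
    by (rule integral_cong_AE[OF m borel_measurable_integrable[OF i]]) (use ae in eventually_elim, simp)
  also have "... = WL q th / kk q" by (simp add: WL_def)
  finally show v: "(\<integral>x. exp (- th * x) * Ws q x \<partial>lborel) = 1 / (\<psi> th - q)" using WL_eq[OF q th] by simp
  show "(\<integral>\<^sup>+x. ennreal (exp (- th * x) * Ws q x) \<partial>lborel) = ennreal (1 / (\<psi> th - q))"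
    using nn_integral_eq_integral[OF I] Ws_nonneg[OF q] v by simp
qed

end

section \<open>Convolutions, comparison of scale functions for different rates, and
  uniqueness\<close>

lemma AE_lborel_dense:
  fixes a b :: real
  assumes ae: "AE x in lborel. Q x" and ab: "a < b" shows "\<exists>x. a < x & x < b & Q x"
proof (rule ccontr)
  assume n: "\<not> ?thesis"
  from AE_E[OF ae] obtain N where N: "{x \<in> space lborel. \<not> Q x} \<subseteq> N" "emeasure lborel N = 0" "N \<in> sets lborel" by blast
  have "emeasure lborel {a<..<b} <= emeasure lborel N" using n N by (intro emeasure_mono) auto
  then show False using N ab by simp
qed

lemma le_of_AE_le:
  fixes f g :: "real => real"
  assumes ae: "AE x in lborel. 0 < x --> f x <= g x" and c: "isCont f x" "isCont g x" and x: "0 < x"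
  shows "f x <= g x"
proof (rule ccontr)
  assume "\<not> f x <= g x"
  then have "0 < f x - g x" by simp
  moreover have "((%y. f y - g y) \<longlongrightarrow> f x - g x) (at x)" using c by (intro tendsto_diff) (auto simp: isCont_def)
  ultimately have "\<forall>\<^sub>F y in at x. 0 < f y - g y" using order_tendstoD(1)[of "%y. f y - g y" "f x - g x" "at x" 0] by blast
  then obtain d where d: "d > 0" "\<forall>y. y \<noteq> x & dist y x < d --> 0 < f y - g y" by (auto simp: eventually_at)
  obtain y where "x < y" "y < x + d" "0 < y --> f y <= g y" using AE_lborel_dense[OF ae, of x "x + d"] d by auto
  then show False using d(2)[rule_format, of y] x by (auto simp: dist_real_def)
qed

definition conv :: "(real => real) => (real => real) => real => ennreal" where
  "conv f g x = (\<integral>\<^sup>+z. ennreal (f (x - z)) * ennreal (g z) \<partial>lborel)"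

lemma conv_measurable:
  assumes [measurable]: "f \<in> borel_measurable borel" "g \<in> borel_measurable borel"
  shows "conv f g \<in> borel_measurable borel"
proof -
  have "(%x. \<integral>\<^sup>+z. ennreal (f (x - z)) * ennreal (g z) \<partial>lborel) \<in> borel_measurable borel"
    by (rule lborel.borel_measurable_nn_integral) simp
  then show ?thesis unfolding conv_def[abs_def] .
qed

lemma conv_laplace:
  assumes f [measurable]: "f \<in> borel_measurable borel" and g [measurable]: "g \<in> borel_measurable borel" and p: "!!x. 0 <= f x" "!!x. 0 <= g x"
  shows "(\<integral>\<^sup>+x. ennreal (exp (- th * x)) * conv f g x \<partial>lborel) = (\<integral>\<^sup>+x. ennreal (exp (- th * x) * f x) \<partial>lborel) * (\<integral>\<^sup>+x. ennreal (exp (- th * x) * g x) \<partial>lborel)"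
proof -
  have "(\<integral>\<^sup>+x. ennreal (exp (- th * x)) * conv f g x \<partial>lborel) = (\<integral>\<^sup>+x. \<integral>\<^sup>+z. ennreal (exp (- th * x)) * (ennreal (f (x - z)) * ennreal (g z)) \<partial>lborel \<partial>lborel)"
    unfolding conv_def by (intro nn_integral_cong nn_integral_cmult[symmetric]) simp
  also have "... = (\<integral>\<^sup>+z. \<integral>\<^sup>+x. ennreal (exp (- th * x)) * (ennreal (f (x - z)) * ennreal (g z)) \<partial>lborel \<partial>lborel)"
    by (rule lborel_pair.Fubini'[symmetric]) simp
  also have "... = (\<integral>\<^sup>+z. (\<integral>\<^sup>+x. ennreal (exp (- th * x) * f x) \<partial>lborel) * ennreal (exp (- th * z) * g z) \<partial>lborel)"
  proof (intro nn_integral_cong)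
    fix z
    have "(\<integral>\<^sup>+x. ennreal (exp (- th * x)) * (ennreal (f (x - z)) * ennreal (g z)) \<partial>lborel) = (\<integral>\<^sup>+x. ennreal (exp (- th * (x + - z)) * f (x + - z)) * ennreal (exp (- th * z) * g z) \<partial>lborel)"
    proof (intro nn_integral_cong)
      fix x
      have "exp (- th * x) = exp (- th * (x + - z)) * exp (- th * z)" by (subst exp_add[symmetric]) (simp add: algebra_simps)
      then show "ennreal (exp (- th * x)) * (ennreal (f (x - z)) * ennreal (g z)) = ennreal (exp (- th * (x + - z)) * f (x + - z)) * ennreal (exp (- th * z) * g z)"
        using p by (simp add: ennreal_mult[symmetric] mult_ac)
    qed
    also have "... = (\<integral>\<^sup>+x. ennreal (exp (- th * (x + - z)) * f (x + - z)) \<partial>lborel) * ennreal (exp (- th * z) * g z)"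
      by (rule nn_integral_multc) simp
    also have "(\<integral>\<^sup>+x. ennreal (exp (- th * (x + - z)) * f (x + - z)) \<partial>lborel) = (\<integral>\<^sup>+x. ennreal (exp (- th * x) * f x) \<partial>lborel)"
      by (rule nn_integral_translate[of "%x. ennreal (exp (- th * x) * f x)" "- z"]) simp
    finally show "(\<integral>\<^sup>+x. ennreal (exp (- th * x)) * (ennreal (f (x - z)) * ennreal (g z)) \<partial>lborel) = (\<integral>\<^sup>+x. ennreal (exp (- th * x) * f x) \<partial>lborel) * ennreal (exp (- th * z) * g z)" .
  qed
  also have "... = (\<integral>\<^sup>+x. ennreal (exp (- th * x) * f x) \<partial>lborel) * (\<integral>\<^sup>+x. ennreal (exp (- th * x) * g x) \<partial>lborel)"
    by (rule nn_integral_cmult) simp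
  finally show ?thesis .
qed

lemma conv_real_laplace:
  assumes f: "f \<in> borel_measurable borel" and g: "g \<in> borel_measurable borel" and p: "!!x. 0 <= f x" "!!x. 0 <= g x"
    and fin: "!!x. conv f g x < \<infinity>" and a: "0 <= a" "0 <= b"
    and lf: "(\<integral>\<^sup>+x. ennreal (exp (- th * x) * f x) \<partial>lborel) = ennreal a" and lg: "(\<integral>\<^sup>+x. ennreal (exp (- th * x) * g x) \<partial>lborel) = ennreal b"
  shows "integrable lborel (%x. exp (- th * x) * enn2real (conv f g x))" "(\<integral>x. exp (- th * x) * enn2real (conv f g x) \<partial>lborel) = a * b"
proof -
  have [measurable]: "conv f g \<in> borel_measurable borel" by (rule conv_measurable[OF f g])
  have m: "(%x. exp (- th * x) * enn2real (conv f g x)) \<in> borel_measurable lborel" by simp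
  have nn: "(\<integral>\<^sup>+x. ennreal (exp (- th * x) * enn2real (conv f g x)) \<partial>lborel) = ennreal (a * b)"
  proof -
    have "(\<integral>\<^sup>+x. ennreal (exp (- th * x) * enn2real (conv f g x)) \<partial>lborel) = (\<integral>\<^sup>+x. ennreal (exp (- th * x)) * conv f g x \<partial>lborel)"
      using fin by (intro nn_integral_cong) (simp add: ennreal_mult)
    also have "... = ennreal (a * b)" using a by (simp only: conv_laplace[OF f g p] lf lg ennreal_mult)
    finally show ?thesis .
  qed
  show i: "integrable lborel (%x. exp (- th * x) * enn2real (conv f g x))"
    using nn by (intro integrableI_nonneg m) auto
  show "(\<integral>x. exp (- th * x) * enn2real (conv f g x) \<partial>lborel) = a * b"
    using nn nn_integral_eq_integral[OF i] a by (simp add: integral_nonneg_AE)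
qed

context levy_law begin

lemma conv_Ws_le:
  assumes q: "0 <= q" "0 <= q'" shows "conv (Ws q) (Ws q') x <= ennreal (max 0 x * (Ws q x * Ws q' x))"
proof -
  have "conv (Ws q) (Ws q') x <= (\<integral>\<^sup>+z. ennreal (Ws q x * Ws q' x) * indicator {0..x} z \<partial>lborel)"
    unfolding conv_def
  proof (rule nn_integral_mono)
    fix z
    consider "z < 0" | "z > x" | "0 <= z" "z <= x" by linarith
    then show "ennreal (Ws q (x - z)) * ennreal (Ws q' z) <= ennreal (Ws q x * Ws q' x) * indicator {0..x} z"
    proof cases
      case 3
      then have "Ws q (x - z) * Ws q' z <= Ws q x * Ws q' x" using q Ws_nonneg by (intro mult_mono Ws_mono) auto
      then show ?thesis using 3 Ws_nonneg q by (simp add: ennreal_mult[symmetric] ennreal_leI)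
    qed (auto simp: Ws_neg)
  qed
  also have "... = ennreal (Ws q x * Ws q' x) * emeasure lborel {0..x}" by (rule nn_integral_cmult_indicator) simp
  also have "emeasure lborel {0..x} = ennreal (max 0 x)" by (cases "0 <= x") auto
  also have "ennreal (Ws q x * Ws q' x) * ennreal (max 0 x) = ennreal (max 0 x * (Ws q x * Ws q' x))"
    using Ws_nonneg q by (subst ennreal_mult[symmetric]) (auto simp: mult.commute)
  finally show ?thesis .
qed

text \<open>The resolvent identity: the difference for q' and q is q' - q times the convolution of
  the two scale functions, because 1 / (\<psi> - q') - 1 / (\<psi> - q) = (q' - q) / ((\<psi> - q)
  (\<psi> - q')). Monotonicity bounds the convolution, and continuity removes the exceptional null
  set.\<close>

lemma Ws_diff_bound:
  assumes q: "0 <= q" "0 <= q'" and x: "0 < x"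
  shows "\<bar>Ws q' x - Ws q x\<bar> <= \<bar>q' - q\<bar> * (x * (Ws q x * Ws q' x))"
proof -
  define cv where "cv x = enn2real (conv (Ws q) (Ws q') x)" for x
  have fin: "conv (Ws q) (Ws q') x < \<infinity>" for x using conv_Ws_le[OF q, of x] by (rule le_less_trans) simp
  define c where "c = max (growth q) (growth q') + 1"
  have m [measurable]: "Ws q \<in> borel_measurable borel" "Ws q' \<in> borel_measurable borel" using q by (auto intro: Ws_measurable)
  have cm [measurable]: "cv \<in> borel_measurable borel" unfolding cv_def using conv_measurable[OF m] by simp
  have th: "th > growth q" "th > growth q'" if "th \<ge> c" for th using that by (auto simp: c_def)
  have cvl: "integrable lborel (%x. exp (- th * x) * cv x)" "(\<integral>x. exp (- th * x) * cv x \<partial>lborel) = (1 / (\<psi> th - q)) * (1 / (\<psi> th - q'))" if "th \<ge> c" for th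
    unfolding cv_def using conv_real_laplace[OF m Ws_nonneg[OF q(1)] Ws_nonneg[OF q(2)] fin _ _ Ws_lap(3)[OF q(1) th(1)[OF that]] Ws_lap(3)[OF q(2) th(2)[OF that]]]
      \<psi>_gt[OF q(1) th(1)[OF that]] \<psi>_gt[OF q(2) th(2)[OF that]] by (auto simp: less_imp_le)
  define f where "f x = Ws q' x - Ws q x - (q' - q) * cv x" for x
  have ex: "exp (- th * x) * f x = (exp (- th * x) * Ws q' x - exp (- th * x) * Ws q x) - (q' - q) * (exp (- th * x) * cv x)" for th x
    by (simp add: f_def algebra_simps)
  have fi: "integrable lborel (%x. exp (- th * x) * f x)" "(\<integral>x. exp (- th * x) * f x \<partial>lborel) = 0" if "th \<ge> c" for th
  proof -
    note i = Ws_lap(1)[OF q(1) th(1)[OF that]] Ws_lap(1)[OF q(2) th(2)[OF that]] cvl(1)[OF that]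
    show "integrable lborel (%x. exp (- th * x) * f x)" unfolding ex
      by (rule Bochner_Integration.integrable_diff[OF Bochner_Integration.integrable_diff[OF i(2,1)] integrable_mult_right]) (rule i(3))
    have "(\<integral>x. exp (- th * x) * f x \<partial>lborel) = (1 / (\<psi> th - q') - 1 / (\<psi> th - q)) - (q' - q) * ((1 / (\<psi> th - q)) * (1 / (\<psi> th - q')))"
      unfolding ex
      by (subst Bochner_Integration.integral_diff[OF Bochner_Integration.integrable_diff[OF i(2,1)] integrable_mult_right], rule i(3),
          subst Bochner_Integration.integral_diff[OF i(2,1)])
         (simp only: Ws_lap(2)[OF q(1) th(1)[OF that]] Ws_lap(2)[OF q(2) th(2)[OF that]] integral_mult_right_zero cvl(2)[OF that])
    also have "... = 0"
    proof -
      define A where "A = \<psi> th - q" define B where "B = \<psi> th - q'"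
      have "A > 0" "B > 0" "q' - q = A - B" using \<psi>_gt[OF q(1) th(1)[OF that]] \<psi>_gt[OF q(2) th(2)[OF that]] by (auto simp: A_def B_def)
      then show ?thesis unfolding \<open>q' - q = A - B\<close> A_def[symmetric] B_def[symmetric] by (simp add: field_simps)
    qed
    finally show "(\<integral>x. exp (- th * x) * f x \<partial>lborel) = 0" .
  qed
  have "AE x in lborel. f x = 0"
  proof (rule laplace_zero_imp_AE_zero[where c=c])
    show "f \<in> borel_measurable borel" unfolding f_def by simp
    show "f x = 0" if "x < 0" for x using conv_Ws_le[OF q, of x] that by (simp add: f_def Ws_neg cv_def)
    show "integrable lborel (%x. exp (- c * x) * f x)" by (rule fi) simp
    show "(\<integral>x. exp (- (c + real n) * x) * f x \<partial>lborel) = 0" for n by (rule fi(2)) simp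
  qed
  then have "AE x in lborel. 0 < x --> \<bar>Ws q' x - Ws q x\<bar> <= \<bar>q' - q\<bar> * (x * (Ws q x * Ws q' x))"
  proof (rule AE_mp, intro AE_I2 impI)
    fix x :: real assume f0: "f x = 0" and x: "0 < x"
    have "cv x <= enn2real (ennreal (max 0 x * (Ws q x * Ws q' x)))" unfolding cv_def by (rule enn2real_mono[OF conv_Ws_le[OF q]]) simp
    then have "cv x <= x * (Ws q x * Ws q' x)" using x Ws_nonneg q by (simp add: max_def)
    moreover have "0 <= cv x" by (simp add: cv_def)
    moreover have "Ws q' x - Ws q x = (q' - q) * cv x" using f0 by (simp add: f_def)
    ultimately show "\<bar>Ws q' x - Ws q x\<bar> <= \<bar>q' - q\<bar> * (x * (Ws q x * Ws q' x))" by (simp add: abs_mult mult_left_mono)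
  qed
  then show ?thesis
    by (rule le_of_AE_le) (use x q Ws_isCont in \<open>auto intro!: continuous_intros\<close>)
qed

text \<open>Both scale functions may vanish at 0, so continuity alone does not decide the quotient;
  the resolvent bound carries the product of both and survives the division. This limit permits the
  exchange of the rates q and q + r at small levels.\<close>

lemma Ws_ratio:
  assumes q: "0 <= q" "0 <= q'" shows "((%y. Ws q y / Ws q' y) \<longlongrightarrow> 1) (at_right 0)"
proof -
  have "((%y. Ws q y / Ws q' y - 1) \<longlongrightarrow> 0) (at_right 0)"
  proof (rule Lim_null_comparison)
    show "\<forall>\<^sub>F y in at_right 0. norm (Ws q y / Ws q' y - 1) <= \<bar>q' - q\<bar> * (y * Ws q 1)"
      unfolding eventually_at_right_field
    proof (intro exI[of _ 1] conjI allI impI)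
      fix y :: real assume y: "0 < y" "y < 1"
      have p: "Ws q' y > 0" using Ws_pos q y by auto
      have "norm (Ws q y / Ws q' y - 1) = \<bar>Ws q' y - Ws q y\<bar> / Ws q' y" using p by (simp add: field_simps abs_minus_commute)
      also have "... <= (\<bar>q' - q\<bar> * (y * (Ws q y * Ws q' y))) / Ws q' y" using Ws_diff_bound[OF q y(1)] p by (intro divide_right_mono) auto
      also have "... = \<bar>q' - q\<bar> * (y * Ws q y)" using p by simp
      also have "... <= \<bar>q' - q\<bar> * (y * Ws q 1)" using Ws_mono[OF q(1), of y 1] y by (intro mult_left_mono) auto
      finally show "norm (Ws q y / Ws q' y - 1) <= \<bar>q' - q\<bar> * (y * Ws q 1)" .
    qed simp
    have "((%y. \<bar>q' - q\<bar> * (y * Ws q 1)) \<longlongrightarrow> \<bar>q' - q\<bar> * (0 * Ws q 1)) (at_right 0)" by (intro tendsto_intros)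
    then show "((%y. \<bar>q' - q\<bar> * (y * Ws q 1)) \<longlongrightarrow> 0) (at_right 0)" by simp
  qed
  then show ?thesis using LIM_zero_iff by blast
qed

lemma Ws_unique:
  assumes q: "0 <= q" and n: "\<forall>y<0. V y = 0" and c: "continuous_on {0..} V" and m: "mono_on {0..} V"
    and L: "\<forall>th>growth q. ((%y. exp (- th * y) * V y) has_integral (1 / (\<psi> th - q))) {0..}"
  shows "V = Ws q"
proof -
  \<comment> \<open>The hypotheses do not give V >= 0 directly. Adding K makes the function
    nonnegative, which permits the passage from gauge to Lebesgue integrals; its transform K / th is
    subtracted again later.\<close>
  define K where "K = \<bar>V 0\<bar>"
  define V1 where "V1 y = (if 0 <= y then V y + K else 0)" for y
  have V1m [measurable]: "V1 \<in> borel_measurable borel"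
  proof -
    have "(%y. indicator {0..} y *\<^sub>R (V y + K)) \<in> borel_measurable borel"
      by (rule borel_measurable_continuous_on_indicator) (use c in \<open>auto intro!: continuous_intros\<close>)
    moreover have "(%y. indicator {0..} y *\<^sub>R (V y + K)) = V1" by (auto simp: V1_def indicator_def)
    ultimately show ?thesis by simp
  qed
  have V1p: "0 <= V1 y" for y
  proof (cases "0 <= y")
    case True
    then have "V 0 <= V y" using m by (auto simp: mono_on_def)
    then show ?thesis using True by (simp add: V1_def K_def)
  qed (simp add: V1_def)
  have l1: "integrable lborel (%y. exp (- th * y) * V1 y) & (\<integral>y. exp (- th * y) * V1 y \<partial>lborel) = 1 / (\<psi> th - q) + K / th" if th: "th > growth q" for th
  proof -
    have th0: "th > 0" using th growth_nonneg[OF q] by simp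
    have "((%y. exp (- th * y)) has_integral exp (- th * 0) / th) {0..}" by (rule has_integral_exp_minus_to_infinity[OF th0])
    then have "((%y. exp (- th * y) * K) has_integral (exp (- th * 0) / th) * K) {0..}" by (rule has_integral_mult_left)
    from has_integral_add[OF L[rule_format, OF th] this]
    have "((%y. exp (- th * y) * (V y + K)) has_integral (1 / (\<psi> th - q) + K / th)) {0..}" by (simp add: algebra_simps)
    then have "((%y. if y \<in> {0..} then exp (- th * y) * (V y + K) else 0) has_integral (1 / (\<psi> th - q) + K / th)) UNIV"
      by (simp only: has_integral_restrict_UNIV)
    moreover have "(%y. if y \<in> {0..} then exp (- th * y) * (V y + K) else 0) = (%y. exp (- th * y) * V1 y)" by (auto simp: V1_def)
    ultimately have hi: "((%y. exp (- th * y) * V1 y) has_integral (1 / (\<psi> th - q) + K / th)) UNIV" by simp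
    have v0: "0 <= 1 / (\<psi> th - q) + K / th" using \<psi>_gt[OF q th] th0 by (simp add: K_def)
    have nn: "(\<integral>\<^sup>+y. ennreal (exp (- th * y) * V1 y) \<partial>lborel) = ennreal (1 / (\<psi> th - q) + K / th)"
      by (rule nn_integral_has_integral_lborel[OF _ _ hi]) (use V1p in auto)
    have i: "integrable lborel (%y. exp (- th * y) * V1 y)" using nn V1p by (intro integrableI_nonneg) auto
    then show ?thesis using nn_integral_eq_integral[OF i] nn V1p v0 by (simp add: integral_nonneg_AE)
  qed
  define f where "f y = V1 y - (Ws q y + K * indicator {0..} y)" for y
  have Wm [measurable]: "Ws q \<in> borel_measurable borel" by (rule Ws_measurable[OF q])
  have ex: "exp (- th * x) * f x = exp (- th * x) * V1 x - (exp (- th * x) * Ws q x + K * (exp (- th * x) * indicator {0..} x))" for th x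
    by (simp add: f_def algebra_simps)
  have le: "integrable lborel (%x. exp (- th * x) * indicator {0..} x) & (\<integral>x. exp (- th * x) * indicator {0..} x \<partial>lborel) = 1 / th" if "th > 0" for th :: real
    using integral_exp_tail[OF that] by simp
  have fi: "integrable lborel (%x. exp (- th * x) * f x)" "(\<integral>x. exp (- th * x) * f x \<partial>lborel) = 0" if th: "th > growth q" for th
  proof -
    have th0: "th > 0" using th growth_nonneg[OF q] by simp
    note i = l1[OF th, THEN conjunct1] Ws_lap(1)[OF q th] le[OF th0, THEN conjunct1]
    have i2: "integrable lborel (%x. exp (- th * x) * Ws q x + K * (exp (- th * x) * indicator {0..} x))"
      by (rule Bochner_Integration.integrable_add[OF i(2) integrable_mult_right]) (rule i(3))
    show "integrable lborel (%x. exp (- th * x) * f x)" unfolding ex by (rule Bochner_Integration.integrable_diff[OF i(1) i2])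
    have "(\<integral>x. exp (- th * x) * f x \<partial>lborel) = (1 / (\<psi> th - q) + K / th) - (1 / (\<psi> th - q) + K * (1 / th))"
      unfolding ex
      by (subst Bochner_Integration.integral_diff[OF i(1) i2], subst Bochner_Integration.integral_add[OF i(2) integrable_mult_right], rule i(3))
         (simp only: l1[OF th, THEN conjunct2] Ws_lap(2)[OF q th] integral_mult_right_zero le[OF th0, THEN conjunct2])
    then show "(\<integral>x. exp (- th * x) * f x \<partial>lborel) = 0" by simp
  qed
  have ae: "AE x in lborel. f x = 0"
  proof (rule laplace_zero_imp_AE_zero[where c="growth q + 1"])
    show "f \<in> borel_measurable borel" unfolding f_def by simp
    show "f x = 0" if "x < 0" for x using that by (simp add: f_def V1_def Ws_neg)
    show "integrable lborel (%x. exp (- (growth q + 1) * x) * f x)" by (rule fi) simp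
    show "(\<integral>x. exp (- (growth q + 1 + real n) * x) * f x \<partial>lborel) = 0" for n by (rule fi(2)) simp
  qed
  have feq: "f y = V y - Ws q y" if "0 <= y" for y using that by (simp add: f_def V1_def)
  show ?thesis
  proof
    fix x show "V x = Ws q x"
    proof (cases "x < 0")
      case False
      have cf: "continuous_on {0..} (%y. V y - Ws q y)" by (intro continuous_on_diff c Ws_continuous[OF q])
      \<comment> \<open>Points to the right of x are used, so that one-sided continuity on the
        half-line also settles x = 0.\<close>
      have "\<exists>y. x < y & y < x + 1 / real (Suc n) & f y = 0" for n by (rule AE_lborel_dense[OF ae]) simp
      then obtain y where y: "!!n. x < y n" "!!n. y n < x + 1 / real (Suc n)" "!!n. f (y n) = 0" by metis
      have "y \<longlonglongrightarrow> x"
      proof (rule tendsto_sandwich[of "%_. x" _ _ "%n. x + 1 / real (Suc n)"])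
        show "(%n. x + 1 / real (Suc n)) \<longlonglongrightarrow> x" using tendsto_add[OF tendsto_const LIMSEQ_Suc[OF lim_1_over_n]] by simp
      qed (use y in \<open>auto intro!: always_eventually less_imp_le\<close>)
      then have "(%n. V (y n) - Ws q (y n)) \<longlonglongrightarrow> V x - Ws q x"
      proof (rule continuous_on_tendsto_compose[OF cf])
        have "y n \<in> {0..}" for n using y(1)[of n] False by simp
        then show "\<forall>\<^sub>F n in sequentially. y n \<in> {0..}" by simp
      qed (use False in simp)
      moreover have "V (y n) - Ws q (y n) = 0" for n using y(1,3)[of n] feq[of "y n"] False by simp
      ultimately show ?thesis by (simp add: LIMSEQ_const_iff)
    qed (simp add: n Ws_neg)
  qed
qed

end

section \<open>Identification with the given Laplace exponent and scale function\<close>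

lemma scale_fn_eq:
  assumes L: "spec_neg_levy M X" and q: "0 <= q"
  defines "P \<equiv> distr M path_space (path_of X)"
  shows "psi M X = levy_law.\<psi> P" "scale_fn M X q = levy_law.Ws P q"
proof -
  interpret levy_law P unfolding P_def by (rule spec_neg_levy_law[OF L])
  have "psi M X th = \<psi> th" for th
    unfolding psi_def \<psi>_def mgf_def unfolding P_def
    using path_of_measurable[OF L] by (subst integral_distr) (auto simp: path_of_def)
  then show psi: "psi M X = \<psi>" by auto
  have Phi: "Phi M X q = growth q" unfolding Phi_def psi by (rule growth_greatest[OF q])
  have "is_scale_fn M X q (Ws q)"
    unfolding is_scale_fn_def Phi psi
  proof (intro conjI allI impI)
    show "mono_on {0..} (Ws q)" by (intro mono_onI Ws_mono q)
    show "continuous_on {0..} (Ws q)" by (rule Ws_continuous[OF q])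
    fix th assume th: "growth q < th"
    have "((%x. exp (- th * x) * Ws q x) has_integral (\<integral>x. exp (- th * x) * Ws q x \<partial>lborel)) UNIV"
      by (rule has_integral_integral_lborel[OF Ws_lap(1)[OF q th]])
    then have "((%x. exp (- th * x) * Ws q x) has_integral 1 / (\<psi> th - q)) UNIV" unfolding Ws_lap(2)[OF q th] .
    also have "(%x. exp (- th * x) * Ws q x) = (%x. if x \<in> {0..} then exp (- th * x) * Ws q x else 0)"
      by (auto simp: Ws_neg)
    finally show "((%y. exp (- th * y) * Ws q y) has_integral 1 / (\<psi> th - q)) {0..}" by (simp only: has_integral_restrict_UNIV)
  qed (simp add: Ws_neg)
  moreover have "V = Ws q" if "is_scale_fn M X q V" for V
    using that unfolding is_scale_fn_def Phi psi by (intro Ws_unique[OF q]) auto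
  ultimately show "scale_fn M X q = Ws q" unfolding scale_fn_def by (rule the_equality)
qed

section \<open>Passage downwards\<close>

lemma dn_param_measurable:
  assumes p: "p \<in> N \<rightarrow>\<^sub>M path_space" and f [measurable]: "f \<in> borel_measurable N"
  shows "Measurable.pred N (%z. fin (dn (f z)) (p z))" "(%z. hit (dn (f z)) (p z)) \<in> borel_measurable N"
proof -
  have [measurable]: "(%z. p z t) \<in> borel_measurable N" for t using measurable_compose[OF p eval_measurable[of t]] .
  show "Measurable.pred N (%z. fin (dn (f z)) (p z))" "(%z. hit (dn (f z)) (p z)) \<in> borel_measurable N"
    by (rule hit_param_measurable[OF _ p]; simp add: dn_def)+
qed

text \<open>The position at passage is measured from the level and not from the start. Then the
  weight is at most 1 for nonnegative q and u, and it is compatible with shifts, as in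
  \<open>dval_shift\<close>.\<close>

definition dval :: "real => real => real => (real => real) => real" where
  "dval q u x w = (if fin (dn x) w then exp (- q * hit (dn x) w + u * (x + w (hit (dn x) w))) else 0)"

lemma dval_measurable:
  assumes p [measurable]: "p \<in> N \<rightarrow>\<^sub>M path_space" and f [measurable]: "f \<in> borel_measurable N"
  shows "(%z. dval q u (f z) (p z)) \<in> borel_measurable N"
proof -
  note [measurable] = dn_param_measurable[OF p f] eval_at_measurable[OF p dn_param_measurable(2)[OF p f]]
  show ?thesis unfolding dval_def by measurable
qed

lemma dval_nonneg: "0 <= dval q u x w" by (simp add: dval_def)

lemma dval_le1: assumes w: "w \<in> Paths" and q: "0 <= q" "0 <= u" shows "dval q u x w <= 1"
proof (cases "fin (dn x) w")
  case True
  have "0 <= q * hit (dn x) w" using q hit_ge0[OF True] by simp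
  moreover have "u * (x + w (hit (dn x) w)) <= 0" using q dn_hit(1)[OF w True] by (intro mult_nonneg_nonpos) auto
  ultimately show ?thesis using True by (simp add: dval_def)
qed (simp add: dval_def)

text \<open>With the factor \<open>exp (- u * x)\<close> the weight concerns the position relative
  to the start, and a deeper level is passed later and lower. This gives measurability of
  \<open>D\<close> in x and, in \<open>D_formula\<close>, the step from almost all x to all
  x.\<close>

lemma dval_antimono:
  assumes w: "w \<in> Paths" and q: "0 <= q" "0 <= u" and xy: "x <= y"
  shows "exp (- u * y) * dval q u y w <= exp (- u * x) * dval q u x w"
proof (cases "fin (dn y) w")
  case fy: True
  then have fx: "fin (dn x) w" using xy by (force simp: fin_def dn_def)
  have e: "exp (- u * z) * dval q u z w = exp (- q * hit (dn z) w + u * w (hit (dn z) w))" if "fin (dn z) w" for z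
    using that by (simp add: dval_def exp_add[symmetric]) (simp add: algebra_simps)
  have le: "hit (dn x) w <= hit (dn y) w" using xy by (intro hit_greatest[OF fy] hit_le) (auto simp: dn_def)
  have "w (hit (dn y) w) <= w (hit (dn x) w)"
  proof (cases "hit (dn x) w = hit (dn y) w")
    case False
    then show ?thesis using dn_hit(2)[OF w fy hit_ge0[OF fx]] dn_hit(1)[OF w fy] le by simp
  qed simp
  then have "- q * hit (dn y) w + u * w (hit (dn y) w) <= - q * hit (dn x) w + u * w (hit (dn x) w)"
    using q le by (intro add_mono) (auto intro: mult_left_mono)
  then show ?thesis unfolding e[OF fx] e[OF fy] by simp
qed (simp add: dval_def)

lemma dval_shift:
  assumes w: "w \<in> Paths" and t: "0 <= t" and i: "- x <= rinf w t"
  shows "dval q u x w = exp (- q * t) * dval q u (x + w t) (pshift t w)"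
proof -
  have ge: "- x <= w s" if "0 <= s" "s <= t" for s using inf_on_le[OF w that] i by simp
  have a: "\<not> dn x w s" if "0 <= s" "s < t" for s using ge[of s] that by (simp add: dn_def)
  have b: "dn x w (t + s) \<longleftrightarrow> dn (x + w t) (pshift t w) s" if "0 <= s" for s using t that by (auto simp: dn_def pshift_at)
  note h = hit_shift[where Q="dn x" and Q'="dn (x + w t)", OF t a b]
  show ?thesis
  proof (cases "fin (dn (x + w t)) (pshift t w)")
    case True
    let ?s = "hit (dn (x + w t)) (pshift t w)"
    have "- q * (t + ?s) + u * (x + w (t + ?s)) = - q * t + (- q * ?s + u * (x + w t + pshift t w ?s))"
      using t hit_ge0[OF True] by (simp add: pshift_at algebra_simps)
    then show ?thesis using True h by (simp add: dval_def exp_add[symmetric])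
  qed (use h in \<open>simp add: dval_def\<close>)
qed

context levy_law begin

lemma dval_P [measurable]: "dval q u x \<in> borel_measurable P"
  unfolding measurable_cong_sets[OF sets_P refl] by (rule dval_measurable) auto

lemma path_at_P [measurable]: "(%w. w t) \<in> borel_measurable P" by measurable

definition D :: "real => real => real => real" where "D q u x = (\<E> w. dval q u x w)"

lemma dval_integrable: "0 <= q ==> 0 <= u ==> integrable P (dval q u x)"
  by (rule integrable_const_bound[where B=1]) (auto simp: dval_nonneg dval_le1)

lemma D_nn: "0 <= q ==> 0 <= u ==> (\<N> w. ennreal (dval q u x w)) = ennreal (D q u x)"
  unfolding D_def by (intro nn_integral_eq_integral dval_integrable) (auto simp: dval_nonneg)

lemma D_nonneg: "0 <= D q u x" unfolding D_def by (intro integral_nonneg_AE) (simp add: dval_nonneg)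

lemma D_le1: assumes "0 <= q" "0 <= u" shows "D q u x <= 1"
proof -
  have "D q u x <= (\<E> w. 1)" unfolding D_def using assms by (intro integral_mono dval_integrable) (auto simp: dval_le1)
  then show ?thesis using prob_space by simp
qed

lemma D_antimono: assumes q: "0 <= q" "0 <= u" and xy: "x <= y" shows "exp (- u * y) * D q u y <= exp (- u * x) * D q u x"
proof -
  have "(\<E> w. exp (- u * y) * dval q u y w) <= (\<E> w. exp (- u * x) * dval q u x w)"
    by (rule integral_mono) (use q xy in \<open>auto intro!: integrable_mult_right dval_integrable dval_antimono[simplified]\<close>)
  then show ?thesis by (simp add: D_def)
qed

lemma D_measurable [measurable]: assumes q: "0 <= q" "0 <= u" shows "D q u \<in> borel_measurable borel"
proof -
  have "(%x. - (exp (- u * x) * D q u x)) \<in> borel_measurable borel"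
    by (intro borel_measurable_mono monoI) (use D_antimono[OF q] in simp)
  then have "(%x. - exp (u * x) * (- (exp (- u * x) * D q u x))) \<in> borel_measurable borel" by (intro borel_measurable_times) auto
  moreover have "- exp (u * x) * (- (exp (- u * x) * D q u x)) = D q u x" for x by (simp add: exp_minus field_simps)
  ultimately have "(%x. D q u x) \<in> borel_measurable borel" by (simp only:)
  then show ?thesis by simp
qed

lemma D_markov:
  assumes q: "0 <= q" "0 <= u" and t: "0 <= t"
  shows "D q u x = (\<E> w. indicator {w. rinf w t < - x} w * dval q u x w) + exp (- q * t) * (\<E> w. indicator {w. - x <= rinf w t} w * D q u (x + w t))"
proof -
  note [measurable] = D_measurable[OF q]
  have i1: "integrable P (%w. indicator {w. rinf w t < - x} w * dval q u x w)"
    by (rule integrable_const_bound[where B=1]) (auto simp: dval_nonneg dval_le1 q indicator_def)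
  have i2: "integrable P (%w. indicator {w. - x <= rinf w t} w * dval q u x w)"
    by (rule integrable_const_bound[where B=1]) (auto simp: dval_nonneg dval_le1 q indicator_def)
  have "D q u x = (\<E> w. indicator {w. rinf w t < - x} w * dval q u x w + indicator {w. - x <= rinf w t} w * dval q u x w)"
    unfolding D_def by (intro Bochner_Integration.integral_cong) (auto simp: indicator_def)
  also have "... = (\<E> w. indicator {w. rinf w t < - x} w * dval q u x w) + (\<E> w. indicator {w. - x <= rinf w t} w * dval q u x w)"
    by (rule Bochner_Integration.integral_add[OF i1 i2])
  also have "(\<E> w. indicator {w. - x <= rinf w t} w * dval q u x w) = (\<E> w. indicator {w. - x <= rinf w t} w * (exp (- q * t) * D q u (x + w t)))"
  proof -
    define U where "U w = (rinf w t, w t)" for w :: "real => real"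
    define F where "F z = ennreal ((if - x <= fst (fst z) then exp (- q * t) else 0) * dval q u (x + snd (fst z)) (snd z))" for z :: "(real \<times> real) \<times> (real => real)"
    have [measurable]: "(%w. rinf w t) \<in> borel_measurable path_space" by (rule inf_on_measurable) auto
    have "(%z :: (real \<times> real) \<times> (real => real). dval q u (x + snd (fst z)) (snd z)) \<in> borel_measurable ((borel \<Otimes>\<^sub>M borel) \<Otimes>\<^sub>M path_space)"
      by (rule dval_measurable) measurable
    then have Fm: "F \<in> borel_measurable ((borel \<Otimes>\<^sub>M borel) \<Otimes>\<^sub>M path_space)" unfolding F_def by measurable
    have "(\<N> w. ennreal (indicator {w. - x <= rinf w t} w * dval q u x w)) = (\<N> w. F (U w, pshift t w))"
      by (intro nn_integral_cong) (auto simp: F_def U_def indicator_def dval_shift[OF _ t])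
    also have "... = (\<N> w. \<N> w'. F (U w, w'))"
      by (rule markov_nn[OF t _ Fm]) (auto simp: U_def stop_rinf pstop_at t)
    also have "... = (\<N> w. ennreal (indicator {w. - x <= rinf w t} w * (exp (- q * t) * D q u (x + w t))))"
    proof (intro nn_integral_cong)
      fix w :: "real => real"
      show "(\<N> w'. F (U w, w')) = ennreal (indicator {w. - x <= rinf w t} w * (exp (- q * t) * D q u (x + w t)))"
      proof (cases "- x <= rinf w t")
        case True
        have "(\<N> w'. F (U w, w')) = (\<N> w'. ennreal (exp (- q * t)) * ennreal (dval q u (x + w t) w'))"
          using True by (intro nn_integral_cong) (simp add: F_def U_def ennreal_mult dval_nonneg)
        also have "... = ennreal (exp (- q * t)) * ennreal (D q u (x + w t))"
          by (subst nn_integral_cmult) (auto simp: D_nn q)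
        finally show ?thesis using True by (simp add: ennreal_mult D_nonneg)
      qed (simp add: F_def U_def)
    qed
    finally have nn: "(\<N> w. ennreal (indicator {w. - x <= rinf w t} w * dval q u x w)) = (\<N> w. ennreal (indicator {w. - x <= rinf w t} w * (exp (- q * t) * D q u (x + w t))))" .
    have "(\<E> w. indicator {w. - x <= rinf w t} w * dval q u x w) = enn2real (\<N> w. ennreal (indicator {w. - x <= rinf w t} w * dval q u x w))"
      by (rule integral_eq_nn_integral) (auto simp: dval_nonneg)
    also have "... = (\<E> w. indicator {w. - x <= rinf w t} w * (exp (- q * t) * D q u (x + w t)))"
      unfolding nn by (rule integral_eq_nn_integral[symmetric]) (auto simp: D_nonneg)
    finally show ?thesis .
  qed
  also have "... = exp (- q * t) * (\<E> w. indicator {w. - x <= rinf w t} w * D q u (x + w t))"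
    by (subst integral_mult_right_zero[symmetric]) (simp only: mult.left_commute)
  finally show ?thesis .
qed

text \<open>The event refers to time t and yet is known immediately after the passage: at a time s
  up to t the fall has already been seen, and at a time s beyond t the whole path up to t is
  visible.\<close>

lemma determined_below:
  assumes t: "0 <= t" shows "determined {w\<in>Paths. fin (dn x) w & rinf w t < - x} (hit (dn x))"
proof (rule determined_hit)
  have [measurable]: "(%w. rinf w t) \<in> borel_measurable path_space" by (rule inf_on_measurable) auto
  show "Measurable.pred path_space (%w. rinf w t < - x)" by measurable
  fix w s assume w: "w \<in> Paths" and f: "fin (dn x) w" and h: "hit (dn x) w < s"
  show "(rinf (pstop s w) t < - x) = (rinf w t < - x)"
  proof (cases "s <= t")
    case True
    obtain r where r: "0 <= r" "r < s" "w r < - x" using h unfolding hit_less_iff[OF f] by (auto simp: dn_def)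
    have "rinf w t < - x" using inf_on_le[OF w, of 0 r t] r True by simp
    moreover have "rinf (pstop s w) t < - x" using inf_on_le[OF pstop_Paths[OF w], of 0 r t s] r True by (simp add: pstop_at)
    ultimately show ?thesis by simp
  qed (use t in \<open>simp add: stop_rinf\<close>)
qed simp

lemma below_fin: assumes "w \<in> Paths" "0 <= t" "rinf w t < - x" shows "fin (dn x) w" "hit (dn x) w <= t"
proof -
  obtain s where s: "0 <= s" "s <= t" "w s < - x" using assms by (auto simp: inf_on_less_iff)
  then show "fin (dn x) w" by (auto simp: fin_def dn_def)
  have "hit (dn x) w <= s" by (rule hit_le) (use s in \<open>auto simp: dn_def\<close>)
  then show "hit (dn x) w <= t" using s by simp
qed

text \<open>From the passage to t the path is an independent copy, which contributes its moment over
  the remaining time. This plays the role of optional stopping for the exponential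
  martingale.\<close>

lemma below_exp:
  assumes u: "0 <= u" and t: "0 <= t"
  shows "(\<E> w. indicator {w. rinf w t < - x} w * exp (u * w t)) = (\<E> w. indicator {w. rinf w t < - x} w * exp (u * w (hit (dn x) w) + (t - hit (dn x) w) * \<psi> u))"
proof -
  let ?A = "{w\<in>Paths. fin (dn x) w & rinf w t < - x}" and ?B = "{w. rinf w t < - x}"
  let ?T = "hit (dn x)"
  have ind: "indicator ?B w = (indicator ?A w :: real)" if "w \<in> Paths" for w using below_fin[OF that t] that by (auto simp: indicator_def)
  define V where "V w = (?T w, w (?T w))" for w
  define F where "F z = ennreal (exp (u * (snd (fst z) + snd z (t - fst (fst z)))))" for z :: "(real \<times> real) \<times> (real => real)"
  have hm [measurable]: "?T \<in> borel_measurable path_space" by (rule hit_measurable) simp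
  have [measurable]: "(%w. w (?T w)) \<in> borel_measurable path_space" by (rule eval_at_measurable) auto
  have Vm: "V \<in> path_space \<rightarrow>\<^sub>M borel \<Otimes>\<^sub>M borel" unfolding V_def by measurable
  have "(%z :: (real \<times> real) \<times> (real => real). snd z (t - fst (fst z))) \<in> borel_measurable ((borel \<Otimes>\<^sub>M borel) \<Otimes>\<^sub>M path_space)"
    by (rule eval_at_measurable) measurable
  then have Fm: "F \<in> borel_measurable ((borel \<Otimes>\<^sub>M borel) \<Otimes>\<^sub>M path_space)" unfolding F_def by measurable
  have "(\<N> w. ennreal (indicator ?B w * exp (u * w t))) = (\<N> w. indicator ?A w * F (V w, pshift (?T w) w))"
  proof (rule nn_integral_cong)
    fix w assume "w \<in> space P"
    then have w: "w \<in> Paths" by simp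
    show "ennreal (indicator ?B w * exp (u * w t)) = indicator ?A w * F (V w, pshift (?T w) w)"
    proof (cases "w \<in> ?A")
      case True
      then have "0 <= ?T w" "?T w <= t" using hit_ge0 below_fin[OF w t] by auto
      then show ?thesis using True by (simp add: F_def V_def pshift_at)
    qed (simp add: ind[OF w])
  qed
  also have "... = (\<N> w. indicator ?A w * (\<N> w'. F (V w, w')))"
  proof (rule strong_markov[OF determined_below[OF t] Vm _ Fm])
    fix w s assume "w \<in> ?A" "?T w < s"
    then show "V (pstop s w) = V w" using hit_stop(2)[of "dn x" w s] by (auto simp: V_def pstop_at)
  qed
  also have "... = (\<N> w. ennreal (indicator ?B w * exp (u * w (?T w) + (t - ?T w) * \<psi> u)))"
  proof (rule nn_integral_cong)
    fix w assume "w \<in> space P"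
    then have w: "w \<in> Paths" by simp
    show "indicator ?A w * (\<N> w'. F (V w, w')) = ennreal (indicator ?B w * exp (u * w (?T w) + (t - ?T w) * \<psi> u))"
    proof (cases "w \<in> ?A")
      case True
      then have T: "0 <= t - ?T w" using below_fin[OF w t] by auto
      have "(\<N> w'. F (V w, w')) = (\<N> w'. ennreal (exp (u * w (?T w))) * ennreal (exp (u * w' (t - ?T w))))"
        by (intro nn_integral_cong) (simp add: F_def V_def ennreal_mult[symmetric] exp_add[symmetric] distrib_left)
      also have "... = ennreal (exp (u * w (?T w))) * (\<N> w'. ennreal (exp (u * w' (t - ?T w))))"
        by (rule nn_integral_cmult) measurable
      also have "... = ennreal (exp (u * w (?T w) + (t - ?T w) * \<psi> u))"
        by (simp add: mgf_nn[OF u T] mgf_exp[OF u T] ennreal_mult[symmetric] exp_add)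
      finally show ?thesis using True by simp
    qed (simp add: ind[OF w])
  qed
  finally have nn: "(\<N> w. ennreal (indicator ?B w * exp (u * w t))) = (\<N> w. ennreal (indicator ?B w * exp (u * w (?T w) + (t - ?T w) * \<psi> u)))" .
  have "(\<E> w. indicator ?B w * exp (u * w t)) = enn2real (\<N> w. ennreal (indicator ?B w * exp (u * w t)))"
    by (rule integral_eq_nn_integral) auto
  also have "... = (\<E> w. indicator ?B w * exp (u * w (?T w) + (t - ?T w) * \<psi> u))"
    unfolding nn by (rule integral_eq_nn_integral[symmetric]) auto
  finally show ?thesis .
qed

end

section \<open>The defect of the transform at downward passage\<close>

context levy_law begin

lemma D_exit:
  assumes q: "0 <= q" "0 <= u" and b: "0 <= b"
  shows "(\<E> w. indicator (exit_up x b) w * dval q u x w) = hh q x b * D q u (x + b)"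
proof -
  have hm [measurable]: "hit (up b) \<in> borel_measurable path_space" by (rule hit_measurable) simp
  have dm [measurable]: "dval q u (x + b) \<in> borel_measurable path_space" by (rule dval_measurable) auto
  have "(\<N> w. ennreal (indicator (exit_up x b) w * dval q u x w)) = (\<N> w. indicator (exit_up x b) w * (ennreal (exp (- q * hit (up b) w)) * ennreal (dval q u (x + b) (pshift (hit (up b) w) w))))"
  proof (rule nn_integral_cong)
    fix w assume "w \<in> space P"
    then have w: "w \<in> Paths" by simp
    show "ennreal (indicator (exit_up x b) w * dval q u x w) = indicator (exit_up x b) w * (ennreal (exp (- q * hit (up b) w)) * ennreal (dval q u (x + b) (pshift (hit (up b) w) w)))"
    proof (cases "w \<in> exit_up x b")
      case True
      then have f: "fin (up b) w" and i: "- x <= rinf w (hit (up b) w)" by (auto simp: exit_up_def)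
      show ?thesis using True dval_shift[OF w hit_ge0[OF f] i, of q u] up_hit(1)[OF w b f] by (simp add: ennreal_mult[symmetric] dval_nonneg)
    qed simp
  qed
  also have "... = (\<N> w. indicator (exit_up x b) w * ennreal (exp (- q * hit (up b) w))) * (\<N> w. ennreal (dval q u (x + b) w))"
  proof (rule strong_markov_prod[OF determined_exit_up])
    fix w t assume "w \<in> exit_up x b" "hit (up b) w < t"
    then show "ennreal (exp (- q * hit (up b) (pstop t w))) = ennreal (exp (- q * hit (up b) w))"
      using hit_stop(2)[of "up b" w t] by (auto simp: exit_up_def)
  qed auto
  also have "... = ennreal (hh q x b * D q u (x + b))" by (simp only: hh_nn[OF q(1)] D_nn[OF q] ennreal_mult[OF hh_nonneg[OF q(1)] D_nonneg])
  finally have nn: "(\<N> w. ennreal (indicator (exit_up x b) w * dval q u x w)) = ennreal (hh q x b * D q u (x + b))" .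
  have "(\<E> w. indicator (exit_up x b) w * dval q u x w) = enn2real (\<N> w. ennreal (indicator (exit_up x b) w * dval q u x w))"
    by (rule integral_eq_nn_integral) (auto simp: dval_nonneg)
  then show ?thesis unfolding nn using q by (simp add: hh_nonneg D_nonneg)
qed

text \<open>For x < 0 the level is passed at time 0 and the transform equals
  \<open>exp (u * x)\<close>. The difference therefore vanishes beyond the floor in a natural way,
  as the locale for Laplace transforms requires, whereas \<open>D\<close> itself does not.\<close>

definition dgap :: "real => real => real => real" where "dgap q u x = (if x < 0 then 0 else exp (u * x) - D q u x)"

lemma dgap_levy_laplace: assumes q: "0 <= q" "0 <= u" shows "levy_laplace P (dgap q u) u 1"
proof unfold_locales
  have [measurable]: "D q u \<in> borel_measurable borel" by (rule D_measurable[OF q])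
  show "dgap q u \<in> borel_measurable borel" unfolding dgap_def[abs_def] by simp
  show "0 <= dgap q u x" for x
  proof (cases "x < 0")
    case False
    then have "1 <= exp (u * x)" using q by simp
    then show ?thesis using order_trans[OF D_le1[OF q, of x] \<open>1 <= exp (u * x)\<close>] False unfolding dgap_def by simp
  qed (simp add: dgap_def)
qed (use q D_nonneg in \<open>auto simp: dgap_def\<close>)

lemma dgap_integrable:
  assumes q: "0 <= q" "0 <= u" and t: "0 <= t"
  shows "integrable P (%w. indicator {w. - x <= rinf w t} w * dgap q u (x + w t))"
proof -
  interpret G: levy_laplace P "dgap q u" u 1 by (rule dgap_levy_laplace[OF q])
  show ?thesis
  proof (rule Bochner_Integration.integrable_bound)
    show "integrable P (%w. exp (u * x) * exp (u * w t))" by (intro integrable_mult_right exp_integrable q t)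
    show "AE w in P. norm (indicator {w. - x <= rinf w t} w * dgap q u (x + w t)) <= norm (exp (u * x) * exp (u * w t))"
    proof (rule AE_I2)
      fix w :: "real => real"
      have "dgap q u (x + w t) <= exp (u * x) * exp (u * w t)"
        using G.g_growth[of "x + w t"] by (cases "x + w t < 0") (auto simp: dgap_def exp_add[symmetric] distrib_left)
      then show "norm (indicator {w. - x <= rinf w t} w * dgap q u (x + w t)) <= norm (exp (u * x) * exp (u * w t))"
        using G.g_nonneg by (auto simp: indicator_def)
    qed
  qed measurable
qed

text \<open>Up to the passage, \<open>exp (u * x)\<close> discounted at rate q changes at rate
  \<kappa>, and \<open>D\<close> is harmonic. On paths that pass before t the two accounts differ by
  the factor \<open>exp (\<kappa> * (t - T))\<close> for the time left after the passage time T, so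
  the error is of order t times the probability of passage.\<close>

lemma dgap_markov:
  assumes q: "0 <= q" "0 <= u" and t: "0 <= t" and x: "0 <= x" and k: "\<kappa> = \<psi> u - q"
  shows "\<bar>dgap q u x - exp (u * x) * (1 - exp (\<kappa> * t)) - exp (- q * t) * (\<E> w. indicator {w. - x <= rinf w t} w * dgap q u (x + w t))\<bar>
    <= (\<bar>\<kappa>\<bar> * t * exp (\<bar>\<kappa>\<bar> * t)) * prob (hits (dn x) t)"
proof -
  let ?B = "{w. rinf w t < - x}" and ?C = "{w. - x <= rinf w t}" and ?T = "hit (dn x)"
  let ?e = "%w. exp (u * w (?T w) + (t - ?T w) * \<psi> u)"
  note [measurable] = D_measurable[OF q]
  have hm [measurable]: "?T \<in> borel_measurable P"
    unfolding measurable_cong_sets[OF sets_P refl] by (rule hit_measurable) simp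
  have [measurable]: "(%w. w (?T w)) \<in> borel_measurable P"
    unfolding measurable_cong_sets[OF sets_P refl] by (rule eval_at_measurable) auto
  note ei = exp_integrable[OF q(2) t]
  have iB: "integrable P (%w. indicator ?B w * exp (u * w t))" and iC: "integrable P (%w. indicator ?C w * exp (u * w t))"
    by (rule Bochner_Integration.integrable_bound[OF ei]; auto simp: indicator_def)+
  have iD: "integrable P (%w. indicator ?C w * D q u (x + w t))"
    by (rule integrable_const_bound[where B=1]) (auto simp: indicator_def D_nonneg D_le1[OF q])
  have iv: "integrable P (%w. indicator ?B w * dval q u x w)"
    by (rule integrable_const_bound[where B=1]) (auto simp: dval_nonneg dval_le1 q indicator_def)
  have ie: "integrable P (%w. indicator ?B w * ?e w)"
  proof (rule integrable_const_bound[where B="exp (t * \<bar>\<psi> u\<bar>)"])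
    show "AE w in P. norm (indicator ?B w * ?e w) <= exp (t * \<bar>\<psi> u\<bar>)"
    proof (rule AE_I2)
      fix w assume "w \<in> space P"
      then have w: "w \<in> Paths" by simp
      show "norm (indicator ?B w * ?e w) <= exp (t * \<bar>\<psi> u\<bar>)"
      proof (cases "w \<in> ?B")
        case True
        then have f: "fin (dn x) w" and h: "?T w <= t" using below_fin[OF w t] by auto
        have "u * w (?T w) <= 0" using dn_hit(1)[OF w f] x q by (intro mult_nonneg_nonpos) auto
        moreover have "(t - ?T w) * \<psi> u <= t * \<bar>\<psi> u\<bar>" using h hit_ge0[OF f] by (intro order_trans[OF mult_left_mono[OF abs_ge_self] mult_right_mono]) auto
        ultimately show ?thesis using True by simp
      qed simp
    qed
  qed measurable
  have "exp (t * \<psi> u) = (\<E> w. exp (u * w t))" using mgf_exp[OF q(2) t] by (simp add: mgf_def)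
  also have "... = (\<E> w. indicator ?B w * exp (u * w t) + indicator ?C w * exp (u * w t))"
    by (intro Bochner_Integration.integral_cong) (auto simp: indicator_def)
  also have "... = (\<E> w. indicator ?B w * exp (u * w t)) + (\<E> w. indicator ?C w * exp (u * w t))"
    by (rule Bochner_Integration.integral_add[OF iB iC])
  finally have E: "(\<E> w. indicator ?C w * exp (u * w t)) = exp (t * \<psi> u) - (\<E> w. indicator ?B w * ?e w)"
    unfolding below_exp[OF q(2) t] by simp
  have "(\<E> w. indicator ?C w * dgap q u (x + w t)) = (\<E> w. exp (u * x) * (indicator ?C w * exp (u * w t)) - indicator ?C w * D q u (x + w t))"
  proof (rule Bochner_Integration.integral_cong[OF refl])
    fix w assume "w \<in> space P"
    then have w: "w \<in> Paths" by simp
    have "0 <= x + w t" if "- x <= rinf w t" using inf_on_le[OF w t order_refl] that by simp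
    then show "indicator ?C w * dgap q u (x + w t) = exp (u * x) * (indicator ?C w * exp (u * w t)) - indicator ?C w * D q u (x + w t)"
      by (auto simp: indicator_def dgap_def exp_add distrib_left)
  qed
  also have "... = exp (u * x) * (\<E> w. indicator ?C w * exp (u * w t)) - (\<E> w. indicator ?C w * D q u (x + w t))"
    by (subst Bochner_Integration.integral_diff[OF integrable_mult_right iD]) (rule iC, simp)
  finally have m: "(\<E> w. indicator ?C w * dgap q u (x + w t)) = exp (u * x) * (exp (t * \<psi> u) - (\<E> w. indicator ?B w * ?e w)) - (\<E> w. indicator ?C w * D q u (x + w t))"
    unfolding E .
  have D: "exp (- q * t) * (\<E> w. indicator ?C w * D q u (x + w t)) = D q u x - (\<E> w. indicator ?B w * dval q u x w)"
    using D_markov[OF q t, of x] by simp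
  have kt: "exp (- q * t) * exp (t * \<psi> u) = exp (\<kappa> * t)" unfolding k by (subst exp_add[symmetric]) (simp add: algebra_simps)
  have "exp (- q * t) * (\<E> w. indicator ?C w * dgap q u (x + w t)) = exp (u * x) * (exp (- q * t) * exp (t * \<psi> u)) - exp (u * x) * exp (- q * t) * (\<E> w. indicator ?B w * ?e w) - exp (- q * t) * (\<E> w. indicator ?C w * D q u (x + w t))"
    unfolding m by (simp only: right_diff_distrib mult_ac)
  then have "dgap q u x - exp (u * x) * (1 - exp (\<kappa> * t)) - exp (- q * t) * (\<E> w. indicator ?C w * dgap q u (x + w t)) = exp (u * x) * exp (- q * t) * (\<E> w. indicator ?B w * ?e w) - (\<E> w. indicator ?B w * dval q u x w)"
    using x unfolding D kt dgap_def by (simp add: right_diff_distrib)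
  also have "... = (\<E> w. exp (u * x) * exp (- q * t) * (indicator ?B w * ?e w) - indicator ?B w * dval q u x w)"
    by (subst Bochner_Integration.integral_diff[OF integrable_mult_right iv]) (rule ie, simp)
  finally have eq: "dgap q u x - exp (u * x) * (1 - exp (\<kappa> * t)) - exp (- q * t) * (\<E> w. indicator ?C w * dgap q u (x + w t)) = (\<E> w. exp (u * x) * exp (- q * t) * (indicator ?B w * ?e w) - indicator ?B w * dval q u x w)" .
  have "norm (\<E> w. exp (u * x) * exp (- q * t) * (indicator ?B w * ?e w) - indicator ?B w * dval q u x w) <= (\<E> w. (\<bar>\<kappa>\<bar> * t * exp (\<bar>\<kappa>\<bar> * t)) * indicator (hits (dn x) t) w)"
  proof (rule order_trans[OF integral_norm_bound integral_mono])
    show "integrable P (%w. norm (exp (u * x) * exp (- q * t) * (indicator ?B w * ?e w) - indicator ?B w * dval q u x w))"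
      by (rule integrable_norm[OF Bochner_Integration.integrable_diff[OF integrable_mult_right iv]]) (rule ie)
    show "integrable P (%w. (\<bar>\<kappa>\<bar> * t * exp (\<bar>\<kappa>\<bar> * t)) * indicator (hits (dn x) t) w)" by (auto simp: hits_P less_top[symmetric])
    fix w assume "w \<in> space P"
    then have w: "w \<in> Paths" by simp
    show "norm (exp (u * x) * exp (- q * t) * (indicator ?B w * ?e w) - indicator ?B w * dval q u x w) <= (\<bar>\<kappa>\<bar> * t * exp (\<bar>\<kappa>\<bar> * t)) * indicator (hits (dn x) t) w"
    proof (cases "w \<in> ?B")
      case True
      then have f: "fin (dn x) w" and h: "?T w <= t" using below_fin[OF w t] by auto
      have evw: "w \<in> hits (dn x) t" using w f h by (simp add: hits_def)
      have "exp (u * x) * exp (- q * t) * ?e w = dval q u x w * exp (\<kappa> * (t - ?T w))"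
        using f unfolding dval_def k by (simp add: exp_add[symmetric]) (simp add: algebra_simps)
      then have "norm (exp (u * x) * exp (- q * t) * (indicator ?B w * ?e w) - indicator ?B w * dval q u x w) = dval q u x w * \<bar>exp (\<kappa> * (t - ?T w)) - 1\<bar>"
      proof -
        have "dval q u x w * exp (\<kappa> * (t - ?T w)) - dval q u x w = dval q u x w * (exp (\<kappa> * (t - ?T w)) - 1)" by (simp add: right_diff_distrib)
        then show ?thesis using True dval_nonneg[of q u x w] \<open>exp (u * x) * exp (- q * t) * ?e w = dval q u x w * exp (\<kappa> * (t - ?T w))\<close> by (simp add: abs_mult)
      qed
      also have "... <= 1 * (\<bar>\<kappa> * (t - ?T w)\<bar> * exp \<bar>\<kappa> * (t - ?T w)\<bar>)"
        by (intro mult_mono dval_le1 exp_minus_one_le w q) (auto simp: dval_nonneg)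
      also have "\<bar>\<kappa> * (t - ?T w)\<bar> <= \<bar>\<kappa>\<bar> * t" using h hit_ge0[OF f] by (simp add: abs_mult mult_left_mono)
      then have "1 * (\<bar>\<kappa> * (t - ?T w)\<bar> * exp \<bar>\<kappa> * (t - ?T w)\<bar>) <= (\<bar>\<kappa>\<bar> * t) * exp (\<bar>\<kappa>\<bar> * t)" unfolding mult_1 by (intro mult_mono) (use t in auto)
      finally show ?thesis using evw by simp
    qed (use t in simp)
  qed
  moreover have "hits (dn x) t \<inter> Paths = hits (dn x) t" by (auto simp: hits_def)
  ultimately show ?thesis unfolding eq by simp
qed

lemma prob_dn_antimono: "x <= y ==> prob (hits (dn y) t) <= prob (hits (dn x) t)"
proof (rule finite_measure_mono)
  assume xy: "x <= y"
  show "hits (dn y) t \<subseteq> hits (dn x) t"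
  proof
    fix w assume "w \<in> hits (dn y) t"
    then have w: "w \<in> Paths" "fin (dn y) w" "hit (dn y) w <= t" by (auto simp: hits_def)
    then have f: "fin (dn x) w" using xy by (force simp: fin_def dn_def)
    have "hit (dn x) w <= hit (dn y) w" using xy by (intro hit_greatest[OF w(2)] hit_le) (auto simp: dn_def)
    then show "w \<in> hits (dn x) t" using w f by (simp add: hits_def)
  qed
qed (simp add: hits_P)

lemma prob_dn_measurable [measurable]: "(%x. prob (hits (dn x) t)) \<in> borel_measurable borel"
proof -
  have "(%x. - prob (hits (dn x) t)) \<in> borel_measurable borel"
    by (intro borel_measurable_mono monoI) (simp add: prob_dn_antimono)
  then show ?thesis by simp
qed

text \<open>For fixed x > 0 the probability of passage within a vanishing time tends to 0.
  Integrated over x, this makes the error of \<open>dgap_markov\<close> of smaller order than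
  t.\<close>

lemma prob_dn_laplace:
  assumes th: "th > 0"
  shows "integrable lborel (%x. exp (- th * x) * indicator {0..} x * prob (hits (dn x) t))"
    "(%n. \<integral>x. exp (- th * x) * indicator {0..} x * prob (hits (dn x) (1 / real (Suc n))) \<partial>lborel) \<longlonglongrightarrow> 0"
proof -
  have b: "norm (exp (- th * x) * indicator {0..} x * prob (hits (dn x) t)) <= exp (- th * x) * indicator {0..} x" for x t
    by (auto simp: indicator_def)
  show "integrable lborel (%x. exp (- th * x) * indicator {0..} x * prob (hits (dn x) t))"
    by (rule Bochner_Integration.integrable_bound[OF integral_exp_tail(1)[OF th]]) (use b[of _ t] in \<open>auto simp: indicator_def\<close>)
  have "(%n. \<integral>x. exp (- th * x) * indicator {0..} x * prob (hits (dn x) (1 / real (Suc n))) \<partial>lborel) \<longlonglongrightarrow> (\<integral>x. 0 \<partial>(lborel :: real measure))"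
  proof (rule integral_dominated_convergence[OF _ _ integral_exp_tail(1)[OF th]])
    show "AE x in lborel. (%n. exp (- th * x) * indicator {0..} x * prob (hits (dn x) (1 / real (Suc n)))) \<longlonglongrightarrow> 0"
      using AE_lborel_singleton[of 0]
    proof eventually_elim
      fix x :: real assume x: "x \<noteq> 0"
      show "(%n. exp (- th * x) * indicator {0..} x * prob (hits (dn x) (1 / real (Suc n)))) \<longlonglongrightarrow> 0"
      proof (cases "x < 0")
        case False
        then have "(%n. prob (hits (dn x) (1 / real (Suc n)))) \<longlonglongrightarrow> 0" using x by (intro hits_to_0 dn_pos) auto
        then show ?thesis by (rule tendsto_mult_right_zero)
      qed simp
    qed
    show "AE x in lborel. norm (exp (- th * x) * indicator {0..} x * prob (hits (dn x) (1 / real (Suc n)))) <= exp (- th * x) * indicator {0..} x" for n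
      by (rule AE_I2) (rule b)
  qed auto
  then show "(%n. \<integral>x. exp (- th * x) * indicator {0..} x * prob (hits (dn x) (1 / real (Suc n))) \<partial>lborel) \<longlonglongrightarrow> 0" by simp
qed

lemma dgap_laplace_bound:
  assumes q: "0 <= q" "0 <= u" and t: "0 <= t" and th: "th > u" and k: "\<kappa> = \<psi> u - q"
  shows "\<exists>h. (\<E> w. exp (th * w t) * levy_laplace.part (dgap q u) th (w t - rinf w t)) = exp (t * \<psi> th) * levy_laplace.lap (dgap q u) th - h &
    \<bar>levy_laplace.lap (dgap q u) th - (1 - exp (\<kappa> * t)) / (th - u) - exp (- q * t) * h\<bar> <= (\<bar>\<kappa>\<bar> * t * exp (\<bar>\<kappa>\<bar> * t)) * (\<integral>x. exp (- th * x) * indicator {0..} x * prob (hits (dn x) t) \<partial>lborel)"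
proof -
  interpret G: levy_laplace P "dgap q u" u 1 by (rule dgap_levy_laplace[OF q])
  define m where "m x = (\<E> w. indicator {w. - x <= rinf w t} w * dgap q u (x + w t))" for x
  define h where "h = (\<integral>x. exp (- th * x) * m x \<partial>lborel)"
  have m0: "0 <= m x" for x unfolding m_def by (intro integral_nonneg_AE) (auto simp: G.g_nonneg)
  have mn: "(\<N> w. indicator {w. - x <= rinf w t} w * ennreal (dgap q u (x + w t))) = ennreal (m x)" for x
  proof -
    have "(\<N> w. indicator {w. - x <= rinf w t} w * ennreal (dgap q u (x + w t))) = (\<N> w. ennreal (indicator {w. - x <= rinf w t} w * dgap q u (x + w t)))"
      by (intro nn_integral_cong) (auto simp: indicator_def)
    also have "... = ennreal (m x)" unfolding m_def by (rule nn_integral_eq_integral[OF dgap_integrable[OF q t]]) (auto simp: G.g_nonneg)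
    finally show ?thesis .
  qed
  have mneg: "m x = 0" if "x < 0" for x
  proof -
    have "m x = (\<E> w. 0)" unfolding m_def
    proof (rule Bochner_Integration.integral_cong[OF refl])
      fix w assume "w \<in> space P"
      then have "\<not> - x <= rinf w t" using rinf_le0[of w t] t that by simp
      then show "indicator {w. - x <= rinf w t} w * dgap q u (x + w t) = 0" by simp
    qed
    then show ?thesis by simp
  qed
  have mm [measurable]: "m \<in> borel_measurable borel"
  proof -
    have rm [measurable]: "(%z. rinf (snd z) t) \<in> borel_measurable (borel \<Otimes>\<^sub>M P)" "(%z. snd z t) \<in> borel_measurable (borel \<Otimes>\<^sub>M P)"
      using measurable_compose[OF measurable_snd rinf_P[of t], of borel] measurable_compose[OF measurable_snd, of "%w. w t" P borel borel] by auto
    have "(%x. \<E> w. (if - x <= rinf w t then 1 else 0) * dgap q u (x + w t)) \<in> borel_measurable borel"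
      by (rule borel_measurable_lebesgue_integral) (simp add: case_prod_beta')
    moreover have "indicator {w. - x <= rinf w t} w = (if - x <= rinf w t then 1 else 0 :: real)" for x w by (simp add: indicator_def)
    ultimately show ?thesis unfolding m_def by (simp only:)
  qed
  have H: "(\<integral>\<^sup>+x. ennreal (exp (- th * x)) * (\<N> w. indicator {w. - x <= rinf w t} w * ennreal (dgap q u (x + w t))) \<partial>lborel) = (\<integral>\<^sup>+x. ennreal (exp (- th * x) * m x) \<partial>lborel)"
    unfolding mn using m0 by (intro nn_integral_cong) (simp add: ennreal_mult)
  have "(\<integral>\<^sup>+x. ennreal (exp (- th * x) * m x) \<partial>lborel) <= ennreal (mgf th t) * ennreal (G.lap th)"
    by (rule order_trans[OF _ eq_refl[OF G.laplace_identity[OF th t, unfolded H]]]) simp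
  also have "... < \<infinity>" by (simp add: ennreal_mult_less_top)
  finally have im: "integrable lborel (%x. exp (- th * x) * m x)" using m0 by (intro integrableI_nonneg) auto
  have h0: "0 <= h" unfolding h_def using m0 by (intro integral_nonneg_AE) auto
  have hn: "(\<integral>\<^sup>+x. ennreal (exp (- th * x) * m x) \<partial>lborel) = ennreal h"
    unfolding h_def using m0 by (intro nn_integral_eq_integral[OF im]) auto
  have e1: "(\<E> w. exp (th * w t) * G.part th (w t - rinf w t)) = exp (t * \<psi> th) * G.lap th - h"
    by (rule G.rem_eq[OF th t h0]) (simp only: H hn)
  have th': "th - u > 0" "th > 0" using th q by auto
  note il = G.lap_integrable[OF th] and it = integral_exp_tail[OF th'(1)] and ip = prob_dn_laplace(1)[OF th'(2), of t]
  define f where "f x = (exp (- th * x) * dgap q u x - (1 - exp (\<kappa> * t)) * (exp (- (th - u) * x) * indicator {0..} x)) - exp (- q * t) * (exp (- th * x) * m x)" for x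
  have i1: "integrable lborel (%x. exp (- th * x) * dgap q u x - (1 - exp (\<kappa> * t)) * (exp (- (th - u) * x) * indicator {0..} x))"
    by (rule Bochner_Integration.integrable_diff[OF il integrable_mult_right]) (rule it(1))
  have fi: "integrable lborel f" unfolding f_def by (rule Bochner_Integration.integrable_diff[OF i1 integrable_mult_right]) (rule im)
  have "(\<integral>x. f x \<partial>lborel) = (G.lap th - (1 - exp (\<kappa> * t)) * (1 / (th - u))) - exp (- q * t) * h"
    unfolding f_def
    by (subst Bochner_Integration.integral_diff[OF i1 integrable_mult_right], rule im, subst Bochner_Integration.integral_diff[OF il integrable_mult_right], rule it(1))
      (simp only: integral_mult_right_zero it(2) h_def G.lap_def)
  moreover have "norm (\<integral>x. f x \<partial>lborel) <= (\<integral>x. (\<bar>\<kappa>\<bar> * t * exp (\<bar>\<kappa>\<bar> * t)) * (exp (- th * x) * indicator {0..} x * prob (hits (dn x) t)) \<partial>lborel)"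
  proof (rule Bochner_Integration.integral_norm_bound_integral[OF fi integrable_mult_right[OF ip]])
    fix x :: real
    show "norm (f x) <= (\<bar>\<kappa>\<bar> * t * exp (\<bar>\<kappa>\<bar> * t)) * (exp (- th * x) * indicator {0..} x * prob (hits (dn x) t))"
    proof (cases "x < 0")
      case False
      have e: "exp (- (th - u) * x) = exp (- th * x) * exp (u * x)" by (subst exp_add[symmetric]) (simp add: algebra_simps)
      have "f x = exp (- th * x) * (dgap q u x - exp (u * x) * (1 - exp (\<kappa> * t)) - exp (- q * t) * m x)"
        using False unfolding f_def e by (simp add: algebra_simps)
      then have "norm (f x) = exp (- th * x) * \<bar>dgap q u x - exp (u * x) * (1 - exp (\<kappa> * t)) - exp (- q * t) * m x\<bar>" by (simp only: real_norm_def abs_mult abs_exp_cancel)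
      also have "... <= exp (- th * x) * ((\<bar>\<kappa>\<bar> * t * exp (\<bar>\<kappa>\<bar> * t)) * prob (hits (dn x) t))"
        unfolding m_def by (intro mult_left_mono dgap_markov q t k) (use False in auto)
      finally show ?thesis using False by (simp add: mult_ac)
    qed (simp add: f_def mneg dgap_def)
  qed
  ultimately have "\<bar>G.lap th - (1 - exp (\<kappa> * t)) / (th - u) - exp (- q * t) * h\<bar> <= (\<bar>\<kappa>\<bar> * t * exp (\<bar>\<kappa>\<bar> * t)) * (\<integral>x. exp (- th * x) * indicator {0..} x * prob (hits (dn x) t) \<partial>lborel)"
    by simp
  with e1 show ?thesis by blast
qed

text \<open>The argument for \<open>W q\<close> with a source added: the rate \<psi> u - q acts on
  the function exp (u x) for x >= 0, whose transform is 1 / (th - u).\<close>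

lemma dgap_limit:
  assumes q: "0 <= q" "0 <= u" and th: "th > u"
  shows "levy_laplace.rem P (dgap q u) th \<longlonglongrightarrow> (\<psi> th - q) * levy_laplace.lap (dgap q u) th - (\<psi> u - q) / (th - u)"
proof -
  interpret G: levy_laplace P "dgap q u" u 1 by (rule dgap_levy_laplace[OF q])
  define \<kappa> where "\<kappa> = \<psi> u - q"
  define N where "N n = real (Suc n)" for n
  have N0: "N n > 0" "0 <= 1 / N n" for n by (auto simp: N_def)
  have lN: "(%n. 1 / N n) \<longlonglongrightarrow> 0" unfolding N_def by (rule LIMSEQ_Suc[OF lim_1_over_n])
  define p where "p n = (\<integral>x. exp (- th * x) * indicator {0..} x * prob (hits (dn x) (1 / N n)) \<partial>lborel)" for n
  have pl: "p \<longlonglongrightarrow> 0" unfolding p_def N_def by (rule prob_dn_laplace(2)) (use th q in simp)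
  have "\<exists>h. \<forall>n. (\<E> w. exp (th * w (1 / N n)) * G.part th (w (1 / N n) - rinf w (1 / N n))) = exp (1 / N n * \<psi> th) * G.lap th - h n &
    \<bar>G.lap th - (1 - exp (\<kappa> * (1 / N n))) / (th - u) - exp (- q * (1 / N n)) * h n\<bar> <= (\<bar>\<kappa>\<bar> * (1 / N n) * exp (\<bar>\<kappa>\<bar> * (1 / N n))) * p n"
    using dgap_laplace_bound[OF q N0(2) th \<kappa>_def] unfolding p_def by (intro choice allI) blast
  then obtain h where h1: "!!n. (\<E> w. exp (th * w (1 / N n)) * G.part th (w (1 / N n) - rinf w (1 / N n))) = exp (1 / N n * \<psi> th) * G.lap th - h n"
    and h2: "!!n. \<bar>G.lap th - (1 - exp (\<kappa> * (1 / N n))) / (th - u) - exp (- q * (1 / N n)) * h n\<bar> <= (\<bar>\<kappa>\<bar> * (1 / N n) * exp (\<bar>\<kappa>\<bar> * (1 / N n))) * p n" by blast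
  define d where "d n = N n * (G.lap th - (1 - exp (\<kappa> * (1 / N n))) / (th - u) - exp (- q * (1 / N n)) * h n)" for n
  have dl: "d \<longlonglongrightarrow> 0"
  proof (rule Lim_null_comparison)
    show "\<forall>\<^sub>F n in sequentially. norm (d n) <= \<bar>\<kappa>\<bar> * exp (\<bar>\<kappa>\<bar> * (1 / N n)) * p n"
    proof (intro always_eventually allI)
      fix n
      have "norm (d n) <= N n * ((\<bar>\<kappa>\<bar> * (1 / N n) * exp (\<bar>\<kappa>\<bar> * (1 / N n))) * p n)"
        unfolding d_def real_norm_def abs_mult abs_of_pos[OF N0(1)] using h2[of n] N0(1)[of n] by (intro mult_left_mono) auto
      also have "... = \<bar>\<kappa>\<bar> * exp (\<bar>\<kappa>\<bar> * (1 / N n)) * p n" using N0(1)[of n] by simp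
      finally show "norm (d n) <= \<bar>\<kappa>\<bar> * exp (\<bar>\<kappa>\<bar> * (1 / N n)) * p n" .
    qed
    have "(%n. \<bar>\<kappa>\<bar> * exp (\<bar>\<kappa>\<bar> * (1 / N n)) * p n) \<longlonglongrightarrow> \<bar>\<kappa>\<bar> * exp (\<bar>\<kappa>\<bar> * 0) * 0" by (intro tendsto_intros lN pl)
    then show "(%n. \<bar>\<kappa>\<bar> * exp (\<bar>\<kappa>\<bar> * (1 / N n)) * p n) \<longlonglongrightarrow> 0" by simp
  qed
  \<comment> \<open>The remainder is arranged so that n occurs, apart from factors tending to 1 and
    the error d, only in brackets \<open>N n * (exp (z / N n) - 1)\<close>, which tend to z.\<close>
  have eq: "(N n * (exp (\<psi> th / N n) - 1)) * G.lap th - (N n * (exp (q / N n) - 1)) * G.lap th - exp (q * (1 / N n)) * ((N n * (exp (\<kappa> / N n) - 1)) / (th - u)) + exp (q * (1 / N n)) * d n = G.rem th n" for n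
  proof -
    have a: "exp (q * (1 / N n)) * (exp (- q * (1 / N n)) * z) = z" for z
      by (simp add: exp_minus)
    have "G.rem th n = N n * (exp (\<psi> th / N n) * G.lap th - exp (q * (1 / N n)) * (exp (- q * (1 / N n)) * h n))"
      unfolding G.rem_def N_def[symmetric] h1 a by simp
    moreover have "exp (- q * (1 / N n)) * h n = G.lap th - (1 - exp (\<kappa> / N n)) / (th - u) - d n / N n"
      using N0(1)[of n] by (simp add: d_def)
    ultimately have "G.rem th n = N n * (exp (\<psi> th / N n) * G.lap th - exp (q * (1 / N n)) * (G.lap th - (1 - exp (\<kappa> / N n)) / (th - u) - d n / N n))" by (simp only:)
    moreover have "(N n * (exp (\<kappa> / N n) - 1)) / (th - u) = - (N n * ((1 - exp (\<kappa> / N n)) / (th - u)))"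
      by (simp add: minus_divide_left right_diff_distrib)
    moreover have "N n * (d n / N n) = d n" using N0(1)[of n] by simp
    ultimately show ?thesis using N0(1)[of n] by (simp add: right_diff_distrib left_diff_distrib mult.left_commute[of "N n"] mult.assoc)
  qed
  have "(%n. (N n * (exp (\<psi> th / N n) - 1)) * G.lap th - (N n * (exp (q / N n) - 1)) * G.lap th - exp (q * (1 / N n)) * ((N n * (exp (\<kappa> / N n) - 1)) / (th - u)) + exp (q * (1 / N n)) * d n)
    \<longlonglongrightarrow> \<psi> th * G.lap th - q * G.lap th - exp (q * 0) * (\<kappa> / (th - u)) + exp (q * 0) * 0"
    unfolding N_def by (intro tendsto_intros tendsto_exp_scaled lN[unfolded N_def] dl) (use th in auto)
  then show ?thesis unfolding eq by (simp add: \<kappa>_def left_diff_distrib)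
qed

end

text \<open>If f x is too small, monotonicity contradicts equality at points to the right of x; if
  it is too large, at points to the left. Continuity is asked of g only, since none has been
  established for \<open>D\<close>.\<close>

lemma antimono_AE_eq:
  fixes f g :: "real => real"
  assumes mono: "!!x y. x <= y ==> f y <= f x" and c: "isCont g x" and x: "0 < x" and ae: "AE y in lborel. 0 < y --> f y = g y"
  shows "f x = g x"
proof (rule ccontr)
  assume ne: "f x \<noteq> g x"
  have "(g \<longlongrightarrow> g x) (at x)" using c by (simp add: isCont_def)
  from tendstoD[OF this, of "\<bar>g x - f x\<bar>"] ne obtain d where d: "d > 0" "!!y. y \<noteq> x ==> dist y x < d ==> dist (g y) (g x) < \<bar>g x - f x\<bar>"
    by (auto simp: eventually_at)
  show False
  proof (cases "f x < g x")
    case True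
    obtain y where "x < y" "y < x + d" "0 < y --> f y = g y" using AE_lborel_dense[OF ae, of x "x + d"] d by auto
    then show False using d(2)[of y] x True mono[of x y] by (auto simp: dist_real_def)
  next
    case False
    obtain y where "max 0 (x - d) < y" "y < x" "0 < y --> f y = g y" using AE_lborel_dense[OF ae, of "max 0 (x - d)" x] d x by auto
    then show False using d(2)[of y] False ne mono[of y x] by (auto simp: dist_real_def)
  qed
qed

section \<open>The explicit transform at downward passage\<close>

context levy_law begin

definition Zs :: "real => real => real => real" where
  "Zs q u x = 1 + (q - \<psi> u) * integral {0..x} (%z. exp (- u * z) * Ws q z)"

lemma exp_Ws_continuous: assumes q: "0 <= q" shows "continuous_on {0..x} (%z. exp (- u * z) * Ws q z)"
  by (intro continuous_intros continuous_on_subset[OF Ws_continuous[OF q]]) auto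

lemma Zs_continuous: assumes s: "0 <= s" shows "continuous_on {0..c} (Zs s u)"
  unfolding Zs_def by (intro continuous_intros indefinite_integral_continuous_1 integrable_continuous_real exp_Ws_continuous s)

lemma Zs_isCont: assumes s: "0 <= s" and x: "0 < x" shows "isCont (Zs s u) x"
proof -
  have "continuous_on {0<..<x + 1} (Zs s u)" by (rule continuous_on_subset[OF Zs_continuous[OF s, of "x + 1"]]) auto
  then show ?thesis using x by (simp add: continuous_on_eq_continuous_at)
qed

text \<open>The integral in \<open>Zs\<close> originates here, in the convolution of the exponential
  source with the scale function.\<close>

lemma conv_exp_Ws:
  assumes q: "0 <= q"
  shows "conv (%y. exp (u * y) * indicator {0..} y) (Ws q) x = ennreal (exp (u * x) * integral {0..x} (%z. exp (- u * z) * Ws q z))"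
proof -
  let ?I = "integral {0..x} (%z. exp (- u * z) * Ws q z)"
  have "((%z. exp (- u * z) * Ws q z) has_integral ?I) {0..x}"
    by (rule integrable_integral[OF integrable_continuous_real[OF exp_Ws_continuous[OF q]]])
  then have "((%z. if z \<in> {0..x} then exp (- u * z) * Ws q z else 0) has_integral ?I) UNIV" by (simp only: has_integral_restrict_UNIV)
  then have hi: "((%z. exp (u * x) * (if z \<in> {0..x} then exp (- u * z) * Ws q z else 0)) has_integral exp (u * x) * ?I) UNIV"
    by (rule has_integral_mult_right)
  have [measurable]: "Ws q \<in> borel_measurable borel" by (rule Ws_measurable[OF q])
  have "conv (%y. exp (u * y) * indicator {0..} y) (Ws q) x = (\<integral>\<^sup>+z. ennreal (exp (u * x) * (if z \<in> {0..x} then exp (- u * z) * Ws q z else 0)) \<partial>lborel)"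
    unfolding conv_def
  proof (rule nn_integral_cong)
    fix z
    have e: "exp (u * (x - z)) = exp (u * x) * exp (- u * z)" by (subst exp_add[symmetric]) (simp add: algebra_simps)
    consider "z < 0" | "z > x" | "0 <= z" "z <= x" by linarith
    then show "ennreal (exp (u * (x - z)) * indicator {0..} (x - z)) * ennreal (Ws q z) = ennreal (exp (u * x) * (if z \<in> {0..x} then exp (- u * z) * Ws q z else 0))"
    proof cases
      case 3
      then show ?thesis unfolding e using Ws_nonneg[OF q, of z] by (simp add: ennreal_mult[symmetric] mult.assoc)
    qed (auto simp: Ws_neg)
  qed
  also have "... = ennreal (exp (u * x) * ?I)"
    by (rule nn_integral_has_integral_lborel[OF _ _ hi]) (use Ws_nonneg[OF q] in auto)
  finally show ?thesis .
qed

text \<open>The limit of the remainder is the same for all th, so the defect has transform (\<kappa>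
  / (th - u) + k) / (\<psi> th - q). Here 1 / (\<psi> th - q) belongs to \<open>Ws q\<close>, and
  its product with 1 / (th - u) to the convolution with the exponential. The value of k is never
  computed.\<close>

lemma D_formula:
  assumes q: "0 <= q" "0 <= u"
  shows "\<exists>k. \<forall>x>0. D q u x = exp (u * x) * Zs q u x - k * Ws q x"
proof -
  interpret G: levy_laplace P "dgap q u" u 1 by (rule dgap_levy_laplace[OF q])
  let ?I = "%x. integral {0..x} (%z. exp (- u * z) * Ws q z)"
  define \<kappa> where "\<kappa> = \<psi> u - q"
  define k where "k = (\<psi> (u + 1) - q) * G.lap (u + 1) - \<kappa> / (u + 1 - u)"
  have keq: "(\<psi> th - q) * G.lap th - \<kappa> / (th - u) = k" if th: "th > u" for th
  proof (cases "th <= u + 1")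
    case True
    show ?thesis unfolding k_def \<kappa>_def by (rule G.rem_limit_unique[OF th True dgap_limit[OF q th] dgap_limit[OF q]]) simp
  next
    case False
    then have le: "u + 1 <= th" by simp
    have "u + 1 > u" by simp
    from G.rem_limit_unique[OF this le dgap_limit[OF q this] dgap_limit[OF q th]] show ?thesis unfolding k_def \<kappa>_def by simp
  qed
  define ef where "ef y = exp (u * y) * indicator {0..} y" for y :: real
  have Wm [measurable]: "Ws q \<in> borel_measurable borel" by (rule Ws_measurable[OF q(1)])
  have em [measurable]: "ef \<in> borel_measurable borel" unfolding ef_def by simp
  have ef0: "0 <= ef y" for y by (simp add: ef_def)
  define cv where "cv x = enn2real (conv ef (Ws q) x)" for x
  have cv0: "conv ef (Ws q) x = ennreal (exp (u * x) * ?I x)" for x unfolding ef_def by (rule conv_exp_Ws[OF q(1)])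
  have I0: "0 <= ?I x" for x by (rule integral_nonneg[OF integrable_continuous_real[OF exp_Ws_continuous[OF q(1)]]]) (use Ws_nonneg[OF q(1)] in auto)
  have cve: "cv x = exp (u * x) * ?I x" for x unfolding cv_def cv0 using I0 by simp
  have cvm [measurable]: "cv \<in> borel_measurable borel" unfolding cv_def using conv_measurable[OF em Wm] by simp
  have fin: "conv ef (Ws q) x < \<infinity>" for x unfolding cv0 by simp
  define c where "c = max u (growth q) + 1"
  have th: "th > u" "th > growth q" if "th \<ge> c" for th using that by (auto simp: c_def)
  have cvl: "integrable lborel (%x. exp (- th * x) * cv x)" "(\<integral>x. exp (- th * x) * cv x \<partial>lborel) = (1 / (th - u)) * (1 / (\<psi> th - q))" if "th \<ge> c" for th
  proof -
    have "(\<integral>\<^sup>+x. ennreal (exp (- th * x) * ef x) \<partial>lborel) = (\<integral>\<^sup>+x. ennreal (exp (- (th - u) * x)) * indicator {0..} x \<partial>lborel)"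
    proof (intro nn_integral_cong)
      fix x
      have "exp (- th * x) * exp (u * x) = exp (- (th - u) * x)" by (subst exp_add[symmetric]) (simp add: algebra_simps)
      then show "ennreal (exp (- th * x) * ef x) = ennreal (exp (- (th - u) * x)) * indicator {0..} x" by (auto simp: ef_def indicator_def)
    qed
    then have lf: "(\<integral>\<^sup>+x. ennreal (exp (- th * x) * ef x) \<partial>lborel) = ennreal (1 / (th - u))" using nn_integral_exp_tail[of "th - u"] th(1)[OF that] by simp
    have a: "0 <= 1 / (th - u)" "0 <= 1 / (\<psi> th - q)" using th(1)[OF that] \<psi>_gt[OF q(1) th(2)[OF that]] by auto
    show "integrable lborel (%x. exp (- th * x) * cv x)" "(\<integral>x. exp (- th * x) * cv x \<partial>lborel) = (1 / (th - u)) * (1 / (\<psi> th - q))"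
      unfolding cv_def by (rule conv_real_laplace[OF em Wm ef0 Ws_nonneg[OF q(1)] fin a lf Ws_lap(3)[OF q(1) th(2)[OF that]]])+
  qed
  define f where "f x = dgap q u x - \<kappa> * cv x - k * Ws q x" for x
  have ex: "exp (- th * x) * f x = (exp (- th * x) * dgap q u x - \<kappa> * (exp (- th * x) * cv x)) - k * (exp (- th * x) * Ws q x)" for th x
    by (simp add: f_def algebra_simps)
  have fi: "integrable lborel (%x. exp (- th * x) * f x)" "(\<integral>x. exp (- th * x) * f x \<partial>lborel) = 0" if thc: "th \<ge> c" for th
  proof -
    note i = G.lap_integrable[OF th(1)[OF thc]] cvl(1)[OF thc] Ws_lap(1)[OF q(1) th(2)[OF thc]]
    have i1: "integrable lborel (%x. exp (- th * x) * dgap q u x - \<kappa> * (exp (- th * x) * cv x))"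
      by (rule Bochner_Integration.integrable_diff[OF i(1) integrable_mult_right]) (rule i(2))
    show "integrable lborel (%x. exp (- th * x) * f x)" unfolding ex
      by (rule Bochner_Integration.integrable_diff[OF i1 integrable_mult_right]) (rule i(3))
    have "(\<integral>x. exp (- th * x) * f x \<partial>lborel) = (G.lap th - \<kappa> * ((1 / (th - u)) * (1 / (\<psi> th - q)))) - k * (1 / (\<psi> th - q))"
      unfolding ex
      by (subst Bochner_Integration.integral_diff[OF i1 integrable_mult_right], rule i(3),
          subst Bochner_Integration.integral_diff[OF i(1) integrable_mult_right], rule i(2))
         (simp only: integral_mult_right_zero cvl(2)[OF thc] Ws_lap(2)[OF q(1) th(2)[OF thc]] G.lap_def)
    also have "... = ((\<psi> th - q) * G.lap th - \<kappa> / (th - u) - k) / (\<psi> th - q)" using \<psi>_gt[OF q(1) th(2)[OF thc]] by (simp add: diff_divide_distrib)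
    also have "... = 0" using keq[OF th(1)[OF thc]] by simp
    finally show "(\<integral>x. exp (- th * x) * f x \<partial>lborel) = 0" .
  qed
  have ae: "AE x in lborel. f x = 0"
  proof (rule laplace_zero_imp_AE_zero[where c=c])
    show "f \<in> borel_measurable borel" unfolding f_def by simp
    show "f x = 0" if "x < 0" for x using that by (simp add: f_def Ws_neg cve dgap_def)
    show "integrable lborel (%x. exp (- c * x) * f x)" by (rule fi) simp
    show "(\<integral>x. exp (- (c + real n) * x) * f x \<partial>lborel) = 0" for n by (rule fi(2)) simp
  qed
  have "D q u x = exp (u * x) * Zs q u x - k * Ws q x" if x: "x > 0" for x
  proof -
    have ee: "exp (- u * y) * (exp (u * y) * z) = z" for y z :: real by (simp add: exp_minus)
    have "exp (- u * x) * D q u x = Zs q u x - k * (exp (- u * x) * Ws q x)"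
    proof (rule antimono_AE_eq[OF D_antimono[OF q] _ x])
      show "isCont (%x. Zs q u x - k * (exp (- u * x) * Ws q x)) x"
        by (intro continuous_intros Zs_isCont[OF q(1) x] Ws_isCont[OF q(1) x])
      show "AE y in lborel. 0 < y --> exp (- u * y) * D q u y = Zs q u y - k * (exp (- u * y) * Ws q y)"
        using ae
      proof eventually_elim
        fix y assume f0: "f y = 0"
        show "0 < y --> exp (- u * y) * D q u y = Zs q u y - k * (exp (- u * y) * Ws q y)"
        proof
          assume "0 < y"
          then have "D q u y = exp (u * y) * Zs q u y - k * Ws q y" using f0 by (simp add: f_def dgap_def cve Zs_def \<kappa>_def algebra_simps)
          then show "exp (- u * y) * D q u y = Zs q u y - k * (exp (- u * y) * Ws q y)" using ee[of y "Zs q u y"] by (simp add: right_diff_distrib)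
        qed
      qed
    qed
    then have "exp (u * x) * (exp (- u * x) * D q u x) = exp (u * x) * (Zs q u x - k * (exp (- u * x) * Ws q x))" by simp
    moreover have ee': "exp (u * x) * (exp (- u * x) * z) = z" for z :: real by (simp add: exp_minus)
    ultimately show ?thesis by (simp only: right_diff_distrib mult.left_commute[of "exp (u * x)" k] ee')
  qed
  then show ?thesis by blast
qed

definition Da :: "real => real => real => real => real" where
  "Da q u y a = exp (u * y) * Zs q u y - exp (u * a) * Zs q u a * (Ws q y / Ws q a)"

text \<open>Here y is the initial height above the floor and a the height of the upper level above
  it. Paths that rise first are removed by the strong Markov property; as their weight is a quotient
  of values of \<open>Ws q\<close>, the unknown multiple of \<open>Ws q\<close> in
  \<open>D_formula\<close> cancels.\<close>

lemma dval_before_up: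
  assumes q: "0 <= q" "0 <= u" and y: "0 < y" "y <= a"
  shows "(\<E> w. indicator (- exit_up y (a - y)) w * dval q u y w) = Da q u y a"
proof -
  obtain k where k: "!!x. x > 0 ==> D q u x = exp (u * x) * Zs q u x - k * Ws q x" using D_formula[OF q] by blast
  let ?E = "exit_up y (a - y)"
  have i: "integrable P (%w. indicator ?E w * dval q u y w)"
    by (rule integrable_const_bound[where B=1]) (auto simp: dval_nonneg dval_le1 q indicator_def)
  have "(\<E> w. indicator (- ?E) w * dval q u y w) = (\<E> w. dval q u y w - indicator ?E w * dval q u y w)"
    by (intro Bochner_Integration.integral_cong) (auto simp: indicator_def)
  also have "... = D q u y - hh q y (a - y) * D q u a"
    unfolding D_def using D_exit[OF q, of "a - y" y] y by (subst Bochner_Integration.integral_diff[OF dval_integrable[OF q] i]) (simp add: D_def)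
  also have "hh q y (a - y) = Ws q y / Ws q a"
    using hh_ratio[OF q(1), of y "a - y"] y kk_pos[OF q(1)] by (simp add: Ws_pos_eq)
  also have "D q u y - Ws q y / Ws q a * D q u a = Da q u y a"
  proof -
    have a: "a > 0" "Ws q a > 0" using y Ws_pos[OF q(1), of a] by auto
    show ?thesis unfolding Da_def k[OF y(1)] k[OF a(1)] using a(2) by (simp add: field_simps)
  qed
  finally show ?thesis .
qed

end

section \<open>The last time at the running infimum\<close>

lemma dn_rinf: assumes w: "w \<in> Paths" and f: "fin (dn y) w" shows "rinf w (hit (dn y) w) = w (hit (dn y) w)"
proof (rule antisym)
  show "rinf w (hit (dn y) w) <= w (hit (dn y) w)" by (rule inf_on_le[OF w hit_ge0[OF f] order_refl])
  have "w (hit (dn y) w) <= w s" if "0 <= s" "s <= hit (dn y) w" for s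
    using dn_hit(1)[OF w f] dn_hit(2)[OF w f that(1)] that by (cases "s = hit (dn y) w") auto
  then show "w (hit (dn y) w) <= rinf w (hit (dn y) w)" using hit_ge0[OF f] by (simp add: inf_on_ge_iff[OF w])
qed

text \<open>The reflected path is at 0 at a downward passage and at a > 0 when the excursion is
  completed.\<close>

lemma dn_neq_ex:
  assumes w: "w \<in> Paths" and a: "0 < a" and f: "fin (dn y) w" "fin (ex a) w" shows "hit (dn y) w \<noteq> hit (ex a) w"
  using dn_rinf[OF w f(1)] ex_hit(1)[OF w a f(2)] a by (metis less_add_same_cancel1 less_irrefl)

lemma inf_on_antimono: assumes w: "w \<in> Paths" and "c <= d" "d <= t" shows "inf_on w c t <= inf_on w d t"
  using assms by (subst inf_on_ge_iff[OF w]) (auto intro: inf_on_le)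

lemma inf_on_shift:
  assumes w: "w \<in> Paths" and t: "0 <= t" and c: "0 <= c" "c <= d"
  shows "inf_on w (t + c) (t + d) = w t + inf_on (pshift t w) c d"
proof -
  have "z <= inf_on w (t + c) (t + d) \<longleftrightarrow> z - w t <= inf_on (pshift t w) c d" for z
  proof -
    have "(\<forall>s\<in>{t + c..t + d}. z <= w s) \<longleftrightarrow> (\<forall>s\<in>{c..d}. z - w t <= pshift t w s)"
    proof
      assume h: "\<forall>s\<in>{t + c..t + d}. z <= w s"
      show "\<forall>s\<in>{c..d}. z - w t <= pshift t w s"
      proof
        fix s assume "s \<in> {c..d}"
        then show "z - w t <= pshift t w s" using bspec[OF h, of "t + s"] t c by (simp add: pshift_at)
      qed
    next
      assume h: "\<forall>s\<in>{c..d}. z - w t <= pshift t w s"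
      show "\<forall>s\<in>{t + c..t + d}. z <= w s"
      proof
        fix s assume "s \<in> {t + c..t + d}"
        then show "z <= w s" using bspec[OF h, of "s - t"] t c by (simp add: pshift_at)
      qed
    qed
    then show ?thesis using w c by (simp add: inf_on_ge_iff)
  qed
  from this[of "inf_on w (t + c) (t + d)"] this[of "w t + inf_on (pshift t w) c d"] show ?thesis by simp
qed

text \<open>With c the set contains every smaller nonnegative time, unlike the set of times spent at
  the infimum, so rational c suffice for measurability. \<open>last_inf_eq\<close> shows that both
  sets have the same supremum.\<close>

definition last_inf :: "(real => real) => real => real" where
  "last_inf w t = Sup {c. 0 <= c & c <= t & inf_on w c t <= rinf w c}"

lemma last_inf_upper: "0 <= c ==> c <= t ==> inf_on w c t <= rinf w c ==> c <= last_inf w t"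
  unfolding last_inf_def by (rule cSup_upper) (auto intro: bdd_aboveI[of _ t])

lemma last_inf_nonneg: assumes "w \<in> Paths" "0 <= t" shows "0 <= last_inf w t"
  using assms by (intro last_inf_upper rinf_mono) auto

lemma last_inf_least:
  assumes w: "w \<in> Paths" "0 <= t" and le: "!!c. 0 <= c ==> c <= t ==> inf_on w c t <= rinf w c ==> c <= z"
  shows "last_inf w t <= z"
  unfolding last_inf_def
proof (rule cSup_least)
  have "inf_on w 0 t <= rinf w 0" using w by (intro rinf_mono) auto
  then show "{c. 0 <= c & c <= t & inf_on w c t <= rinf w c} \<noteq> {}" using w by auto
qed (use le in auto)

lemma last_inf_greater_iff:
  assumes w: "w \<in> Paths" "0 <= t"
  shows "b < last_inf w t \<longleftrightarrow> b < 0 \<or> (\<exists>c::rat. b < of_rat c & 0 <= real_of_rat c & of_rat c <= t & inf_on w (of_rat c) t <= rinf w (of_rat c))"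
proof
  assume l: "b < last_inf w t"
  show "b < 0 \<or> (\<exists>c::rat. b < of_rat c & 0 <= real_of_rat c & of_rat c <= t & inf_on w (of_rat c) t <= rinf w (of_rat c))"
  proof (cases "b < 0")
    case False
    obtain c where c: "0 <= c" "c <= t" "inf_on w c t <= rinf w c" "b < c"
      using last_inf_least[OF w, of b] l by (force simp: not_le[symmetric])
    obtain d :: rat where d: "b < of_rat d" "of_rat d < c" using of_rat_dense[OF c(4)] by blast
    have d0: "0 <= real_of_rat d" "real_of_rat d <= t" "real_of_rat d <= c" using d c False by linarith+
    have "inf_on w (of_rat d) t <= inf_on w c t" using c d by (intro inf_on_antimono w) auto
    also have "... <= rinf w (of_rat d)" by (rule order_trans[OF c(3) rinf_mono[OF w(1) d0(1,3)]])
    finally have "inf_on w (of_rat d) t <= rinf w (of_rat d)" .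
    then show ?thesis using d(1) d0 by blast
  qed simp
next
  assume "b < 0 \<or> (\<exists>c::rat. b < of_rat c & 0 <= real_of_rat c & of_rat c <= t & inf_on w (of_rat c) t <= rinf w (of_rat c))"
  then show "b < last_inf w t"
  proof
    assume "\<exists>c::rat. b < of_rat c & 0 <= real_of_rat c & of_rat c <= t & inf_on w (of_rat c) t <= rinf w (of_rat c)"
    then obtain c :: rat where c: "b < of_rat c" "0 <= real_of_rat c" "of_rat c <= t" "inf_on w (of_rat c) t <= rinf w (of_rat c)" by blast
    show ?thesis using last_inf_upper[OF c(2-4)] c(1) by simp
  qed (use last_inf_nonneg[OF w] in simp)
qed

lemma last_inf_measurable:
  assumes p: "p \<in> N \<rightarrow>\<^sub>M path_space" and f [measurable]: "f \<in> borel_measurable N"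
  shows "(%x. last_inf (p x) (max 0 (f x))) \<in> borel_measurable N"
proof (rule borel_measurableI_greater)
  fix b :: real
  have m1: "(%x. inf_on (p x) c (max 0 (f x))) \<in> borel_measurable N" for c by (rule inf_on_measurable[OF p]) simp
  have m2: "(%x. rinf (p x) c) \<in> borel_measurable N" for c by (rule inf_on_measurable[OF p]) simp
  note [measurable] = m1 m2
  have "{x\<in>space N. b < last_inf (p x) (max 0 (f x))} = {x\<in>space N. b < 0 \<or> (\<exists>c::rat. b < of_rat c & 0 <= real_of_rat c & of_rat c <= max 0 (f x) & inf_on (p x) (of_rat c) (max 0 (f x)) <= rinf (p x) (of_rat c))}"
  proof (rule Collect_cong, rule conj_cong[OF refl])
    fix x assume "x \<in> space N"
    then have "p x \<in> Paths" using measurable_space[OF p] by simp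
    then show "b < last_inf (p x) (max 0 (f x)) \<longleftrightarrow> b < 0 \<or> (\<exists>c::rat. b < of_rat c & 0 <= real_of_rat c & of_rat c <= max 0 (f x) & inf_on (p x) (of_rat c) (max 0 (f x)) <= rinf (p x) (of_rat c))"
      by (rule last_inf_greater_iff) simp
  qed
  also have "... \<in> sets N" by simp
  finally show "{x\<in>space N. b < last_inf (p x) (max 0 (f x))} \<in> sets N" .
qed

text \<open>At a downward passage the path is at its running infimum, so for later c the comparison
  of infima before and after c involves the shifted path only.\<close>

lemma last_inf_shift:
  assumes w: "w \<in> Paths" and f: "fin (dn y) w" and t: "0 <= t"
  defines "T \<equiv> hit (dn y) w"
  shows "last_inf w (T + t) = T + last_inf (pshift T w) t"
proof -
  have T: "0 <= T" unfolding T_def by (rule hit_ge0[OF f])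
  have iff: "inf_on w (T + c) (T + t) <= rinf w (T + c) \<longleftrightarrow> inf_on (pshift T w) c t <= rinf (pshift T w) c" if "0 <= c" "c <= t" for c
    unfolding inf_on_shift[OF w T that] rinf_shift[OF w T that(1)]
    using dn_rinf[OF w f] rinf_le0[OF pshift_Paths[OF w] that(1), of T] by (simp add: T_def min_def)
  have Tt: "0 <= T + t" using T t by simp
  show ?thesis
  proof (rule antisym)
    show "last_inf w (T + t) <= T + last_inf (pshift T w) t"
    proof (rule last_inf_least[OF w Tt])
      fix c assume c: "0 <= c" "c <= T + t" "inf_on w c (T + t) <= rinf w c"
      show "c <= T + last_inf (pshift T w) t"
      proof (cases "c < T")
        case True
        then show ?thesis using last_inf_nonneg[OF pshift_Paths[OF w] t, of T] by simp
      next
        case False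
        then have "c - T <= last_inf (pshift T w) t" using c iff[of "c - T"] by (intro last_inf_upper) auto
        then show ?thesis by simp
      qed
    qed
    have "last_inf (pshift T w) t <= last_inf w (T + t) - T"
    proof (rule last_inf_least[OF pshift_Paths[OF w] t])
      fix c assume c: "0 <= c" "c <= t" "inf_on (pshift T w) c t <= rinf (pshift T w) c"
      have "T + c <= last_inf w (T + t)" using c iff[of c] T by (intro last_inf_upper) auto
      then show "c <= last_inf w (T + t) - T" by simp
    qed
    then show "T + last_inf (pshift T w) t <= last_inf w (T + t)" by simp
  qed
qed

text \<open>If the path were above its running infimum at \<gamma>, right continuity and a left
  limit not below the value would keep it above on both sides. Then the defining set either has no
  point just before or at \<gamma>, or it contains a later one.\<close>

lemma last_inf_attained:
  assumes w: "w \<in> Paths" and t: "0 <= t"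
  defines "\<gamma> \<equiv> last_inf w t"
  shows "0 <= \<gamma>" "\<gamma> <= t" "w \<gamma> = rinf w \<gamma> \<or> left_lim w \<gamma> = rinf w \<gamma>"
proof -
  show g0: "0 <= \<gamma>" unfolding \<gamma>_def by (rule last_inf_nonneg[OF w t])
  show gt: "\<gamma> <= t" unfolding \<gamma>_def by (rule last_inf_least[OF w t])
  have "w \<gamma> = rinf w \<gamma>"
  proof (rule ccontr)
    define i where "i = rinf w \<gamma>"
    define e where "e = (i + w \<gamma>) / 2"
    assume "w \<gamma> \<noteq> rinf w \<gamma>"
    then have "i < w \<gamma>" using inf_on_le[OF w g0 order_refl] by (simp add: i_def)
    then have e: "i < e" "e < w \<gamma>" by (auto simp: e_def)
    obtain d where d: "d > 0" "!!s. \<gamma> <= s ==> s < \<gamma> + d ==> \<bar>w s - w \<gamma>\<bar> < w \<gamma> - e" using Paths_right[OF w, of "w \<gamma> - e" \<gamma>] e by auto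
    obtain l where l: "w \<gamma> <= l" "!!e. e > 0 ==> \<exists>d>0. \<forall>s. \<gamma> - d < s & s < \<gamma> --> \<bar>w s - l\<bar> < e" using Paths_left[OF w, of \<gamma>] by blast
    obtain d' where d': "d' > 0" "!!s. \<gamma> - d' < s ==> s < \<gamma> ==> \<bar>w s - l\<bar> < l - e" using l(2)[of "l - e"] l(1) e by auto
    have near: "e <= w s" if "\<gamma> - d' < s" "s < \<gamma> + d" for s
      using d(2)[of s] d'(2)[of s] that by (cases "s < \<gamma>") auto
    have "\<exists>c. 0 <= c & c <= t & inf_on w c t <= rinf w c & \<gamma> - d' < c"
      using last_inf_least[OF w t, of "\<gamma> - d'"] d'(1) unfolding \<gamma>_def[symmetric] by (force simp: not_le[symmetric])
    then obtain c where c: "0 <= c" "c <= t" "inf_on w c t <= rinf w c" "\<gamma> - d' < c" by blast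
    have cg: "c <= \<gamma>" unfolding \<gamma>_def by (rule last_inf_upper[OF c(1-3)])
    have "rinf w c <= i"
    proof (rule ccontr)
      assume n: "\<not> rinf w c <= i"
      have "min (rinf w c) e <= w s" if "0 <= s" "s <= \<gamma>" for s
        using inf_on_le[OF w that(1), of c] near[of s] that c(4) d(1) by (cases "s <= c") auto
      then have "min (rinf w c) e <= i" unfolding i_def using g0 by (subst inf_on_ge_iff[OF w]) auto
      then show False using n e by simp
    qed
    then have ci: "inf_on w c t <= i" using c(3) by simp
    show False
    proof (cases "t < \<gamma> + d")
      case True
      have "e <= inf_on w c t" using c(2,4) True by (subst inf_on_ge_iff[OF w]) (auto intro!: near)
      then show False using ci e by simp
    next
      case False
      define c2 where "c2 = \<gamma> + d / 2"
      have c2: "\<gamma> < c2" "c2 < \<gamma> + d" "c2 <= t" using d(1) False by (auto simp: c2_def)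
      have "inf_on w c2 t <= i"
      proof (rule ccontr)
        assume n: "\<not> inf_on w c2 t <= i"
        have "min (inf_on w c2 t) e <= w s" if "c <= s" "s <= t" for s
          using inf_on_le[OF w _ that(2), of c2] near[of s] that c(4) c2 by (cases "s < c2") auto
        then have "min (inf_on w c2 t) e <= inf_on w c t" using c(2) by (subst inf_on_ge_iff[OF w]) auto
        then show False using ci n e by simp
      qed
      also have "i <= rinf w c2"
      proof -
        have "i <= w s" if "0 <= s" "s <= c2" for s
          using inf_on_le[OF w that(1), of \<gamma>] near[of s] that d'(1) c2 e by (cases "s <= \<gamma>") (auto simp: i_def)
        then show ?thesis using g0 c2 by (subst inf_on_ge_iff[OF w]) auto
      qed
      finally have "c2 <= \<gamma>" unfolding \<gamma>_def using g0 c2 by (intro last_inf_upper) auto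
      then show False using c2 by simp
    qed
  qed
  then show "w \<gamma> = rinf w \<gamma> \<or> left_lim w \<gamma> = rinf w \<gamma>" ..
qed

lemma le_left_lim: assumes w: "w \<in> Paths" shows "w s <= left_lim w s"
proof -
  obtain l where "(w \<longlongrightarrow> l) (at_left s)" "w s <= l" using w unfolding Paths_def by blast
  moreover have "left_lim w s = l" unfolding left_lim_def by (rule tendsto_Lim) (use calculation in auto)
  ultimately show ?thesis by simp
qed

text \<open>A left limit is never below the value, so both alternatives place the path itself at its
  running infimum, and the supremum is a maximum by \<open>last_inf_attained\<close>.\<close>

lemma last_inf_eq:
  assumes w: "w \<in> Paths" and t: "0 <= t"
  shows "Sup {s. 0 <= s & s <= t & (w s = rinf w s \<or> left_lim w s = rinf w s)} = last_inf w t"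
proof (rule cSup_eq_maximum)
  show "last_inf w t \<in> {s. 0 <= s & s <= t & (w s = rinf w s \<or> left_lim w s = rinf w s)}" using last_inf_attained[OF w t] by blast
  fix s assume s: "s \<in> {s. 0 <= s & s <= t & (w s = rinf w s \<or> left_lim w s = rinf w s)}"
  then have "w s <= rinf w s" using le_left_lim[OF w, of s] by auto
  then have "inf_on w s t <= rinf w s" using inf_on_le[OF w order_refl, of s t] s by simp
  then show "s <= last_inf w t" using s by (intro last_inf_upper) auto
qed

definition val :: "real => real => real => real => (real => real) => real" where
  "val q r u a w = (if fin (ex a) w then exp (- q * hit (ex a) w - r * last_inf w (hit (ex a) w) + u * rinf w (hit (ex a) w)) else 0)"

lemma val_nonneg: "0 <= val q r u a w" by (simp add: val_def)

lemma val_le1: assumes w: "w \<in> Paths" and q: "0 <= q" "0 <= r" "0 <= u" shows "val q r u a w <= 1"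
proof (cases "fin (ex a) w")
  case True
  have h: "0 <= hit (ex a) w" by (rule hit_ge0[OF True])
  have "0 <= q * hit (ex a) w" "0 <= r * last_inf w (hit (ex a) w)" "u * rinf w (hit (ex a) w) <= 0"
    using q h last_inf_nonneg[OF w h] rinf_le0[OF w h] by (auto intro: mult_nonneg_nonpos)
  then show ?thesis using True by (simp add: val_def)
qed (simp add: val_def)

lemma val_measurable: "val q r u a \<in> borel_measurable path_space"
proof -
  have fm [measurable]: "Measurable.pred path_space (fin (ex a))" and hm [measurable]: "hit (ex a) \<in> borel_measurable path_space" by (auto intro: fin_measurable hit_measurable)
  have [measurable]: "(%w. last_inf w (max 0 (hit (ex a) w))) \<in> borel_measurable path_space" by (rule last_inf_measurable) auto
  have [measurable]: "(%w. rinf w (hit (ex a) w)) \<in> borel_measurable path_space" by (rule inf_on_measurable) auto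
  have "(%w. if fin (ex a) w then exp (- q * hit (ex a) w - r * last_inf w (max 0 (hit (ex a) w)) + u * rinf w (hit (ex a) w)) else 0) \<in> borel_measurable path_space"
    by measurable
  moreover have "(%w. if fin (ex a) w then exp (- q * hit (ex a) w - r * last_inf w (max 0 (hit (ex a) w)) + u * rinf w (hit (ex a) w)) else 0) = val q r u a"
    by (auto simp: val_def hit_ge0 max_absorb2)
  ultimately show ?thesis by simp
qed

text \<open>The time before the passage precedes both the end of the excursion and the last infimum,
  so it is discounted at rate q + r. Afterwards the infimum starts afresh from the position reached,
  overshoot included.\<close>

lemma val_shift:
  assumes w: "w \<in> Paths" and f: "fin (dn y) w" and lt: "fin (ex a) w ==> hit (dn y) w < hit (ex a) w"
  shows "val q r u a w = exp (- u * y) * dval (q + r) u y w * val q r u a (pshift (hit (dn y) w) w)"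
proof -
  let ?T = "hit (dn y) w" and ?w = "pshift (hit (dn y) w) w"
  have T: "0 <= ?T" by (rule hit_ge0[OF f])
  have a: "\<not> ex a w s" if "0 <= s" "s < ?T" for s
  proof
    assume e: "ex a w s"
    then have "fin (ex a) w" using that by (auto simp: fin_def)
    then show False using lt hit_le[of s "ex a" w] that e by fastforce
  qed
  have b: "ex a w (?T + s) \<longleftrightarrow> ex a ?w s" if "0 <= s" for s
    unfolding ex_def reflected_shift[OF w T that] using dn_rinf[OF w f] rinf_le0[OF pshift_Paths[OF w] that, of ?T] by simp
  note h = hit_shift[where Q="ex a" and Q'="ex a", OF T a b]
  show ?thesis
  proof (cases "fin (ex a) ?w")
    case True
    let ?s = "hit (ex a) ?w"
    have s: "0 <= ?s" by (rule hit_ge0[OF True])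
    have he: "hit (ex a) w = ?T + ?s" using h(2) True by simp
    have ri: "rinf w (?T + ?s) = w ?T + rinf ?w ?s"
      unfolding rinf_shift[OF w T s] using dn_rinf[OF w f] rinf_le0[OF pshift_Paths[OF w] s, of ?T] by (simp add: min_def)
    have "- q * (?T + ?s) - r * (?T + last_inf ?w ?s) + u * (w ?T + rinf ?w ?s) = - u * y + (- (q + r) * ?T + u * (y + w ?T)) + (- q * ?s - r * last_inf ?w ?s + u * rinf ?w ?s)"
      by (simp add: algebra_simps)
    then show ?thesis using True h(1) f by (simp add: val_def dval_def he ri last_inf_shift[OF w f s] exp_add[symmetric])
  qed (use h in \<open>simp add: val_def\<close>)
qed

section \<open>The law at the first passage of the reflected process\<close>

lemma exit_up_hit_le: assumes w: "w \<in> exit_up y b" and f: "fin (dn y) w" shows "hit (up b) w <= hit (dn y) w"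
proof (rule hit_greatest[OF f], rule ccontr)
  fix s assume s: "0 <= s" "dn y w s" "\<not> hit (up b) w <= s"
  have "w \<in> Paths" "- y <= rinf w (hit (up b) w)" using w by (auto simp: exit_up_def)
  then show False using inf_on_le[of w 0 s "hit (up b) w"] s by (auto simp: dn_def)
qed

lemma ex_le_up:
  assumes w: "w \<in> Paths" and f: "fin (up a) w" shows "fin (ex a) w" "hit (ex a) w <= hit (up a) w"
proof -
  have e: "ex a w s" if "0 <= s" "up a w s" for s using that rinf_le0[OF w that(1)] by (simp add: ex_def up_def)
  show "fin (ex a) w" using f e by (auto simp: fin_def)
  show "hit (ex a) w <= hit (up a) w" by (intro hit_greatest[OF f] hit_le e)
qed

text \<open>Otherwise the reflected path exceeds a at some time while the infimum is still at least
  -y, so the path itself is above a - y, which is the excluded exit.\<close>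

lemma dn_before_ex:
  assumes w: "w \<in> Paths" and y: "y <= a" "0 < a" and f: "fin (dn y) w" "fin (ex a) w" and n: "w \<notin> exit_up y (a - y)"
  shows "hit (dn y) w < hit (ex a) w"
proof (rule ccontr)
  let ?T = "hit (dn y) w"
  assume "\<not> ?T < hit (ex a) w"
  then have "hit (ex a) w < ?T" using dn_neq_ex[OF w y(2) f] by simp
  then obtain s where s: "hit (ex a) w <= s" "s < ?T" "ex a w s" using hit_approach[OF f(2), of "?T - hit (ex a) w"] by auto
  have s0: "0 <= s" using s(1) hit_ge0[OF f(2)] by simp
  have i: "- y <= rinf w s" using s0 s(2) dn_hit(2)[OF w f(1)] by (subst inf_on_ge_iff[OF w]) auto
  then have u: "up (a - y) w s" using s(3) by (simp add: up_def ex_def)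
  then have fu: "fin (up (a - y)) w" and h: "hit (up (a - y)) w <= s" using s0 hit_le by (auto simp: fin_def)
  have "- y <= rinf w (hit (up (a - y)) w)" using i rinf_mono[OF w hit_ge0[OF fu] h] by simp
  then show False using n w fu by (simp add: exit_up_def)
qed

definition falls_first :: "real => real => (real => real) set" where
  "falls_first y a = {w\<in>Paths. fin (dn y) w & (fin (ex a) w --> hit (dn y) w < hit (ex a) w)}"

lemma falls_first_not_exit: assumes "w \<in> falls_first y a" shows "w \<notin> exit_up y a"
proof
  assume e: "w \<in> exit_up y a"
  have w: "w \<in> Paths" "fin (dn y) w" "fin (ex a) w ==> hit (dn y) w < hit (ex a) w" and f: "fin (up a) w"
    using assms e by (auto simp: falls_first_def exit_up_def)
  show False using ex_le_up[OF w(1) f] exit_up_hit_le[OF e w(2)] w(3) by simp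
qed

lemma falls_first_sets: "falls_first y a \<in> sets path_space"
proof -
  have [measurable]: "Measurable.pred path_space (fin (ex a))" "hit (ex a) \<in> borel_measurable path_space"
    "Measurable.pred path_space (fin (dn y))" "hit (dn y) \<in> borel_measurable path_space" by (auto intro: fin_measurable hit_measurable)
  have "{w\<in>space path_space. fin (dn y) w & (fin (ex a) w --> hit (dn y) w < hit (ex a) w)} \<in> sets path_space" by measurable
  then show ?thesis by (simp add: falls_first_def)
qed

lemma determined_falls_first: "determined (falls_first y a) (hit (dn y))"
  unfolding falls_first_def
proof (rule determined_hit)
  have [measurable]: "Measurable.pred path_space (fin (ex a))" "hit (ex a) \<in> borel_measurable path_space"
    "hit (dn y) \<in> borel_measurable path_space" by (auto intro: fin_measurable hit_measurable)
  show "Measurable.pred path_space (%w. fin (ex a) w --> hit (dn y) w < hit (ex a) w)" by measurable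
  fix w t assume w: "w \<in> Paths" and f: "fin (dn y) w" and h: "hit (dn y) w < t"
  have T: "hit (dn y) (pstop t w) = hit (dn y) w" by (rule hit_stop(2)[OF _ w f h]) simp
  note e = hit_stop[OF progressive_ex w, of a t]
  show "(fin (ex a) (pstop t w) --> hit (dn y) (pstop t w) < hit (ex a) (pstop t w)) = (fin (ex a) w --> hit (dn y) w < hit (ex a) w)"
    unfolding T using e h by (cases "fin (ex a) w & hit (ex a) w < t") auto
qed simp

text \<open>On \<open>exit_up\<close> the upward passage comes no later than the downward one, so
  the question is settled at the downward passage.\<close>

lemma determined_not_exit: "determined {w\<in>Paths. fin (dn y) w & w \<notin> exit_up y b} (hit (dn y))"
proof (rule determined_hit)
  have "{w\<in>space path_space. w \<in> exit_up y b} = exit_up y b" by (auto simp: exit_up_def)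
  then have "Measurable.pred path_space (%w. w \<in> exit_up y b)" unfolding pred_def using exit_up_sets by simp
  then show "Measurable.pred path_space (%w. w \<notin> exit_up y b)" by measurable
  fix w t assume w: "w \<in> Paths" and f: "fin (dn y) w" and h: "hit (dn y) w < t"
  have T: "fin (dn y) (pstop t w)" "hit (dn y) (pstop t w) < t" using hit_stop(1)[OF progressive_dn w, of y t] f h by auto
  have "w \<in> exit_up y b & hit (up b) w < t \<longleftrightarrow> pstop t w \<in> exit_up y b & hit (up b) (pstop t w) < t"
    using determined_exit_up[of y b] w unfolding determined_def by blast
  then show "(pstop t w \<notin> exit_up y b) = (w \<notin> exit_up y b)"
    using exit_up_hit_le[OF _ f, of b] exit_up_hit_le[OF _ T(1), of b] T(2) h by fastforce
qed simp

text \<open>The infimum stays above or at -y, so the excursion ends at or above a - y. The level b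
  has to be strictly smaller because a passage requires strict excess.\<close>

lemma exit_up_of_not_falls_first:
  assumes w: "w \<in> Paths" "w \<notin> falls_first y a" and f: "fin (ex a) w" and y: "0 < y" "0 < a" and b: "b < a - y"
  shows "w \<in> exit_up y b" "hit (up b) w <= hit (ex a) w"
proof -
  let ?t = "hit (ex a) w"
  have t: "0 <= ?t" by (rule hit_ge0[OF f])
  have i: "- y <= rinf w ?t"
  proof (rule ccontr)
    assume "\<not> - y <= rinf w ?t"
    then have lt: "rinf w ?t < - y" by simp
    obtain s where s: "0 <= s" "s <= ?t" "w s < - y" using lt t by (auto simp: inf_on_less_iff[OF w(1)])
    have fd: "fin (dn y) w" using s by (auto simp: fin_def dn_def)
    have "hit (dn y) w <= s" by (rule hit_le) (use s in \<open>auto simp: dn_def\<close>)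
    then have "hit (dn y) w < ?t" using dn_neq_ex[OF w(1) y(2) fd f] s by simp
    then show False using w fd by (simp add: falls_first_def)
  qed
  have u: "up b w ?t" using ex_hit(1)[OF w(1) y(2) f] i b by (simp add: up_def)
  then have fu: "fin (up b) w" using t by (auto simp: fin_def)
  show h: "hit (up b) w <= ?t" by (rule hit_le[of _ "up b" w, OF t u])
  have "- y <= rinf w (hit (up b) w)" using i rinf_mono[OF w(1) hit_ge0[OF fu] h] by simp
  then show "w \<in> exit_up y b" using w fu by (simp add: exit_up_def)
qed

text \<open>Two stages: a rise to d - y before falling below -y, then a rise to a without falling
  back below y. During the second stage the path is above the running infimum, which is at most 0,
  so the last infimum lies in the first stage, and only this stage is charged with r. The auxiliary
  d tends to 0 after y.\<close>

lemma val_lower: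
  assumes w: "w \<in> Paths" and q: "0 <= q" "0 <= r" "0 <= u" and y: "0 < y" "2 * y < d" "d <= a"
    and e1: "w \<in> exit_up y (d - y)" and e2: "pshift (hit (up (d - y)) w) w \<in> exit_up (d - 2 * y) (a + y - d)"
  shows "w \<notin> falls_first y a"
    "exp (- (q + r) * hit (up (d - y)) w) * exp (- u * y) * exp (- q * hit (up (a + y - d)) (pshift (hit (up (d - y)) w) w)) <= val q r u a w"
proof -
  let ?h = "hit (up (d - y)) w" let ?w = "pshift ?h w" let ?k = "hit (up (a + y - d)) ?w"
  have e3: "?w \<in> exit_up (y + (d - y)) (a + y - d)" using e2 y by (auto simp: exit_up_def)
  have ea: "w \<in> exit_up y a" "hit (up a) w = ?h + ?k"
    using exit_up_shift[OF w, of "d - y" "a + y - d" y] e1 e3 y by auto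
  then show "w \<notin> falls_first y a" using falls_first_not_exit by blast
  have f1: "fin (up (d - y)) w" and fu: "fin (up a) w" and f2: "fin (up (a + y - d)) ?w" using e1 ea e2 by (auto simp: exit_up_def)
  have h: "0 <= ?h" "0 <= ?k" using hit_ge0 f1 f2 by auto
  let ?t = "hit (ex a) w"
  have fe: "fin (ex a) w" and t: "?t <= ?h + ?k" using ex_le_up[OF w fu] ea(2) by auto
  have t0: "0 <= ?t" by (rule hit_ge0[OF fe])
  have i: "- y <= rinf w ?t" using rinf_mono[OF w t0 t] ea by (simp add: exit_up_def)
  have l: "last_inf w ?t <= ?h"
  proof (rule last_inf_least[OF w t0], rule ccontr)
    fix c assume c: "0 <= c" "c <= ?t" "inf_on w c ?t <= rinf w c" "\<not> c <= ?h"
    have "y <= w s" if "c <= s" "s <= ?t" for s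
    proof -
      have s: "0 <= s - ?h" "s - ?h <= ?k" using that c t by auto
      have "- (d - 2 * y) <= ?w (s - ?h)" using inf_on_le[OF pshift_Paths[OF w] s(1) s(2), of ?h] e2 by (simp add: exit_up_def)
      then show ?thesis using s h up_hit(1)[OF w _ f1] y by (simp add: pshift_at)
    qed
    then have "y <= inf_on w c ?t" using c by (subst inf_on_ge_iff[OF w]) auto
    then show False using c(3) rinf_le0[OF w c(1)] y by simp
  qed
  have "q * ?t <= q * (?h + ?k)" "r * last_inf w ?t <= r * ?h" "u * (- y) <= u * rinf w ?t" by (rule mult_left_mono[OF t q(1)], rule mult_left_mono[OF l q(2)], rule mult_left_mono[OF i q(3)])
  then have "- (q + r) * ?h + - u * y + - q * ?k <= - q * ?t - r * last_inf w ?t + u * rinf w ?t" by (simp add: algebra_simps)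
  then show "exp (- (q + r) * ?h) * exp (- u * y) * exp (- q * ?k) <= val q r u a w"
    using fe unfolding val_def exp_add[symmetric] by simp
qed

context levy_law begin

lemma val_P [measurable]: "val q r u a \<in> borel_measurable P"
  unfolding measurable_cong_sets[OF sets_P refl] by (rule val_measurable)

definition KK :: "real => real => real => real => real" where "KK q r u a = (\<E> w. val q r u a w)"

context fixes q r u a :: real assumes q: "0 <= q" "0 <= r" "0 <= u" and a: "0 < a" begin

lemma val_integrable: "A \<in> sets P ==> integrable P (%w. indicator A w * val q r u a w)"
  by (rule integrable_const_bound[where B=1]) (auto simp: val_nonneg val_le1 q indicator_def)

lemma KK_nonneg: "0 <= KK q r u a" unfolding KK_def by (intro integral_nonneg_AE) (simp add: val_nonneg)

lemma KK_nn: "(\<N> w. ennreal (val q r u a w)) = ennreal (KK q r u a)"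
  unfolding KK_def by (rule nn_integral_eq_integral) (use val_integrable[of "space P"] in \<open>auto simp: val_nonneg val_le1 q intro!: integrable_const_bound[where B=1]\<close>)

lemma dn_strong_markov:
  assumes A: "determined A (hit (dn y))" and sub: "A \<subseteq> falls_first y a"
  shows "(\<E> w. indicator A w * val q r u a w) = exp (- u * y) * (\<E> w. indicator A w * dval (q + r) u y w) * KK q r u a"
proof -
  have q': "0 <= q + r" using q by simp
  have Am [measurable]: "A \<in> sets path_space" using A by (simp add: determined_def)
  have AP [measurable]: "A \<in> sets P" using Am sets_P by simp
  have dm [measurable]: "dval (q + r) u y \<in> borel_measurable path_space" by (rule dval_measurable) auto
  note [measurable] = val_measurable
  have sb: "w \<in> Paths" "fin (dn y) w" "fin (ex a) w ==> hit (dn y) w < hit (ex a) w" if "w \<in> A" for w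
    using sub that by (auto simp: falls_first_def)
  have i: "integrable P (%w. indicator A w * dval (q + r) u y w)"
    by (rule integrable_const_bound[where B=1]) (auto simp: dval_nonneg dval_le1 q q' indicator_def)
  have "(\<N> w. ennreal (indicator A w * val q r u a w)) = (\<N> w. indicator A w * (ennreal (exp (- u * y) * dval (q + r) u y w) * ennreal (val q r u a (pshift (hit (dn y) w) w))))"
  proof (rule nn_integral_cong)
    fix w
    show "ennreal (indicator A w * val q r u a w) = indicator A w * (ennreal (exp (- u * y) * dval (q + r) u y w) * ennreal (val q r u a (pshift (hit (dn y) w) w)))"
      using val_shift[OF sb, of w q r u] by (cases "w \<in> A") (auto simp: ennreal_mult[symmetric] dval_nonneg val_nonneg)
  qed
  also have "... = (\<N> w. indicator A w * ennreal (exp (- u * y) * dval (q + r) u y w)) * (\<N> w. ennreal (val q r u a w))"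
  proof (rule strong_markov_prod[OF A])
    fix w t assume w: "w \<in> A" and t: "hit (dn y) w < t"
    note s = hit_stop[OF progressive_dn sb(1)[OF w], of y t]
    have "dval (q + r) u y (pstop t w) = dval (q + r) u y w" using s sb(2)[OF w] t by (simp add: dval_def pstop_at)
    then show "ennreal (exp (- u * y) * dval (q + r) u y (pstop t w)) = ennreal (exp (- u * y) * dval (q + r) u y w)" by simp
  qed auto
  also have "(\<N> w. indicator A w * ennreal (exp (- u * y) * dval (q + r) u y w)) = (\<N> w. ennreal (exp (- u * y) * (indicator A w * dval (q + r) u y w)))"
    by (intro nn_integral_cong) (auto simp: indicator_def)
  also have "... = ennreal (exp (- u * y) * (\<E> w. indicator A w * dval (q + r) u y w))"
    using nn_integral_eq_integral[OF integrable_mult_right[OF i, of "exp (- u * y)"]] by (simp add: dval_nonneg)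
  finally have nn: "(\<N> w. ennreal (indicator A w * val q r u a w)) = ennreal (exp (- u * y) * (\<E> w. indicator A w * dval (q + r) u y w) * KK q r u a)"
    unfolding KK_nn by (subst (asm) ennreal_mult[symmetric]) (auto simp: KK_nonneg dval_nonneg intro!: mult_nonneg_nonneg integral_nonneg_AE)
  have "(\<E> w. indicator A w * val q r u a w) = enn2real (\<N> w. ennreal (indicator A w * val q r u a w))"
    by (rule integral_eq_nn_integral) (auto simp: val_nonneg)
  then show ?thesis unfolding nn by (subst (asm) enn2real_ennreal) (auto simp: KK_nonneg dval_nonneg intro!: mult_nonneg_nonneg integral_nonneg_AE)
qed

definition stay :: "real => real" where "stay y = (\<E> w. indicator (- falls_first y a) w * val q r u a w)"

text \<open>A renewal equation: after a fall below -y the path starts afresh. The factor of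
  \<open>KK q r u a\<close> on the right is \<beta>(y), and \<open>stay y\<close> is A(y).\<close>

lemma KK_eq: "KK q r u a = exp (- u * y) * (\<E> w. indicator (falls_first y a) w * dval (q + r) u y w) * KK q r u a + stay y"
proof -
  have F: "falls_first y a \<in> sets P" using falls_first_sets sets_P by simp
  have i: "integrable P (%w. indicator (- falls_first y a) w * val q r u a w)"
  proof (rule Bochner_Integration.integrable_cong[THEN iffD2, OF refl])
    show "integrable P (%w. indicator (space P - falls_first y a) w * val q r u a w)" by (rule val_integrable) (use sets.compl_sets[OF F] in simp)
  qed (auto simp: indicator_def)
  have "KK q r u a = (\<E> w. indicator (falls_first y a) w * val q r u a w + indicator (- falls_first y a) w * val q r u a w)"
    unfolding KK_def by (intro Bochner_Integration.integral_cong) (auto simp: indicator_def)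
  also have "... = (\<E> w. indicator (falls_first y a) w * val q r u a w) + stay y"
    unfolding stay_def by (rule Bochner_Integration.integral_add[OF val_integrable[OF F] i])
  finally show ?thesis unfolding dn_strong_markov[OF determined_falls_first order_refl] .
qed

end

end

section \<open>Asymptotics at small levels and the unrestricted value\<close>

context levy_law begin

text \<open>Monotonicity bounds the integral over [0, y] by y times the value of \<open>Ws s\<close>
  at y, even when the latter tends to 0.\<close>

lemma Zs_small: assumes s: "0 <= s" and u: "0 <= u" shows "((%y. (1 - Zs s u y) / Ws s y) \<longlongrightarrow> 0) (at_right 0)"
proof (rule Lim_null_comparison)
  show "\<forall>\<^sub>F y in at_right 0. norm ((1 - Zs s u y) / Ws s y) <= \<bar>s - \<psi> u\<bar> * y"
    unfolding eventually_at_right_field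
  proof (intro exI[of _ 1] conjI allI impI)
    fix y :: real assume y: "0 < y" "y < 1"
    let ?I = "integral {0..y} (%z. exp (- u * z) * Ws s z)"
    have p: "Ws s y > 0" by (rule Ws_pos[OF s y(1)])
    note i = integrable_continuous_real[OF exp_Ws_continuous[OF s, of y u]]
    have "?I <= integral {0..y} (%z. Ws s y)"
    proof (rule integral_le[OF i])
      fix z assume z: "z \<in> {0..y}"
      have "exp (- u * z) * Ws s z <= 1 * Ws s y" using z u Ws_nonneg[OF s] by (intro mult_mono Ws_mono s) auto
      then show "exp (- u * z) * Ws s z <= Ws s y" by simp
    qed (rule integrable_continuous_real[OF continuous_on_const])
    then have I: "?I <= y * Ws s y" using y by simp
    have I0: "0 <= ?I" by (rule integral_nonneg[OF i]) (use Ws_nonneg[OF s] in auto)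
    have "norm ((1 - Zs s u y) / Ws s y) = \<bar>s - \<psi> u\<bar> * (?I / Ws s y)" using p I0 by (simp add: Zs_def abs_mult)
    also have "... <= \<bar>s - \<psi> u\<bar> * y" using I p by (intro mult_left_mono) (auto simp: field_simps)
    finally show "norm ((1 - Zs s u y) / Ws s y) <= \<bar>s - \<psi> u\<bar> * y" .
  qed simp
  have "((%y. \<bar>s - \<psi> u\<bar> * y) \<longlongrightarrow> \<bar>s - \<psi> u\<bar> * 0) (at_right (0::real))" by (intro tendsto_intros)
  then show "((%y. \<bar>s - \<psi> u\<bar> * y) \<longlongrightarrow> 0) (at_right 0)" by simp
qed

text \<open>In 1 - exp (- u y) Da the term with \<open>Zs s u y\<close> is negligible against
  \<open>Ws s y\<close>, and the other term is proportional to it. The moving level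
  \<open>g y\<close> covers both bounds of \<open>falls_first_bounds\<close>.\<close>

lemma Da_limit:
  assumes s: "0 <= s" and u: "0 <= u" and a: "0 < a" and g: "(g \<longlongrightarrow> a) (at_right 0)" and g0: "!!y. 0 < y ==> 0 < g y"
  shows "((%y. (1 - exp (- u * y) * Da s u y (g y)) / Ws s y) \<longlongrightarrow> exp (u * a) * Zs s u a / Ws s a) (at_right 0)"
proof -
  have "((%y. (1 - Zs s u y) / Ws s y + exp (- u * y) * (exp (u * g y) * Zs s u (g y) / Ws s (g y))) \<longlongrightarrow> 0 + exp (- u * 0) * (exp (u * a) * Zs s u a / Ws s a)) (at_right 0)"
    using Ws_pos[OF s a] by (intro tendsto_intros Zs_small s u g isCont_tendsto_compose[OF Zs_isCont[OF s a] g] isCont_tendsto_compose[OF Ws_isCont[OF s a] g]) auto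
  moreover have "\<forall>\<^sub>F y in at_right 0. (1 - Zs s u y) / Ws s y + exp (- u * y) * (exp (u * g y) * Zs s u (g y) / Ws s (g y)) = (1 - exp (- u * y) * Da s u y (g y)) / Ws s y"
    unfolding eventually_at_right_field
  proof (intro exI[of _ 1] conjI allI impI)
    fix y :: real assume y: "0 < y" "y < 1"
    have p: "Ws s y > 0" "Ws s (g y) > 0" using Ws_pos[OF s] y g0 by auto
    have "exp (- u * y) * Da s u y (g y) = Zs s u y - exp (- u * y) * (exp (u * g y) * Zs s u (g y) * (Ws s y / Ws s (g y)))"
    proof -
      have "exp (- u * y) * (exp (u * y) * Zs s u y) = Zs s u y" by (simp add: exp_minus)
      then show ?thesis unfolding Da_def right_diff_distrib by simp
    qed
    then show "(1 - Zs s u y) / Ws s y + exp (- u * y) * (exp (u * g y) * Zs s u (g y) / Ws s (g y)) = (1 - exp (- u * y) * Da s u y (g y)) / Ws s y"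
      using p by (simp add: diff_divide_distrib add_divide_distrib)
  qed simp
  ultimately show ?thesis by (auto intro: Lim_transform_eventually)
qed

context fixes q r u a :: real assumes q: "0 <= q" "0 <= r" "0 <= u" and a: "0 < a" begin

text \<open>Until the fall the infimum lies between -y and 0, so the moving level at which the
  excursion ends lies between a - y and a. Measured from the floor at -y, these are the heights a
  and a + y in the two bounds.\<close>

lemma falls_first_bounds:
  assumes y: "0 < y" "y <= a"
  shows "Da (q + r) u y a <= (\<E> w. indicator (falls_first y a) w * dval (q + r) u y w)"
    "(\<E> w. indicator (falls_first y a) w * dval (q + r) u y w) <= Da (q + r) u y (a + y)"
proof -
  have q': "0 <= q + r" using q by simp
  have FP [measurable]: "falls_first y a \<in> sets P" using falls_first_sets sets_P by simp
  have i: "integrable P (%w. indicator (- exit_up y b) w * dval (q + r) u y w)" for b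
    by (rule integrable_const_bound[where B=1]) (auto simp: dval_nonneg dval_le1 q q' indicator_def)
  have iF: "integrable P (%w. indicator (falls_first y a) w * dval (q + r) u y w)"
    by (rule integrable_const_bound[where B=1]) (auto simp: dval_nonneg dval_le1 q q' indicator_def)
  show "Da (q + r) u y a <= (\<E> w. indicator (falls_first y a) w * dval (q + r) u y w)"
    unfolding dval_before_up[OF q' q(3) y, symmetric]
  proof (rule integral_mono[OF i iF])
    fix w assume "w \<in> space P"
    then have w: "w \<in> Paths" by simp
    show "indicator (- exit_up y (a - y)) w * dval (q + r) u y w <= indicator (falls_first y a) w * dval (q + r) u y w"
    proof (cases "w \<notin> exit_up y (a - y) & fin (dn y) w")
      case True
      then have "w \<in> falls_first y a" using dn_before_ex[OF w y(2) a] w by (auto simp: falls_first_def)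
      then show ?thesis by (simp add: dval_nonneg indicator_def)
    qed (auto simp: dval_def indicator_def)
  qed
  have e: "y <= a + y" "a + y - y = a" using a by auto
  show "(\<E> w. indicator (falls_first y a) w * dval (q + r) u y w) <= Da (q + r) u y (a + y)"
    unfolding dval_before_up[OF q' q(3) y(1) e(1), symmetric] e(2)
  proof (rule integral_mono[OF iF i])
    fix w show "indicator (falls_first y a) w * dval (q + r) u y w <= indicator (- exit_up y a) w * dval (q + r) u y w"
      using falls_first_not_exit[of w y a] by (auto simp: indicator_def dval_nonneg)
  qed
qed

lemma stay_integrable: "integrable P (%w. indicator (- falls_first y a) w * val q r u a w)"
proof -
  have FP [measurable]: "falls_first y a \<in> sets P" using falls_first_sets sets_P by simp
  show ?thesis by (rule integrable_const_bound[where B=1]) (auto simp: val_nonneg val_le1 q indicator_def)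
qed

text \<open>The weights with r and u are bounded by 1, and the level a - 2 y, strictly below a - y,
  has been passed when the excursion ends.\<close>

lemma stay_upper: assumes y: "0 < y" shows "stay q r u a y <= hh q y (a - 2 * y)"
  unfolding stay_def[OF q a] hh_def
proof (rule integral_mono[OF stay_integrable hh_integrable[OF q(1)]])
  fix w assume "w \<in> space P"
  then have w: "w \<in> Paths" by simp
  show "indicator (- falls_first y a) w * val q r u a w <= indicator (exit_up y (a - 2 * y)) w * exp (- q * hit (up (a - 2 * y)) w)"
  proof (cases "w \<notin> falls_first y a & fin (ex a) w")
    case True
    then have n: "w \<notin> falls_first y a" and f: "fin (ex a) w" by auto
    have "a - 2 * y < a - y" using y by simp
    note e = exit_up_of_not_falls_first[OF w n f y a this]
    have t: "0 <= hit (ex a) w" by (rule hit_ge0[OF f])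
    have "q * hit (up (a - 2 * y)) w <= q * hit (ex a) w" by (rule mult_left_mono[OF e(2) q(1)])
    moreover have "0 <= r * last_inf w (hit (ex a) w)" "u * rinf w (hit (ex a) w) <= 0"
      using q last_inf_nonneg[OF w t] rinf_le0[OF w t] by (auto intro: mult_nonneg_nonpos)
    ultimately have "val q r u a w <= exp (- q * hit (up (a - 2 * y)) w)" using f by (simp add: val_def)
    then show ?thesis using n e(1) by simp
  qed (auto simp: val_def indicator_def)
qed

lemma stay_lower:
  assumes y: "0 < y" "2 * y < d" "d <= a"
  shows "exp (- u * y) * hh (q + r) y (d - y) * hh q (d - 2 * y) (a + y - d) <= stay q r u a y"
proof -
  let ?E = "exit_up y (d - y)" and ?F = "exit_up (d - 2 * y) (a + y - d)" and ?h = "hit (up (d - y))" and ?k = "hit (up (a + y - d))"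
  have q': "0 <= q + r" using q by simp
  have [measurable]: "?h \<in> borel_measurable path_space" "?k \<in> borel_measurable path_space" by (auto intro: hit_measurable)
  have s0: "0 <= stay q r u a y" unfolding stay_def[OF q a] by (intro integral_nonneg_AE) (simp add: val_nonneg)
  have "ennreal (hh (q + r) y (d - y)) * ennreal (hh q (d - 2 * y) (a + y - d)) = (\<N> w. indicator ?E w * ennreal (exp (- (q + r) * ?h w))) * (\<N> w. indicator ?F w * ennreal (exp (- q * ?k w)))"
    by (simp only: hh_nn[OF q'] hh_nn[OF q(1)])
  also have "... = (\<N> w. indicator ?E w * (ennreal (exp (- (q + r) * ?h w)) * (indicator ?F (pshift (?h w) w) * ennreal (exp (- q * ?k (pshift (?h w) w))))))"
  proof (rule strong_markov_prod[OF determined_exit_up, symmetric])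
    fix w t assume "w \<in> ?E" "?h w < t"
    then show "ennreal (exp (- (q + r) * ?h (pstop t w))) = ennreal (exp (- (q + r) * ?h w))"
      using hit_stop(2)[of "up (d - y)" w t] by (auto simp: exit_up_def)
  qed auto
  finally have Q: "ennreal (hh (q + r) y (d - y)) * ennreal (hh q (d - 2 * y) (a + y - d)) = (\<N> w. indicator ?E w * (ennreal (exp (- (q + r) * ?h w)) * (indicator ?F (pshift (?h w) w) * ennreal (exp (- q * ?k (pshift (?h w) w))))))" .
  have "ennreal (exp (- u * y) * hh (q + r) y (d - y) * hh q (d - 2 * y) (a + y - d)) = ennreal (exp (- u * y)) * (ennreal (hh (q + r) y (d - y)) * ennreal (hh q (d - 2 * y) (a + y - d)))"
    using hh_nonneg[OF q'] hh_nonneg[OF q(1)] by (simp add: ennreal_mult[symmetric] mult.assoc)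
  also have "... = ennreal (exp (- u * y)) * (\<N> w. indicator ?E w * (ennreal (exp (- (q + r) * ?h w)) * (indicator ?F (pshift (?h w) w) * ennreal (exp (- q * ?k (pshift (?h w) w))))))" by (simp only: Q)
  also have "... = (\<N> w. ennreal (exp (- u * y)) * (indicator ?E w * (ennreal (exp (- (q + r) * ?h w)) * (indicator ?F (pshift (?h w) w) * ennreal (exp (- q * ?k (pshift (?h w) w)))))))"
  proof (rule nn_integral_cmult[symmetric])
    have sh: "(%w. pshift (?h w) w) \<in> path_space \<rightarrow>\<^sub>M path_space" by (rule pshift_measurable) auto
    have [measurable]: "(%w. indicator ?F (pshift (?h w) w) :: ennreal) \<in> borel_measurable path_space"
      by (rule measurable_compose[OF sh borel_measurable_indicator[OF exit_up_sets]])
    have [measurable]: "(%w. ?k (pshift (?h w) w)) \<in> borel_measurable path_space"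
      by (rule measurable_compose[OF sh hit_measurable]) simp
    have "(%w. indicator ?E w * (ennreal (exp (- (q + r) * ?h w)) * (indicator ?F (pshift (?h w) w) * ennreal (exp (- q * ?k (pshift (?h w) w)))))) \<in> borel_measurable path_space" by measurable
    then show "(%w. indicator ?E w * (ennreal (exp (- (q + r) * ?h w)) * (indicator ?F (pshift (?h w) w) * ennreal (exp (- q * ?k (pshift (?h w) w)))))) \<in> borel_measurable P"
      unfolding measurable_cong_sets[OF sets_P refl] .
  qed
  also have "... <= (\<N> w. ennreal (indicator (- falls_first y a) w * val q r u a w))"
  proof (rule nn_integral_mono)
    fix w assume "w \<in> space P"
    then have w: "w \<in> Paths" by simp
    show "ennreal (exp (- u * y)) * (indicator ?E w * (ennreal (exp (- (q + r) * ?h w)) * (indicator ?F (pshift (?h w) w) * ennreal (exp (- q * ?k (pshift (?h w) w)))))) <= ennreal (indicator (- falls_first y a) w * val q r u a w)"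
    proof (cases "w \<in> ?E & pshift (?h w) w \<in> ?F")
      case True
      then have e: "w \<in> ?E" "pshift (?h w) w \<in> ?F" by auto
      have "ennreal (exp (- (q + r) * ?h w) * exp (- u * y) * exp (- q * ?k (pshift (?h w) w))) <= ennreal (val q r u a w)"
        by (rule ennreal_leI[OF val_lower(2)[OF w q y e]])
      then show ?thesis using e val_lower(1)[OF w q y e] by (simp add: ennreal_mult mult_ac)
    qed auto
  qed
  also have "... = ennreal (stay q r u a y)"
    unfolding stay_def[OF q a] by (rule nn_integral_eq_integral[OF stay_integrable]) (simp add: val_nonneg)
  finally show ?thesis using s0 by simp
qed

text \<open>The renewal equation, divided by \<open>Ws (q + r) y\<close>, is squeezed as y tends to
  0. The upper bound is sharp at once. The lower bound loses the factor
  \<open>Ws q d / Ws (q + r) d\<close>, from charging the first stage with q + r, which tends to 1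
  as d tends to 0.\<close>

lemma KK_formula: "KK q r u a * (exp (u * a) * Zs (q + r) u a / Ws (q + r) a) = 1 / Ws q a"
proof -
  let ?s = "q + r" and ?L = "exp (u * a) * Zs (q + r) u a / Ws (q + r) a"
  let ?b = "%y. \<E> w. indicator (falls_first y a) w * dval (q + r) u y w"
  have s: "0 <= ?s" using q by simp
  have K0: "0 <= KK q r u a" by (rule KK_nonneg[OF q a])
  have Wa: "Ws q a > 0" by (rule Ws_pos[OF q(1) a])
  have eqn: "KK q r u a * ((1 - exp (- u * y) * ?b y) / Ws ?s y) = stay q r u a y / Ws ?s y" for y
    using KK_eq[OF q a, of y] by (simp add: algebra_simps)
  have mono: "KK q r u a * ((1 - exp (- u * y) * z) / Ws ?s y) <= KK q r u a * ((1 - exp (- u * y) * z') / Ws ?s y)" if "z' <= z" "0 < y" for y z z'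
    using that Ws_pos[OF s that(2)] K0 by (intro mult_left_mono divide_right_mono) auto
  have t0: "((%y. y) \<longlongrightarrow> 0) (at_right (0::real))" by (rule tendsto_ident_at)
  have "((%y. a - y) \<longlongrightarrow> a - 0) (at_right 0)" by (intro tendsto_intros t0)
  then have aW: "((%y. Ws q (a - y)) \<longlongrightarrow> Ws q a) (at_right 0)" by (intro isCont_tendsto_compose[OF Ws_isCont[OF q(1) a]]) simp
  have ratio: "hh p x b = Ws p x / Ws p (x + b)" if "0 <= p" "0 < x" "0 <= b" for p x b
    using hh_ratio[OF that(1), of x b] that kk_pos[OF that(1)] by (simp add: Ws_pos_eq)
  have up: "KK q r u a * ?L <= 1 / Ws q a"
  proof (rule tendsto_le[OF trivial_limit_at_right_real])
    have "((%y. a + y) \<longlongrightarrow> a + 0) (at_right 0)" by (intro tendsto_intros t0)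
    then have "((%y. a + y) \<longlongrightarrow> a) (at_right 0)" by simp
    then show "((%y. KK q r u a * ((1 - exp (- u * y) * Da ?s u y (a + y)) / Ws ?s y)) \<longlongrightarrow> KK q r u a * ?L) (at_right 0)"
      by (intro tendsto_mult tendsto_const Da_limit s q a) (use a in auto)
    have "((%y. (Ws q y / Ws ?s y) / Ws q (a - y)) \<longlongrightarrow> 1 / Ws q a) (at_right 0)"
      using Wa by (intro tendsto_divide Ws_ratio aW q s) auto
    then show "((%y. (Ws q y / Ws ?s y) / Ws q (a - y)) \<longlongrightarrow> 1 / Ws q a) (at_right 0)" .
    show "\<forall>\<^sub>F y in at_right 0. KK q r u a * ((1 - exp (- u * y) * Da ?s u y (a + y)) / Ws ?s y) <= (Ws q y / Ws ?s y) / Ws q (a - y)"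
      unfolding eventually_at_right_field
    proof (intro exI[of _ "a / 2"] conjI allI impI)
      fix y assume y: "0 < y" "y < a / 2"
      have p: "Ws ?s y > 0" by (rule Ws_pos[OF s y(1)])
      have "KK q r u a * ((1 - exp (- u * y) * Da ?s u y (a + y)) / Ws ?s y) <= KK q r u a * ((1 - exp (- u * y) * ?b y) / Ws ?s y)"
        by (rule mono[OF falls_first_bounds(2) y(1)]) (use y in auto)
      also have "... <= hh q y (a - 2 * y) / Ws ?s y" unfolding eqn using p by (intro divide_right_mono stay_upper y) auto
      also have "hh q y (a - 2 * y) = Ws q y / Ws q (y + (a - 2 * y))" by (rule ratio[OF q(1) y(1)]) (use y in simp)
      also have "y + (a - 2 * y) = a - y" by simp
      finally show "KK q r u a * ((1 - exp (- u * y) * Da ?s u y (a + y)) / Ws ?s y) <= (Ws q y / Ws ?s y) / Ws q (a - y)"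
        by (simp add: mult.commute)
    qed (use a in simp)
  qed
  have low: "(Ws q d / Ws ?s d) / Ws q a <= KK q r u a * ?L" if d: "0 < d" "d <= a" for d
  proof (rule tendsto_le[OF trivial_limit_at_right_real])
    show "((%y. KK q r u a * ((1 - exp (- u * y) * Da ?s u y a) / Ws ?s y)) \<longlongrightarrow> KK q r u a * ?L) (at_right 0)"
      by (intro tendsto_mult tendsto_const Da_limit s q a)
    have "((%y. d - 2 * y) \<longlongrightarrow> d - 2 * 0) (at_right 0)" by (intro tendsto_intros t0)
    then have dW: "((%y. Ws q (d - 2 * y)) \<longlongrightarrow> Ws q d) (at_right 0)" by (intro isCont_tendsto_compose[OF Ws_isCont[OF q(1) d(1)]]) simp
    have "((%y. exp (- u * y) * (1 / Ws ?s d) * (Ws q (d - 2 * y) / Ws q (a - y))) \<longlongrightarrow> exp (- u * 0) * (1 / Ws ?s d) * (Ws q d / Ws q a)) (at_right 0)"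
      using Wa Ws_pos[OF s d(1)] by (intro tendsto_intros t0 dW aW) auto
    then show "((%y. exp (- u * y) * (1 / Ws ?s d) * (Ws q (d - 2 * y) / Ws q (a - y))) \<longlongrightarrow> (Ws q d / Ws ?s d) / Ws q a) (at_right 0)" by simp
    show "\<forall>\<^sub>F y in at_right 0. exp (- u * y) * (1 / Ws ?s d) * (Ws q (d - 2 * y) / Ws q (a - y)) <= KK q r u a * ((1 - exp (- u * y) * Da ?s u y a) / Ws ?s y)"
      unfolding eventually_at_right_field
    proof (intro exI[of _ "d / 2"] conjI allI impI)
      fix y assume y: "0 < y" "y < d / 2"
      have p: "Ws ?s y > 0" by (rule Ws_pos[OF s y(1)])
      have "hh ?s y (d - y) = Ws ?s y / Ws ?s (y + (d - y))" by (rule ratio[OF s y(1)]) (use y in simp)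
      moreover have "hh q (d - 2 * y) (a + y - d) = Ws q (d - 2 * y) / Ws q (d - 2 * y + (a + y - d))" by (rule ratio[OF q(1)]) (use y d in auto)
      moreover have "y + (d - y) = d" "d - 2 * y + (a + y - d) = a - y" by auto
      ultimately have h: "hh ?s y (d - y) = Ws ?s y / Ws ?s d" "hh q (d - 2 * y) (a + y - d) = Ws q (d - 2 * y) / Ws q (a - y)" by simp_all
      have "exp (- u * y) * (1 / Ws ?s d) * (Ws q (d - 2 * y) / Ws q (a - y)) = (exp (- u * y) * hh ?s y (d - y) * hh q (d - 2 * y) (a + y - d)) / Ws ?s y"
        unfolding h using p by simp
      also have "... <= stay q r u a y / Ws ?s y" using p y d by (intro divide_right_mono stay_lower) auto
      also have "... <= KK q r u a * ((1 - exp (- u * y) * Da ?s u y a) / Ws ?s y)"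
        unfolding eqn[symmetric] by (rule mono[OF falls_first_bounds(1) y(1)]) (use y d in auto)
      finally show "exp (- u * y) * (1 / Ws ?s d) * (Ws q (d - 2 * y) / Ws q (a - y)) <= KK q r u a * ((1 - exp (- u * y) * Da ?s u y a) / Ws ?s y)" .
    qed (use d in simp)
  qed
  have "1 / Ws q a <= KK q r u a * ?L"
  proof (rule tendsto_le[OF trivial_limit_at_right_real tendsto_const])
    show "((%d. (Ws q d / Ws ?s d) / Ws q a) \<longlongrightarrow> 1 / Ws q a) (at_right 0)" using Wa by (intro tendsto_divide Ws_ratio tendsto_const q s) auto
    show "\<forall>\<^sub>F d in at_right 0. (Ws q d / Ws ?s d) / Ws q a <= KK q r u a * ?L"
      unfolding eventually_at_right_field using low a by (intro exI[of _ a]) auto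
  qed
  with up show ?thesis by simp
qed

text \<open>Nonvanishing of \<open>Zs\<close> is a by-product: the right-hand side of
  \<open>KK_formula\<close> is not 0.\<close>

lemma KK_value: "Zs (q + r) u a \<noteq> 0" "KK q r u a = Ws (q + r) a / Ws q a * (exp (- u * a) / Zs (q + r) u a)"
proof -
  have p: "Ws (q + r) a > 0" "Ws q a > 0" using Ws_pos a q by auto
  show Z: "Zs (q + r) u a \<noteq> 0" using KK_formula p by auto
  have "exp (- u * a) * exp (u * a) = 1" by (simp add: exp_minus)
  then show "KK q r u a = Ws (q + r) a / Ws q a * (exp (- u * a) / Zs (q + r) u a)"
    using KK_formula p Z by (simp add: field_simps exp_minus)
qed

end

end

section \<open>The restriction on the supremum\<close>

lemma ex_bounded:
  assumes w: "w \<in> Paths" and a: "0 < a" and f: "fin (ex a) w" and s: "0 <= s" "s <= hit (ex a) w"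
  shows "w s <= a"
  using ex_hit(2)[OF w a f s] rinf_le0[OF w s(1)] by simp

text \<open>Before the fall the level a - y has not been passed; after it the infimum is at most -y
  and the path at most a above it.\<close>

lemma not_exit_bounded:
  assumes w: "w \<in> Paths" and a: "0 < a" and y: "y <= a" and f: "fin (dn y) w" "fin (ex a) w" and n: "w \<notin> exit_up y (a - y)" and s: "0 <= s" "s <= hit (ex a) w"
  shows "w s <= a - y"
proof -
  let ?T = "hit (dn y) w"
  consider "s < ?T" | "?T <= s" by linarith
  then show ?thesis
  proof cases
    case 1
    show ?thesis
    proof (rule ccontr)
      assume "\<not> w s <= a - y"
      then have u: "up (a - y) w s" by (simp add: up_def)
      then have fu: "fin (up (a - y)) w" using s by (auto simp: fin_def)
      have h: "hit (up (a - y)) w <= s" by (rule hit_le[of _ "up (a - y)" w, OF s(1) u])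
      have "- y <= rinf w (hit (up (a - y)) w)" using h 1 dn_hit(2)[OF w f(1)] hit_ge0[OF fu] by (subst inf_on_ge_iff[OF w]) auto
      then show False using n w fu by (simp add: exit_up_def)
    qed
  next
    case 2
    have "w s <= a + rinf w s" using ex_hit(2)[OF w a f(2) s] by simp
    moreover have "rinf w s <= w ?T" by (rule inf_on_le[OF w hit_ge0[OF f(1)] 2])
    ultimately show ?thesis using dn_hit(1)[OF w f(1)] by simp
  qed
qed

text \<open>When the excursion ends the path is below b and its infimum lower by a, so it has fallen
  below b - a; and level b has not been reached until then.\<close>

lemma bounded_not_exit:
  assumes w: "w \<in> Paths" and a: "0 < a" and b: "0 <= b" and f: "fin (ex a) w" and lt: "!!s. 0 <= s ==> s <= hit (ex a) w ==> w s < b"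
  shows "fin (dn (a - b)) w & w \<notin> exit_up (a - b) b"
proof -
  let ?t = "hit (ex a) w"
  have t: "0 <= ?t" by (rule hit_ge0[OF f])
  have "rinf w ?t < - (a - b)" using ex_hit(1)[OF w a f] lt[OF t order_refl] by simp
  then obtain s where s: "0 <= s" "s <= ?t" "w s < - (a - b)" using t by (auto simp: inf_on_less_iff[OF w])
  then have d: "dn (a - b) w s" by (simp add: dn_def)
  then have fd: "fin (dn (a - b)) w" using s by (auto simp: fin_def)
  have T: "hit (dn (a - b)) w <= ?t" using hit_le[of _ "dn (a - b)" w, OF s(1) d] s by simp
  have "w \<notin> exit_up (a - b) b"
  proof
    assume e: "w \<in> exit_up (a - b) b"
    then have fu: "fin (up b) w" by (simp add: exit_up_def)
    have "hit (up b) w <= ?t" using exit_up_hit_le[OF e fd] T by simp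
    then show False using lt[OF hit_ge0[OF fu]] up_hit(1)[OF w b fu] by simp
  qed
  then show ?thesis using fd by simp
qed

abbreviation "rsup w t \<equiv> Sup (w ` {0..t})" for w :: "real => real" and t :: real

lemma rsup_upper: "w \<in> Paths ==> 0 <= s ==> s <= t ==> w s <= rsup w t"
  using Paths_bdd_above[of w 0 t] by (intro cSup_upper) (auto simp: bdd_above_def)

lemma rsup_least: "0 <= t ==> (!!s. 0 <= s ==> s <= t ==> w s <= c) ==> rsup w t <= c"
  by (rule cSup_least) auto

context levy_law begin

context fixes q r u a :: real assumes q: "0 <= q" "0 <= r" "0 <= u" and a: "0 < a" begin

lemma not_exit_value:
  assumes y: "0 < y" "y <= a"
  shows "(\<E> w. indicator {w\<in>Paths. fin (dn y) w & w \<notin> exit_up y (a - y)} w * val q r u a w)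
    = KK q r u a * (Zs (q + r) u y - exp (u * (a - y)) * Zs (q + r) u a * (Ws (q + r) y / Ws (q + r) a))"
proof -
  let ?E = "{w\<in>Paths. fin (dn y) w & w \<notin> exit_up y (a - y)}"
  have q': "0 <= q + r" using q by simp
  have "?E \<subseteq> falls_first y a" using dn_before_ex[OF _ y(2) a] by (auto simp: falls_first_def)
  from dn_strong_markov[OF q a determined_not_exit this]
  have "(\<E> w. indicator ?E w * val q r u a w) = exp (- u * y) * (\<E> w. indicator ?E w * dval (q + r) u y w) * KK q r u a" .
  also have "(\<E> w. indicator ?E w * dval (q + r) u y w) = (\<E> w. indicator (- exit_up y (a - y)) w * dval (q + r) u y w)"
    by (intro Bochner_Integration.integral_cong) (auto simp: indicator_def dval_def)
  also have "... = Da (q + r) u y a" by (rule dval_before_up[OF q' q(3) y])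
  also have "exp (- u * y) * Da (q + r) u y a = Zs (q + r) u y - exp (u * (a - y)) * Zs (q + r) u a * (Ws (q + r) y / Ws (q + r) a)"
  proof -
    have "exp (- u * y) * (exp (u * y) * Zs (q + r) u y) = Zs (q + r) u y" by (simp add: exp_minus)
    moreover have "exp (- u * y) * (exp (u * a) * Zs (q + r) u a * (Ws (q + r) y / Ws (q + r) a)) = exp (u * (a - y)) * Zs (q + r) u a * (Ws (q + r) y / Ws (q + r) a)"
    proof -
      have "exp (u * (a - y)) = exp (- u * y) * exp (u * a)" by (subst exp_add[symmetric]) (simp add: algebra_simps)
      then show ?thesis by (simp only: mult.assoc)
    qed
    ultimately show ?thesis unfolding Da_def right_diff_distrib by (simp only:)
  qed
  finally show ?thesis by (simp only: mult.commute)
qed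

text \<open>A supremum less than b implies the two-sided event at level b, but that event only
  bounds the supremum weakly. The strict event is therefore reached through levels a - y n that
  increase to b and stay below it, and continuity of \<open>Zs\<close> and \<open>Ws\<close> gives
  the value.\<close>

lemma sup_value:
  assumes b: "0 <= b"
  defines "f \<equiv> %w. val q r u a w * indicator {w. rsup w (hit (ex a) w) < b} w"
  shows "f \<in> borel_measurable P"
    "(\<E> w. f w) = KK q r u a * (Zs (q + r) u (a - b) - exp (u * b) * Zs (q + r) u a * (Ws (q + r) (a - b) / Ws (q + r) a))"
proof -
  have q': "0 <= q + r" using q by simp
  have Wa: "Ws (q + r) a > 0" by (rule Ws_pos[OF q' a])
  have "f \<in> borel_measurable P & (\<E> w. f w) = KK q r u a * (Zs (q + r) u (a - b) - exp (u * b) * Zs (q + r) u a * (Ws (q + r) (a - b) / Ws (q + r) a))"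
  proof -
    consider "b = 0" | "0 < b" "b <= a" | "a < b" using b by linarith
    then show ?thesis
    proof cases
      \<comment> \<open>The path starts at 0, so the event is empty, and the right-hand side
        cancels.\<close>
      case 1
      have f0: "f w = 0" if "w \<in> space P" for w
      proof (cases "fin (ex a) w")
        case True
        have "w \<in> Paths" using that by simp
        from rsup_upper[OF this order_refl hit_ge0[OF True]] Paths_0[OF this, of 0] show ?thesis by (simp add: f_def 1)
      qed (simp add: f_def val_def)
      have "f \<in> borel_measurable P \<longleftrightarrow> (%w. 0 :: real) \<in> borel_measurable P" by (rule measurable_cong[OF f0])
      moreover have "(\<E> w. f w) = (\<E> w. 0)" by (rule Bochner_Integration.integral_cong[OF refl f0])
      ultimately show ?thesis using Wa by (simp add: 1)
    next
      \<comment> \<open>A level above a is not reached before the excursion ends, so the restriction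
        is void. The formula agrees because at the negative argument a - b the function
        \<open>Zs\<close> is 1 and \<open>Ws\<close> is 0.\<close>
      case 3
      have fv: "f w = val q r u a w" if "w \<in> space P" for w
      proof (cases "fin (ex a) w")
        case True
        have "rsup w (hit (ex a) w) <= a"
        proof -
          have w: "w \<in> Paths" using that by simp
          show ?thesis by (rule rsup_least[OF hit_ge0[OF True] ex_bounded[OF w a True]])
        qed
        then show ?thesis using 3 by (simp add: f_def)
      qed (simp add: f_def val_def)
      then have "f \<in> borel_measurable P \<longleftrightarrow> val q r u a \<in> borel_measurable P" by (intro measurable_cong)
      moreover have "(\<E> w. f w) = KK q r u a" unfolding KK_def using fv by (intro Bochner_Integration.integral_cong) auto
      ultimately show ?thesis using 3 by (simp add: Zs_def Ws_neg)
    next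
      case 2
      \<comment> \<open>Starting with b / 2 keeps a - y n at least b / 2, hence y n <= a; being
        strictly above a - b, y n is positive even for b = a.\<close>
      define y where "y n = a - b + b / 2 / real (Suc n)" for n
      have yb: "b / 2 / real (Suc n) <= b / 2" for n
        using 2 by (simp add: divide_le_eq mult_left_mono)
      have y: "0 < y n" "y n <= a" "a - y n < b" for n
      proof -
        have "0 < b / 2 / real (Suc n)" using 2 by simp
        then show "0 < y n" "a - y n < b" using 2 unfolding y_def by linarith+
        show "y n <= a" using yb[of n] 2 unfolding y_def by linarith
      qed
      have "(%n. a - b + b / 2 * (1 / real (Suc n))) \<longlonglongrightarrow> a - b + b / 2 * 0" by (intro tendsto_intros LIMSEQ_Suc[OF lim_1_over_n])
      then have yl: "y \<longlonglongrightarrow> a - b" by (simp add: y_def[abs_def])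
      define E where "E n = {w\<in>Paths. fin (dn (y n)) w & w \<notin> exit_up (y n) (a - y n)}" for n
      have EP: "E n \<in> sets P" for n
        using determined_not_exit[of "y n" "a - y n"] unfolding determined_def E_def sets_P by blast
      have lim: "(%n. indicator (E n) w * val q r u a w) \<longlonglongrightarrow> f w" if "w \<in> space P" for w
      proof (cases "fin (ex a) w")
        case fe: True
        have w: "w \<in> Paths" using that by simp
        let ?S = "rsup w (hit (ex a) w)"
        have t: "0 <= hit (ex a) w" by (rule hit_ge0[OF fe])
        show ?thesis
        proof (cases "?S < b")
          case True
          have "(%n. a - y n) \<longlonglongrightarrow> a - (a - b)" by (intro tendsto_intros yl)
          then have "(%n. a - y n) \<longlonglongrightarrow> b" by simp
          from order_tendstoD(1)[OF this True]
          have "\<forall>\<^sub>F n in sequentially. indicator (E n) w * val q r u a w = f w"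
          proof eventually_elim
            case (elim n)
            have lt: "w s < a - y n" if "0 <= s" "s <= hit (ex a) w" for s using rsup_upper[OF w that] elim by simp
            have "0 <= a - y n" using y(2)[of n] by simp
            from bounded_not_exit[OF w a this fe lt] have "w \<in> E n" using w by (simp add: E_def)
            then show ?case using True by (simp add: f_def)
          qed
          then show ?thesis by (rule tendsto_eventually)
        next
          case False
          have "w \<notin> E n" for n
          proof
            assume "w \<in> E n"
            then have fd: "fin (dn (y n)) w" and ne: "w \<notin> exit_up (y n) (a - y n)" by (auto simp: E_def)
            have "?S <= a - y n" by (rule rsup_least[OF t not_exit_bounded[OF w a y(2) fd fe ne]])
            then show False using False y(3)[of n] by simp
          qed
          then show ?thesis using False by (simp add: f_def)
        qed
      qed (simp add: f_def val_def)
      have fm: "f \<in> borel_measurable P"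
        by (rule borel_measurable_LIMSEQ_real[of P "%n w. indicator (E n) w * val q r u a w"]) (use lim EP in auto)
      have "(%n. \<E> w. indicator (E n) w * val q r u a w) \<longlonglongrightarrow> (\<E> w. f w)"
      proof (rule integral_dominated_convergence[where w="%_. 1"])
        show "AE w in P. (%n. indicator (E n) w * val q r u a w) \<longlonglongrightarrow> f w" by (rule AE_I2) (rule lim)
        show "AE w in P. norm (indicator (E n) w * val q r u a w) <= 1" for n
          by (rule AE_I2) (auto simp: indicator_def val_nonneg val_le1 q)
      qed (use fm EP in auto)
      moreover have "(%n. KK q r u a * (Zs (q + r) u (y n) - exp (u * (a - y n)) * Zs (q + r) u a * (Ws (q + r) (y n) / Ws (q + r) a)))
        \<longlonglongrightarrow> KK q r u a * (Zs (q + r) u (a - b) - exp (u * (a - (a - b))) * Zs (q + r) u a * (Ws (q + r) (a - b) / Ws (q + r) a))"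
      proof -
        have "0 <= y n & y n <= a" for n using y[of n] by simp
        then have "(%n. Zs (q + r) u (y n)) \<longlonglongrightarrow> Zs (q + r) u (a - b)" "(%n. Ws (q + r) (y n)) \<longlonglongrightarrow> Ws (q + r) (a - b)"
          using 2 by (auto intro!: continuous_on_tendsto_compose[OF Zs_continuous[OF q', of a u] yl] continuous_on_tendsto_compose[OF Ws_continuous[OF q'] yl])
        then show ?thesis using Wa by (intro tendsto_intros yl) auto
      qed
      ultimately show ?thesis using fm LIMSEQ_unique unfolding E_def not_exit_value[OF y(1,2)] by fastforce
    qed
  qed
  then show "f \<in> borel_measurable P" "(\<E> w. f w) = KK q r u a * (Zs (q + r) u (a - b) - exp (u * b) * Zs (q + r) u a * (Ws (q + r) (a - b) / Ws (q + r) a))" by auto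
qed

end

end

section \<open>Return to the original process\<close>

lemma path_functionals:
  assumes L: "spec_neg_levy M X" and w: "\<omega> \<in> space M"
  defines "w \<equiv> path_of X \<omega>"
  shows "0 <= t ==> run_inf X x t \<omega> = x + rinf w t"
    "0 <= t ==> run_sup X x t \<omega> = x + rsup w t"
    "exceed_set X x a \<omega> \<noteq> {} \<longleftrightarrow> fin (ex a) w"
    "tau_hat X x a \<omega> = hit (ex a) w"
    "0 <= t ==> G_inf X x t \<omega> = last_inf w t"
proof -
  have P: "w \<in> Paths" unfolding w_def by (rule path_of_Paths[OF L w])
  have X0: "X 0 \<omega> = 0" using L w by (simp add: spec_neg_levy_def)
  have X: "X t \<omega> = w t" if "0 <= t" for t using that X0 by (simp add: w_def path_of_def)
  show inf: "run_inf X x t \<omega> = x + rinf w t" if t: "0 <= t" for t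
    unfolding run_inf_def
  proof (rule cInf_eq_non_empty)
    show "(%s. x + X s \<omega>) ` {0..t} \<noteq> {}" using t by simp
    show "x + rinf w t <= z" if "z \<in> (%s. x + X s \<omega>) ` {0..t}" for z
      using that inf_on_le[OF P, of 0 _ t] by (auto simp: X)
    show "z <= x + rinf w t" if z: "!!v. v \<in> (%s. x + X s \<omega>) ` {0..t} ==> z <= v" for z
    proof -
      have "z - x <= w s" if "0 <= s" "s <= t" for s using z[OF imageI, of s] that X[of s] by simp
      then have "z - x <= rinf w t" using t by (subst inf_on_ge_iff[OF P]) auto
      then show ?thesis by simp
    qed
  qed
  show "run_sup X x t \<omega> = x + rsup w t" if t: "0 <= t" for t
    unfolding run_sup_def
  proof (rule cSup_eq_non_empty)
    show "(%s. x + X s \<omega>) ` {0..t} \<noteq> {}" using t by simp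
    show "z <= x + rsup w t" if "z \<in> (%s. x + X s \<omega>) ` {0..t}" for z
      using that rsup_upper[OF P, of _ t] by (auto simp: X)
    show "x + rsup w t <= z" if z: "!!v. v \<in> (%s. x + X s \<omega>) ` {0..t} ==> v <= z" for z
    proof -
      have "w s <= z - x" if "0 <= s" "s <= t" for s using z[OF imageI, of s] that X[of s] by simp
      then have "rsup w t <= z - x" by (rule rsup_least[OF t])
      then show ?thesis by simp
    qed
  qed
  have ex: "exceed_set X x a \<omega> = {t. 0 <= t & ex a w t}"
    unfolding exceed_set_def by (auto simp: inf X ex_def)
  show "exceed_set X x a \<omega> \<noteq> {} \<longleftrightarrow> fin (ex a) w" unfolding ex fin_def by auto
  show "tau_hat X x a \<omega> = hit (ex a) w" unfolding tau_hat_def ex hit_def ..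
  show "G_inf X x t \<omega> = last_inf w t" if t: "0 <= t" for t
  proof -
    have ll: "left_lim (%r. x + X r \<omega>) s = x + left_lim w s" if s: "0 < s" for s
    proof -
      obtain l where l: "(w \<longlongrightarrow> l) (at_left s)" using P unfolding Paths_def by blast
      have "((%r. x + w r) \<longlongrightarrow> x + l) (at_left s)" by (intro tendsto_intros l)
      moreover have "\<forall>\<^sub>F r in at_left s. x + w r = x + X r \<omega>"
        unfolding eventually_at_left_field using s X by (intro exI[of _ 0]) auto
      ultimately have "((%r. x + X r \<omega>) \<longlongrightarrow> x + l) (at_left s)" by (rule Lim_transform_eventually)
      then have "left_lim (%r. x + X r \<omega>) s = x + l" unfolding left_lim_def by (intro tendsto_Lim) auto
      moreover have "left_lim w s = l" unfolding left_lim_def by (intro tendsto_Lim l) auto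
      ultimately show ?thesis by simp
    qed
    \<comment> \<open>At time 0 the left limit of X depends on negative times, which are not
      controlled; there the first alternative of the disjunction holds anyway.\<close>
    have z: "w 0 = rinf w 0" by (simp add: inf_on_def)
    have "(x + X s \<omega> = run_inf X x s \<omega> \<or> left_lim (%r. x + X r \<omega>) s = run_inf X x s \<omega>) \<longleftrightarrow> (w s = rinf w s \<or> left_lim w s = rinf w s)" if "0 <= s" for s
      using that z ll[of s] by (cases "s = 0") (auto simp: inf X)
    then have "{s. 0 <= s & s <= t & (x + X s \<omega> = run_inf X x s \<omega> \<or> left_lim (%r. x + X r \<omega>) s = run_inf X x s \<omega>)} = {s. 0 <= s & s <= t & (w s = rinf w s \<or> left_lim w s = rinf w s)}" by blast
    then show ?thesis unfolding G_inf_def using last_inf_eq[OF P t] by simp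
  qed
qed

theorem theorem2:
  fixes M :: "'a measure" and X :: "real \<Rightarrow> 'a \<Rightarrow> real" and a x q r u v :: real
  assumes "spec_neg_levy M X"
    and "a > 0" and "q \<ge> 0" and "r \<ge> 0" and "u \<ge> 0" and "v \<ge> 0"
    and "x \<le> v"
  shows "(\<integral>\<omega>. indicator {\<omega>. exceed_set X x a \<omega> \<noteq> {}} \<omega> *
             exp (- q * tau_hat X x a \<omega> - r * G_inf X x (tau_hat X x a \<omega>) \<omega>
                  + u * run_inf X x (tau_hat X x a \<omega>) \<omega>) *
             indicator {\<omega>. run_sup X x (tau_hat X x a \<omega>) \<omega> < v} \<omega> \<partial>M)
    = scale_fn M X (q + r) a / scale_fn M X q a *
      (exp (- u * (a - x)) * Zfn M X q r u (a + x - v) / Zfn M X q r u a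
       - exp (- u * (a - v)) * scale_fn M X (q + r) (a + x - v) / scale_fn M X (q + r) a)"
proof -
  note L = assms(1) and a = assms(2) and q = assms(3-5)
  define P where "P = distr M path_space (path_of X)"
  have lawP: "levy_law P" unfolding P_def by (rule spec_neg_levy_law[OF L])
  interpret levy_law P by (rule lawP)
  have q': "0 <= q + r" using q by simp
  have b: "0 <= v - x" using assms(7) by simp
  have psi: "psi M X = \<psi>" and Wq: "scale_fn M X q = Ws q" and Wr: "scale_fn M X (q + r) = Ws (q + r)"
    using scale_fn_eq[OF L q(1)] scale_fn_eq[OF L q'] unfolding P_def by auto
  have Z: "Zfn M X q r u y = Zs (q + r) u y" for y unfolding Zfn_def Zs_def psi Wr ..
  \<comment> \<open>The starting point x contributes the factor \<open>exp (u * x)\<close> through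
    the infimum and shifts the level for the supremum to v - x; time and the last infimum do not see
    it.\<close>
  define f where "f w = val q r u a w * indicator {w. rsup w (hit (ex a) w) < v - x} w" for w
  have fm: "f \<in> borel_measurable P" and fI: "(\<integral>w. f w \<partial>P) = KK q r u a * (Zs (q + r) u (a - (v - x)) - exp (u * (v - x)) * Zs (q + r) u a * (Ws (q + r) (a - (v - x)) / Ws (q + r) a))"
    unfolding f_def by (rule sup_value[OF q a b])+
  have "(\<integral>\<omega>. indicator {\<omega>. exceed_set X x a \<omega> \<noteq> {}} \<omega> * exp (- q * tau_hat X x a \<omega> - r * G_inf X x (tau_hat X x a \<omega>) \<omega> + u * run_inf X x (tau_hat X x a \<omega>) \<omega>) *
      indicator {\<omega>. run_sup X x (tau_hat X x a \<omega>) \<omega> < v} \<omega> \<partial>M) = (\<integral>\<omega>. exp (u * x) * f (path_of X \<omega>) \<partial>M)"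
  proof (rule Bochner_Integration.integral_cong[OF refl])
    fix \<omega> assume w: "\<omega> \<in> space M"
    let ?w = "path_of X \<omega>"
    note F = path_functionals[OF L w]
    show "indicator {\<omega>. exceed_set X x a \<omega> \<noteq> {}} \<omega> * exp (- q * tau_hat X x a \<omega> - r * G_inf X x (tau_hat X x a \<omega>) \<omega> + u * run_inf X x (tau_hat X x a \<omega>) \<omega>) *
      indicator {\<omega>. run_sup X x (tau_hat X x a \<omega>) \<omega> < v} \<omega> = exp (u * x) * f ?w"
    proof (cases "fin (ex a) ?w")
      case True
      have t: "0 <= hit (ex a) ?w" by (rule hit_ge0[OF True])
      have "exp (- q * hit (ex a) ?w - r * last_inf ?w (hit (ex a) ?w) + u * (x + rinf ?w (hit (ex a) ?w))) = exp (u * x) * val q r u a ?w"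
        using True by (simp add: val_def exp_add[symmetric]) (simp add: algebra_simps)
      moreover have "x + rsup ?w (hit (ex a) ?w) < v \<longleftrightarrow> rsup ?w (hit (ex a) ?w) < v - x" by auto
      ultimately show ?thesis using True by (simp add: f_def F(3,4) F(1,2,5)[OF t] indicator_def)
    qed (simp add: f_def val_def F(3))
  qed
  also have "... = exp (u * x) * (\<integral>\<omega>. f (path_of X \<omega>) \<partial>M)" by simp
  also have "(\<integral>\<omega>. f (path_of X \<omega>) \<partial>M) = (\<integral>w. f w \<partial>P)"
    unfolding P_def by (rule integral_distr[symmetric, OF path_of_measurable[OF L]]) (use fm sets_P in \<open>simp cong: measurable_cong_sets\<close>)
  finally have I: "(\<integral>\<omega>. indicator {\<omega>. exceed_set X x a \<omega> \<noteq> {}} \<omega> * exp (- q * tau_hat X x a \<omega> - r * G_inf X x (tau_hat X x a \<omega>) \<omega> + u * run_inf X x (tau_hat X x a \<omega>) \<omega>) *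
      indicator {\<omega>. run_sup X x (tau_hat X x a \<omega>) \<omega> < v} \<omega> \<partial>M) = exp (u * x) * (\<integral>w. f w \<partial>P)" .
  define z where "z = a + x - v"
  have z: "a - (v - x) = z" by (simp add: z_def)
  have Wp: "Ws (q + r) a > 0" "Ws q a > 0" using Ws_pos a q by auto
  note KK = KK_value[OF q a]
  have e1: "exp (- u * (a - x)) = exp (u * x) * exp (- u * a)" by (subst exp_add[symmetric]) (simp add: algebra_simps)
  have e2: "exp (- u * (a - v)) = exp (u * x) * exp (- u * a) * exp (u * (v - x))" by (simp only: exp_add[symmetric]) (simp add: algebra_simps)
  show ?thesis
    unfolding I fI z Wq Wr Z z_def[symmetric] e1 e2 KK(2) using KK(1) Wp by (simp add: field_simps)
qed

end
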